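(* Spanners given in a regular representation $q$ (e.g., regex UCQs) can be evaluated with FPT delay for the parameter $|q|$: there are a computable function $f$, a polynomial $p$ and an algorithm that, given a regular spanner representation $q$ and a string $\mathbf{s}\in\Sigma^*$, enumerates $[\![q]\!](\mathbf{s})$, each tuple exactly once, such that the delay between every two consecutive answers is bounded by $f(|q|)\cdot p(|x|)$, where $|x|$ is the size of the input $x=(q,\mathbf{s})$.
   Context: Strings and spans. $\Sigma$ is a finite alphabet with $|\Sigma|\ge 2$. A span of $\mathbf{s}=\sigma_1\cdots\sigma_\ell\in\Sigma^*$ is an expression $[i,j\rangle$ with $1\le i\le j\le \ell+1$. $\mathsf{Vars}$ is an infinite set of variables, disjoint from $\Sigma$. For finite $V\subset\mathsf{Vars}$, a $(V,\mathbf{s})$-tuple is a function from $V$ to the spans of $\mathbf{s}$; a spanner $P$ with finite variable set $\mathsf{Vars}(P)=V$ maps each $\mathbf{s}\in\Sigma^*$ to a set $P(\mathbf{s})$ of $(V,\mathbf{s})$-tuples. Ref-words. For finite $V\subset\mathsf{Vars}$ let $\Gamma_V=\{x{\vdash},\ {\dashv}x \mid x\in V\}$, disjoint from $\Sigma$. A word $\mathbf{r}\in(\Sigma\cup\Gamma_V)^*$ is valid for $V$ if for each $x\in V$ it contains exactly one $x{\vdash}$ and exactly one ${\dashv}x$, the former to the left of the latter. $\mathsf{clr}$ is the morphism erasing $\Gamma_V$ and fixing $\Sigma$. A valid $\mathbf{r}$ with $\mathsf{clr}(\mathbf{r})=\mathbf{s}$ defines the $(V,\mathbf{s})$-tuple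 $\mu^{\mathbf{r}}$: writing $\mathbf{r}=\mathbf{r}'_x\, x{\vdash}\,\mathbf{r}_x\,{\dashv}x\,\mathbf{r}''_x$, $\mu^{\mathbf{r}}(x)=[i,j\rangle$ with $i=|\mathsf{clr}(\mathbf{r}'_x)|+1$, $j=i+|\mathsf{clr}(\mathbf{r}_x)|$. Regex formulas. Syntax: $\alpha ::= \emptyset\mid\epsilon\mid\sigma\mid(\alpha\vee\alpha)\mid(\alpha\cdot\alpha)\mid\alpha^*\mid x\{\alpha\}$ with $\sigma\in\Sigma$, $x\in\mathsf{Vars}$. $\mathsf{Vars}(\alpha)$ is the set of variables occurring in $\alpha$. $\mathcal{R}(\alpha)$ is defined as the language of a regular expression, with $\mathcal{R}(x\{\beta\})=x{\vdash}\,\mathcal{R}(\beta)\,{\dashv}x$. $[\![\alpha]\!](\mathbf{s})=\{\mu^{\mathbf{r}}\mid \mathbf{r}\in\mathcal{R}(\alpha)\text{ valid for }\mathsf{Vars}(\alpha),\ \mathsf{clr}(\mathbf{r})=\mathbf{s}\}$. Regex formulas are assumed functional: every word in $\mathcal{R}(\alpha)$ is valid for $\mathsf{Vars}(\alpha)$. Regular spanner representations are the expressions built from (functional) regex formulas by repeated application of: union $P_1\cup P_2$ (requires $\mathsf{Vars}(P_1)=\mathsf{Vars}(P_2)$; $(P_1\cup P_2)(\mathbf{s})=P_1(\mathbf{s})\cup P_2(\mathbf{s})$); projection $\pi_Y P$ for $Y\subseteq\mathsf{Vars}(P)$ (restrict all tuples to $Y$); natural join $P_1\bowtie P_2$ (variables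 $\mathsf{Vars}(P_1)\cup\mathsf{Vars}(P_2)$; all tuples $\mu$ with $\mu|_{\mathsf{Vars}(P_i)}\in P_i(\mathbf{s})$ for $i=1,2$). $[\![q]\!]$ is the resulting spanner and $|q|$ the size of the expression. Regex UCQs (unions of expressions $\pi_Y(\alpha_1\bowtie\cdots\bowtie\alpha_k)$ with regex formulas $\alpha_i$, all with the same output variables) are a special case. The delay is the time between every two consecutive answers produced. *)

theory Defs
  imports Main "HOL-Computational_Algebra.Polynomial"
begin

section \<open>Document spanners\<close>

text \<open>The alphabet is a finite type \<open>'a\<close>. Variables are natural numbers, since they have to be
  written into the input of an algorithm.\<close>

type_synonym var = nat
type_synonym span = "nat \<times> nat"
type_synonym tuple = "var \<rightharpoonup> span"

text \<open>A \<open>(V, s)\<close>-tuple is a partial map with domain \<open>V\<close>. The pair \<open>(i, j)\<close> is the span from \<open>i\<close>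
  (inclusive) to \<open>j\<close> (exclusive), positions being counted from 1.\<close>

datatype 'a ref_symbol = Letter 'a | Open var | Close var

type_synonym 'a ref_word = "'a ref_symbol list"

fun clr :: "'a ref_word \<Rightarrow> 'a list" where
  "clr [] = []"
| "clr (Letter a # r) = a # clr r"
| "clr (Open x # r) = clr r"
| "clr (Close x # r) = clr r"

definition valid :: "var set \<Rightarrow> 'a ref_word \<Rightarrow> bool" where
  "valid V r \<longleftrightarrow>
     set r \<subseteq> range Letter \<union> Open ` V \<union> Close ` V \<and>
     (\<forall>x\<in>V. count_list r (Open x) = 1 \<and> count_list r (Close x) = 1 \<and>
        (\<exists>u v w. r = u @ Open x # v @ Close x # w))"

text \<open>For a word that is valid for some \<open>V\<close> containing \<open>x\<close> the factorization below is unique.\<close>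

definition ref_span :: "'a ref_word \<Rightarrow> var \<Rightarrow> span" where
  "ref_span r x = (THE p. \<exists>u v w. r = u @ Open x # v @ Close x # w \<and>
     p = (length (clr u) + 1, length (clr u) + 1 + length (clr v)))"

definition ref_tuple :: "var set \<Rightarrow> 'a ref_word \<Rightarrow> tuple" where
  "ref_tuple V r = (\<lambda>x. if x \<in> V then Some (ref_span r x) else None)"

datatype 'a regex_formula =
    REmpty
  | REps
  | RLetter 'a
  | ROr "'a regex_formula" "'a regex_formula"
  | RConc "'a regex_formula" "'a regex_formula"
  | RStar "'a regex_formula"
  | RBind var "'a regex_formula"

fun regex_vars :: "'a regex_formula \<Rightarrow> var set" where
  "regex_vars REmpty = {}"
| "regex_vars REps = {}"
| "regex_vars (RLetter a) = {}"
| "regex_vars (ROr \<alpha> \<beta>) = regex_vars \<alpha> \<union> regex_vars \<beta>"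
| "regex_vars (RConc \<alpha> \<beta>) = regex_vars \<alpha> \<union> regex_vars \<beta>"
| "regex_vars (RStar \<alpha>) = regex_vars \<alpha>"
| "regex_vars (RBind x \<alpha>) = insert x (regex_vars \<alpha>)"

fun ref_lang :: "'a regex_formula \<Rightarrow> 'a ref_word set" where
  "ref_lang REmpty = {}"
| "ref_lang REps = {[]}"
| "ref_lang (RLetter a) = {[Letter a]}"
| "ref_lang (ROr \<alpha> \<beta>) = ref_lang \<alpha> \<union> ref_lang \<beta>"
| "ref_lang (RConc \<alpha> \<beta>) = {u @ v | u v. u \<in> ref_lang \<alpha> \<and> v \<in> ref_lang \<beta>}"
| "ref_lang (RStar \<alpha>) = {concat us | us. set us \<subseteq> ref_lang \<alpha>}"
| "ref_lang (RBind x \<alpha>) = {Open x # u @ [Close x] | u. u \<in> ref_lang \<alpha>}"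

definition functional :: "'a regex_formula \<Rightarrow> bool" where
  "functional \<alpha> \<longleftrightarrow> (\<forall>r \<in> ref_lang \<alpha>. valid (regex_vars \<alpha>) r)"

definition regex_sem :: "'a regex_formula \<Rightarrow> 'a list \<Rightarrow> tuple set" where
  "regex_sem \<alpha> s =
     {ref_tuple (regex_vars \<alpha>) r | r. r \<in> ref_lang \<alpha> \<and> valid (regex_vars \<alpha>) r \<and> clr r = s}"

text \<open>The projection set is syntax, hence a finite listing of its elements.\<close>

datatype 'a rep =
    Regex "'a regex_formula"
  | UnionOf "'a rep" "'a rep"
  | Proj "var list" "'a rep"
  | JoinOf "'a rep" "'a rep"

fun rep_vars :: "'a rep \<Rightarrow> var set" where
  "rep_vars (Regex \<alpha>) = regex_vars \<alpha>"
| "rep_vars (UnionOf p q) = rep_vars p \<union> rep_vars q"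
| "rep_vars (Proj Y p) = set Y"
| "rep_vars (JoinOf p q) = rep_vars p \<union> rep_vars q"

fun regular_rep :: "'a rep \<Rightarrow> bool" where
  "regular_rep (Regex \<alpha>) \<longleftrightarrow> functional \<alpha>"
| "regular_rep (UnionOf p q) \<longleftrightarrow> regular_rep p \<and> regular_rep q \<and> rep_vars p = rep_vars q"
| "regular_rep (Proj Y p) \<longleftrightarrow> regular_rep p \<and> set Y \<subseteq> rep_vars p"
| "regular_rep (JoinOf p q) \<longleftrightarrow> regular_rep p \<and> regular_rep q"

fun rep_sem :: "'a rep \<Rightarrow> 'a list \<Rightarrow> tuple set" where
  "rep_sem (Regex \<alpha>) s = regex_sem \<alpha> s"
| "rep_sem (UnionOf p q) s = rep_sem p s \<union> rep_sem q s"
| "rep_sem (Proj Y p) s = (\<lambda>\<mu>. \<mu> |` set Y) ` rep_sem p s"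
| "rep_sem (JoinOf p q) s =
     {\<mu>. dom \<mu> = rep_vars p \<union> rep_vars q \<and>
         \<mu> |` rep_vars p \<in> rep_sem p s \<and> \<mu> |` rep_vars q \<in> rep_sem q s}"


section \<open>Random access machines\<close>

text \<open>Unit-cost RAM with addition and truncated subtraction only (so that, up to polynomials,
  time agrees with Turing machine time), with a bank of registers and an indirectly addressed
  memory. \<open>Write\<close> appends a number to an output buffer; \<open>Yield\<close> produces the contents of that
  buffer as the next answer and empties it. The machine halts when the program counter leaves
  the program.\<close>

datatype instr =
    Const nat nat
  | Move nat nat
  | Add nat nat nat
  | Sub nat nat nat
  | Load nat nat
  | Store nat nat
  | Jump nat
  | JumpZero nat nat
  | Write nat
  | Yield

record config =
  pc :: nat
  reg :: "nat \<Rightarrow> nat"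
  mem :: "nat \<Rightarrow> nat"
  out :: "nat list"

abbreviation set_reg :: "nat \<Rightarrow> nat \<Rightarrow> config \<Rightarrow> config" where
  "set_reg r n c \<equiv> c\<lparr>pc := pc c + 1, reg := (reg c)(r := n)\<rparr>"

fun exec_instr :: "instr \<Rightarrow> config \<Rightarrow> config" where
  "exec_instr (Const r n) c = set_reg r n c"
| "exec_instr (Move r a) c = set_reg r (reg c a) c"
| "exec_instr (Add r a b) c = set_reg r (reg c a + reg c b) c"
| "exec_instr (Sub r a b) c = set_reg r (reg c a - reg c b) c"
| "exec_instr (Load r a) c = set_reg r (mem c (reg c a)) c"
| "exec_instr (Store a r) c = c\<lparr>pc := pc c + 1, mem := (mem c)(reg c a := reg c r)\<rparr>"
| "exec_instr (Jump l) c = c\<lparr>pc := l\<rparr>"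
| "exec_instr (JumpZero a l) c = c\<lparr>pc := (if reg c a = 0 then l else pc c + 1)\<rparr>"
| "exec_instr (Write a) c = c\<lparr>pc := pc c + 1, out := out c @ [reg c a]\<rparr>"
| "exec_instr Yield c = c\<lparr>pc := pc c + 1, out := []\<rparr>"

type_synonym program = "instr list"

definition halted :: "program \<Rightarrow> config \<Rightarrow> bool" where
  "halted P c \<longleftrightarrow> pc c \<ge> length P"

definition step :: "program \<Rightarrow> config \<Rightarrow> config" where
  "step P c = (if halted P c then c else exec_instr (P ! pc c) c)"

definition init_config :: "nat list \<Rightarrow> config" where
  "init_config w = \<lparr>pc = 0, reg = (\<lambda>_. 0)(0 := length w),
     mem = (\<lambda>i. if i < length w then w ! i else 0), out = []\<rparr>"

definition run :: "program \<Rightarrow> nat list \<Rightarrow> nat \<Rightarrow> config" where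
  "run P w t = (step P ^^ t) (init_config w)"

definition halts_at :: "program \<Rightarrow> nat list \<Rightarrow> nat \<Rightarrow> bool" where
  "halts_at P w T \<longleftrightarrow> halted P (run P w T) \<and> (\<forall>t<T. \<not> halted P (run P w t))"

definition computable :: "(nat \<Rightarrow> nat) \<Rightarrow> bool" where
  "computable f \<longleftrightarrow> (\<exists>P. \<forall>n. \<exists>T. halts_at P [n] T \<and> out (run P [n] T) = [f n])"

definition yields :: "program \<Rightarrow> nat list \<Rightarrow> nat \<Rightarrow> bool" where
  "yields P w t \<longleftrightarrow> \<not> halted P (run P w t) \<and> P ! pc (run P w t) = Yield"

definition answer_times :: "program \<Rightarrow> nat list \<Rightarrow> nat \<Rightarrow> nat list" where
  "answer_times P w T = filter (yields P w) [0..<T]"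

text \<open>As usual, the delay also covers the time before the first answer and the time from the last
  answer to termination; otherwise all answers could be precomputed for free.\<close>

definition enumerates_with_delay ::
    "program \<Rightarrow> nat list \<Rightarrow> ('b \<Rightarrow> nat list) \<Rightarrow> 'b set \<Rightarrow> nat \<Rightarrow> bool" where
  "enumerates_with_delay P w enc A d \<longleftrightarrow>
     (\<exists>T as. halts_at P w T \<and>
        map (\<lambda>t. out (run P w t)) (answer_times P w T) = map enc as \<and>
        distinct as \<and> set as = A \<and>
        (let ts = 0 # answer_times P w T @ [T]
         in \<forall>i. Suc i < length ts \<longrightarrow> ts ! Suc i - ts ! i \<le> d))"


section \<open>Encoding of inputs and answers\<close>

text \<open>Expressions are written in postfix notation, as a sequence of numbers: the operands come
  first, then a tag for the operator, then the letter or variables that the operator mentions.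
  The parameter \<open>code\<close> numbers the letters of the alphabet.\<close>

fun enc_regex :: "('a \<Rightarrow> nat) \<Rightarrow> 'a regex_formula \<Rightarrow> nat list" where
  "enc_regex code REmpty = [0]"
| "enc_regex code REps = [1]"
| "enc_regex code (RLetter a) = [2, code a]"
| "enc_regex code (ROr \<alpha> \<beta>) = enc_regex code \<alpha> @ enc_regex code \<beta> @ [3]"
| "enc_regex code (RConc \<alpha> \<beta>) = enc_regex code \<alpha> @ enc_regex code \<beta> @ [4]"
| "enc_regex code (RStar \<alpha>) = enc_regex code \<alpha> @ [5]"
| "enc_regex code (RBind x \<alpha>) = enc_regex code \<alpha> @ [6, x]"

fun enc_rep :: "('a \<Rightarrow> nat) \<Rightarrow> 'a rep \<Rightarrow> nat list" where
  "enc_rep code (Regex \<alpha>) = enc_regex code \<alpha> @ [7]"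
| "enc_rep code (UnionOf p q) = enc_rep code p @ enc_rep code q @ [8]"
| "enc_rep code (Proj Y p) = enc_rep code p @ [9, length Y] @ Y"
| "enc_rep code (JoinOf p q) = enc_rep code p @ enc_rep code q @ [10]"

text \<open>The tag 11 marks the end of the expression.\<close>

definition enc_input :: "('a \<Rightarrow> nat) \<Rightarrow> 'a rep \<Rightarrow> 'a list \<Rightarrow> nat list" where
  "enc_input code q s = enc_rep code q @ [11] @ map code s"

definition enc_tuple :: "tuple \<Rightarrow> nat list" where
  "enc_tuple \<mu> =
     concat (map (\<lambda>x. [x, fst (the (\<mu> x)), snd (the (\<mu> x))]) (sorted_list_of_set (dom \<mu>)))"

end

theory Submission
  imports Defs "HOL-Library.Nat_Bijection"
begin

text \<open>A tuple on a string is the same thing as the sequence of the states (unopened, open, closed) of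
  its variables at the letters of the string. Over the alphabet of pairs of a letter and such a state
  vector, the operators on spanners become operators on regular languages: union, a letter-to-letter
  morphism for the projection and a synchronous product for the join. A representation \<open>q\<close> thus has an
  automaton with at most \<open>2\<^sup>|\<^sup>q\<^sup>|\<close> states, and whether some answer extends a given partial assignment of
  end points to variables is decided by one run of it over the string. Lexicographic backtracking
  over the end points asks this question polynomially often between two answers. The machine is
  programmed in a language of bounded loops with a heap, whose compiler comes with a static bound of
  the running time, polynomial in a common bound of all loops.\<close>

section \<open>A language of bounded loops\<close>

text \<open>Markers between two letters may stand in any order, so a join on ref-words would have to
  identify all these orders, and one tuple would have many words. Counting the markers of each
  variable before each letter avoids both: a tuple has one status word, and the join compares
  statuses letter by letter. Nothing is lost behind the last letter, because an end point not
  reached at any letter can only be \<open>l + 1\<close>. In position (Glushkov) automata the status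
  vector sits on the position and there are no silent transitions; sizes add up, except at joins,
  where they multiply, hence the bound \<open>2 ^ length (enc_rep code q)\<close>. The backtracking
  meets no dead ends, since a value is kept only if some answer still extends the assignment.
  Variables are unbounded numbers, but table indices must be bounded; so variables are addressed by
  the input positions where they are written. With \<open>B = 2 ^ m * (2 * n + 2)\<close> as bound
  of all loops, where \<open>m\<close> and \<open>n\<close> are the lengths of the expression and of
  the input, a cost \<open>C * (B + 1) ^ k\<close> splits into \<open>2 ^ (k * m)\<close> and a
  polynomial in \<open>n\<close>.\<close>

datatype aexp =
    Lit nat
  | Var nat
  | Len
  | Inp aexp
  | Plus aexp aexp
  | Minus aexp aexp
  | Times aexp aexp
  | Ite aexp aexp aexp
  | Sum nat aexp aexp
  | Rd nat aexp aexp aexp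

record store =
  regs :: "nat \<Rightarrow> nat"
  heap :: "nat \<times> nat \<times> nat \<times> nat \<Rightarrow> nat"
  obuf :: "nat list"

abbreviation setr :: "nat \<Rightarrow> nat \<Rightarrow> store \<Rightarrow> store" where
  "setr r k s \<equiv> s\<lparr>regs := (regs s)(r := k)\<rparr>"

primrec aval :: "nat list \<Rightarrow> aexp \<Rightarrow> store \<Rightarrow> nat" where
  "aval w (Lit n) = (\<lambda>s. n)"
| "aval w (Var r) = (\<lambda>s. regs s r)"
| "aval w Len = (\<lambda>s. length w)"
| "aval w (Inp a) = (\<lambda>s. w ! aval w a s)"
| "aval w (Plus a b) = (\<lambda>s. aval w a s + aval w b s)"
| "aval w (Minus a b) = (\<lambda>s. aval w a s - aval w b s)"
| "aval w (Times a b) = (\<lambda>s. aval w a s * aval w b s)"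
| "aval w (Ite c a b) = (\<lambda>s. if aval w c s \<noteq> 0 then aval w a s else aval w b s)"
| "aval w (Sum r a b) = (\<lambda>s. \<Sum>k<aval w a s. aval w b (setr r k s))"
| "aval w (Rd i a b c) = (\<lambda>s. heap s (i, aval w a s, aval w b s, aval w c s))"

text \<open>\<open>B\<close> limits exactly what costs more than constant time on a machine that
  only adds and subtracts: the left factor of a product (repeated addition), the number of summands,
  and the table indices, which have to be paired. Other values, such as the right factor, may be
  arbitrarily large. A conditional is checked only in the branch taken, so that a test can protect
  an access.\<close>

primrec abnd :: "nat list \<Rightarrow> nat \<Rightarrow> aexp \<Rightarrow> store \<Rightarrow> bool" where
  "abnd w B (Lit n) = (\<lambda>s. True)"
| "abnd w B (Var r) = (\<lambda>s. True)"
| "abnd w B Len = (\<lambda>s. True)"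
| "abnd w B (Inp a) = (\<lambda>s. abnd w B a s \<and> aval w a s < length w)"
| "abnd w B (Plus a b) = (\<lambda>s. abnd w B a s \<and> abnd w B b s)"
| "abnd w B (Minus a b) = (\<lambda>s. abnd w B a s \<and> abnd w B b s)"
| "abnd w B (Times a b) = (\<lambda>s. abnd w B a s \<and> abnd w B b s \<and> aval w a s \<le> B)"
| "abnd w B (Ite c a b) = (\<lambda>s. abnd w B c s \<and> (if aval w c s \<noteq> 0 then abnd w B a s else abnd w B b s))"
| "abnd w B (Sum r a b) = (\<lambda>s. abnd w B a s \<and> aval w a s \<le> B \<and>
     (\<forall>k<aval w a s. abnd w B b (setr r k s)))"
| "abnd w B (Rd i a b c) = (\<lambda>s. abnd w B a s \<and> abnd w B b s \<and> abnd w B c s \<and>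
     aval w a s \<le> B \<and> aval w b s \<le> B \<and> aval w c s \<le> B)"

datatype com =
    Skip
  | Set nat aexp
  | Put nat aexp aexp aexp aexp
  | Seq com com
  | If aexp com com
  | For nat aexp com
  | Out aexp

text \<open>The loop register gets its old value back after the loop, so that loops compose without
  any record of their counters.\<close>

primrec exec :: "nat list \<Rightarrow> com \<Rightarrow> store \<Rightarrow> store" where
  "exec w Skip = (\<lambda>s. s)"
| "exec w (Set r e) = (\<lambda>s. setr r (aval w e s) s)"
| "exec w (Put i a b c e) = (\<lambda>s. s\<lparr>heap := (heap s)((i, aval w a s, aval w b s, aval w c s) := aval w e s)\<rparr>)"
| "exec w (Seq c d) = (\<lambda>s. exec w d (exec w c s))"
| "exec w (If e c d) = (\<lambda>s. if aval w e s \<noteq> 0 then exec w c s else exec w d s)"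
| "exec w (For r e c) = (\<lambda>s. setr r (regs s r)
     (foldl (\<lambda>s k. exec w c (setr r k s)) s [0..<aval w e s]))"
| "exec w (Out e) = (\<lambda>s. s\<lparr>obuf := obuf s @ [aval w e s]\<rparr>)"

primrec cbnd :: "nat list \<Rightarrow> nat \<Rightarrow> com \<Rightarrow> store \<Rightarrow> bool" where
  "cbnd w B Skip = (\<lambda>s. True)"
| "cbnd w B (Set r e) = (\<lambda>s. abnd w B e s)"
| "cbnd w B (Put i a b c e) = (\<lambda>s. abnd w B a s \<and> abnd w B b s \<and> abnd w B c s \<and> abnd w B e s \<and>
     aval w a s \<le> B \<and> aval w b s \<le> B \<and> aval w c s \<le> B)"
| "cbnd w B (Seq c d) = (\<lambda>s. cbnd w B c s \<and> cbnd w B d (exec w c s))"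
| "cbnd w B (If e c d) = (\<lambda>s. abnd w B e s \<and> (if aval w e s \<noteq> 0 then cbnd w B c s else cbnd w B d s))"
| "cbnd w B (For r e c) = (\<lambda>s. abnd w B e s \<and> aval w e s \<le> B \<and>
     (\<forall>k<aval w e s. cbnd w B c (setr r k (foldl (\<lambda>s k. exec w c (setr r k s)) s [0..<k]))))"
| "cbnd w B (Out e) = (\<lambda>s. abnd w B e s)"

subsection \<open>Structured machine code\<close>

declare split_paired_All [simp del] split_paired_Ex [simp del]

type_synonym data = "(nat \<Rightarrow> nat) \<times> (nat \<Rightarrow> nat) \<times> nat list"
text \<open>Jumps of the machine are absolute; code therefore depends on the address at which it is
  placed.\<close>

type_synonym gen = "nat \<Rightarrow> instr list"

definition cfg :: "nat \<Rightarrow> data \<Rightarrow> config" where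
  "cfg i d = (case d of (R, M, b) \<Rightarrow> \<lparr>pc = i, reg = R, mem = M, out = b\<rparr>)"

lemma cfg_sel [simp]:
  "pc (cfg i (R, M, b)) = i" "reg (cfg i (R, M, b)) = R" "mem (cfg i (R, M, b)) = M" "out (cfg i (R, M, b)) = b"
  by (simp_all add: cfg_def)

lemma pc_cfg [simp]: "pc (cfg i d) = i"
  by (cases d) simp

text \<open>A stretch of a run without \<open>Yield\<close>, not halted before its end: its whole
  length counts towards a single delay.\<close>

inductive seg :: "program \<Rightarrow> nat \<Rightarrow> config \<Rightarrow> config \<Rightarrow> bool" for P where
  seg0: "seg P 0 c c"
| segS: "pc c < length P \<Longrightarrow> P ! pc c \<noteq> Yield \<Longrightarrow> seg P t (exec_instr (P ! pc c) c) c' \<Longrightarrow> seg P (Suc t) c c'"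

lemma seg_trans: "seg P t c c' \<Longrightarrow> seg P t' c' c'' \<Longrightarrow> seg P (t + t') c c''"
  by (induction rule: seg.induct) (auto intro: seg.intros)

lemma seg_steps:
  "seg P t c c' \<Longrightarrow> (step P ^^ t) c = c' \<and>
     (\<forall>i<t. \<not> halted P ((step P ^^ i) c) \<and> P ! pc ((step P ^^ i) c) \<noteq> Yield)"
proof (induction rule: seg.induct)
  case (seg0 c)
  then show ?case by simp
next
  case (segS c t c')
  have 1: "step P c = exec_instr (P ! pc c) c"
    using segS by (simp add: step_def halted_def)
  have 2: "(step P ^^ Suc i) c = (step P ^^ i) (exec_instr (P ! pc c) c)" for i
    using 1 by (simp add: funpow_swap1)
  have "\<not> halted P ((step P ^^ i) c) \<and> P ! pc ((step P ^^ i) c) \<noteq> Yield" if "i < Suc t" for i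
    using segS that by (cases i) (auto simp: 2 halted_def simp del: funpow.simps(2))
  then show ?case
    using segS 2 by (auto simp del: funpow.simps(2))
qed

definition reach :: "program \<Rightarrow> nat \<Rightarrow> config \<Rightarrow> config \<Rightarrow> bool" where
  "reach P b c c' \<longleftrightarrow> (\<exists>t\<le>b. seg P t c c')"

lemma reach_trans: "reach P b c c' \<Longrightarrow> reach P b' c' c'' \<Longrightarrow> reach P (b + b') c c''"
  unfolding reach_def by (meson add_mono seg_trans)

lemma reach_refl: "reach P b c c"
  unfolding reach_def using seg0 by blast

lemma reach_mono: "reach P b c c' \<Longrightarrow> b \<le> b' \<Longrightarrow> reach P b' c c'"
  unfolding reach_def by (meson order_trans)

definition code_at :: "program \<Rightarrow> nat \<Rightarrow> instr list \<Rightarrow> bool" where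
  "code_at P off is \<longleftrightarrow> off + length is \<le> length P \<and> (\<forall>i<length is. P ! (off + i) = is ! i)"

lemma code_at_append:
  "code_at P off (is @ js) \<longleftrightarrow> code_at P off is \<and> code_at P (off + length is) js"
proof -
  have "(\<forall>i<length is + length js. P ! (off + i) = (is @ js) ! i) \<longleftrightarrow>
      (\<forall>i<length is. P ! (off + i) = is ! i) \<and> (\<forall>i<length js. P ! (off + length is + i) = js ! i)"
    (is "?L \<longleftrightarrow> ?R")
  proof
    assume L: ?L
    show ?R
    proof (intro conjI allI impI)
      fix i assume "i < length is"
      then show "P ! (off + i) = is ! i" using L[rule_format, of i] by (simp add: nth_append)
    next
      fix i assume "i < length js"
      then show "P ! (off + length is + i) = js ! i"
        using L[rule_format, of "length is + i"] by (simp add: nth_append add.assoc)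
    qed
  next
    assume R: ?R
    show ?L
    proof (intro allI impI)
      fix i assume "i < length is + length js"
      then show "P ! (off + i) = (is @ js) ! i"
        using R conjunct2[OF R, rule_format, of "i - length is"]
        by (cases "i < length is") (auto simp: nth_append)
    qed
  qed
  then show ?thesis
    unfolding code_at_def by auto
qed

lemma code_at_Cons:
  "code_at P off (i # is) \<longleftrightarrow> off < length P \<and> P ! off = i \<and> code_at P (Suc off) is"
  using code_at_append[of P off "[i]" "is"] by (auto simp: code_at_def)

text \<open>Total correctness with a time bound for code that may be placed anywhere in any program.
  Quantifying over \<open>P\<close> and \<open>off\<close> is what makes sequences, branches and
  loops compose.\<close>

definition gwp :: "gen \<Rightarrow> nat \<Rightarrow> (data \<Rightarrow> bool) \<Rightarrow> data \<Rightarrow> bool" where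
  "gwp g b Q d \<longleftrightarrow> (\<forall>P off. code_at P off (g off) \<longrightarrow>
     (\<exists>d'. reach P b (cfg off d) (cfg (off + length (g off)) d') \<and> Q d'))"

lemma gwp_weaken: "gwp g b Q d \<Longrightarrow> b \<le> b' \<Longrightarrow> (\<And>d'. Q d' \<Longrightarrow> Q' d') \<Longrightarrow> gwp g b' Q' d"
  unfolding gwp_def by (meson reach_mono)

definition gseq :: "gen \<Rightarrow> gen \<Rightarrow> gen" (infixr ";;" 60) where
  "(g ;; g') = (\<lambda>off. g off @ g' (off + length (g off)))"

lemma gwp_seq:
  assumes "gwp g b (gwp g' b' Q) d"
  shows "gwp (g ;; g') (b + b') Q d"
  unfolding gwp_def
proof (intro allI impI)
  fix P off
  assume "code_at P off ((g ;; g') off)"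
  then have c: "code_at P off (g off)" "code_at P (off + length (g off)) (g' (off + length (g off)))"
    by (auto simp: gseq_def code_at_append)
  obtain d' where 1: "reach P b (cfg off d) (cfg (off + length (g off)) d')" "gwp g' b' Q d'"
    using assms c(1) unfolding gwp_def by blast
  obtain d'' where 2: "reach P b' (cfg (off + length (g off)) d')
      (cfg (off + length (g off) + length (g' (off + length (g off)))) d'')" "Q d''"
    using 1(2) c(2) unfolding gwp_def by blast
  show "\<exists>d'. reach P (b + b') (cfg off d) (cfg (off + length ((g ;; g') off)) d') \<and> Q d'"
    using reach_trans[OF 1(1) 2(1)] 2(2) by (auto simp: gseq_def add.assoc)
qed

fun deff :: "instr \<Rightarrow> data \<Rightarrow> data" where
  "deff (Const r n) d = ((fst d)(r := n), snd d)"
| "deff (Move r a) d = ((fst d)(r := fst d a), snd d)"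
| "deff (Add r a a') d = ((fst d)(r := fst d a + fst d a'), snd d)"
| "deff (Sub r a a') d = ((fst d)(r := fst d a - fst d a'), snd d)"
| "deff (Load r a) d = ((fst d)(r := fst (snd d) (fst d a)), snd d)"
| "deff (Store a r) d = (fst d, (fst (snd d))(fst d a := fst d r), snd (snd d))"
| "deff (Write a) d = (fst d, fst (snd d), snd (snd d) @ [fst d a])"
| "deff _ d = d"

definition ins :: "instr \<Rightarrow> gen" where
  "ins i = (\<lambda>_. [i])"

fun straight :: "instr \<Rightarrow> bool" where
  "straight (Jump _) = False"
| "straight (JumpZero _ _) = False"
| "straight Yield = False"
| "straight _ = True"

lemma exec_straight: "straight i \<Longrightarrow> exec_instr i (cfg p d) = cfg (Suc p) (deff i d)"
  by (cases d; cases i) (auto simp: cfg_def)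

lemma reach_step: "off < length P \<Longrightarrow> P ! off \<noteq> Yield \<Longrightarrow> reach P 1 (cfg off d) (exec_instr (P ! off) (cfg off d))"
  unfolding reach_def using segS[OF _ _ seg0, of "cfg off d" P] by auto

lemma gwp_ins:
  assumes "straight i \<and> 1 \<le> b" "Q (deff i d)"
  shows "gwp (ins i) b Q d"
  unfolding gwp_def ins_def
proof (intro allI impI)
  fix P off
  assume "code_at P off [i]"
  then have "off < length P" "P ! off = i"
    by (auto simp: code_at_Cons)
  then have "reach P 1 (cfg off d) (cfg (off + length [i]) (deff i d))"
    using reach_step[of off P d] assms exec_straight[of i off d] by (cases i) auto
  then have "reach P b (cfg off d) (cfg (off + length [i]) (deff i d))"
    by (rule reach_mono) (use assms in auto)
  then show "\<exists>d'. reach P b (cfg off d) (cfg (off + length [i]) d') \<and> Q d'"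
    using assms by blast
qed

definition gwhile :: "nat \<Rightarrow> gen \<Rightarrow> gen" where
  "gwhile r g = (\<lambda>off. JumpZero r (off + length (g (Suc off)) + 2) # g (Suc off) @ [Jump off])"

text \<open>Bounded loops know their number of rounds beforehand, so the invariant is indexed by the
  round and proves termination as well. A round costs a test and a jump back besides the body; the
  final test costs one more step.\<close>

lemma gwp_while:
  assumes "J 0 d"
    and "\<And>k d. k < n \<Longrightarrow> J k d \<Longrightarrow> fst d r \<noteq> 0 \<and> gwp g b (J (Suc k)) d"
    and "\<And>d. J n d \<Longrightarrow> fst d r = 0 \<and> Q d"
  shows "gwp (gwhile r g) (n * (b + 2) + 1) Q d"
  unfolding gwp_def
proof (intro allI impI)
  fix P off
  assume c: "code_at P off (gwhile r g off)"
  define e where "e = off + length (g (Suc off)) + 2"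
  have c0: "off < length P" "P ! off = JumpZero r e" and c1: "code_at P (Suc off) (g (Suc off))"
    and c2: "Suc off + length (g (Suc off)) < length P" "P ! (Suc off + length (g (Suc off))) = Jump off"
    using c unfolding gwhile_def e_def by (auto simp: code_at_Cons code_at_append)
  have len: "off + length (gwhile r g off) = e"
    by (simp add: gwhile_def e_def)
  have "\<exists>d'. reach P ((n - k) * (b + 2) + 1) (cfg off d) (cfg e d') \<and> Q d'" if "k \<le> n" "J k d" for k d
    using that
  proof (induction "n - k" arbitrary: k d)
    case 0
    then have "J n d" by simp
    then have "fst d r = 0" "Q d" using assms(3) by auto
    then have "exec_instr (P ! off) (cfg off d) = cfg e d"
      using c0 by (cases d) (simp add: cfg_def)
    then show ?case
      using reach_step[of off P d] c0 0 \<open>Q d\<close> by auto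
  next
    case (Suc m)
    then have "k < n" by simp
    then have nz: "fst d r \<noteq> 0" and g: "gwp g b (J (Suc k)) d"
      using assms(2) Suc by auto
    have 1: "reach P 1 (cfg off d) (cfg (Suc off) d)"
      using reach_step[of off P d] c0 nz by (cases d) (auto simp: cfg_def)
    obtain d' where 2: "reach P b (cfg (Suc off) d) (cfg (Suc off + length (g (Suc off))) d')" "J (Suc k) d'"
      using g c1 unfolding gwp_def by blast
    have 3: "reach P 1 (cfg (Suc off + length (g (Suc off))) d') (cfg off d')"
      using reach_step[of "Suc off + length (g (Suc off))" P d'] c2 by (cases d') (auto simp: cfg_def)
    obtain d'' where 4: "reach P ((n - Suc k) * (b + 2) + 1) (cfg off d') (cfg e d'')" "Q d''"
      using Suc.hyps(1)[OF _ _ 2(2)] Suc.hyps(2) \<open>k < n\<close> by (metis Suc_leI Suc_diff_Suc nat.inject)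
    have "reach P (1 + (b + (1 + ((n - Suc k) * (b + 2) + 1)))) (cfg off d) (cfg e d'')"
      using 1 2 3 4 by (meson reach_trans)
    moreover have "1 + (b + (1 + ((n - Suc k) * (b + 2) + 1))) = (n - k) * (b + 2) + 1"
    proof -
      have "n - k = Suc (n - Suc k)" using \<open>k < n\<close> by simp
      then show ?thesis by simp
    qed
    ultimately show ?case
      using 4(2) by auto
  qed
  from this[of 0 d] assms(1)
  show "\<exists>d'. reach P (n * (b + 2) + 1) (cfg off d) (cfg (off + length (gwhile r g off)) d') \<and> Q d'"
    unfolding len by simp
qed

definition gif :: "nat \<Rightarrow> gen \<Rightarrow> gen \<Rightarrow> gen" where
  "gif r g g' = (\<lambda>off. let o1 = Suc off + length (g (Suc off)); o2 = Suc o1 in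
     JumpZero r o2 # g (Suc off) @ Jump (o2 + length (g' o2)) # g' o2)"

text \<open>The costs of the branches are added rather than maximised, so that static costs are
  built from sums and products only.\<close>

lemma gwp_if:
  assumes "fst d r \<noteq> 0 \<Longrightarrow> gwp g b Q d" and "fst d r = 0 \<Longrightarrow> gwp g' b' Q d"
  shows "gwp (gif r g g') (b + b' + 2) Q d"
  unfolding gwp_def
proof (intro allI impI)
  fix P off
  assume c: "code_at P off (gif r g g' off)"
  define o1 where "o1 = Suc off + length (g (Suc off))"
  define o2 where "o2 = Suc o1"
  define e where "e = o2 + length (g' o2)"
  have c': "off < length P" "P ! off = JumpZero r o2" "code_at P (Suc off) (g (Suc off))"
      "o1 < length P" "P ! o1 = Jump e" "code_at P o2 (g' o2)"
    using c unfolding gif_def Let_def e_def o2_def o1_def by (auto simp: code_at_Cons code_at_append)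
  have len: "off + length (gif r g g' off) = e"
    by (simp add: gif_def e_def o2_def o1_def Let_def)
  show "\<exists>d'. reach P (b + b' + 2) (cfg off d) (cfg (off + length (gif r g g' off)) d') \<and> Q d'"
    unfolding len
  proof (cases "fst d r = 0")
    case True
    have 1: "reach P 1 (cfg off d) (cfg o2 d)"
      using reach_step[of off P d] c' True by (cases d) (auto simp: cfg_def)
    obtain d' where 2: "reach P b' (cfg o2 d) (cfg e d')" "Q d'"
      using assms(2)[OF True] c' unfolding gwp_def e_def by blast
    have "reach P (b + b' + 2) (cfg off d) (cfg e d')"
      by (rule reach_mono[OF reach_trans[OF 1 2(1)]]) simp
    then show "\<exists>d'. reach P (b + b' + 2) (cfg off d) (cfg e d') \<and> Q d'"
      using 2(2) by auto
  next
    case False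
    have 1: "reach P 1 (cfg off d) (cfg (Suc off) d)"
      using reach_step[of off P d] c' False by (cases d) (auto simp: cfg_def)
    obtain d' where 2: "reach P b (cfg (Suc off) d) (cfg o1 d')" "Q d'"
      using assms(1)[OF False] c' unfolding gwp_def o1_def by blast
    have 3: "reach P 1 (cfg o1 d') (cfg e d')"
      using reach_step[of o1 P d'] c' by (cases d') (auto simp: cfg_def)
    have "reach P (1 + (b + 1)) (cfg off d) (cfg e d')"
      using 1 2 3 by (meson reach_trans)
    then have "reach P (b + b' + 2) (cfg off d) (cfg e d')"
      by (rule reach_mono) simp
    then show "\<exists>d'. reach P (b + b' + 2) (cfg off d) (cfg e d') \<and> Q d'"
      using 2(2) by auto
  qed
qed

lemma gwp_seq2:
  "gwp g b Q1 d \<Longrightarrow> (\<And>d'. Q1 d' \<Longrightarrow> gwp g' b' Q d') \<Longrightarrow> gwp (g ;; g') (b + b') Q d"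
  by (rule gwp_seq, erule gwp_weaken) auto

subsection \<open>Compilation\<close>

text \<open>Layout of the registers: register 0 always holds the length of the input, the odd
  register \<open>2 * r + 1\<close> is register \<open>r\<close> of the language, and the even
  registers from 2 on form a stack of intermediate results. An expression evaluated at height
  \<open>h\<close> may change only the stack from \<open>2 * h\<close> on.\<close>

definition keeps :: "nat \<Rightarrow> data \<Rightarrow> data \<Rightarrow> bool" where
  "keeps h d d' \<longleftrightarrow> snd d' = snd d \<and> (\<forall>r. odd r \<or> r < 2 * h \<longrightarrow> fst d' r = fst d r)"

lemma keeps_trans: "keeps h d d' \<Longrightarrow> keeps h' d' d'' \<Longrightarrow> h \<le> h' \<Longrightarrow> keeps h d d''"
  unfolding keeps_def by auto

text \<open>\<open>prod_encode (x, y)\<close> is \<open>x\<close> plus the sum of all numbers up to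
  \<open>x + y\<close>; without multiplication it is obtained by adding a counter that runs down
  from \<open>x + y\<close>.\<close>

definition gpair :: "nat \<Rightarrow> gen" where
  "gpair h = (ins (Add (2*h+4) (2*h) (2*h+2)) ;; ins (Move (2*h) (2*h+2)) ;; ins (Const (2*h+6) 1) ;;
     gwhile (2*h+4) (ins (Add (2*h) (2*h) (2*h+4)) ;; ins (Sub (2*h+4) (2*h+4) (2*h+6))))"

lemma gwp_pair:
  assumes "fst d (2*h+2) = x" "fst d (2*h) = y"
  shows "gwp (gpair h) (4 * (x + y) + 4) (\<lambda>d'. keeps h d d' \<and> fst d' (2*h) = prod_encode (x, y)) d"
proof -
  obtain R M b where d: "d = (R, M, b)" by (cases d)
  define J where "J = (\<lambda>k d'. keeps h d d' \<and> fst d' (2*h+4) = x + y - k \<and> fst d' (2*h+6) = 1 \<and>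
      fst d' (2*h) + triangle (x + y - k) = triangle (x + y) + x)"
  have loop: "gwp (gwhile (2*h+4) (ins (Add (2*h) (2*h) (2*h+4)) ;; ins (Sub (2*h+4) (2*h+4) (2*h+6))))
      ((x + y) * ((1 + 1) + 2) + 1) (\<lambda>d'. keeps h d d' \<and> fst d' (2*h) = prod_encode (x, y)) d'"
    if "J 0 d'" for d'
  proof (rule gwp_while[where J = J], fact)
    fix k d'
    assume k: "k < x + y" and J: "J k d'"
    obtain R' M' b' where d': "d' = (R', M', b')" by (cases d')
    have "x + y - k = Suc (x + y - Suc k)" using k by simp
    then have t: "triangle (x + y - k) = triangle (x + y - Suc k) + (x + y - k)"
      by (metis triangle_Suc)
    have "J (Suc k) (deff (Sub (2*h+4) (2*h+4) (2*h+6)) (deff (Add (2*h) (2*h) (2*h+4)) d'))"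
      using J k t unfolding J_def keeps_def d' d by auto
    then show "fst d' (2*h+4) \<noteq> 0 \<and> gwp (ins (Add (2*h) (2*h) (2*h+4)) ;; ins (Sub (2*h+4) (2*h+4) (2*h+6))) (1 + 1) (J (Suc k)) d'"
      using J k by (intro conjI gwp_seq gwp_ins) (auto simp: J_def)
  next
    fix d' assume "J (x + y) d'"
    then show "fst d' (2*h+4) = 0 \<and> keeps h d d' \<and> fst d' (2*h) = prod_encode (x, y)"
      unfolding J_def prod_encode_def by auto
  qed
  have "gwp (gpair h) (1 + (1 + (1 + ((x + y) * ((1 + 1) + 2) + 1))))
      (\<lambda>d'. keeps h d d' \<and> fst d' (2*h) = prod_encode (x, y)) d"
    unfolding gpair_def
    apply (rule gwp_seq, rule gwp_ins, simp, rule gwp_seq, rule gwp_ins, simp, rule gwp_seq, rule gwp_ins, simp)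
    apply (rule loop)
    using assms by (auto simp: J_def d keeps_def)
  then show ?thesis
    by (rule gwp_weaken) auto
qed

fun kaddr :: "nat \<times> nat \<times> nat \<times> nat \<Rightarrow> nat" where
  "kaddr (i, a, b, c) = prod_encode (i, prod_encode (a, prod_encode (b, c)))"

lemma kaddr_inj [simp]: "kaddr k = kaddr k' \<longleftrightarrow> k = k'"
  by (cases k; cases k') auto

text \<open>The heap lies behind the input. Since \<open>kaddr\<close> is injective, tables need no
  declared size and a write changes a single cell.\<close>

definition rel :: "nat list \<Rightarrow> store \<Rightarrow> data \<Rightarrow> bool" where
  "rel w s d \<longleftrightarrow>
     (\<forall>r. fst d (2 * r + 1) = regs s r) \<and> fst d 0 = length w \<and> (\<forall>i<length w. fst (snd d) i = w ! i) \<and>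
     (\<forall>k. fst (snd d) (length w + kaddr k) = heap s k) \<and> snd (snd d) = obuf s"

lemma rel_keeps: "rel w s d \<Longrightarrow> keeps h d d' \<Longrightarrow> h \<ge> 1 \<Longrightarrow> rel w s d'"
  by (auto simp: rel_def keeps_def)

lemma rel_setr:
  assumes "rel w s d" "snd d' = snd d" "fst d' (2 * r + 1) = k"
    and "\<And>q. q \<noteq> 2 * r + 1 \<Longrightarrow> odd q \<or> q = 0 \<Longrightarrow> fst d' q = fst d q"
  shows "rel w (setr r k s) d'"
proof -
  have "fst d' (2 * q + 1) = (if q = r then k else regs s q)" for q
    using assms(1,3) assms(4)[of "2 * q + 1"] by (auto simp: rel_def)
  moreover have "fst d' 0 = length w"
    using assms(1) assms(4)[of 0] by (simp add: rel_def)
  ultimately show ?thesis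
    using assms(1,2) by (simp add: rel_def)
qed

definition evalok :: "nat list \<Rightarrow> store \<Rightarrow> nat \<Rightarrow> nat \<Rightarrow> (nat \<Rightarrow> gen) \<Rightarrow> bool" where
  "evalok w s v c g \<longleftrightarrow> (\<forall>h d. h \<ge> 1 \<longrightarrow> rel w s d \<longrightarrow>
     gwp (g h) c (\<lambda>d'. keeps h d d' \<and> fst d' (2*h) = v) d)"

text \<open>The innermost pair is formed first, so that only two operands are on the stack at a
  time. Adding register 0 at the end skips the input.\<close>

definition gkey :: "nat \<Rightarrow> (nat \<Rightarrow> gen) \<Rightarrow> (nat \<Rightarrow> gen) \<Rightarrow> (nat \<Rightarrow> gen) \<Rightarrow> nat \<Rightarrow> gen" where
  "gkey i ga gb gc h = (gc h ;; gb (h + 1) ;; gpair h ;; ga (h + 1) ;; gpair h ;;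
     ins (Const (2*h+2) i) ;; gpair h ;; ins (Add (2*h) (2*h) 0))"

text \<open>\<open>e1\<close> and \<open>e2\<close> bound the inner and the middle pair by
  \<open>prod_encode_le\<close>, for components of sum at most \<open>2 * B\<close> and
  \<open>B + e1\<close>. Each summand of the form \<open>4 * z + 4\<close> is the price of one
  \<open>gpair\<close>; the two 1s pay for loading \<open>i\<close> and for adding the length of the
  input.\<close>

definition kcst :: "nat \<Rightarrow> nat \<Rightarrow> nat" where
  "kcst i B = (let e1 = (2*B+1)*(2*B+1); e2 = (B+e1+1)*(B+e1+1) in
     (4*(2*B)+4) + (4*(B+e1)+4) + 1 + (4*(i+e2)+4) + 1)"

lemma triangle_mono: "x \<le> y \<Longrightarrow> triangle x \<le> triangle y"
  unfolding triangle_def by (intro div_le_mono mult_le_mono) auto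

lemma prod_encode_le: "x + y \<le> z \<Longrightarrow> prod_encode (x, y) \<le> (z+1)*(z+1)"
proof -
  assume le: "x + y \<le> z"
  have "triangle z + z \<le> (z+1)*(z+1)"
    by (induction z) auto
  then show ?thesis
    using le triangle_mono[OF le] unfolding prod_encode_def by auto
qed

lemma evalok_key:
  assumes a: "evalok w s va ca ga" "va \<le> B" and b: "evalok w s vb cb gb" "vb \<le> B"
    and c: "evalok w s vc cc gc" "vc \<le> B"
  shows "evalok w s (length w + kaddr (i, va, vb, vc)) (ca + cb + cc + kcst i B) (gkey i ga gb gc)"
  unfolding evalok_def
proof (intro allI impI)
  fix h :: nat and d :: data
  assume h: "1 \<le> h" and r: "rel w s d"
  define e1 where "e1 = prod_encode (vb, vc)"
  define e2 where "e2 = prod_encode (va, e1)"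
  have e1: "e1 \<le> (2*B+1)*(2*B+1)"
    unfolding e1_def using b(2) c(2) by (intro prod_encode_le) auto
  have e2: "e2 \<le> (B+(2*B+1)*(2*B+1)+1)*(B+(2*B+1)*(2*B+1)+1)"
    unfolding e2_def using a(2) e1 by (intro prod_encode_le) auto
  let ?K = "\<lambda>v d'. keeps h d d' \<and> fst d' (2*h) = v"
  let ?K2 = "\<lambda>v u d'. keeps h d d' \<and> fst d' (2*h) = v \<and> fst d' (2*h+2) = u"
  have arg: "gwp (g (h+1)) c (?K2 v u) d'" if "?K v d'" "evalok w s u c g" for g c v u d'
  proof -
    have "gwp (g (h+1)) c (\<lambda>d''. keeps (h+1) d' d'' \<and> fst d'' (2*(h+1)) = u) d'"
      using that(2)[unfolded evalok_def, rule_format, of "h+1" d'] rel_keeps[OF r _ h] that(1) by simp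
    then show ?thesis
      by (rule gwp_weaken[OF _ order_refl]) (use that(1) in \<open>auto simp: keeps_def\<close>)
  qed
  have pair: "gwp (gpair h) (4*(u+v)+4) (?K (prod_encode (u, v))) d'" if "?K2 v u d'" for u v d'
    by (rule gwp_weaken[OF gwp_pair[of d' h u v]]) (use that in \<open>auto intro: keeps_trans\<close>)
  have const: "gwp (ins (Const (2*h+2) i)) 1 (?K2 v i) d'" if "?K v d'" for v d'
    using that by (intro gwp_ins) (auto simp: keeps_def)
  have add: "gwp (ins (Add (2*h) (2*h) 0)) 1 (?K (length w + v)) d'" if "?K v d'" for v d'
  proof -
    have "rel w s d'" using rel_keeps[OF r _ h] that by auto
    then show ?thesis
      using that by (intro gwp_ins) (auto simp: keeps_def rel_def)
  qed
  have "gwp (gkey i ga gb gc h) (cc + (cb + ((4*(vb+vc)+4) + (ca + ((4*(va+e1)+4) + (1 + ((4*(i+e2)+4) + 1)))))))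
     (?K (length w + prod_encode (i, e2))) d"
    unfolding gkey_def e2_def e1_def
  proof (rule gwp_seq2)
    show "gwp (gc h) cc (?K vc) d" using c h r unfolding evalok_def by auto
  qed (rule gwp_seq2, erule arg, rule b(1), rule gwp_seq2, erule pair, rule gwp_seq2, erule arg, rule a(1),
     rule gwp_seq2, erule pair, rule gwp_seq2, erule const, rule gwp_seq2, erule pair, erule add)
  then show "gwp (gkey i ga gb gc h) (ca + cb + cc + kcst i B) (?K (length w + kaddr (i, va, vb, vc))) d"
  proof (rule gwp_weaken)
    show "cc + (cb + ((4*(vb+vc)+4) + (ca + ((4*(va+e1)+4) + (1 + ((4*(i+e2)+4) + 1))))))
        \<le> ca + cb + cc + kcst i B"
    proof -
      have "cc + (cb + ((4*(vb+vc)+4) + (ca + ((4*(va+e1)+4) + (1 + ((4*(i+e2)+4) + 1)))))) \<le>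
          ca + cb + cc + ((4*(2*B)+4) + (4*(B+E1)+4) + 1 + (4*(i+E2)+4) + 1)"
        if "e1 \<le> E1" "e2 \<le> E2" for E1 E2
      proof -
        have *: "cc + (cb + ((x+4) + (ca + ((y+4) + (1 + ((z+4) + 1)))))) \<le>
            ca + cb + cc + ((x'+4) + (y'+4) + 1 + (z'+4) + 1)" if "x \<le> x'" "y \<le> y'" "z \<le> z'" for x x' y y' z z'
          using that by simp
        show ?thesis
          by (rule *) (use that a(2) b(2) c(2) in auto)
      qed
      from this[OF e1 e2] show ?thesis
        unfolding kcst_def Let_def .
    qed
  qed (simp add: e1_def e2_def)
qed

text \<open>\<open>Sum\<close> counts down on the stack and counts up directly in the register of
  the summation variable, whose old value is parked at \<open>2 * h + 2\<close>. This is sound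
  because evaluating the summand leaves every register of the language as it was.\<close>

primrec acomp :: "aexp \<Rightarrow> nat \<Rightarrow> gen" where
  "acomp (Lit n) = (\<lambda>h. ins (Const (2*h) n))"
| "acomp (Var r) = (\<lambda>h. ins (Move (2*h) (2*r+1)))"
| "acomp Len = (\<lambda>h. ins (Move (2*h) 0))"
| "acomp (Inp a) = (\<lambda>h. acomp a h ;; ins (Load (2*h) (2*h)))"
| "acomp (Plus a b) = (\<lambda>h. acomp a h ;; acomp b (h+1) ;; ins (Add (2*h) (2*h) (2*h+2)))"
| "acomp (Minus a b) = (\<lambda>h. acomp a h ;; acomp b (h+1) ;; ins (Sub (2*h) (2*h) (2*h+2)))"
| "acomp (Times a b) = (\<lambda>h. acomp a h ;; acomp b (h+1) ;; ins (Const (2*h+4) 0) ;; ins (Const (2*h+6) 1) ;;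
     gwhile (2*h) (ins (Add (2*h+4) (2*h+4) (2*h+2)) ;; ins (Sub (2*h) (2*h) (2*h+6))) ;;
     ins (Move (2*h) (2*h+4)))"
| "acomp (Ite c a b) = (\<lambda>h. acomp c h ;; gif (2*h) (acomp a h) (acomp b h))"
| "acomp (Sum r a b) = (\<lambda>h. acomp a h ;; ins (Move (2*h+2) (2*r+1)) ;; ins (Const (2*h+4) 0) ;;
     ins (Const (2*r+1) 0) ;;
     gwhile (2*h) (acomp b (h+3) ;; ins (Add (2*h+4) (2*h+4) (2*h+6)) ;; ins (Const (2*h+6) 1) ;;
       ins (Add (2*r+1) (2*r+1) (2*h+6)) ;; ins (Sub (2*h) (2*h) (2*h+6))) ;;
     ins (Move (2*r+1) (2*h+2)) ;; ins (Move (2*h) (2*h+4)))"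
| "acomp (Rd i a b c) = (\<lambda>h. gkey i (acomp a) (acomp b) (acomp c) h ;; ins (Load (2*h) (2*h)))"

primrec acst :: "aexp \<Rightarrow> nat \<Rightarrow> nat" where
  "acst (Lit n) = (\<lambda>B. 1)"
| "acst (Var r) = (\<lambda>B. 1)"
| "acst Len = (\<lambda>B. 1)"
| "acst (Inp a) = (\<lambda>B. acst a B + 1)"
| "acst (Plus a b) = (\<lambda>B. acst a B + acst b B + 1)"
| "acst (Minus a b) = (\<lambda>B. acst a B + acst b B + 1)"
| "acst (Times a b) = (\<lambda>B. acst a B + acst b B + (B * 4 + 4))"
| "acst (Ite c a b) = (\<lambda>B. acst c B + acst a B + acst b B + 2)"
| "acst (Sum r a b) = (\<lambda>B. acst a B + B * (acst b B + 6) + 6)"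
| "acst (Rd i a b c) = (\<lambda>B. acst a B + acst b B + acst c B + kcst i B + 1)"

lemma acomp_evalok: "abnd w B e s \<Longrightarrow> evalok w s (aval w e s) (acst e B) (acomp e)"
proof (induction e arbitrary: s)
  case (Lit n)
  show ?case unfolding evalok_def acomp.simps acst.simps by (intro allI impI gwp_ins) (auto simp: keeps_def)
next
  case (Var r)
  show ?case unfolding evalok_def acomp.simps acst.simps by (intro allI impI gwp_ins) (auto simp: keeps_def rel_def)
next
  case Len
  show ?case unfolding evalok_def acomp.simps acst.simps by (intro allI impI gwp_ins) (auto simp: keeps_def rel_def)
next
  case (Inp a)
  have IH: "evalok w s (aval w a s) (acst a B) (acomp a)" and l: "aval w a s < length w"
    using Inp by auto
  show ?case
    unfolding evalok_def acomp.simps acst.simps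
  proof (intro allI impI)
    fix h :: nat and d :: data assume h: "1 \<le> h" and r: "rel w s d"
    show "gwp (acomp a h ;; ins (Load (2*h) (2*h))) (acst a B + 1)
       (\<lambda>d'. keeps h d d' \<and> fst d' (2*h) = aval w (Inp a) s) d"
    proof (rule gwp_seq2[OF IH[unfolded evalok_def, rule_format, OF h r]])
      fix d' assume d': "keeps h d d' \<and> fst d' (2*h) = aval w a s"
      then have "rel w s d'" using rel_keeps r h by blast
      then have "fst (snd d') (fst d' (2*h)) = aval w (Inp a) s"
        using d' l by (simp add: rel_def)
      then show "gwp (ins (Load (2*h) (2*h))) 1 (\<lambda>d'. keeps h d d' \<and> fst d' (2*h) = aval w (Inp a) s) d'"
        using d' l by (intro gwp_ins) (simp_all add: keeps_def)
    qed
  qed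
next
  case (Plus a b)
  then have IH: "evalok w s (aval w a s) (acst a B) (acomp a)" "evalok w s (aval w b s) (acst b B) (acomp b)"
    by auto
  show ?case
    unfolding evalok_def acomp.simps acst.simps add.assoc
  proof (intro allI impI, rule gwp_seq2[OF IH(1)[unfolded evalok_def, rule_format]], assumption, assumption)
    fix h :: nat and d d' :: data assume h: "1 \<le> h" and r: "rel w s d" and d': "keeps h d d' \<and> fst d' (2*h) = aval w a s"
    then have r': "rel w s d'" using rel_keeps by blast
    show "gwp (acomp b (h+1) ;; ins (Add (2*h) (2*h) (2*h+2))) (acst b B + 1)
       (\<lambda>d'. keeps h d d' \<and> fst d' (2*h) = aval w (Plus a b) s) d'"
    proof (rule gwp_seq2[OF IH(2)[unfolded evalok_def, rule_format, OF _ r']])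
      fix d'' assume d'': "keeps (h+1) d' d'' \<and> fst d'' (2*(h+1)) = aval w b s"
      then show "gwp (ins (Add (2*h) (2*h) (2*h+2))) 1 (\<lambda>d'. keeps h d d' \<and> fst d' (2*h) = aval w (Plus a b) s) d''"
        using d' by (intro gwp_ins) (auto simp: keeps_def)
    qed simp
  qed
next
  case (Minus a b)
  then have IH: "evalok w s (aval w a s) (acst a B) (acomp a)" "evalok w s (aval w b s) (acst b B) (acomp b)"
    by auto
  show ?case
    unfolding evalok_def acomp.simps acst.simps add.assoc
  proof (intro allI impI, rule gwp_seq2[OF IH(1)[unfolded evalok_def, rule_format]], assumption, assumption)
    fix h :: nat and d d' :: data assume h: "1 \<le> h" and r: "rel w s d" and d': "keeps h d d' \<and> fst d' (2*h) = aval w a s"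
    then have r': "rel w s d'" using rel_keeps by blast
    show "gwp (acomp b (h+1) ;; ins (Sub (2*h) (2*h) (2*h+2))) (acst b B + 1)
       (\<lambda>d'. keeps h d d' \<and> fst d' (2*h) = aval w (Minus a b) s) d'"
    proof (rule gwp_seq2[OF IH(2)[unfolded evalok_def, rule_format, OF _ r']])
      fix d'' assume d'': "keeps (h+1) d' d'' \<and> fst d'' (2*(h+1)) = aval w b s"
      then show "gwp (ins (Sub (2*h) (2*h) (2*h+2))) 1 (\<lambda>d'. keeps h d d' \<and> fst d' (2*h) = aval w (Minus a b) s) d''"
        using d' by (intro gwp_ins) (auto simp: keeps_def)
    qed simp
  qed
next
  case (Times a b)
  then have IH: "evalok w s (aval w a s) (acst a B) (acomp a)" "evalok w s (aval w b s) (acst b B) (acomp b)"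
    and le: "aval w a s \<le> B"
    by auto
  let ?g = "\<lambda>h. ins (Add (2*h+4) (2*h+4) (2*h+2)) ;; ins (Sub (2*h) (2*h) (2*h+6))"
  show ?case
    unfolding evalok_def acomp.simps acst.simps add.assoc
  proof (intro allI impI, rule gwp_seq2[OF IH(1)[unfolded evalok_def, rule_format]], assumption, assumption)
    fix h :: nat and d d' :: data assume h: "1 \<le> h" and r: "rel w s d" and d': "keeps h d d' \<and> fst d' (2*h) = aval w a s"
    then have r': "rel w s d'" using rel_keeps by blast
    let ?Q = "\<lambda>d'. keeps h d d' \<and> fst d' (2*h) = aval w (Times a b) s"
    define J where "J = (\<lambda>k d'. keeps h d d' \<and> fst d' (2*h) = aval w a s - k \<and> fst d' (2*h+2) = aval w b s \<and>
       fst d' (2*h+6) = 1 \<and> fst d' (2*h+4) = k * aval w b s)"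
    have loop: "gwp (gwhile (2*h) (?g h)) (aval w a s * ((1+1)+2) + 1) (J (aval w a s)) d'" if "J 0 d'" for d'
    proof (rule gwp_while[where J = J], fact)
      fix k d' assume "k < aval w a s" "J k d'"
      then show "fst d' (2*h) \<noteq> 0 \<and> gwp (?g h) (1+1) (J (Suc k)) d'"
        by (intro conjI gwp_seq gwp_ins) (auto simp: J_def keeps_def)
    qed (auto simp: J_def)
    show "gwp (acomp b (h+1) ;; ins (Const (2*h+4) 0) ;; ins (Const (2*h+6) 1) ;; gwhile (2*h) (?g h) ;;
        ins (Move (2*h) (2*h+4))) (acst b B + (B * 4 + 4)) ?Q d'"
    proof (rule gwp_seq2[OF IH(2)[unfolded evalok_def, rule_format, OF _ r']])
      fix d'' assume d'': "keeps (h+1) d' d'' \<and> fst d'' (2*(h+1)) = aval w b s"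
      have "gwp (ins (Const (2*h+4) 0) ;; ins (Const (2*h+6) 1) ;; gwhile (2*h) (?g h) ;;
        ins (Move (2*h) (2*h+4))) (1 + (1 + ((aval w a s * ((1+1)+2) + 1) + 1))) ?Q d''"
      proof (rule gwp_seq, rule gwp_ins, simp, rule gwp_seq, rule gwp_ins, simp, rule gwp_seq2, rule loop)
        show "J 0 (deff (Const (2*h+6) 1) (deff (Const (2*h+4) 0) d''))"
          using d' d'' by (cases d'') (auto simp: J_def keeps_def)
      next
        fix d3 assume "J (aval w a s) d3"
        then show "gwp (ins (Move (2*h) (2*h+4))) 1 ?Q d3"
          by (intro gwp_ins) (auto simp: J_def keeps_def)
      qed
      then show "gwp (ins (Const (2*h+4) 0) ;; ins (Const (2*h+6) 1) ;; gwhile (2*h) (?g h) ;;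
        ins (Move (2*h) (2*h+4))) (B * 4 + 4) ?Q d''"
        by (rule gwp_weaken) (use le in auto)
    qed simp
  qed
next
  case (Ite c a b)
  then have IH: "evalok w s (aval w c s) (acst c B) (acomp c)"
      "aval w c s \<noteq> 0 \<Longrightarrow> evalok w s (aval w a s) (acst a B) (acomp a)"
      "aval w c s = 0 \<Longrightarrow> evalok w s (aval w b s) (acst b B) (acomp b)"
    by auto
  show ?case
    unfolding evalok_def acomp.simps acst.simps add.assoc
  proof (intro allI impI, rule gwp_seq2[OF IH(1)[unfolded evalok_def, rule_format]], assumption, assumption)
    fix h :: nat and d d' :: data assume h: "1 \<le> h" and r: "rel w s d" and d': "keeps h d d' \<and> fst d' (2*h) = aval w c s"
    then have r': "rel w s d'" using rel_keeps by blast
    let ?Q = "\<lambda>d'. keeps h d d' \<and> fst d' (2*h) = aval w (Ite c a b) s"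
    have "gwp (gif (2*h) (acomp a h) (acomp b h)) (acst a B + acst b B + 2) ?Q d'"
    proof (rule gwp_if)
      assume "fst d' (2*h) \<noteq> 0"
      with d' have nz: "aval w c s \<noteq> 0" by simp
      show "gwp (acomp a h) (acst a B) ?Q d'"
        by (rule gwp_weaken[OF IH(2)[OF nz, unfolded evalok_def, rule_format, OF h r'] order_refl])
          (use d' nz in \<open>auto intro: keeps_trans\<close>)
    next
      assume "fst d' (2*h) = 0"
      with d' have z: "aval w c s = 0" by simp
      show "gwp (acomp b h) (acst b B) ?Q d'"
        by (rule gwp_weaken[OF IH(3)[OF z, unfolded evalok_def, rule_format, OF h r'] order_refl])
          (use d' z in \<open>auto intro: keeps_trans\<close>)
    qed
    then show "gwp (gif (2*h) (acomp a h) (acomp b h)) (acst a B + (acst b B + 2)) ?Q d'"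
      by (simp add: add.assoc)
  qed
next
  case (Sum r a b)
  let ?n = "aval w a s"
  have IH1: "evalok w s ?n (acst a B) (acomp a)" and le: "?n \<le> B"
    and IH2: "\<And>k. k < ?n \<Longrightarrow> evalok w (setr r k s) (aval w b (setr r k s)) (acst b B) (acomp b)"
    using Sum by auto
  let ?g = "\<lambda>h. acomp b (h+3) ;; ins (Add (2*h+4) (2*h+4) (2*h+6)) ;; ins (Const (2*h+6) 1) ;;
       ins (Add (2*r+1) (2*r+1) (2*h+6)) ;; ins (Sub (2*h) (2*h) (2*h+6))"
  show ?case
    unfolding evalok_def acomp.simps acst.simps add.assoc
  proof (intro allI impI, rule gwp_seq2[OF IH1[unfolded evalok_def, rule_format]], assumption, assumption)
    fix h :: nat and d d' :: data assume h: "1 \<le> h" and re: "rel w s d" and d': "keeps h d d' \<and> fst d' (2*h) = ?n"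
    let ?Q = "\<lambda>d'. keeps h d d' \<and> fst d' (2*h) = aval w (Sum r a b) s"
    \<comment> \<open>Between rounds the machine represents the store with index \<open>k\<close> in
      register \<open>r\<close>. Hence \<open>keeps\<close> fails for that one register and is
      required for all others; it is restored from the parked value at the end.\<close>
    define J where "J = (\<lambda>k d'. rel w (setr r k s) d' \<and> snd d' = snd d \<and>
       (\<forall>q. q \<noteq> 2*r+1 \<and> (odd q \<or> q < 2*h) \<longrightarrow> fst d' q = fst d q) \<and>
       fst d' (2*h) = ?n - k \<and> fst d' (2*h+2) = regs s r \<and>
       fst d' (2*h+4) = (\<Sum>j<k. aval w b (setr r j s)))"
    have body: "gwp (?g h) (acst b B + (1 + (1 + (1 + 1)))) (J (Suc k)) d'" if J: "J k d'" and k: "k < ?n" for k d'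
    proof (rule gwp_seq2)
      show "gwp (acomp b (h+3)) (acst b B) (\<lambda>d''. keeps (h+3) d' d'' \<and> fst d'' (2*(h+3)) = aval w b (setr r k s)) d'"
        using IH2[OF k, unfolded evalok_def, rule_format, of "h+3" d'] J unfolding J_def by simp
    next
      fix d'' assume d'': "keeps (h+3) d' d'' \<and> fst d'' (2*(h+3)) = aval w b (setr r k s)"
      have rl: "rel w (setr r k s) d''"
        using J d'' rel_keeps[of w "setr r k s" d' "h+3" d''] unfolding J_def by auto
      define d4 where "d4 = deff (Sub (2*h) (2*h) (2*h+6)) (deff (Add (2*r+1) (2*r+1) (2*h+6)) (deff (Const (2*h+6) 1)
          (deff (Add (2*h+4) (2*h+4) (2*h+6)) d'')))"
      have neq: "2 * q + 1 \<noteq> 2 * h" "2 * q + 1 \<noteq> 2 * h + 2" "2 * q + 1 \<noteq> 2 * h + 4" "2 * q + 1 \<noteq> 2 * h + 6"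
        for q by presburger+
      have "fst d'' (2*r+1) = k" using rl by (simp add: rel_def)
      then have v4: "fst d4 (2*r+1) = Suc k" "fst d4 (2*h) = fst d'' (2*h) - 1" "fst d4 (2*h+2) = fst d'' (2*h+2)"
          "fst d4 (2*h+4) = fst d'' (2*h+4) + fst d'' (2*h+6)" "snd d4 = snd d''"
        using neq[of r] neq[of r, symmetric] unfolding d4_def by simp_all
      have o4: "fst d4 q = fst d'' q" if "q \<noteq> 2*r+1" "odd q \<or> q < 2*h" for q
      proof -
        have "q \<noteq> 2*h" "q \<noteq> 2*h+4" "q \<noteq> 2*h+6" using that by auto
        then show ?thesis using that unfolding d4_def by simp
      qed
      have "rel w (setr r (Suc k) (setr r k s)) d4"
        by (rule rel_setr[OF rl v4(5,1)], rule o4) (use h in auto)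
      moreover have "snd d4 = snd d"
        using J d'' v4(5) by (simp add: J_def keeps_def del: deff.simps)
      moreover have "fst d4 q = fst d q" if "q \<noteq> 2*r+1" "odd q \<or> q < 2*h" for q
      proof -
        have "odd q \<or> q < 2*(h+3)" using that by auto
        then have "fst d'' q = fst d' q" using d'' unfolding keeps_def by blast
        then show ?thesis using o4[OF that] J that unfolding J_def by metis
      qed
      moreover have "fst d4 (2*h) = ?n - Suc k" "fst d4 (2*h+2) = regs s r"
          "fst d4 (2*h+4) = (\<Sum>j<Suc k. aval w b (setr r j s))"
        using J d'' v4 k by (simp_all add: J_def keeps_def del: deff.simps)
      ultimately have "J (Suc k) d4"
        unfolding J_def by simp
      then show "gwp (ins (Add (2*h+4) (2*h+4) (2*h+6)) ;; ins (Const (2*h+6) 1) ;;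
          ins (Add (2*r+1) (2*r+1) (2*h+6)) ;; ins (Sub (2*h) (2*h) (2*h+6))) (1 + (1 + (1 + 1))) (J (Suc k)) d''"
        unfolding d4_def by (intro gwp_seq gwp_ins) (simp_all del: deff.simps)
    qed
    have loop: "gwp (gwhile (2*h) (?g h)) (?n * ((acst b B + (1 + (1 + (1 + 1)))) + 2) + 1) (J ?n) d'" if "J 0 d'" for d'
      by (rule gwp_while[where J = J], fact, use body in \<open>auto simp: J_def\<close>)
    have "gwp (ins (Move (2*h+2) (2*r+1)) ;; ins (Const (2*h+4) 0) ;; ins (Const (2*r+1) 0) ;; gwhile (2*h) (?g h) ;;
         ins (Move (2*r+1) (2*h+2)) ;; ins (Move (2*h) (2*h+4)))
        (1 + (1 + (1 + ((?n * ((acst b B + (1 + (1 + (1 + 1)))) + 2) + 1) + (1 + 1))))) ?Q d'"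
    proof (rule gwp_seq, rule gwp_ins, simp, rule gwp_seq, rule gwp_ins, simp, rule gwp_seq, rule gwp_ins, simp,
        rule gwp_seq2, rule loop)
      have "rel w s d'" using rel_keeps d' re h by blast
      define d3 where "d3 = deff (Const (2*r+1) 0) (deff (Const (2*h+4) 0) (deff (Move (2*h+2) (2*r+1)) d'))"
      have neq: "2 * r + 1 \<noteq> 2 * h" "2 * r + 1 \<noteq> 2 * h + 2" "2 * r + 1 \<noteq> 2 * h + 4" by presburger+
      have v: "fst d3 (2*r+1) = 0" "fst d3 (2*h) = ?n" "fst d3 (2*h+2) = regs s r" "fst d3 (2*h+4) = 0"
          "snd d3 = snd d'"
        using neq neq[symmetric] d' \<open>rel w s d'\<close> unfolding d3_def by (simp_all add: rel_def)
      have o: "fst d3 q = fst d' q" if "q \<noteq> 2*r+1" "odd q \<or> q < 2*h" for q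
      proof -
        have "q \<noteq> 2*h+2" "q \<noteq> 2*h+4" using that by auto
        then show ?thesis using that unfolding d3_def by simp
      qed
      have "rel w (setr r 0 s) d3"
        by (rule rel_setr[OF \<open>rel w s d'\<close> v(5,1)], rule o) (use h in auto)
      then show "J 0 (deff (Const (2*r+1) 0) (deff (Const (2*h+4) 0) (deff (Move (2*h+2) (2*r+1)) d')))"
        using d' o v unfolding J_def keeps_def d3_def[symmetric] by simp
    next
      fix d3 assume J: "J ?n d3"
      have "regs s r = fst d (2*r+1)" using re by (cases d) (auto simp: rel_def)
      moreover have "2*h+4 \<noteq> 2*r+1" by presburger
      ultimately show "gwp (ins (Move (2*r+1) (2*h+2)) ;; ins (Move (2*h) (2*h+4))) (1+1) ?Q d3"
        using J by (intro gwp_ins gwp_seq) (auto simp: J_def keeps_def)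
    qed
    then show "gwp (ins (Move (2*h+2) (2*r+1)) ;; ins (Const (2*h+4) 0) ;; ins (Const (2*r+1) 0) ;; gwhile (2*h) (?g h) ;;
         ins (Move (2*r+1) (2*h+2)) ;; ins (Move (2*h) (2*h+4))) (B * (acst b B + 6) + 6) ?Q d'"
    proof (rule gwp_weaken)
      have "?n * (acst b B + 6) \<le> B * (acst b B + 6)" using le by simp
      then show "1 + (1 + (1 + ((?n * ((acst b B + (1 + (1 + (1 + 1)))) + 2) + 1) + (1 + 1)))) \<le> B * (acst b B + 6) + 6"
        by (simp add: eval_nat_numeral)
    qed
  qed
next
  case (Rd i a b c)
  then have IH: "evalok w s (aval w a s) (acst a B) (acomp a)" "evalok w s (aval w b s) (acst b B) (acomp b)"
     "evalok w s (aval w c s) (acst c B) (acomp c)" and le: "aval w a s \<le> B" "aval w b s \<le> B" "aval w c s \<le> B"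
    by auto
  note key = evalok_key[OF IH(1) le(1) IH(2) le(2) IH(3) le(3), of i]
  show ?case
    unfolding evalok_def acomp.simps acst.simps
  proof (intro allI impI, rule gwp_seq2[OF key[unfolded evalok_def, rule_format]], assumption, assumption)
    fix h :: nat and d d' :: data assume h: "1 \<le> h" and r: "rel w s d"
      and d': "keeps h d d' \<and> fst d' (2*h) = length w + kaddr (i, aval w a s, aval w b s, aval w c s)"
    then have "rel w s d'" using rel_keeps by blast
    then have "fst (snd d') (fst d' (2*h)) = aval w (Rd i a b c) s"
      using d' by (simp add: rel_def del: kaddr.simps)
    then show "gwp (ins (Load (2*h) (2*h))) 1 (\<lambda>d'. keeps h d d' \<and> fst d' (2*h) = aval w (Rd i a b c) s) d'"
      using d' by (intro gwp_ins) (simp_all add: keeps_def)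
  qed
qed

text \<open>Unlike a summand, the body of a loop may assign the loop register. The index therefore
  lives at \<open>2 * h + 4\<close> and is copied at the start of each round; the body works above
  the three cells for countdown, old value and index.\<close>

primrec ccomp :: "com \<Rightarrow> nat \<Rightarrow> gen" where
  "ccomp Skip = (\<lambda>h off. [])"
| "ccomp (Set r e) = (\<lambda>h. acomp e h ;; ins (Move (2*r+1) (2*h)))"
| "ccomp (Put i a b c e) = (\<lambda>h. acomp e h ;; gkey i (acomp a) (acomp b) (acomp c) (h+1) ;;
     ins (Store (2*h+2) (2*h)))"
| "ccomp (Seq c d) = (\<lambda>h. ccomp c h ;; ccomp d h)"
| "ccomp (If e c d) = (\<lambda>h. acomp e h ;; gif (2*h) (ccomp c h) (ccomp d h))"
| "ccomp (For r e c) = (\<lambda>h. acomp e h ;; ins (Move (2*h+2) (2*r+1)) ;; ins (Const (2*h+4) 0) ;;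
     gwhile (2*h) (ins (Move (2*r+1) (2*h+4)) ;; ccomp c (h+3) ;; ins (Const (2*h+6) 1) ;;
       ins (Add (2*h+4) (2*h+4) (2*h+6)) ;; ins (Sub (2*h) (2*h) (2*h+6))) ;;
     ins (Move (2*r+1) (2*h+2)))"
| "ccomp (Out e) = (\<lambda>h. acomp e h ;; ins (Write (2*h)))"

primrec ccst :: "com \<Rightarrow> nat \<Rightarrow> nat" where
  "ccst Skip = (\<lambda>B. 0)"
| "ccst (Set r e) = (\<lambda>B. acst e B + 1)"
| "ccst (Put i a b c e) = (\<lambda>B. acst e B + (acst a B + acst b B + acst c B + kcst i B) + 1)"
| "ccst (Seq c d) = (\<lambda>B. ccst c B + ccst d B)"
| "ccst (If e c d) = (\<lambda>B. acst e B + ccst c B + ccst d B + 2)"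
| "ccst (For r e c) = (\<lambda>B. acst e B + B * (ccst c B + 6) + 4)"
| "ccst (Out e) = (\<lambda>B. acst e B + 1)"

text \<open>Commands are meant to change registers of the language and the memory, so only the stack
  part of \<open>keeps\<close> is left to preserve.\<close>

definition keepe :: "nat \<Rightarrow> data \<Rightarrow> data \<Rightarrow> bool" where
  "keepe h d d' \<longleftrightarrow> (\<forall>q. even q \<and> q < 2 * h \<longrightarrow> fst d' q = fst d q)"

lemma keepe_trans: "keepe h d d' \<Longrightarrow> keepe h' d' d'' \<Longrightarrow> h \<le> h' \<Longrightarrow> keepe h d d''"
  unfolding keepe_def by auto

lemma keeps_keepe: "keeps h d d' \<Longrightarrow> keepe h d d'"
  unfolding keepe_def keeps_def by auto

lemma rel_even:
  "rel w s d \<Longrightarrow> snd d' = snd d \<Longrightarrow> (\<And>q. odd q \<or> q = 0 \<Longrightarrow> fst d' q = fst d q) \<Longrightarrow> rel w s d'"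
  unfolding rel_def by simp

lemma kaddr_upd:
  assumes "rel w s d"
  shows "rel w (s\<lparr>heap := (heap s)(k := v)\<rparr>) (fst d, (fst (snd d))(length w + kaddr k := v), snd (snd d))"
  using assms unfolding rel_def by (auto simp del: kaddr.simps)

text \<open>The cost depends on the store only through the hypothesis \<open>cbnd\<close>, so one
  number bounds every execution of the command, whatever the state reached between two
  answers.\<close>

lemma ccomp_gwp:
  "cbnd w B c s \<Longrightarrow> h \<ge> 1 \<Longrightarrow> rel w s d \<Longrightarrow>
     gwp (ccomp c h) (ccst c B) (\<lambda>d'. rel w (exec w c s) d' \<and> keepe h d d') d"
proof (induction c arbitrary: s h d)
  case Skip
  then show ?case
    by (auto simp: gwp_def keepe_def intro!: exI[of _ d] reach_refl)
next
  case (Set r e)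
  have e: "evalok w s (aval w e s) (acst e B) (acomp e)"
    using Set by (intro acomp_evalok) simp
  show ?case
    unfolding ccomp.simps ccst.simps
  proof (rule gwp_seq2[OF e[unfolded evalok_def, rule_format, OF Set.prems(2,3)]], rule gwp_ins)
    fix d' assume d': "keeps h d d' \<and> fst d' (2*h) = aval w e s"
    have rl: "rel w s d'" using rel_keeps Set d' by blast
    show "rel w (exec w (Set r e) s) (deff (Move (2*r+1) (2*h)) d') \<and> keepe h d (deff (Move (2*r+1) (2*h)) d')"
      unfolding exec.simps
      by (intro conjI, rule rel_setr[OF rl]) (use d' in \<open>auto simp: keepe_def keeps_def\<close>)
  qed simp
next
  case (Put i a b c e)
  have e: "evalok w s (aval w e s) (acst e B) (acomp e)"
    "evalok w s (aval w a s) (acst a B) (acomp a)"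
    "evalok w s (aval w b s) (acst b B) (acomp b)"
    "evalok w s (aval w c s) (acst c B) (acomp c)" and le: "aval w a s \<le> B" "aval w b s \<le> B" "aval w c s \<le> B"
    using Put by (auto intro: acomp_evalok)
  note key = evalok_key[OF e(2) le(1) e(3) le(2) e(4) le(3), of i]
  show ?case
    unfolding ccomp.simps ccst.simps add.assoc[of "acst e B"]
  proof (rule gwp_seq2[OF e(1)[unfolded evalok_def, rule_format, OF Put.prems(2,3)]])
    fix d' assume d': "keeps h d d' \<and> fst d' (2*h) = aval w e s"
    have rl: "rel w s d'" using rel_keeps Put.prems d' by blast
    show "gwp (gkey i (acomp a) (acomp b) (acomp c) (h+1) ;; ins (Store (2*h+2) (2*h)))
       (acst a B + acst b B + acst c B + kcst i B + 1)
       (\<lambda>d'. rel w (exec w (Put i a b c e) s) d' \<and> keepe h d d') d'"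
    proof (rule gwp_seq2[OF key[unfolded evalok_def, rule_format, OF _ rl]], simp, rule gwp_ins)
      fix d''
      assume d'': "keeps (h+1) d' d'' \<and> fst d'' (2*(h+1)) = length w + kaddr (i, aval w a s, aval w b s, aval w c s)"
      have rl: "rel w s d''" using rel_keeps[OF rl conjunct1[OF d'']] by simp
      have "deff (Store (2*h+2) (2*h)) d'' =
          (fst d'', (fst (snd d''))(length w + kaddr (i, aval w a s, aval w b s, aval w c s) := aval w e s), snd (snd d''))"
        using d' d'' by (simp add: keeps_def)
      then show "rel w (exec w (Put i a b c e) s) (deff (Store (2*h+2) (2*h)) d'') \<and>
          keepe h d (deff (Store (2*h+2) (2*h)) d'')"
        using kaddr_upd[OF rl] d' d'' by (simp add: keepe_def keeps_def del: deff.simps kaddr.simps)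
    qed simp
  qed
next
  case (Seq c1 c2)
  have b: "cbnd w B c1 s" "cbnd w B c2 (exec w c1 s)" using Seq.prems by auto
  show ?case
    unfolding ccomp.simps ccst.simps
  proof (rule gwp_seq2[OF Seq.IH(1)[OF b(1) Seq.prems(2,3)]])
    fix d' assume d': "rel w (exec w c1 s) d' \<and> keepe h d d'"
    show "gwp (ccomp c2 h) (ccst c2 B) (\<lambda>d'. rel w (exec w (Seq c1 c2) s) d' \<and> keepe h d d') d'"
      by (rule gwp_weaken[OF Seq.IH(2)[OF b(2) Seq.prems(2)] order_refl])
        (use d' in \<open>auto intro: keepe_trans\<close>)
  qed
next
  case (If e c1 c2)
  have e: "evalok w s (aval w e s) (acst e B) (acomp e)"
    using If by (intro acomp_evalok) simp
  let ?Q = "\<lambda>d'. rel w (exec w (If e c1 c2) s) d' \<and> keepe h d d'"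
  show ?case
    unfolding ccomp.simps ccst.simps add.assoc[of "acst e B"]
  proof (rule gwp_seq2[OF e[unfolded evalok_def, rule_format, OF If.prems(2,3)]])
    fix d' assume d': "keeps h d d' \<and> fst d' (2*h) = aval w e s"
    have rl: "rel w s d'" using rel_keeps If d' by blast
    show "gwp (gif (2*h) (ccomp c1 h) (ccomp c2 h)) (ccst c1 B + ccst c2 B + 2) ?Q d'"
    proof (rule gwp_if)
      assume "fst d' (2*h) \<noteq> 0"
      then have nz: "aval w e s \<noteq> 0" using d' by simp
      then have "cbnd w B c1 s" using If.prems by simp
      then show "gwp (ccomp c1 h) (ccst c1 B) ?Q d'"
        by (rule gwp_weaken[OF If.IH(1)[OF _ If.prems(2) rl] order_refl])
          (use d' nz in \<open>auto intro: keepe_trans keeps_keepe\<close>)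
    next
      assume "fst d' (2*h) = 0"
      then have z: "aval w e s = 0" using d' by simp
      then have "cbnd w B c2 s" using If.prems by simp
      then show "gwp (ccomp c2 h) (ccst c2 B) ?Q d'"
        by (rule gwp_weaken[OF If.IH(2)[OF _ If.prems(2) rl] order_refl])
          (use d' z in \<open>auto intro: keepe_trans keeps_keepe\<close>)
    qed
  qed
next
  case (For r e c)
  let ?n = "aval w e s"
  define S where "S = (\<lambda>k. foldl (\<lambda>s k. exec w c (setr r k s)) s [0..<k])"
  have S: "S 0 = s" "S (Suc k) = exec w c (setr r k (S k))" for k
    by (simp_all add: S_def)
  have e: "evalok w s ?n (acst e B) (acomp e)" and le: "?n \<le> B"
    and b: "\<And>k. k < ?n \<Longrightarrow> cbnd w B c (setr r k (S k))"
    using For by (auto simp: S_def intro: acomp_evalok)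
  let ?Q = "\<lambda>d'. rel w (exec w (For r e c) s) d' \<and> keepe h d d'"
  let ?g = "ins (Move (2*r+1) (2*h+4)) ;; ccomp c (h+3) ;; ins (Const (2*h+6) 1) ;;
       ins (Add (2*h+4) (2*h+4) (2*h+6)) ;; ins (Sub (2*h) (2*h) (2*h+6))"
  \<comment> \<open>The three control values sit below height \<open>h + 3\<close>, so the body
    cannot disturb them, even if it assigns the loop register.\<close>
  define J where "J = (\<lambda>k d'. rel w (S k) d' \<and> keepe h d d' \<and> fst d' (2*h) = ?n - k \<and>
     fst d' (2*h+2) = regs s r \<and> fst d' (2*h+4) = k)"
  have body: "gwp ?g (1 + (ccst c B + (1 + (1 + 1)))) (J (Suc k)) d'" if J: "J k d'" and k: "k < ?n" for k d'
  proof (rule gwp_seq, rule gwp_ins, simp)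
    define d1 where "d1 = deff (Move (2*r+1) (2*h+4)) d'"
    have rl1: "rel w (setr r k (S k)) d1"
      by (rule rel_setr[of w "S k" d']) (use J in \<open>auto simp: J_def d1_def\<close>)
    have ev1: "fst d1 q = fst d' q" if "even q" for q
      using that by (auto simp: d1_def)
    show "gwp (ccomp c (h+3) ;; ins (Const (2*h+6) 1) ;; ins (Add (2*h+4) (2*h+4) (2*h+6)) ;;
        ins (Sub (2*h) (2*h) (2*h+6))) (ccst c B + (1 + (1 + 1))) (J (Suc k)) (deff (Move (2*r+1) (2*h+4)) d')"
      unfolding d1_def[symmetric]
    proof (rule gwp_seq2[OF For.IH[OF b[OF k] _ rl1]])
      fix d2 assume d2: "rel w (exec w c (setr r k (S k))) d2 \<and> keepe (h+3) d1 d2"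
      define d3 where "d3 = deff (Sub (2*h) (2*h) (2*h+6)) (deff (Add (2*h+4) (2*h+4) (2*h+6)) (deff (Const (2*h+6) 1) d2))"
      have "rel w (S (Suc k)) d3"
      proof (rule rel_even[of w _ d2])
        fix q :: nat assume "odd q \<or> q = 0"
        then have "q \<noteq> 2*h" "q \<noteq> 2*h+4" "q \<noteq> 2*h+6" using For.prems(2) by auto
        then show "fst d3 q = fst d2 q" by (simp add: d3_def)
      qed (use d2 S in \<open>auto simp: d3_def\<close>)
      moreover have ev2: "fst d2 q = fst d' q" if "even q" "q < 2*(h+3)" for q
        using d2 that ev1 by (simp add: keepe_def)
      have "fst d3 q = fst d q" if "even q" "q < 2 * h" for q
        using that ev2[of q] J by (auto simp: keepe_def d3_def J_def)
      moreover have "fst d3 (2*h) = ?n - Suc k" "fst d3 (2*h+2) = regs s r" "fst d3 (2*h+4) = Suc k"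
        using ev2[of "2*h"] ev2[of "2*h+2"] ev2[of "2*h+4"] J by (simp_all add: d3_def J_def)
      ultimately have "J (Suc k) d3" by (simp add: J_def keepe_def)
      then show "gwp (ins (Const (2*h+6) 1) ;; ins (Add (2*h+4) (2*h+4) (2*h+6)) ;; ins (Sub (2*h) (2*h) (2*h+6)))
          (1 + (1 + 1)) (J (Suc k)) d2"
        unfolding d3_def by (intro gwp_seq gwp_ins) (simp_all del: deff.simps)
    qed simp
  qed
  have loop: "gwp (gwhile (2*h) ?g) (?n * ((1 + (ccst c B + (1 + (1 + 1)))) + 2) + 1) (J ?n) d'" if "J 0 d'" for d'
    by (rule gwp_while[where J = J], fact, use body in \<open>auto simp: J_def\<close>)
  show ?case
    unfolding ccomp.simps ccst.simps add.assoc[of "acst e B"]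
  proof (rule gwp_seq2[OF e[unfolded evalok_def, rule_format, OF For.prems(2,3)]])
    fix d' assume d': "keeps h d d' \<and> fst d' (2*h) = ?n"
    have rl: "rel w s d'" using rel_keeps For.prems d' by blast
    have "gwp (ins (Move (2*h+2) (2*r+1)) ;; ins (Const (2*h+4) 0) ;; gwhile (2*h) ?g ;; ins (Move (2*r+1) (2*h+2)))
        (1 + (1 + ((?n * ((1 + (ccst c B + (1 + (1 + 1)))) + 2) + 1) + 1))) ?Q d'"
    proof (rule gwp_seq, rule gwp_ins, simp, rule gwp_seq, rule gwp_ins, simp, rule gwp_seq2, rule loop)
      define d2 where "d2 = deff (Const (2*h+4) 0) (deff (Move (2*h+2) (2*r+1)) d')"
      have "fst d2 q = fst d' q" if "odd q \<or> q < 2 * h" for q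
      proof -
        have "q \<noteq> 2*h+2" "q \<noteq> 2*h+4" using that by auto
        then show ?thesis by (simp add: d2_def)
      qed
      moreover from this have "rel w s d2"
        by (intro rel_even[OF rl]) (use For.prems(2) in \<open>auto simp: d2_def\<close>)
      moreover have "fst d2 (2*h) = ?n" "fst d2 (2*h+2) = regs s r" "fst d2 (2*h+4) = 0"
        using d' rl by (simp_all add: d2_def rel_def)
      ultimately show "J 0 (deff (Const (2*h+4) 0) (deff (Move (2*h+2) (2*r+1)) d'))"
        using d' unfolding d2_def[symmetric] J_def keepe_def keeps_def S by auto
    next
      fix d3 assume J: "J ?n d3"
      have "rel w (setr r (regs s r) (S ?n)) (deff (Move (2*r+1) (2*h+2)) d3)"
        by (rule rel_setr[of w "S ?n" d3]) (use J in \<open>auto simp: J_def\<close>)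
      then show "gwp (ins (Move (2*r+1) (2*h+2))) 1 ?Q d3"
        using J by (intro gwp_ins) (auto simp: J_def keepe_def S_def)
    qed
    then show "gwp (ins (Move (2*h+2) (2*r+1)) ;; ins (Const (2*h+4) 0) ;; gwhile (2*h) ?g ;; ins (Move (2*r+1) (2*h+2)))
        (B * (ccst c B + 6) + 4) ?Q d'"
    proof (rule gwp_weaken)
      have "?n * (ccst c B + 6) \<le> B * (ccst c B + 6)" using le by simp
      then show "1 + (1 + ((?n * ((1 + (ccst c B + (1 + (1 + 1)))) + 2) + 1) + 1)) \<le> B * (ccst c B + 6) + 4"
        by (simp add: eval_nat_numeral)
    qed
  qed
next
  case (Out e)
  have e: "evalok w s (aval w e s) (acst e B) (acomp e)"
    using Out by (intro acomp_evalok) simp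
  show ?case
    unfolding ccomp.simps ccst.simps
  proof (rule gwp_seq2[OF e[unfolded evalok_def, rule_format, OF Out.prems(2,3)]], rule gwp_ins)
    fix d' assume d': "keeps h d d' \<and> fst d' (2*h) = aval w e s"
    have rl: "rel w s d'" using rel_keeps Out d' by blast
    show "rel w (exec w (Out e) s) (deff (Write (2*h)) d') \<and> keepe h d (deff (Write (2*h)) d')"
      using rl d' by (simp add: rel_def keepe_def keeps_def)
  qed simp
qed

subsection \<open>Polynomial cost\<close>

text \<open>A single monomial in \<open>B + 1\<close> instead of a polynomial: as the base is at
  least 1, exponents can be raised to a common one, and for a product as base the power later splits
  into powers of the factors.\<close>

definition polyb :: "(nat \<Rightarrow> nat) \<Rightarrow> bool" where
  "polyb g \<longleftrightarrow> (\<exists>C k. \<forall>B. g B \<le> C * (B + 1) ^ k)"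

lemma polyb_const: "polyb (\<lambda>B. n)"
  unfolding polyb_def by (rule exI[of _ n], rule exI[of _ 0]) simp

lemma polyb_id: "polyb (\<lambda>B. B)"
  unfolding polyb_def by (rule exI[of _ 1], rule exI[of _ 1]) simp

lemma polyb_add: "polyb g \<Longrightarrow> polyb g' \<Longrightarrow> polyb (\<lambda>B. g B + g' B)"
  unfolding polyb_def
proof (elim exE)
  fix C k C' k' assume "\<forall>B. g B \<le> C * (B+1)^k" "\<forall>B. g' B \<le> C' * (B+1)^k'"
  moreover have "(B+1)^k \<le> (B+1)^(k+k')" "(B+1)^k' \<le> (B+1)^(k+k')" for B :: nat
    by (intro power_increasing; simp)+
  ultimately have "g B + g' B \<le> C * (B+1)^(k+k') + C' * (B+1)^(k+k')" for B
    by (meson add_mono mult_le_mono2 order_trans)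
  then have "\<forall>B. g B + g' B \<le> (C + C') * (B+1)^(k+k')"
    by (simp add: add_mult_distrib)
  then show "\<exists>C k. \<forall>B. g B + g' B \<le> C * (B+1)^k" by blast
qed

lemma polyb_mult: "polyb g \<Longrightarrow> polyb g' \<Longrightarrow> polyb (\<lambda>B. g B * g' B)"
  unfolding polyb_def
proof (elim exE)
  fix C k C' k' assume "\<forall>B. g B \<le> C * (B+1)^k" "\<forall>B. g' B \<le> C' * (B+1)^k'"
  then have "g B * g' B \<le> (C * (B+1)^k) * (C' * (B+1)^k')" for B
    by (meson mult_le_mono)
  then have "\<forall>B. g B * g' B \<le> (C * C') * (B+1)^(k+k')"
    by (simp add: power_add mult_ac)
  then show "\<exists>C k. \<forall>B. g B * g' B \<le> C * (B+1)^k" by blast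
qed

lemmas polyb_intros = polyb_const polyb_id polyb_add polyb_mult

lemma polyb_kcst: "polyb (kcst i)"
  unfolding kcst_def Let_def by (intro polyb_intros)

lemma polyb_acst: "polyb (acst e)"
  by (induction e) (simp_all only: acst.simps, (intro polyb_intros polyb_kcst | assumption)+)

lemma polyb_ccst: "polyb (ccst c)"
  by (induction c) (simp_all only: ccst.simps, (intro polyb_intros polyb_acst polyb_kcst | assumption)+)

section \<open>Position automata\<close>

text \<open>Position automata in the sense of Glushkov, visiting one position per letter;
  \<open>status p x\<close> counts the markers of \<open>x\<close> before the letter at
  \<open>p\<close>. \<open>marks x\<close> summarises the markers of \<open>x\<close> in a whole
  word and is meaningful only if \<open>nonempty\<close> holds; for representations only its being
  zero or not matters. A false \<open>nonempty\<close> means that there are no words, but a true one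
  does not promise an accepting run once joins are involved.\<close>

record aut =
  npos :: nat
  lab :: "nat \<Rightarrow> nat"
  status :: "nat \<Rightarrow> var \<Rightarrow> nat"
  is_first :: "nat \<Rightarrow> bool"
  is_last :: "nat \<Rightarrow> bool"
  follow :: "nat \<Rightarrow> nat \<Rightarrow> bool"
  nullable :: bool
  nonempty :: bool
  marks :: "var \<Rightarrow> nat"

type_synonym sletter = "nat \<times> (var \<Rightarrow> nat)"

definition accepted :: "aut \<Rightarrow> nat list \<Rightarrow> bool" where
  "accepted A ps \<longleftrightarrow> (if ps = [] then nullable A
     else set ps \<subseteq> {..<npos A} \<and> is_first A (hd ps) \<and> is_last A (last ps) \<and> successively (follow A) ps)"

definition word :: "aut \<Rightarrow> nat list \<Rightarrow> sletter list" where
  "word A ps = map (\<lambda>p. (lab A p, status A p)) ps"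

definition lang :: "aut \<Rightarrow> sletter list set" where
  "lang A = word A ` {ps. accepted A ps}"

definition aut_prim :: "nat \<Rightarrow> nat \<Rightarrow> bool \<Rightarrow> bool \<Rightarrow> aut" where
  "aut_prim n c u e = \<lparr>npos = n, lab = (\<lambda>_. c), status = (\<lambda>_ _. 0), is_first = (\<lambda>_. True), is_last = (\<lambda>_. True),
     follow = (\<lambda>_ _. False), nullable = u, nonempty = e, marks = (\<lambda>_. 0)\<rparr>"

definition aut_or :: "aut \<Rightarrow> aut \<Rightarrow> aut" where
  "aut_or A B = (let n = npos A in
     \<lparr>npos = n + npos B,
      lab = (\<lambda>p. if p < n then lab A p else lab B (p - n)),
      status = (\<lambda>p x. if p < n then status A p x else status B (p - n) x),
      is_first = (\<lambda>p. if p < n then is_first A p else is_first B (p - n)),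
      is_last = (\<lambda>p. if p < n then is_last A p else is_last B (p - n)),
      follow = (\<lambda>p q. if p < n then q < n \<and> follow A p q else \<not> q < n \<and> follow B (p - n) (q - n)),
      nullable = (nullable A \<or> nullable B),
      nonempty = (nonempty A \<or> nonempty B),
      marks = (\<lambda>x. if nonempty A then marks A x else marks B x)\<rparr>)"

definition aut_conc :: "aut \<Rightarrow> aut \<Rightarrow> aut" where
  "aut_conc A B = (let n = npos A in
     \<lparr>npos = n + npos B,
      lab = (\<lambda>p. if p < n then lab A p else lab B (p - n)),
      status = (\<lambda>p x. if p < n then status A p x else status B (p - n) x + marks A x),
      is_first = (\<lambda>p. if p < n then is_first A p else nullable A \<and> is_first B (p - n)),
      is_last = (\<lambda>p. if p < n then nullable B \<and> is_last A p else is_last B (p - n)),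
      follow = (\<lambda>p q. if p < n then (if q < n then follow A p q else is_last A p \<and> is_first B (q - n))
                  else \<not> q < n \<and> follow B (p - n) (q - n)),
      nullable = (nullable A \<and> nullable B),
      nonempty = (nonempty A \<and> nonempty B),
      marks = (\<lambda>x. marks A x + marks B x)\<rparr>)"

text \<open>The empty word is among the words of a star, so if all words have the same markers, they
  have none. Hence \<open>marks\<close> is 0, and the statuses need no shift from one iteration to
  the next.\<close>

definition aut_star :: "aut \<Rightarrow> aut" where
  "aut_star A = A\<lparr>follow := (\<lambda>p q. follow A p q \<or> is_last A p \<and> is_first A q), nullable := True, nonempty := True, marks := (\<lambda>x. 0)\<rparr>"

text \<open>Inside the binding only the opening marker has been read, behind it both, hence 1 and
  2.\<close>

definition aut_bind :: "var \<Rightarrow> aut \<Rightarrow> aut" where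
  "aut_bind y A = A\<lparr>status := (\<lambda>p x. status A p x + (if x = y then 1 else 0)),
     marks := (\<lambda>x. marks A x + (if x = y then 2 else 0))\<rparr>"

text \<open>Status 3 marks a variable that is out of scope.\<close>

definition aut_mask :: "(var \<Rightarrow> bool) \<Rightarrow> aut \<Rightarrow> aut" where
  "aut_mask K A = A\<lparr>status := (\<lambda>p x. if K x then status A p x else 3), marks := (\<lambda>x. if K x then marks A x else 0)\<rparr>"

text \<open>A variable out of scope on one side is unconstrained by that side. A join tests this on
  a finite set \<open>U\<close> only; the machine takes for \<open>U\<close> all numbers of the
  input, which include every variable of the representation.\<close>

definition compat :: "nat \<Rightarrow> nat \<Rightarrow> bool" where
  "compat a b \<longleftrightarrow> a = 3 \<or> b = 3 \<or> a = b"

text \<open>Letter 0 marks the incompatible pairs: no string contains it, so that they are dead.\<close>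

definition aut_join :: "var set \<Rightarrow> aut \<Rightarrow> aut \<Rightarrow> aut" where
  "aut_join U A B = (let n = npos B in
     \<lparr>npos = npos A * n,
      lab = (\<lambda>p. if lab A (p div n) = lab B (p mod n) \<and> (\<forall>x\<in>U. compat (status A (p div n) x) (status B (p mod n) x))
                 then lab A (p div n) else 0),
      status = (\<lambda>p x. if status A (p div n) x = 3 then status B (p mod n) x else status A (p div n) x),
      is_first = (\<lambda>p. is_first A (p div n) \<and> is_first B (p mod n)),
      is_last = (\<lambda>p. is_last A (p div n) \<and> is_last B (p mod n)),
      follow = (\<lambda>p q. follow A (p div n) (q div n) \<and> follow B (p mod n) (q mod n)),
      nullable = (nullable A \<and> nullable B),
      nonempty = (nonempty A \<and> nonempty B),
      marks = (\<lambda>x. marks A x + marks B x)\<rparr>)"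

section \<open>Languages of the constructed automata\<close>

lemma lang_prim0: "lang (aut_prim 0 c u e) = (if u then {[]} else {})"
  by (auto simp: lang_def accepted_def aut_prim_def word_def)

lemma lang_prim1: "lang (aut_prim 1 c False e) = {[(c, \<lambda>_. 0)]}"
proof -
  have "accepted (aut_prim 1 c False e) ps \<longleftrightarrow> ps = [0]" for ps
  proof (cases ps)
    case (Cons p qs)
    then show ?thesis
      by (cases qs) (auto simp: accepted_def aut_prim_def)
  qed (auto simp: accepted_def aut_prim_def)
  then show ?thesis
    by (auto simp: lang_def word_def aut_prim_def)
qed

text \<open>In a union or a concatenation no edge leads back from the second operand, whose
  positions are those from \<open>n\<close> on: once entered, it is never left.\<close>

lemma split_path:
  assumes "successively R ps" and "\<And>p q. R p q \<Longrightarrow> \<not> p < n \<Longrightarrow> \<not> q < (n::nat)"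
  obtains us var_list where "ps = us @ map ((+) n) var_list" "\<forall>p\<in>set us. p < n"
proof -
  have "\<exists>us var_list. ps = us @ map ((+) n) var_list \<and> (\<forall>p\<in>set us. p < n)"
    using assms(1)
  proof (induction ps)
    case (Cons p ps)
    show ?case
    proof (cases "p < n")
      case True
      obtain us var_list where "ps = us @ map ((+) n) var_list" "\<forall>p\<in>set us. p < n"
        using Cons by (auto simp: successively_Cons)
      then show ?thesis using True by (intro exI[of _ "p # us"] exI[of _ var_list]) auto
    next
      case False
      have "\<forall>q\<in>set (p # ps). \<not> q < n"
        using Cons.prems False
      proof (induction ps arbitrary: p)
        case (Cons q qs)
        then have "\<not> q < n" using assms(2) by auto
        then show ?case using Cons by auto
      qed auto
      then have "map ((+) n) (map (\<lambda>q. q - n) (p # ps)) = p # ps"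
        unfolding map_map by (intro map_idI) auto
      then show ?thesis
        by (intro exI[of _ "[]"] exI[of _ "map (\<lambda>q. q - n) (p # ps)"]) simp
    qed
  qed auto
  then show ?thesis using that by blast
qed

lemma map_shift_last: "var_list \<noteq> [] \<Longrightarrow> last (map ((+) (n::nat)) var_list) = n + last var_list"
  by (simp add: last_map)

lemma accepted_or_left: "\<forall>p\<in>set us. p < npos A \<Longrightarrow> us \<noteq> [] \<Longrightarrow> accepted (aut_or A B) us \<longleftrightarrow> accepted A us"
proof -
  assume us: "\<forall>p\<in>set us. p < npos A" "us \<noteq> []"
  have "successively (follow (aut_or A B)) us \<longleftrightarrow> successively (follow A) us"
    by (rule successively_cong) (use us in \<open>auto simp: aut_or_def Let_def\<close>)
  moreover have "hd us < npos A" "last us < npos A" using us by auto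
  moreover have "set us \<subseteq> {..<npos A}" using us by auto
  ultimately show ?thesis
    using us by (auto simp: accepted_def aut_or_def Let_def)
qed

lemma accepted_or_right: "var_list \<noteq> [] \<Longrightarrow> accepted (aut_or A B) (map ((+) (npos A)) var_list) \<longleftrightarrow> accepted B var_list"
  by (auto simp: accepted_def aut_or_def Let_def successively_map map_shift_last hd_map)

text \<open>A run splits into a part in the first operand followed by one in the second, and a union
  has no edge from the first to the second; so one of the parts is empty.\<close>

lemma lang_or: "lang (aut_or A B) = lang A \<union> lang B"
proof
  show "lang (aut_or A B) \<subseteq> lang A \<union> lang B"
  proof
    fix w assume "w \<in> lang (aut_or A B)"
    then obtain ps where w: "w = word (aut_or A B) ps" and ps: "accepted (aut_or A B) ps"
      by (auto simp: lang_def)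
    show "w \<in> lang A \<union> lang B"
    proof (cases "ps = []")
      case True
      then show ?thesis using w ps by (auto simp: lang_def accepted_def aut_or_def Let_def word_def)
    next
      case False
      then have su: "successively (follow (aut_or A B)) ps" using ps by (simp add: accepted_def)
      then obtain us var_list where d: "ps = us @ map ((+) (npos A)) var_list" "\<forall>p\<in>set us. p < npos A"
        by (rule split_path[where n = "npos A"]) (auto simp: aut_or_def Let_def split: if_splits)
      have e: "us = [] \<or> var_list = []"
      proof (rule ccontr)
        assume n: "\<not> (us = [] \<or> var_list = [])"
        then have "follow (aut_or A B) (last us) (npos A + hd var_list)"
          using su d by (auto simp: successively_append_iff hd_map)
        moreover have "last us < npos A" using d n by auto
        ultimately show False by (auto simp: aut_or_def Let_def)
      qed
      then show ?thesis
      proof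
        assume [simp]: "us = []"
        have "accepted B var_list" using accepted_or_right[of var_list A B] ps d False by auto
        moreover have "w = word B var_list" using w d by (simp add: word_def aut_or_def Let_def)
        ultimately show ?thesis by (auto simp: lang_def)
      next
        assume [simp]: "var_list = []"
        have "accepted A us" using accepted_or_left[of us A B] ps d False by auto
        moreover have "w = word A us" using w d by (auto simp: word_def aut_or_def Let_def)
        ultimately show ?thesis by (auto simp: lang_def)
      qed
    qed
  qed
  show "lang A \<union> lang B \<subseteq> lang (aut_or A B)"
  proof
    fix w assume "w \<in> lang A \<union> lang B"
    then show "w \<in> lang (aut_or A B)"
    proof
      assume "w \<in> lang A"
      then obtain ps where w: "w = word A ps" and ps: "accepted A ps" by (auto simp: lang_def)
      have b: "\<forall>p\<in>set ps. p < npos A" using ps by (auto simp: accepted_def split: if_splits)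
      have "accepted (aut_or A B) ps"
        using ps accepted_or_left[OF b] by (cases "ps = []") (auto simp: accepted_def aut_or_def Let_def)
      moreover have "w = word (aut_or A B) ps" using w b by (auto simp: word_def aut_or_def Let_def)
      ultimately show ?thesis by (auto simp: lang_def)
    next
      assume "w \<in> lang B"
      then obtain ps where w: "w = word B ps" and ps: "accepted B ps" by (auto simp: lang_def)
      have "accepted (aut_or A B) (map ((+) (npos A)) ps)"
        using ps accepted_or_right[of ps A B] by (cases "ps = []") (auto simp: accepted_def aut_or_def Let_def)
      moreover have "w = word (aut_or A B) (map ((+) (npos A)) ps)" using w by (auto simp: word_def aut_or_def Let_def)
      ultimately show ?thesis unfolding lang_def by blast
    qed
  qed
qed

definition shift :: "(var \<Rightarrow> nat) \<Rightarrow> sletter \<Rightarrow> sletter" where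
  "shift t = (\<lambda>(c, f). (c, \<lambda>x. f x + t x))"

lemma accepted_conc:
  assumes "\<forall>p\<in>set us. p < npos A"
  shows "accepted (aut_conc A B) (us @ map ((+) (npos A)) var_list) \<longleftrightarrow> accepted A us \<and> accepted B var_list"
proof -
  have s1: "successively (follow (aut_conc A B)) us \<longleftrightarrow> successively (follow A) us"
    by (rule successively_cong) (use assms in \<open>auto simp: aut_conc_def Let_def\<close>)
  have s2: "successively (follow (aut_conc A B)) (map ((+) (npos A)) var_list) \<longleftrightarrow> successively (follow B) var_list"
    by (simp add: successively_map aut_conc_def Let_def)
  have us: "set us \<subseteq> {..<npos A}" "us \<noteq> [] \<Longrightarrow> hd us < npos A" "us \<noteq> [] \<Longrightarrow> last us < npos A"
    using assms by auto
  have f: "is_first (aut_conc A B) p \<longleftrightarrow> is_first A p" "is_last (aut_conc A B) p \<longleftrightarrow> nullable B \<and> is_last A p" if "p < npos A" for p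
    using that by (auto simp: aut_conc_def Let_def)
  have g: "is_first (aut_conc A B) (npos A + p) \<longleftrightarrow> nullable A \<and> is_first B p" "is_last (aut_conc A B) (npos A + p) \<longleftrightarrow> is_last B p" for p
    by (auto simp: aut_conc_def Let_def)
  have h: "follow (aut_conc A B) p (npos A + q) \<longleftrightarrow> is_last A p \<and> is_first B q" if "p < npos A" for p q
    using that by (auto simp: aut_conc_def Let_def)
  have z: "npos (aut_conc A B) = npos A + npos B" "nullable (aut_conc A B) \<longleftrightarrow> nullable A \<and> nullable B"
    by (auto simp: aut_conc_def Let_def)
  show ?thesis
  proof (cases "us = []"; cases "var_list = []")
    assume "us \<noteq> []" "var_list \<noteq> []"
    then show ?thesis using us
      by (auto simp: accepted_def successively_append_iff s1 s2 f g h z hd_map map_shift_last subset_iff)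
  qed (use us in \<open>auto simp: accepted_def s1 s2 f g z hd_map map_shift_last subset_iff\<close>)
qed

lemma wd_conc:
  assumes "\<forall>p\<in>set us. p < npos A"
  shows "word (aut_conc A B) (us @ map ((+) (npos A)) var_list) = word A us @ map (shift (marks A)) (word B var_list)"
  using assms by (auto simp: word_def aut_conc_def Let_def shift_def)

lemma lang_conc: "lang (aut_conc A B) = {u @ map (shift (marks A)) v | u v. u \<in> lang A \<and> v \<in> lang B}"
proof
  show "lang (aut_conc A B) \<subseteq> {u @ map (shift (marks A)) v | u v. u \<in> lang A \<and> v \<in> lang B}"
  proof
    fix w assume "w \<in> lang (aut_conc A B)"
    then obtain ps where w: "w = word (aut_conc A B) ps" and ps: "accepted (aut_conc A B) ps"
      by (auto simp: lang_def)
    then have "successively (follow (aut_conc A B)) ps" by (cases "ps = []") (auto simp: accepted_def)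
    then obtain us var_list where d: "ps = us @ map ((+) (npos A)) var_list" "\<forall>p\<in>set us. p < npos A"
      by (rule split_path[where n = "npos A"]) (auto simp: aut_conc_def Let_def split: if_splits)
    then show "w \<in> {u @ map (shift (marks A)) v | u v. u \<in> lang A \<and> v \<in> lang B}"
      using w ps accepted_conc[OF d(2), of B var_list] wd_conc[OF d(2), of B var_list] by (auto simp: lang_def)
  qed
  show "{u @ map (shift (marks A)) v | u v. u \<in> lang A \<and> v \<in> lang B} \<subseteq> lang (aut_conc A B)"
  proof clarify
    fix u v assume "u \<in> lang A" "v \<in> lang B"
    then obtain ps qs where *: "u = word A ps" "accepted A ps" "v = word B qs" "accepted B qs"
      by (auto simp: lang_def)
    have b: "\<forall>p\<in>set ps. p < npos A" using * by (auto simp: accepted_def split: if_splits)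
    then show "u @ map (shift (marks A)) v \<in> lang (aut_conc A B)"
      unfolding lang_def *(1,3) wd_conc[OF b, symmetric] using accepted_conc[OF b, of B qs] * by blast
  qed
qed

text \<open>Each edge either continues the leading piece inside \<open>A\<close>, or leads from a
  last to a first position and ends it. The leading piece is kept apart because in the induction it
  starts at an arbitrary position, not necessarily a first one.\<close>

lemma star_path:
  assumes "successively (follow (aut_star A)) (p # ps)" "is_last A (last (p # ps))" "set (p # ps) \<subseteq> {..<npos A}"
  shows "\<exists>qs pss. p # ps = (p # qs) @ concat pss \<and> successively (follow A) (p # qs) \<and> is_last A (last (p # qs)) \<and>
    (\<forall>rs\<in>set pss. accepted A rs)"
  using assms
proof (induction ps arbitrary: p)
  case Nil
  then show ?case by (intro exI[of _ "[]"]) auto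
next
  case (Cons q ps)
  have "successively (follow (aut_star A)) (q # ps)" "is_last A (last (q # ps))" "set (q # ps) \<subseteq> {..<npos A}"
    using Cons.prems by auto
  then obtain qs pss where *: "q # ps = (q # qs) @ concat pss" "successively (follow A) (q # qs)"
      "is_last A (last (q # qs))" "\<forall>rs\<in>set pss. accepted A rs"
    using Cons.IH by blast
  have "follow A p q \<or> is_last A p \<and> is_first A q"
    using Cons.prems by (simp add: aut_star_def)
  then show ?case
  proof
    assume "follow A p q"
    then show ?thesis using * by (intro exI[of _ "q # qs"] exI[of _ pss]) auto
  next
    assume l: "is_last A p \<and> is_first A q"
    have "set (q # qs) \<subseteq> set (q # ps)" unfolding *(1) by auto
    then have "accepted A (q # qs)" using * l Cons.prems by (auto simp: accepted_def)
    then show ?thesis using * l by (intro exI[of _ "[]"] exI[of _ "(q # qs) # pss"]) auto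
  qed
qed

lemma accepted_star: "accepted (aut_star A) ps \<longleftrightarrow> (\<exists>pss. ps = concat pss \<and> (\<forall>qs\<in>set pss. accepted A qs))"
proof
  assume a: "accepted (aut_star A) ps"
  show "\<exists>pss. ps = concat pss \<and> (\<forall>qs\<in>set pss. accepted A qs)"
  proof (cases ps)
    case Nil
    then show ?thesis by (intro exI[of _ "[]"]) auto
  next
    case (Cons p qs)
    have sel: "is_first (aut_star A) = is_first A" "is_last (aut_star A) = is_last A" "npos (aut_star A) = npos A"
      by (simp_all add: aut_star_def)
    have b: "is_first A p" "successively (follow (aut_star A)) (p # qs)" "is_last A (last (p # qs))" "set (p # qs) \<subseteq> {..<npos A}"
      using a by (simp_all add: Cons accepted_def sel)
    obtain rs pss where *: "p # qs = (p # rs) @ concat pss" "successively (follow A) (p # rs)" "is_last A (last (p # rs))"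
       "\<forall>rs\<in>set pss. accepted A rs"
      using star_path[OF b(2-4)] by blast
    have "set (p # rs) \<subseteq> set (p # qs)" unfolding *(1) by auto
    then have "accepted A (p # rs)" using * b by (auto simp: accepted_def)
    then show ?thesis using * Cons by (intro exI[of _ "(p # rs) # pss"]) auto
  qed
next
  have 1: "accepted (aut_star A) (qs @ ps)" if "accepted A qs" "accepted (aut_star A) ps" for qs ps
  proof (cases "qs = []")
    case False
    have "successively (follow (aut_star A)) qs"
      using that False by (auto simp: accepted_def aut_star_def intro: successively_mono)
    then show ?thesis
      using that False by (cases "ps = []")
        (auto simp: accepted_def successively_append_iff, auto simp: aut_star_def)
  qed (use that in auto)
  assume "\<exists>pss. ps = concat pss \<and> (\<forall>qs\<in>set pss. accepted A qs)"
  then obtain pss where "ps = concat pss" "\<forall>qs\<in>set pss. accepted A qs" by blast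
  then show "accepted (aut_star A) ps"
  proof (induction pss arbitrary: ps)
    case Nil
    then show ?case by (simp add: accepted_def aut_star_def)
  qed (auto intro: 1)
qed

lemma lang_star: "lang (aut_star A) = {concat us | us. set us \<subseteq> lang A}"
proof -
  have word: "word (aut_star A) (concat pss) = concat (map (word A) pss)" for pss
    by (induction pss) (simp_all add: word_def aut_star_def)
  show ?thesis
  proof
    show "lang (aut_star A) \<subseteq> {concat us | us. set us \<subseteq> lang A}"
    proof
      fix w assume "w \<in> lang (aut_star A)"
      then obtain pss where p: "w = concat (map (word A) pss)" "\<forall>qs\<in>set pss. accepted A qs"
        by (auto simp: lang_def accepted_star word)
      then have "set (map (word A) pss) \<subseteq> lang A" by (auto simp: lang_def)
      then show "w \<in> {concat us | us. set us \<subseteq> lang A}" using p by blast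
    qed
    show "{concat us | us. set us \<subseteq> lang A} \<subseteq> lang (aut_star A)"
    proof clarify
      fix us assume "set us \<subseteq> lang A"
      then have "\<forall>u\<in>set us. \<exists>ps. u = word A ps \<and> accepted A ps" by (auto simp: lang_def)
      then obtain g where g: "\<forall>u\<in>set us. u = word A (g u) \<and> accepted A (g u)" by metis
      have "concat us = word (aut_star A) (concat (map g us))"
        unfolding word map_map by (rule arg_cong[of _ _ concat], rule map_idI[symmetric]) (use g in auto)
      moreover have "accepted (aut_star A) (concat (map g us))"
        unfolding accepted_star using g by (intro exI[of _ "map g us"]) auto
      ultimately show "concat us \<in> lang (aut_star A)"
        unfolding lang_def by blast
    qed
  qed
qed

lemma lang_map:
  assumes "npos B = npos A" "is_first B = is_first A" "is_last B = is_last A" "follow B = follow A" "nullable B = nullable A"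
    and "\<And>p. (lab B p, status B p) = F (lab A p, status A p)"
  shows "lang B = map F ` lang A"
proof -
  have "accepted B = accepted A" by (rule ext) (simp add: accepted_def assms)
  moreover have "word B = map F \<circ> word A" by (rule ext) (simp add: word_def assms)
  ultimately show ?thesis by (simp add: lang_def image_comp)
qed

lemma lang_bind: "lang (aut_bind x A) = map (shift (\<lambda>y. if y = x then 1 else 0)) ` lang A"
  by (rule lang_map) (simp_all add: aut_bind_def shift_def)

lemma lang_mask: "lang (aut_mask K A) = map (\<lambda>(c, f). (c, \<lambda>x. if K x then f x else 3)) ` lang A"
  by (rule lang_map) (simp_all add: aut_mask_def)

subsection \<open>Ref-words and status words\<close>

context
  fixes code :: "'a \<Rightarrow> nat"
begin

text \<open>Markers behind the last letter leave no trace; in a valid ref-word they are the ones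
  still missing to reach the count 2. Letters are numbered from 1, which leaves 0 for the dead
  positions of joins.\<close>

fun status_from :: "(var \<Rightarrow> nat) \<Rightarrow> 'a ref_word \<Rightarrow> sletter list" where
  "status_from f [] = []"
| "status_from f (Letter a # r) = (Suc (code a), f) # status_from f r"
| "status_from f (Open x # r) = status_from (f(x := f x + 1)) r"
| "status_from f (Close x # r) = status_from (f(x := f x + 1)) r"

abbreviation ref_status :: "'a ref_word \<Rightarrow> sletter list" where
  "ref_status \<equiv> status_from (\<lambda>_. 0)"

definition marker_count :: "'a ref_word \<Rightarrow> var \<Rightarrow> nat" where
  "marker_count r x = count_list r (Open x) + count_list r (Close x)"

lemma status_from_append: "status_from f (u @ v) = status_from f u @ status_from (\<lambda>x. f x + marker_count u x) v"
  by (induction f u rule: status_from.induct)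
    (auto simp: marker_count_def fun_upd_def intro!: arg_cong2[of _ _ _ _ status_from])

text \<open>Counters are only ever incremented, so their initial values enter additively.\<close>

lemma status_from_shift: "status_from (\<lambda>x. f x + g x) r = map (shift g) (status_from f r)"
proof (induction f r rule: status_from.induct)
  case (3 f x r)
  have "(\<lambda>x. f x + g x)(x := f x + g x + 1) = (\<lambda>y. (f(x := f x + 1)) y + g y)" by auto
  then show ?case using 3 by (simp add: fun_upd_def)
next
  case (4 f x r)
  have "(\<lambda>x. f x + g x)(x := f x + g x + 1) = (\<lambda>y. (f(x := f x + 1)) y + g y)" by auto
  then show ?case using 4 by (simp add: fun_upd_def)
qed (auto simp: shift_def)

lemma status_from_shift0: "status_from g r = map (shift g) (ref_status r)"
  using status_from_shift[of "\<lambda>_. 0" g r] by simp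

lemma ref_status_append: "ref_status (u @ v) = ref_status u @ map (shift (marker_count u)) (ref_status v)"
  by (simp add: status_from_append status_from_shift0[of "marker_count u"])

lemma status_from_fst: "map fst (status_from f r) = map (\<lambda>a. Suc (code a)) (clr r)"
  by (induction f r rule: status_from.induct) (auto simp: fun_upd_def)

lemma balanced: "r \<in> ref_lang \<alpha> \<Longrightarrow> count_list r (Open x) = count_list r (Close x)"
proof (induction \<alpha> arbitrary: r)
  case (RStar \<alpha>)
  then obtain us where us: "r = concat us" "set us \<subseteq> ref_lang \<alpha>" by auto
  have "count_list (concat us) (Open x) = count_list (concat us) (Close x)" using us(2)
    by (induction us) (auto simp: RStar.IH)
  then show ?case using us by simp
qed auto

primrec aut_regex :: "'a regex_formula \<Rightarrow> aut" where
  "aut_regex REmpty = aut_prim 0 0 False False"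
| "aut_regex REps = aut_prim 0 0 True True"
| "aut_regex (RLetter a) = aut_prim 1 (Suc (code a)) False True"
| "aut_regex (ROr \<alpha> \<beta>) = aut_or (aut_regex \<alpha>) (aut_regex \<beta>)"
| "aut_regex (RConc \<alpha> \<beta>) = aut_conc (aut_regex \<alpha>) (aut_regex \<beta>)"
| "aut_regex (RStar \<alpha>) = aut_star (aut_regex \<alpha>)"
| "aut_regex (RBind x \<alpha>) = aut_bind x (aut_regex \<alpha>)"

text \<open>Induction over formulas needs this in place of \<open>functional\<close>, which
  subformulas do not inherit: \<open>RConc (ROr (RBind x REmpty) REps) (RBind x REps)\<close> is
  functional, but its left factor has the word \<open>[]\<close>, which is not valid for
  \<open>{x}\<close>. Closing markers need no mention because of \<open>balanced\<close>.\<close>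

definition homogeneous :: "'a regex_formula \<Rightarrow> (var \<Rightarrow> nat) \<Rightarrow> bool" where
  "homogeneous \<alpha> C \<longleftrightarrow> (\<forall>r\<in>ref_lang \<alpha>. \<forall>x. count_list r (Open x) = C x)"

lemma hom_cnt: "homogeneous \<alpha> C \<Longrightarrow> r \<in> ref_lang \<alpha> \<Longrightarrow> marker_count r = (\<lambda>x. 2 * C x)"
  by (auto simp: homogeneous_def marker_count_def balanced[symmetric])

lemma setcompr_cong2: "(\<And>u v. P u v \<Longrightarrow> f u v = g u v) \<Longrightarrow> {f u v | u v. P u v} = {g u v | u v. P u v}"
  by (intro Collect_cong) metis

lemma setcompr_eq_image2: "{f (g u v) | u v. P u v} = f ` {g u v | u v. P u v}"
  by auto

text \<open>All words of a functional formula contain the same markers. This makes the markers seen before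
  a factor of a concatenation independent of the word, so that no run of an automaton has to keep
  track of them.\<close>

lemma aut_regex:
  "homogeneous \<alpha> C \<Longrightarrow> lang (aut_regex \<alpha>) = ref_status ` ref_lang \<alpha> \<and> (nonempty (aut_regex \<alpha>) \<longleftrightarrow> ref_lang \<alpha> \<noteq> {}) \<and>
     (ref_lang \<alpha> \<noteq> {} \<longrightarrow> marks (aut_regex \<alpha>) = (\<lambda>x. 2 * C x))"
proof (induction \<alpha> arbitrary: C)
  case REmpty
  then show ?case by (simp add: lang_prim0) (simp add: aut_prim_def)
next
  case REps
  then show ?case by (simp add: lang_prim0 homogeneous_def) (simp add: aut_prim_def)
next
  case (RLetter a)
  then show ?case by (simp add: lang_prim1 homogeneous_def One_nat_def[symmetric] del: One_nat_def) (simp add: aut_prim_def)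
next
  case (ROr \<alpha> \<beta>)
  then have "homogeneous \<alpha> C" "homogeneous \<beta> C" by (auto simp: homogeneous_def)
  note A = ROr.IH(1)[OF this(1)] and B = ROr.IH(2)[OF this(2)]
  have "nonempty (aut_or (aut_regex \<alpha>) (aut_regex \<beta>)) \<longleftrightarrow> nonempty (aut_regex \<alpha>) \<or> nonempty (aut_regex \<beta>)"
    "marks (aut_or (aut_regex \<alpha>) (aut_regex \<beta>)) =
      (if nonempty (aut_regex \<alpha>) then marks (aut_regex \<alpha>) else marks (aut_regex \<beta>))"
    by (auto simp: aut_or_def Let_def)
  then show ?case
    using A B by (cases "ref_lang \<alpha> = {}") (auto simp: lang_or)
next
  case (RConc \<alpha> \<beta>)
  let ?A = "aut_regex \<alpha>" and ?B = "aut_regex \<beta>"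
  have nonempty: "nonempty (aut_conc ?A ?B) \<longleftrightarrow> nonempty ?A \<and> nonempty ?B" "marks (aut_conc ?A ?B) = (\<lambda>x. marks ?A x + marks ?B x)"
    by (auto simp: aut_conc_def Let_def)
  show ?case
  \<comment> \<open>If a factor has no word, nothing is known about the markers of the other. The
    induction hypothesis is then applied only to the empty factor, which is homogeneous
    vacuously.\<close>
  proof (cases "ref_lang \<alpha> = {} \<or> ref_lang \<beta> = {}")
    case True
    then have "lang ?A = {} \<and> \<not> nonempty ?A \<or> lang ?B = {} \<and> \<not> nonempty ?B"
      using RConc.IH(1)[of C] RConc.IH(2)[of C] by (auto simp: homogeneous_def)
    then show ?thesis using True by (auto simp: lang_conc nonempty)
  next
    case False
    then obtain u0 v0 where uv: "u0 \<in> ref_lang \<alpha>" "v0 \<in> ref_lang \<beta>" by auto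
    \<comment> \<open>The counts of one fixed word of each factor. Since counts of both factors
      always add up to \<open>C\<close>, every other word of a factor has the same counts.\<close>
    define Ca where "Ca = (\<lambda>x. count_list u0 (Open x))"
    define Cb where "Cb = (\<lambda>x. count_list v0 (Open x))"
    have C: "count_list u (Open x) + count_list v (Open x) = C x" if "u \<in> ref_lang \<alpha>" "v \<in> ref_lang \<beta>" for u v x
    proof -
      have "u @ v \<in> ref_lang (RConc \<alpha> \<beta>)" using that by auto
      then have "count_list (u @ v) (Open x) = C x" using RConc.prems unfolding homogeneous_def by blast
      then show ?thesis by simp
    qed
    have a: "homogeneous \<alpha> Ca" unfolding homogeneous_def Ca_def using C[OF _ uv(2)] C[OF uv] by (metis add_right_cancel)
    have b: "homogeneous \<beta> Cb" unfolding homogeneous_def Cb_def using C[OF uv(1)] C[OF uv] by (metis add_left_cancel)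
    note A = RConc.IH(1)[OF a] and B = RConc.IH(2)[OF b]
    have "C x = Ca x + Cb x" for x using C[OF uv] by (simp add: Ca_def Cb_def)
    moreover have "lang (aut_conc ?A ?B) = ref_status ` ref_lang (RConc \<alpha> \<beta>)"
    proof -
      have t: "marks ?A = marker_count u" if "u \<in> ref_lang \<alpha>" for u using A hom_cnt[OF a that] that by auto
      have "lang (aut_conc ?A ?B) = {ref_status u @ map (shift (marks ?A)) (ref_status v) | u v. u \<in> ref_lang \<alpha> \<and> v \<in> ref_lang \<beta>}"
      proof -
        have L: "lang ?A = ref_status ` ref_lang \<alpha>" "lang ?B = ref_status ` ref_lang \<beta>" using A B by auto
        show ?thesis
          unfolding lang_conc L
        proof (intro set_eqI iffI)
          fix w assume "w \<in> {u @ map (shift (marks ?A)) v |u v. u \<in> ref_status ` ref_lang \<alpha> \<and> v \<in> ref_status ` ref_lang \<beta>}"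
          then obtain u v where "w = ref_status u @ map (shift (marks ?A)) (ref_status v)" "u \<in> ref_lang \<alpha>" "v \<in> ref_lang \<beta>" by auto
          then show "w \<in> {ref_status u @ map (shift (marks ?A)) (ref_status v) | u v. u \<in> ref_lang \<alpha> \<and> v \<in> ref_lang \<beta>}" by blast
        next
          fix w assume "w \<in> {ref_status u @ map (shift (marks ?A)) (ref_status v) | u v. u \<in> ref_lang \<alpha> \<and> v \<in> ref_lang \<beta>}"
          then obtain u v where "w = ref_status u @ map (shift (marks ?A)) (ref_status v)" "ref_status u \<in> ref_status ` ref_lang \<alpha>" "ref_status v \<in> ref_status ` ref_lang \<beta>" by auto
          then show "w \<in> {u @ map (shift (marks ?A)) v |u v. u \<in> ref_status ` ref_lang \<alpha> \<and> v \<in> ref_status ` ref_lang \<beta>}" by blast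
        qed
      qed
      also have "\<dots> = {ref_status (u @ v) | u v. u \<in> ref_lang \<alpha> \<and> v \<in> ref_lang \<beta>}"
        by (rule setcompr_cong2) (use t in \<open>auto simp: ref_status_append\<close>)
      also have "\<dots> = ref_status ` ref_lang (RConc \<alpha> \<beta>)" unfolding ref_lang.simps by (rule setcompr_eq_image2)
      finally show ?thesis .
    qed
    ultimately show ?thesis using A B False by (auto simp: nonempty)
  qed
next
  case (RStar \<alpha>)
  \<comment> \<open>The empty word forces \<open>C\<close> to be 0, so the iterations shift nothing
    and their status words are simply concatenated.\<close>
  have "[] \<in> ref_lang (RStar \<alpha>)" by (simp add: exI[of _ "[]"])
  then have "count_list ([] :: 'a ref_word) (Open x) = C x" for x using RStar.prems unfolding homogeneous_def by blast
  then have C: "C x = 0" for x by (metis count_list.simps(1))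
  have "homogeneous \<alpha> C"
    unfolding homogeneous_def
  proof (intro ballI allI)
    fix r x assume "r \<in> ref_lang \<alpha>"
    then have "r \<in> ref_lang (RStar \<alpha>)" by (auto intro!: exI[of _ "[r]"])
    then show "count_list r (Open x) = C x" using RStar.prems by (auto simp: homogeneous_def)
  qed
  note A = RStar.IH[OF this] and h = hom_cnt[OF this]
  have 0: "ref_status (concat us) = concat (map ref_status us)" if "set us \<subseteq> ref_lang \<alpha>" for us
    using that
  proof (induction us)
    case (Cons u us)
    have "marker_count u = (\<lambda>x. 0)" using h[of u] Cons C by auto
    then have "shift (marker_count u) = id" by (auto simp: shift_def)
    then show ?case using Cons by (simp add: ref_status_append)
  qed auto
  have "lang (aut_star (aut_regex \<alpha>)) = ref_status ` ref_lang (RStar \<alpha>)"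
  proof -
    have "lang (aut_star (aut_regex \<alpha>)) = {concat us | us. set us \<subseteq> ref_status ` ref_lang \<alpha>}"
      using A by (simp add: lang_star)
    also have "\<dots> = concat ` lists (ref_status ` ref_lang \<alpha>)" by (auto simp: lists_eq_set)
    also have "\<dots> = (\<lambda>us. concat (map ref_status us)) ` {us. set us \<subseteq> ref_lang \<alpha>}"
      unfolding lists_image image_image unfolding lists_eq_set ..
    also have "\<dots> = (\<lambda>us. ref_status (concat us)) ` {us. set us \<subseteq> ref_lang \<alpha>}"
      by (rule image_cong) (use 0 in auto)
    also have "\<dots> = ref_status ` ref_lang (RStar \<alpha>)" by auto
    finally show ?thesis .
  qed
  moreover have "ref_lang (RStar \<alpha>) \<noteq> {}" using \<open>[] \<in> ref_lang (RStar \<alpha>)\<close> by blast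
  moreover have "nonempty (aut_star (aut_regex \<alpha>))" "marks (aut_star (aut_regex \<alpha>)) = (\<lambda>x. 2 * C x)"
    using C by (auto simp: aut_star_def)
  ultimately show ?case by (simp del: ref_lang.simps)
next
  case (RBind x \<alpha>)
  have c: "count_list r (Open y) + (if y = x then 1 else 0) = C y" if "r \<in> ref_lang \<alpha>" for r y
  proof -
    have "Open x # r @ [Close x] \<in> ref_lang (RBind x \<alpha>)" using that by auto
    then have "count_list (Open x # r @ [Close x]) (Open y) = C y" using RBind.prems unfolding homogeneous_def by blast
    then show ?thesis by (auto split: if_splits)
  qed
  \<comment> \<open>The binding itself contributes one opening marker of \<open>x\<close>. If
    \<open>C x\<close> is 0, there is no word in the body, and the truncated subtraction does no
    harm.\<close>
  have h: "homogeneous \<alpha> (C(x := C x - 1))" unfolding homogeneous_def using c by (fastforce split: if_splits)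
  note A = RBind.IH[OF h]
  have "ref_status (Open x # r @ [Close x]) = map (shift (\<lambda>y. if y = x then 1 else 0)) (ref_status r)" for r
  proof -
    have "status_from ((\<lambda>_. 0)(x := 0 + 1)) r = map (shift (\<lambda>y. if y = x then 1 else 0)) (ref_status r)"
      unfolding fun_upd_def add_0 by (rule status_from_shift0)
    then show ?thesis by (simp add: status_from_append)
  qed
  moreover have "ref_lang (RBind x \<alpha>) = (\<lambda>u. Open x # u @ [Close x]) ` ref_lang \<alpha>"
    by auto
  ultimately have "lang (aut_bind x (aut_regex \<alpha>)) = ref_status ` ref_lang (RBind x \<alpha>)"
    using A by (simp only: lang_bind image_image)
  moreover have "marks (aut_bind x (aut_regex \<alpha>)) = (\<lambda>y. 2 * C y)" if nonempty: "ref_lang \<alpha> \<noteq> {}"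
  proof
    obtain r where "r \<in> ref_lang \<alpha>" using nonempty by auto
    then have "1 \<le> C x" using c[of r x] by simp
    then show "marks (aut_bind x (aut_regex \<alpha>)) y = 2 * C y" for y using A nonempty by (auto simp: aut_bind_def)
  qed
  ultimately show ?case using A by (auto simp: aut_bind_def)
qed

text \<open>The mask over a formula turns the status 0 of variables that do not occur in it into 3;
  otherwise a join would force such a variable to be unopened in the other operand as well. It is
  applied only to the complete formula, because inside formulas statuses are still being added
  up.\<close>

primrec aut_rep :: "var set \<Rightarrow> 'a rep \<Rightarrow> aut" where
  "aut_rep U (Regex \<alpha>) = aut_mask (\<lambda>x. marks (aut_regex \<alpha>) x \<noteq> 0) (aut_regex \<alpha>)"
| "aut_rep U (UnionOf p q) = aut_or (aut_rep U p) (aut_rep U q)"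
| "aut_rep U (Proj Y p) = aut_mask (\<lambda>x. x \<in> set Y) (aut_rep U p)"
| "aut_rep U (JoinOf p q) = aut_join U (aut_rep U p) (aut_rep U q)"

definition status_words :: "aut \<Rightarrow> 'a list \<Rightarrow> (var \<Rightarrow> nat) list set" where
  "status_words A s = {map snd w | w. w \<in> lang A \<and> map fst w = map (\<lambda>a. Suc (code a)) s}"

definition tuple_status :: "tuple \<Rightarrow> nat \<Rightarrow> var \<Rightarrow> nat" where
  "tuple_status \<mu> i x = (case \<mu> x of None \<Rightarrow> 3 | Some (a, b) \<Rightarrow> of_bool (a \<le> i) + of_bool (b \<le> i))"

definition tuple_word :: "'a list \<Rightarrow> tuple \<Rightarrow> (var \<Rightarrow> nat) list" where
  "tuple_word s \<mu> = map (tuple_status \<mu>) [1..<Suc (length s)]"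

definition wf_tuple :: "var set \<Rightarrow> 'a list \<Rightarrow> tuple \<Rightarrow> bool" where
  "wf_tuple V s \<mu> \<longleftrightarrow> dom \<mu> = V \<and> (\<forall>x a b. \<mu> x = Some (a, b) \<longrightarrow> 1 \<le> a \<and> a \<le> b \<and> b \<le> length s + 1)"

lemma length_stw [simp]: "length (tuple_word s \<mu>) = length s"
  by (simp add: tuple_word_def del: upt_Suc)

lemma nth_stw: "i < length s \<Longrightarrow> tuple_word s \<mu> ! i = tuple_status \<mu> (Suc i)"
  by (simp add: tuple_word_def del: upt_Suc)

text \<open>Comparisons with the letters \<open>1..l\<close> separate all admissible end points,
  because only one of these, \<open>l + 1\<close>, lies beyond the last letter.\<close>

lemma thr_eq:
  assumes "\<And>i. 1 \<le> i \<Longrightarrow> i \<le> l \<Longrightarrow> a \<le> i \<longleftrightarrow> b \<le> i" "1 \<le> a" "1 \<le> b" "a \<le> l + 1" "b \<le> l + (1::nat)"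
  shows "a = b"
proof (rule ccontr)
  assume "a \<noteq> b"
  then consider "a < b" | "b < a" by linarith
  then show False
    by cases (use assms(1)[of a] assms(1)[of b] assms(2-) in linarith)+
qed

text \<open>A start is never behind its end, so the number of end points reached at a letter tells
  which of them are reached. Then \<open>thr_eq\<close> applies to each end point.\<close>

lemma sts_eq:
  assumes "wf_tuple V s \<mu>" "wf_tuple V' s \<mu>'" "x \<in> V" "x \<in> V'"
    and "\<And>i. 1 \<le> i \<Longrightarrow> i \<le> length s \<Longrightarrow> tuple_status \<mu> i x = tuple_status \<mu>' i x"
  shows "\<mu> x = \<mu>' x"
proof -
  obtain a b a' b' where m: "\<mu> x = Some (a, b)" "\<mu>' x = Some (a', b')"
    using assms(1-4) by (fastforce simp: wf_tuple_def)
  then have r: "1 \<le> a \<and> a \<le> b \<and> b \<le> length s + 1" "1 \<le> a' \<and> a' \<le> b' \<and> b' \<le> length s + 1"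
    using assms(1,2) by (auto simp: wf_tuple_def)
  have e: "of_bool (a \<le> i) + of_bool (b \<le> i) = (of_bool (a' \<le> i) + of_bool (b' \<le> i) :: nat)"
    if "1 \<le> i" "i \<le> length s" for i
    using assms(5)[OF that] by (simp add: tuple_status_def m)
  have A: "(a \<le> i \<longleftrightarrow> a' \<le> i) \<and> (b \<le> i \<longleftrightarrow> b' \<le> i)" if "1 \<le> i" "i \<le> length s" for i
    using e[OF that] r by (cases "a \<le> i"; cases "b \<le> i"; cases "a' \<le> i"; cases "b' \<le> i") simp_all
  have "a = a'"
    by (rule thr_eq[of "length s" a a']) (use A r in simp_all)
  moreover have "b = b'"
    by (rule thr_eq[of "length s" b b']) (use A r in simp_all)
  ultimately show ?thesis by (simp add: m)
qed

lemma sw_or: "status_words (aut_or A B) s = status_words A s \<union> status_words B s"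
  by (auto simp: status_words_def lang_or)

lemma sw_mask: "status_words (aut_mask K A) s = map (\<lambda>f x. if K x then f x else 3) ` status_words A s"
proof -
  let ?F = "map (\<lambda>(c :: nat, f). (c, \<lambda>x. if K x then f x else (3::nat)))"
  have "map fst (?F w) = map fst w" "map snd (?F w) = map (\<lambda>f x. if K x then f x else 3) (map snd w)" for w
    by (induction w) auto
  moreover have "{map snd w | w. w \<in> F ` L \<and> map fst w = X} = (\<lambda>w. map snd (F w)) ` {w \<in> L. map fst (F w) = X}"
    for F :: "sletter list \<Rightarrow> sletter list" and L X by blast
  ultimately have "status_words (aut_mask K A) s = (\<lambda>w. map (\<lambda>f x. if K x then f x else 3) (map snd w)) `
      {w \<in> lang A. map fst w = map (\<lambda>a. Suc (code a)) s}"
    unfolding status_words_def lang_mask by (simp only:)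
  also have "\<dots> = map (\<lambda>f x. if K x then f x else 3) ` status_words A s"
    unfolding status_words_def by (auto simp del: map_map)
  finally show ?thesis .
qed

lemma accepted_join:
  assumes "\<forall>p\<in>set ps. p < npos A * npos B"
  shows "accepted (aut_join U A B) ps \<longleftrightarrow>
    accepted A (map (\<lambda>p. p div npos B) ps) \<and> accepted B (map (\<lambda>p. p mod npos B) ps)"
proof (cases "ps = []")
  case True
  then show ?thesis by (auto simp: accepted_def aut_join_def Let_def)
next
  case False
  have pos: "p div npos B < npos A" "p mod npos B < npos B" if "p < npos A * npos B" for p
    using that by (auto simp: less_mult_imp_div_less) (cases "npos B"; simp)
  have conj: "successively (\<lambda>x y. P x y \<and> Q x y) xs \<longleftrightarrow> successively P xs \<and> successively Q xs" for P Q and xs :: "nat list"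
    by (induction xs) (auto simp: successively_Cons)
  show ?thesis
    using assms False pos
    by (auto simp: accepted_def aut_join_def Let_def hd_map last_map successively_map conj)
qed

definition merge :: "(var \<Rightarrow> nat) \<Rightarrow> (var \<Rightarrow> nat) \<Rightarrow> var \<Rightarrow> nat" where
  "merge g h = (\<lambda>x. if g x = 3 then h x else g x)"

text \<open>A run of the product that reads the letters of \<open>s\<close> avoids all positions
  labelled 0; so at each of its positions the labels of both components coincide and the statuses
  are compatible.\<close>

lemma sw_join: "status_words (aut_join U A B) s = {map2 merge gs hs | gs hs. gs \<in> status_words A s \<and> hs \<in> status_words B s \<and>
    list_all2 (\<lambda>g h. \<forall>x\<in>U. compat (g x) (h x)) gs hs}"
  (is "_ = ?R")
proof
  let ?J = "aut_join U A B"
  show "status_words ?J s \<subseteq> ?R"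
  proof
    fix fs assume "fs \<in> status_words ?J s"
    then obtain ps where ps: "accepted ?J ps" "map fst (word ?J ps) = map (\<lambda>a. Suc (code a)) s" "fs = map snd (word ?J ps)"
      by (auto simp: status_words_def lang_def)
    let ?as = "map (\<lambda>p. p div npos B) ps" and ?bs = "map (\<lambda>p. p mod npos B) ps"
    have b: "\<forall>p\<in>set ps. p < npos A * npos B"
      using ps(1) by (auto simp: accepted_def aut_join_def Let_def split: if_splits)
    have ab: "accepted A ?as" "accepted B ?bs" using accepted_join[OF b] ps(1) by auto
    have l: "map (lab ?J) ps = map (\<lambda>a. Suc (code a)) s" using ps(2) by (simp add: word_def o_def)
    have c: "lab A (p div npos B) = lab ?J p \<and> lab B (p mod npos B) = lab ?J p \<and>
        (\<forall>x\<in>U. compat (status A (p div npos B) x) (status B (p mod npos B) x))" if "p \<in> set ps" for p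
    proof -
      have "lab ?J p \<in> set (map (lab ?J) ps)" using that by simp
      then have "lab ?J p \<noteq> 0" unfolding l by auto
      then show ?thesis by (auto simp: aut_join_def Let_def split: if_splits)
    qed
    have "map fst (word A ?as) = map (lab ?J) ps" "map fst (word B ?bs) = map (lab ?J) ps"
      using c by (auto simp: word_def)
    then have "map snd (word A ?as) \<in> status_words A s" "map snd (word B ?bs) \<in> status_words B s"
      unfolding status_words_def lang_def using ab l by auto
    moreover have "list_all2 (\<lambda>g h. \<forall>x\<in>U. compat (g x) (h x)) (map snd (word A ?as)) (map snd (word B ?bs))"
      using c by (auto simp: word_def list_all2_conv_all_nth)
    moreover have "fs = map2 merge (map snd (word A ?as)) (map snd (word B ?bs))"
      unfolding ps(3) by (rule nth_equalityI) (auto simp: word_def aut_join_def Let_def merge_def)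
    ultimately show "fs \<in> ?R" by blast
  qed
  show "?R \<subseteq> status_words ?J s"
  proof clarify
    fix gs hs assume g: "gs \<in> status_words A s" and h: "hs \<in> status_words B s" and c: "list_all2 (\<lambda>g h. \<forall>x\<in>U. compat (g x) (h x)) gs hs"
    from g obtain as where as: "accepted A as" "map (lab A) as = map (\<lambda>a. Suc (code a)) s" "gs = map (status A) as"
      by (auto simp: status_words_def lang_def word_def o_def)
    from h obtain bs where bs: "accepted B bs" "map (lab B) bs = map (\<lambda>a. Suc (code a)) s" "hs = map (status B) bs"
      by (auto simp: status_words_def lang_def word_def o_def)
    have len: "length as = length s" "length bs = length s"
      using as(2) bs(2) by (auto dest: map_eq_imp_length_eq)
    have ra: "as ! i < npos A" if "i < length s" for i
    proof -
      have "as ! i \<in> set as" using that len by simp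
      then show ?thesis using as(1) by (auto simp: accepted_def split: if_splits)
    qed
    have rb: "bs ! i < npos B" if "i < length s" for i
    proof -
      have "bs ! i \<in> set bs" using that len by simp
      then show ?thesis using bs(1) by (auto simp: accepted_def split: if_splits)
    qed
    define ps where "ps = map2 (\<lambda>a b. a * npos B + b) as bs"
    have len': "length ps = length s" by (simp add: ps_def len)
    have dm: "ps ! i div npos B = as ! i" "ps ! i mod npos B = bs ! i" "ps ! i < npos A * npos B" if "i < length s" for i
    proof -
      have *: "ps ! i = as ! i * npos B + bs ! i" using that len by (simp add: ps_def)
      show "ps ! i div npos B = as ! i" "ps ! i mod npos B = bs ! i" using * rb[OF that] by auto
      have "as ! i * npos B + bs ! i < Suc (as ! i) * npos B" using rb[OF that] by simp
      also have "\<dots> \<le> npos A * npos B" using ra[OF that] by (intro mult_le_mono1) simp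
      finally show "ps ! i < npos A * npos B" using * by simp
    qed
    have m: "map (\<lambda>p. p div npos B) ps = as" "map (\<lambda>p. p mod npos B) ps = bs"
      by (rule nth_equalityI; simp add: dm len len')+
    have "\<forall>p\<in>set ps. p < npos A * npos B" using dm(3) len' by (metis in_set_conv_nth)
    then have accepted: "accepted ?J ps" using accepted_join m as(1) bs(1) by metis
    have cc: "\<forall>x\<in>U. compat (status A (as ! i) x) (status B (bs ! i) x)" if "i < length s" for i
      using c that len as(3) bs(3) by (auto simp: list_all2_conv_all_nth)
    have ll: "lab A (as ! i) = Suc (code (s ! i))" "lab B (bs ! i) = Suc (code (s ! i))" if "i < length s" for i
    proof -
      have "map (lab A) as ! i = Suc (code (s ! i))" "map (lab B) bs ! i = Suc (code (s ! i))"
        unfolding as(2) bs(2) using that by simp_all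
      then show "lab A (as ! i) = Suc (code (s ! i))" "lab B (bs ! i) = Suc (code (s ! i))" using that len by simp_all
    qed
    have "map fst (word ?J ps) = map (\<lambda>a. Suc (code a)) s"
      by (rule nth_equalityI) (auto simp: word_def len' aut_join_def Let_def dm ll cc)
    moreover have "map2 merge gs hs = map snd (word ?J ps)"
      by (rule nth_equalityI) (auto simp: word_def len' len as(3) bs(3) aut_join_def Let_def dm merge_def)
    ultimately show "map2 merge gs hs \<in> status_words ?J s"
      unfolding status_words_def lang_def using accepted by auto
  qed
qed

section \<open>Status words of tuples, of formulas and of representations\<close>

lemma status_from_const:
  "Open x \<notin> set r \<Longrightarrow> Close x \<notin> set r \<Longrightarrow> map (\<lambda>(c, g). g x) (status_from f r) = replicate (length (clr r)) (f x)"
  by (induction f r rule: status_from.induct) (auto simp: fun_upd_def)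

lemma clr_append: "clr (u @ v) = clr u @ clr v"
  by (induction u rule: clr.induct) auto

text \<open>As each marker of \<open>x\<close> occurs once, the word splits at them in only one way.
  The counter of \<open>x\<close> is 0, 1 and 2 on the three factors, and the lengths of the first
  two are what \<open>ref_span\<close> measures.\<close>

lemma valid_var:
  assumes "valid V r" "x \<in> V"
  obtains a b where "ref_span r x = (a, b)" "1 \<le> a" "a \<le> b" "b \<le> length (clr r) + 1"
    "\<And>i. i < length (clr r) \<Longrightarrow> snd (ref_status r ! i) x = of_bool (a \<le> Suc i) + of_bool (b \<le> Suc i)"
proof -
  obtain u v w where r: "r = u @ Open x # v @ Close x # w"
    and c: "count_list r (Open x) = 1" "count_list r (Close x) = 1"
    using assms by (auto simp: valid_def)
  have n: "Open x \<notin> set u" "Open x \<notin> set v" "Open x \<notin> set w" "Close x \<notin> set u" "Close x \<notin> set v" "Close x \<notin> set w"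
    using c by (auto simp: r count_list_0_iff[symmetric])
  let ?a = "length (clr u) + 1" and ?b = "length (clr u) + 1 + length (clr v)"
  have "ref_span r x = (?a, ?b)"
    unfolding ref_span_def
  proof (rule the_equality)
    show "\<exists>u v w. r = u @ Open x # v @ Close x # w \<and> (?a, ?b) = (length (clr u) + 1, length (clr u) + 1 + length (clr v))"
      using r by blast
  next
    fix p assume "\<exists>u v w. r = u @ Open x # v @ Close x # w \<and> p = (length (clr u) + 1, length (clr u) + 1 + length (clr v))"
    then obtain u' v' w' where *: "r = u' @ Open x # v' @ Close x # w'"
       "p = (length (clr u') + 1, length (clr u') + 1 + length (clr v'))" by blast
    have "u = u' \<and> v @ Close x # w = v' @ Close x # w'"
      using r *(1) n(1-3) by (intro append_Cons_eq_iff[THEN iffD1, of "Open x"]) auto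
    moreover from this have "v = v' \<and> w = w'"
      using n(5,6) by (intro append_Cons_eq_iff[THEN iffD1, of "Close x"]) auto
    ultimately have "u = u'" "v = v'" by auto
    then show "p = (?a, ?b)" using * by simp
  qed
  moreover have len: "length (clr r) = length (clr u) + length (clr v) + length (clr w)"
    by (simp add: r clr_append)
  moreover have "snd (ref_status r ! i) x = of_bool (?a \<le> Suc i) + of_bool (?b \<le> Suc i)" if "i < length (clr r)" for i
  proof -
    have cu: "marker_count u x = 0" "marker_count v x = 0"
      using n by (simp_all add: marker_count_def)
    have "map (\<lambda>(c, g). g x) (ref_status r) = replicate (length (clr u)) 0 @ replicate (length (clr v)) 1 @ replicate (length (clr w)) 2"
      unfolding r status_from_append status_from.simps map_append using n cu by (simp add: status_from_const)
    moreover have "length (ref_status r) = length (clr r)"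
      using arg_cong[OF status_from_fst, of length] by simp
    ultimately have "snd (ref_status r ! i) x = (replicate (length (clr u)) 0 @ replicate (length (clr v)) 1 @ replicate (length (clr w)) (2::nat)) ! i"
      using that by (metis (no_types, lifting) nth_map case_prod_beta)
    then show ?thesis using that len by (auto simp: nth_append)
  qed
  ultimately show ?thesis
    using that[of ?a ?b] by simp
qed

lemma wft_ref_tuple: "valid V r \<Longrightarrow> clr r = s \<Longrightarrow> wf_tuple V s (ref_tuple V r)"
  unfolding wf_tuple_def
proof (intro conjI allI impI)
  assume v: "valid V r" and c: "clr r = s"
  show "dom (ref_tuple V r) = V" by (auto simp: ref_tuple_def split: if_splits)
  fix x a b assume "ref_tuple V r x = Some (a, b)"
  then have x: "x \<in> V" "ref_span r x = (a, b)" by (auto simp: ref_tuple_def split: if_splits)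
  show "1 \<le> a" "a \<le> b" "b \<le> length s + 1"
    by (rule valid_var[OF v x(1)]; use x(2) c in simp)+
qed

text \<open>The passage from ref-words to tuples: the order of markers between two letters is
  forgotten on both sides, so all ref-words of one tuple yield one status word.\<close>

lemma stw_ref_tuple:
  assumes "valid V r" "clr r = s"
  shows "tuple_word s (ref_tuple V r) = map (\<lambda>f x. if x \<in> V then f x else 3) (map snd (ref_status r))"
proof (rule nth_equalityI)
  have l: "length (ref_status r) = length s"
    using arg_cong[OF status_from_fst, of length] assms by simp
  then show "length (tuple_word s (ref_tuple V r)) = length (map (\<lambda>f x. if x \<in> V then f x else 3) (map snd (ref_status r)))"
    by simp
  fix i assume "i < length (tuple_word s (ref_tuple V r))"
  then have i: "i < length s" by simp
  have "tuple_status (ref_tuple V r) (Suc i) x = (if x \<in> V then snd (ref_status r ! i) x else 3)" for x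
  proof (cases "x \<in> V")
    case True
    then obtain a b where *: "ref_span r x = (a, b)"
       "\<And>i. i < length (clr r) \<Longrightarrow> snd (ref_status r ! i) x = of_bool (a \<le> Suc i) + of_bool (b \<le> Suc i)"
      using valid_var[OF assms(1)] by metis
    show ?thesis using True *(2)[of i] i assms(2) by (simp add: tuple_status_def ref_tuple_def *(1))
  qed (simp add: tuple_status_def ref_tuple_def)
  then show "tuple_word s (ref_tuple V r) ! i = map (\<lambda>f x. if x \<in> V then f x else 3) (map snd (ref_status r)) ! i"
    using i l by (auto simp: nth_stw)
qed

text \<open>Functionality gives homogeneity with count 1 for the variables of the formula and 0 for
  all others. If there is a word, \<open>marks\<close> therefore is 2 or 0, and the mask by
  \<open>marks\<close> is the mask by \<open>regex_vars\<close>.\<close>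

lemma rep_regex:
  assumes "functional \<alpha>" and "inj code"
  defines "A \<equiv> aut_mask (\<lambda>x. marks (aut_regex \<alpha>) x \<noteq> 0) (aut_regex \<alpha>)"
  shows "status_words A s = tuple_word s ` regex_sem \<alpha> s" "nonempty A \<Longrightarrow> marks A x \<noteq> 0 \<longleftrightarrow> x \<in> regex_vars \<alpha>"
    "\<not> nonempty A \<Longrightarrow> regex_sem \<alpha> s = {}"
proof -
  let ?V = "regex_vars \<alpha>"
  let ?C = "\<lambda>x. of_bool (x \<in> ?V) :: nat"
  have v: "valid ?V r" if "r \<in> ref_lang \<alpha>" for r using assms that by (simp add: functional_def)
  have "homogeneous \<alpha> ?C"
    unfolding homogeneous_def
  proof (intro ballI allI)
    fix r x assume "r \<in> ref_lang \<alpha>"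
    then have "valid ?V r" by (rule v)
    then show "count_list r (Open x) = ?C x"
      by (cases "x \<in> ?V") (auto simp: valid_def count_list_0_iff)
  qed
  note a = aut_regex[OF this]
  have nonempty: "nonempty A \<longleftrightarrow> ref_lang \<alpha> \<noteq> {}" using a by (simp add: A_def aut_mask_def)
  have t: "marks (aut_regex \<alpha>) x \<noteq> 0 \<longleftrightarrow> x \<in> ?V" if "ref_lang \<alpha> \<noteq> {}" for x using a that by simp
  show "\<not> nonempty A \<Longrightarrow> regex_sem \<alpha> s = {}" using nonempty by (auto simp: regex_sem_def)
  show "nonempty A \<Longrightarrow> marks A x \<noteq> 0 \<longleftrightarrow> x \<in> regex_vars \<alpha>" using t nonempty by (simp add: A_def aut_mask_def)
  show "status_words A s = tuple_word s ` regex_sem \<alpha> s"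
  proof (cases "ref_lang \<alpha> = {}")
    case True
    then show ?thesis using a by (simp add: A_def sw_mask) (simp add: status_words_def regex_sem_def)
  next
    case False
    have "status_words A s = map (\<lambda>f x. if x \<in> ?V then f x else 3) ` status_words (aut_regex \<alpha>) s"
    proof -
      have "(\<lambda>x. marks (aut_regex \<alpha>) x \<noteq> 0) = (\<lambda>x. x \<in> ?V)" using t[OF False] by blast
      then show ?thesis unfolding A_def sw_mask by (rule arg_cong)
    qed
    also have "status_words (aut_regex \<alpha>) s = (\<lambda>r. map snd (ref_status r)) ` {r \<in> ref_lang \<alpha>. clr r = s}"
    proof -
      have "inj (\<lambda>a. Suc (code a))" using assms(2) by (auto simp: inj_def)
      then have "map (\<lambda>a. Suc (code a)) (clr r) = map (\<lambda>a. Suc (code a)) s \<longleftrightarrow> clr r = s" for r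
        by (simp add: inj_map_eq_map)
      then show ?thesis
        unfolding status_words_def using a by (auto simp: status_from_fst)
    qed
    also have "map (\<lambda>f x. if x \<in> ?V then f x else 3) ` \<dots> = (\<lambda>r. tuple_word s (ref_tuple ?V r)) ` {r \<in> ref_lang \<alpha>. clr r = s}"
      unfolding image_image by (rule image_cong) (use stw_ref_tuple v in auto)
    also have "\<dots> = tuple_word s ` regex_sem \<alpha> s"
      unfolding regex_sem_def using v by auto
    finally show ?thesis .
  qed
qed

lemma regex_vars_enc: "regex_vars \<alpha> \<subseteq> set (enc_regex code \<alpha>)"
  by (induction \<alpha>) auto

text \<open>Every variable in scope is written in the encoding, so a test on the numbers of the
  encoding covers all variables.\<close>

lemma rep_vars_enc: "rep_vars q \<subseteq> set (enc_rep code q)"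
  using regex_vars_enc by (induction q) fastforce+

lemma regex_sem_wft: "\<mu> \<in> regex_sem \<alpha> s \<Longrightarrow> wf_tuple (regex_vars \<alpha>) s \<mu>"
  by (auto simp: regex_sem_def intro: wft_ref_tuple)

lemma wft_restrict: "wf_tuple V s \<mu> \<Longrightarrow> Y \<subseteq> V \<Longrightarrow> wf_tuple Y s (\<mu> |` Y)"
  by (auto simp: wf_tuple_def restrict_map_def split: if_splits)

lemma rep_sem_wft: "regular_rep q \<Longrightarrow> \<mu> \<in> rep_sem q s \<Longrightarrow> wf_tuple (rep_vars q) s \<mu>"
proof (induction q arbitrary: \<mu>)
  case (JoinOf p q)
  then have "wf_tuple (rep_vars p) s (\<mu> |` rep_vars p)" "wf_tuple (rep_vars q) s (\<mu> |` rep_vars q)" "dom \<mu> = rep_vars p \<union> rep_vars q"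
    by auto
  then show ?case
    by (auto simp: wf_tuple_def restrict_map_def split: if_splits) (metis UnE domI)+
qed (auto simp: regex_sem_wft intro: wft_restrict)

lemma stw_restrict: "tuple_word s (\<mu> |` Y) = map (\<lambda>f x. if x \<in> Y then f x else 3) (tuple_word s \<mu>)"
  by (auto simp: tuple_word_def tuple_status_def restrict_map_def)

lemma sts_3: "tuple_status \<mu> i x = 3 \<longleftrightarrow> x \<notin> dom \<mu>"
  by (auto simp: tuple_status_def of_bool_def split: option.splits if_splits)

text \<open>The claims on \<open>marks\<close> and \<open>nonempty\<close> tell the machine the
  scope of the output: either \<open>marks\<close> reveals it, or there are no answers and it does
  not matter. The hypothesis on \<open>U\<close> passes to subexpressions, since their encodings are
  factors of the whole one.\<close>

lemma rep_correct:
  assumes "inj code"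
  shows "regular_rep q \<Longrightarrow> set (enc_rep code q) \<subseteq> U \<Longrightarrow>
    (\<forall>s. status_words (aut_rep U q) s = tuple_word s ` rep_sem q s) \<and>
    (nonempty (aut_rep U q) \<longrightarrow> (\<forall>x. marks (aut_rep U q) x \<noteq> 0 \<longleftrightarrow> x \<in> rep_vars q)) \<and>
    (\<not> nonempty (aut_rep U q) \<longrightarrow> (\<forall>s. rep_sem q s = {}))"
proof (induction q)
  case (Regex \<alpha>)
  then show ?case using rep_regex[of \<alpha>] assms by simp
next
  case (UnionOf p q)
  then have "regular_rep p" "regular_rep q" "rep_vars p = rep_vars q" "set (enc_rep code p) \<subseteq> U" "set (enc_rep code q) \<subseteq> U"
    by auto
  with UnionOf.IH have IH: "\<forall>s. status_words (aut_rep U p) s = tuple_word s ` rep_sem p s" "\<forall>s. status_words (aut_rep U q) s = tuple_word s ` rep_sem q s"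
    "nonempty (aut_rep U p) \<longrightarrow> (\<forall>x. marks (aut_rep U p) x \<noteq> 0 \<longleftrightarrow> x \<in> rep_vars p)"
    "nonempty (aut_rep U q) \<longrightarrow> (\<forall>x. marks (aut_rep U q) x \<noteq> 0 \<longleftrightarrow> x \<in> rep_vars p)"
    "\<not> nonempty (aut_rep U p) \<longrightarrow> (\<forall>s. rep_sem p s = {})" "\<not> nonempty (aut_rep U q) \<longrightarrow> (\<forall>s. rep_sem q s = {})"
    by auto
  have sel: "nonempty (aut_or A B) \<longleftrightarrow> nonempty A \<or> nonempty B" "marks (aut_or A B) = (if nonempty A then marks A else marks B)" for A B
    by (auto simp: aut_or_def Let_def)
  show ?case
    using IH \<open>rep_vars p = rep_vars q\<close> by (auto simp: sw_or sel image_Un split: if_splits)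
next
  case (Proj Y p)
  then have "regular_rep p" "set Y \<subseteq> rep_vars p" "set (enc_rep code p) \<subseteq> U" by auto
  with Proj.IH have IH: "\<forall>s. status_words (aut_rep U p) s = tuple_word s ` rep_sem p s"
    "nonempty (aut_rep U p) \<longrightarrow> (\<forall>x. marks (aut_rep U p) x \<noteq> 0 \<longleftrightarrow> x \<in> rep_vars p)"
    "\<not> nonempty (aut_rep U p) \<longrightarrow> (\<forall>s. rep_sem p s = {})"
    by auto
  have sel: "nonempty (aut_mask K A) \<longleftrightarrow> nonempty A" "marks (aut_mask K A) x = (if K x then marks A x else 0)" for K A x
    by (auto simp: aut_mask_def)
  show ?case
    using IH \<open>set Y \<subseteq> rep_vars p\<close> by (auto simp: sw_mask sel image_image stw_restrict)
next
  case (JoinOf p q)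
  let ?A = "aut_rep U p" and ?B = "aut_rep U q" and ?V = "rep_vars p" and ?W = "rep_vars q"
  have reg: "regular_rep p" "regular_rep q" and U: "set (enc_rep code p) \<subseteq> U" "set (enc_rep code q) \<subseteq> U"
    using JoinOf.prems by auto
  with JoinOf.IH have IH: "\<forall>s. status_words ?A s = tuple_word s ` rep_sem p s" "\<forall>s. status_words ?B s = tuple_word s ` rep_sem q s"
    "nonempty ?A \<longrightarrow> (\<forall>x. marks ?A x \<noteq> 0 \<longleftrightarrow> x \<in> ?V)"
    "nonempty ?B \<longrightarrow> (\<forall>x. marks ?B x \<noteq> 0 \<longleftrightarrow> x \<in> ?W)"
    "\<not> nonempty ?A \<longrightarrow> (\<forall>s. rep_sem p s = {})" "\<not> nonempty ?B \<longrightarrow> (\<forall>s. rep_sem q s = {})"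
    by auto
  have sel: "nonempty (aut_join U ?A ?B) \<longleftrightarrow> nonempty ?A \<and> nonempty ?B" "marks (aut_join U ?A ?B) = (\<lambda>x. marks ?A x + marks ?B x)"
    by (auto simp: aut_join_def Let_def)
  have "status_words (aut_join U ?A ?B) s = tuple_word s ` rep_sem (JoinOf p q) s" for s
  proof
    show "status_words (aut_join U ?A ?B) s \<subseteq> tuple_word s ` rep_sem (JoinOf p q) s"
    proof
      fix fs assume "fs \<in> status_words (aut_join U ?A ?B) s"
      then obtain m1 m2 where m: "m1 \<in> rep_sem p s" "m2 \<in> rep_sem q s"
        and fs: "fs = map2 merge (tuple_word s m1) (tuple_word s m2)"
        and c: "list_all2 (\<lambda>g h. \<forall>x\<in>U. compat (g x) (h x)) (tuple_word s m1) (tuple_word s m2)"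
        unfolding sw_join using IH(1,2) by auto
      have wf: "wf_tuple ?V s m1" "wf_tuple ?W s m2" using rep_sem_wft reg m by auto
      then have dom: "dom m1 = ?V" "dom m2 = ?W" by (auto simp: wf_tuple_def)
      \<comment> \<open>A common variable is in \<open>U\<close> and has status 3 on neither side,
        so compatibility means equality at every letter, and the statuses determine the
        span.\<close>
      have eq: "m1 x = m2 x" if "x \<in> ?V" "x \<in> ?W" for x
      proof (rule sts_eq[OF wf that])
        fix i assume i: "1 \<le> i" "i \<le> length s"
        have "x \<in> U" using that(1) rep_vars_enc[of p] U by auto
        then have "compat ((tuple_word s m1 ! (i - 1)) x) ((tuple_word s m2 ! (i - 1)) x)"
          using c i by (auto simp: list_all2_conv_all_nth)
        then have "compat (tuple_status m1 i x) (tuple_status m2 i x)" using i by (simp add: nth_stw)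
        then show "tuple_status m1 i x = tuple_status m2 i x"
          using that dom sts_3[of m1 i x] sts_3[of m2 i x] by (auto simp: compat_def)
      qed
      define \<mu> where "\<mu> = m1 ++ m2"
      have \<mu>: "\<mu> x = (if x \<in> ?V then m1 x else if x \<in> ?W then m2 x else None)" for x
      proof (cases "x \<in> ?W")
        case True
        then have "\<mu> x = m2 x" using dom by (auto simp: \<mu>_def map_add_def split: option.splits)
        then show ?thesis using True eq by auto
      next
        case False
        then have "m2 x = None" using dom by blast
        then have "\<mu> x = m1 x" by (simp add: \<mu>_def map_add_def)
        then show ?thesis using False dom by (auto simp: domIff[symmetric])
      qed
      have r: "\<mu> |` ?V = m1" "\<mu> |` ?W = m2"
      proof -
        have none: "x \<notin> ?V \<Longrightarrow> m1 x = None" "x \<notin> ?W \<Longrightarrow> m2 x = None" for x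
          using dom by blast+
        show "\<mu> |` ?V = m1"
          by (rule ext) (simp add: restrict_map_def \<mu> none)
        show "\<mu> |` ?W = m2"
          by (rule ext) (simp add: restrict_map_def \<mu> none eq)
      qed
      have "dom \<mu> = ?V \<union> ?W" using dom by (auto simp: \<mu>_def)
      then have "\<mu> \<in> rep_sem (JoinOf p q) s" using r m by simp
      moreover have "fs = tuple_word s \<mu>"
      proof (rule nth_equalityI)
        fix i assume "i < length fs"
        then have i: "i < length s" by (simp add: fs)
        have "merge (tuple_status m1 (Suc i)) (tuple_status m2 (Suc i)) x = tuple_status \<mu> (Suc i) x" for x
          using dom sts_3[of m1 "Suc i" x] by (auto simp: merge_def tuple_status_def \<mu> domIff[symmetric] split: option.splits if_splits)
        then show "fs ! i = tuple_word s \<mu> ! i" using i by (auto simp: fs nth_stw)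
      qed (simp add: fs)
      ultimately show "fs \<in> tuple_word s ` rep_sem (JoinOf p q) s" by blast
    qed
    show "tuple_word s ` rep_sem (JoinOf p q) s \<subseteq> status_words (aut_join U ?A ?B) s"
    proof clarify
      fix \<mu> assume "\<mu> \<in> rep_sem (JoinOf p q) s"
      then have d: "dom \<mu> = ?V \<union> ?W" and m: "\<mu> |` ?V \<in> rep_sem p s" "\<mu> |` ?W \<in> rep_sem q s" by auto
      let ?g = "tuple_word s (\<mu> |` ?V)" and ?h = "tuple_word s (\<mu> |` ?W)"
      have "list_all2 (\<lambda>g h. \<forall>x\<in>U. compat (g x) (h x)) ?g ?h"
        by (auto simp: list_all2_conv_all_nth nth_stw compat_def tuple_status_def restrict_map_def)
      moreover have "tuple_word s \<mu> = map2 merge ?g ?h"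
      proof (rule nth_equalityI)
        fix i assume "i < length (tuple_word s \<mu>)"
        then have i: "i < length s" by simp
        have "tuple_status \<mu> (Suc i) x = merge (tuple_status (\<mu> |` ?V) (Suc i)) (tuple_status (\<mu> |` ?W) (Suc i)) x" for x
          using d sts_3[of "\<mu> |` ?V" "Suc i" x] by (auto simp: merge_def tuple_status_def restrict_map_def split: option.splits if_splits)
        then show "tuple_word s \<mu> ! i = map2 merge ?g ?h ! i" using i by (auto simp: nth_stw)
      qed simp
      ultimately show "tuple_word s \<mu> \<in> status_words (aut_join U ?A ?B) s"
        unfolding sw_join using m IH(1,2) by auto
    qed
  qed
  moreover have "\<not> nonempty (aut_join U ?A ?B) \<longrightarrow> (\<forall>s. rep_sem (JoinOf p q) s = {})"
    using IH(5,6) by (auto simp: sel)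
  ultimately show ?case using IH(3,4) by (auto simp: sel)
qed

section \<open>Size of the automata\<close>

lemma power_sum_le: "(2::nat) ^ a + 2 ^ b \<le> 2 ^ (a + (b + 1))"
proof -
  have "(2::nat) ^ a \<le> 2 ^ (a + b)" "(2::nat) ^ b \<le> 2 ^ (a + b)" by (intro power_increasing; simp)+
  moreover have "(2::nat) ^ (a + (b + 1)) = 2 * 2 ^ (a + b)" by simp
  ultimately show ?thesis by linarith
qed

lemma npos_regex: "npos (aut_regex \<alpha>) \<le> 2 ^ length (enc_regex code \<alpha>)"
proof (induction \<alpha>)
  case (ROr \<alpha> \<beta>)
  then have "npos (aut_regex \<alpha>) + npos (aut_regex \<beta>) \<le> 2 ^ length (enc_regex code (ROr \<alpha> \<beta>))"
    using power_sum_le[of "length (enc_regex code \<alpha>)" "length (enc_regex code \<beta>)"] by simp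
  then show ?case by (simp only: aut_regex.simps aut_or_def Let_def aut.select_convs)
next
  case (RConc \<alpha> \<beta>)
  then have "npos (aut_regex \<alpha>) + npos (aut_regex \<beta>) \<le> 2 ^ length (enc_regex code (RConc \<alpha> \<beta>))"
    using power_sum_le[of "length (enc_regex code \<alpha>)" "length (enc_regex code \<beta>)"] by simp
  then show ?case by (simp only: aut_regex.simps aut_conc_def Let_def aut.select_convs)
qed (simp_all add: aut_prim_def aut_star_def aut_bind_def)

text \<open>Joins multiply sizes, which adds exponents; for a union the tag lengthens the encoding
  by 1 and thereby pays for the factor 2 in the bound of a sum.\<close>

lemma npos_rep: "npos (aut_rep U q) \<le> 2 ^ length (enc_rep code q)"
proof (induction q)
  case (Regex \<alpha>)
  then show ?case using npos_regex[of \<alpha>] by (simp add: aut_mask_def)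
next
  case (UnionOf p q)
  then have "npos (aut_rep U p) + npos (aut_rep U q) \<le> 2 ^ length (enc_rep code (UnionOf p q))"
    using power_sum_le[of "length (enc_rep code p)" "length (enc_rep code q)"] by simp
  then show ?case by (simp only: aut_rep.simps aut_or_def Let_def aut.select_convs)
next
  case (Proj Y p)
  have "(2::nat) ^ length (enc_rep code p) \<le> 2 ^ length (enc_rep code (Proj Y p))"
    by (intro power_increasing) simp_all
  with Proj have "npos (aut_rep U p) \<le> 2 ^ length (enc_rep code (Proj Y p))"
    by (rule order_trans)
  then show ?case by (simp add: aut_mask_def)
next
  case (JoinOf p q)
  then have "npos (aut_rep U p) * npos (aut_rep U q) \<le> 2 ^ length (enc_rep code p) * 2 ^ length (enc_rep code q)"
    by (rule mult_le_mono)
  then show ?case by (simp add: aut_join_def Let_def power_add)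
qed

end

section \<open>Weakest preconditions\<close>

text \<open>Bound and result in one predicate: a proof of it yields correctness and, by
  \<open>ccomp_gwp\<close>, also the running time.\<close>

definition wp :: "nat list \<Rightarrow> nat \<Rightarrow> com \<Rightarrow> (store \<Rightarrow> bool) \<Rightarrow> store \<Rightarrow> bool" where
  "wp w B c Q s \<longleftrightarrow> cbnd w B c s \<and> Q (exec w c s)"

lemma wp_simps [simp]:
  "wp w B Skip Q s \<longleftrightarrow> Q s"
  "wp w B (Set r e) Q s \<longleftrightarrow> abnd w B e s \<and> Q (setr r (aval w e s) s)"
  "wp w B (Put i a b c e) Q s \<longleftrightarrow> abnd w B a s \<and> abnd w B b s \<and> abnd w B c s \<and> abnd w B e s \<and>
     aval w a s \<le> B \<and> aval w b s \<le> B \<and> aval w c s \<le> B \<and>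
     Q (s\<lparr>heap := (heap s)((i, aval w a s, aval w b s, aval w c s) := aval w e s)\<rparr>)"
  "wp w B (Seq c1 c2) Q s \<longleftrightarrow> wp w B c1 (wp w B c2 Q) s"
  "wp w B (If e c1 c2) Q s \<longleftrightarrow> abnd w B e s \<and> (if aval w e s \<noteq> 0 then wp w B c1 Q s else wp w B c2 Q s)"
  "wp w B (Out e) Q s \<longleftrightarrow> abnd w B e s \<and> Q (s\<lparr>obuf := obuf s @ [aval w e s]\<rparr>)"
  by (auto simp: wp_def)

text \<open>Rounds \<open>t\<close> to \<open>t + n - 1\<close> of a loop, without restoring its
  register. Such a block can be cut at any round, which the parser needs: a subexpression is
  processed by consecutive rounds of one loop.\<close>

primrec iter :: "nat list \<Rightarrow> nat \<Rightarrow> com \<Rightarrow> nat \<Rightarrow> nat \<Rightarrow> nat \<Rightarrow> (store \<Rightarrow> bool) \<Rightarrow> store \<Rightarrow> bool" where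
  "iter w B c r 0 = (\<lambda>t Q. Q)"
| "iter w B c r (Suc n) = (\<lambda>t Q s. wp w B c (iter w B c r n (Suc t) Q) (setr r t s))"

lemma iter_add: "iter w B c r (m + n) t Q s \<longleftrightarrow> iter w B c r m t (iter w B c r n (t + m) Q) s"
  by (induction m arbitrary: t s) (auto simp: wp_def)

lemma iter_foldl:
  "iter w B c r n t Q s \<longleftrightarrow>
     (\<forall>k<n. cbnd w B c (setr r (t + k) (foldl (\<lambda>s k. exec w c (setr r k s)) s [t..<t + k]))) \<and>
     Q (foldl (\<lambda>s k. exec w c (setr r k s)) s [t..<t + n])"
proof (induction n arbitrary: t s)
  case (Suc n)
  have u: "[t..<t + Suc k] = t # [Suc t..<Suc t + k]" for k
    by (simp add: upt_conv_Cons)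
  have all: "(\<forall>k<Suc n. P k) \<longleftrightarrow> P 0 \<and> (\<forall>k<n. P (Suc k))" for P
    by (auto simp: less_Suc_eq_0_disj)
  show ?case
    unfolding iter.simps wp_def Suc.IH all u by (simp del: upt_Suc fun_upd_apply)
qed simp

lemma wp_For_iter:
  assumes "abnd w B e s" "aval w e s \<le> B"
    and "iter w B c r (aval w e s) 0 (\<lambda>s'. Q (setr r (regs s r) s')) s"
  shows "wp w B (For r e c) Q s"
  using assms by (simp add: wp_def iter_foldl)

lemma iter_inv:
  assumes "J 0 s" "\<And>k s'. k < n \<Longrightarrow> J k s' \<Longrightarrow> wp w B c (J (Suc k)) (setr r (t + k) s')"
    and "\<And>s'. J n s' \<Longrightarrow> Q s'"
  shows "iter w B c r n t Q s"
  using assms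
proof (induction n arbitrary: t s J)
  case (Suc n)
  have "wp w B c (J (Suc 0)) (setr r t s)" using Suc.prems(2)[of 0 s] Suc.prems(1) by (simp del: fun_upd_apply)
  moreover have "iter w B c r n (Suc t) Q s'" if "J (Suc 0) s'" for s'
    by (rule Suc.IH[where J = "\<lambda>k. J (Suc k)"], rule that) (use Suc.prems(2)[of "Suc _"] Suc.prems(3) in auto)
  ultimately show ?case by (auto simp: wp_def)
qed auto

lemma wp_For:
  assumes "abnd w B e s" "aval w e s = n" "n \<le> B" "J 0 s"
    and "\<And>k s'. k < n \<Longrightarrow> J k s' \<Longrightarrow> wp w B c (J (Suc k)) (setr r k s')"
    and "\<And>s'. J n s' \<Longrightarrow> Q (setr r (regs s r) s')"
  shows "wp w B (For r e c) Q s"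
  by (rule wp_For_iter) (use assms in \<open>auto intro!: iter_inv[where J = J]\<close>)

lemma wp_mono: "wp w B c Q s \<Longrightarrow> (\<And>s'. Q s' \<Longrightarrow> Q' s') \<Longrightarrow> wp w B c Q' s"
  by (auto simp: wp_def)

definition eNz :: "aexp \<Rightarrow> aexp" where "eNz a = Ite a (Lit 1) (Lit 0)"
definition eNot :: "aexp \<Rightarrow> aexp" where "eNot a = Ite a (Lit 0) (Lit 1)"
text \<open>The second operand is evaluated only if the first is nonzero, so a range test may guard
  a table access.\<close>

definition eAnd :: "aexp \<Rightarrow> aexp \<Rightarrow> aexp" where "eAnd a b = Ite a (eNz b) (Lit 0)"
definition eOr :: "aexp \<Rightarrow> aexp \<Rightarrow> aexp" where "eOr a b = Ite a (Lit 1) (eNz b)"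
definition eLt :: "aexp \<Rightarrow> aexp \<Rightarrow> aexp" where "eLt a b = eNz (Minus b a)"
definition eLe :: "aexp \<Rightarrow> aexp \<Rightarrow> aexp" where "eLe a b = eNot (Minus a b)"
definition eEq :: "aexp \<Rightarrow> aexp \<Rightarrow> aexp" where "eEq a b = eNot (Plus (Minus a b) (Minus b a))"

lemma aval_bool [simp]:
  "aval w (eNz a) s = of_bool (aval w a s \<noteq> 0)"
  "aval w (eNot a) s = of_bool (aval w a s = 0)"
  "aval w (eAnd a b) s = of_bool (aval w a s \<noteq> 0 \<and> aval w b s \<noteq> 0)"
  "aval w (eOr a b) s = of_bool (aval w a s \<noteq> 0 \<or> aval w b s \<noteq> 0)"
  "aval w (eLt a b) s = of_bool (aval w a s < aval w b s)"
  "aval w (eLe a b) s = of_bool (aval w a s \<le> aval w b s)"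
  "aval w (eEq a b) s = of_bool (aval w a s = aval w b s)"
  by (auto simp: eNz_def eNot_def eAnd_def eOr_def eLt_def eLe_def eEq_def)

lemma abnd_bool [simp]:
  "abnd w B (eNz a) s \<longleftrightarrow> abnd w B a s"
  "abnd w B (eNot a) s \<longleftrightarrow> abnd w B a s"
  "abnd w B (eAnd a b) s \<longleftrightarrow> abnd w B a s \<and> (aval w a s \<noteq> 0 \<longrightarrow> abnd w B b s)"
  "abnd w B (eOr a b) s \<longleftrightarrow> abnd w B a s \<and> (aval w a s = 0 \<longrightarrow> abnd w B b s)"
  "abnd w B (eLt a b) s \<longleftrightarrow> abnd w B a s \<and> abnd w B b s"
  "abnd w B (eLe a b) s \<longleftrightarrow> abnd w B a s \<and> abnd w B b s"
  "abnd w B (eEq a b) s \<longleftrightarrow> abnd w B a s \<and> abnd w B b s"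
  by (auto simp: eNz_def eNot_def eAnd_def eOr_def eLt_def eLe_def eEq_def)

text \<open>Sums serve as bounded quantifiers: being zero is a universal statement about the
  summands, being nonzero an existential one.\<close>

lemma aval_Sum0: "aval w (Sum r a b) s = 0 \<longleftrightarrow> (\<forall>k<aval w a s. aval w b (setr r k s) = 0)"
  by (simp add: sum_eq_0_iff) auto

subsection \<open>Automata in memory\<close>

abbreviation (input) "rP \<equiv> 0 :: nat"
abbreviation (input) "rQ \<equiv> 10 :: nat"
abbreviation (input) "rK \<equiv> 2 :: nat"
abbreviation (input) "rT \<equiv> 3 :: nat"
abbreviation (input) "rA \<equiv> 4 :: nat"
abbreviation (input) "rB \<equiv> 5 :: nat"
abbreviation (input) "rTag \<equiv> 6 :: nat"
abbreviation (input) "rSP \<equiv> 7 :: nat"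
abbreviation (input) "rNxt \<equiv> 8 :: nat"
abbreviation (input) "rM \<equiv> 9 :: nat"

text \<open>Statuses and \<open>marks\<close> are tabulated for input positions \<open>j\<close> and
  not for the variables \<open>w ! j\<close>: variables may be huge, whereas indices have to stay
  below \<open>B\<close>. Truth values are kept as zero or nonzero, without normalisation.\<close>

definition stored :: "nat list \<Rightarrow> (nat \<times> nat \<times> nat \<times> nat \<Rightarrow> nat) \<Rightarrow> nat \<Rightarrow> aut \<Rightarrow> bool" where
  "stored w h t A \<longleftrightarrow> h (0, t, 0, 0) = npos A \<and> (h (1, t, 0, 0) \<noteq> 0) = nullable A \<and> (h (2, t, 0, 0) \<noteq> 0) = nonempty A \<and>
     (\<forall>j<length w. h (3, t, j, 0) = marks A (w ! j)) \<and>
     (\<forall>p<npos A. h (4, t, p, 0) = lab A p) \<and>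
     (\<forall>p<npos A. (h (5, t, p, 0) \<noteq> 0) = is_first A p) \<and>
     (\<forall>p<npos A. (h (6, t, p, 0) \<noteq> 0) = is_last A p) \<and>
     (\<forall>p<npos A. \<forall>j<length w. h (7, t, p, j) = status A p (w ! j)) \<and>
     (\<forall>p<npos A. \<forall>q<npos A. (h (8, t, p, q) \<noteq> 0) = follow A p q)"

definition agree_off :: "nat \<Rightarrow> (nat \<times> nat \<times> nat \<times> nat \<Rightarrow> nat) \<Rightarrow> (nat \<times> nat \<times> nat \<times> nat \<Rightarrow> nat) \<Rightarrow> bool" where
  "agree_off t h h' \<longleftrightarrow> (\<forall>i a b c. \<not> (i \<le> 8 \<and> a = t) \<longrightarrow> h' (i, a, b, c) = h (i, a, b, c))"

lemma offt_obj: "agree_off t h h' \<Longrightarrow> a \<noteq> t \<Longrightarrow> stored w h a A \<Longrightarrow> stored w h' a A"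
  unfolding stored_def agree_off_def by simp

text \<open>\<open>R\<close> is a relation because truth values are fixed only up to being nonzero.
  The entry expression must be right on every heap that differs from the initial one in the part of
  table \<open>tb\<close> being filled, since earlier entries are already in place when it is
  evaluated.\<close>

lemma wp_fill1:
  fixes R :: "nat \<Rightarrow> nat \<Rightarrow> bool"
  assumes "abnd w B e s" "aval w e s = n" "n \<le> B" "regs s rT = t" "t \<le> B" "r \<noteq> rT"
    and "\<And>k h. k < n \<Longrightarrow> (\<And>i a b c. i \<noteq> tb \<or> a \<noteq> t \<Longrightarrow> h (i, a, b, c) = heap s (i, a, b, c)) \<Longrightarrow>
      abnd w B ex (s\<lparr>regs := (regs s)(r := k), heap := h\<rparr>) \<and>
      R k (aval w ex (s\<lparr>regs := (regs s)(r := k), heap := h\<rparr>))"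
    and "\<And>h. (\<And>k. k < n \<Longrightarrow> R k (h (tb, t, k, 0))) \<Longrightarrow>
      (\<And>i a b c. i \<noteq> tb \<or> a \<noteq> t \<Longrightarrow> h (i, a, b, c) = heap s (i, a, b, c)) \<Longrightarrow>
      Q (s\<lparr>heap := h\<rparr>)"
  shows "wp w B (For r e (Put tb (Var rT) (Var r) (Lit 0) ex)) Q s"
proof (rule wp_For[OF assms(1-3), where J = "\<lambda>k s'. \<exists>h x. s' = s\<lparr>regs := (regs s)(r := x), heap := h\<rparr> \<and>
      (\<forall>i<k. R i (h (tb, t, i, 0))) \<and> (\<forall>i a b c. i \<noteq> tb \<or> a \<noteq> t \<longrightarrow> h (i, a, b, c) = heap s (i, a, b, c))"])
  show "\<exists>h x. s = s\<lparr>regs := (regs s)(r := x), heap := h\<rparr> \<and>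
      (\<forall>i<0. R i (h (tb, t, i, 0))) \<and> (\<forall>i a b c. i \<noteq> tb \<or> a \<noteq> t \<longrightarrow> h (i, a, b, c) = heap s (i, a, b, c))"
    by (rule exI[of _ "heap s"], rule exI[of _ "regs s r"]) simp
next
  fix k s' assume k: "k < n" and "\<exists>h x. s' = s\<lparr>regs := (regs s)(r := x), heap := h\<rparr> \<and>
      (\<forall>i<k. R i (h (tb, t, i, 0))) \<and> (\<forall>i a b c. i \<noteq> tb \<or> a \<noteq> t \<longrightarrow> h (i, a, b, c) = heap s (i, a, b, c))"
  then obtain h x where s': "s' = s\<lparr>regs := (regs s)(r := x), heap := h\<rparr>"
    and h: "\<forall>i<k. R i (h (tb, t, i, 0))" "\<And>i a b c. i \<noteq> tb \<or> a \<noteq> t \<Longrightarrow> h (i, a, b, c) = heap s (i, a, b, c)"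
    by blast
  note e = assms(7)[OF k, of h, OF h(2)]
  let ?v = "aval w ex (s\<lparr>regs := (regs s)(r := k), heap := h\<rparr>)"
  let ?h = "h((tb, t, k, 0) := ?v)"
  have eq: "s'\<lparr>regs := (regs s')(r := k)\<rparr> = s\<lparr>regs := (regs s)(r := k), heap := h\<rparr>" by (simp add: s')
  show "wp w B (Put tb (Var rT) (Var r) (Lit 0) ex) (\<lambda>s'. \<exists>h x. s' = s\<lparr>regs := (regs s)(r := x), heap := h\<rparr> \<and>
      (\<forall>i<Suc k. R i (h (tb, t, i, 0))) \<and> (\<forall>i a b c. i \<noteq> tb \<or> a \<noteq> t \<longrightarrow> h (i, a, b, c) = heap s (i, a, b, c))) (setr r k s')"
    unfolding eq
    using e k assms(3-6) h by (auto simp: less_Suc_eq intro!: exI[of _ ?h] exI[of _ k])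
next
  fix s' assume "\<exists>h x. s' = s\<lparr>regs := (regs s)(r := x), heap := h\<rparr> \<and>
      (\<forall>i<n. R i (h (tb, t, i, 0))) \<and> (\<forall>i a b c. i \<noteq> tb \<or> a \<noteq> t \<longrightarrow> h (i, a, b, c) = heap s (i, a, b, c))"
  then obtain h x where s': "s' = s\<lparr>regs := (regs s)(r := x), heap := h\<rparr>"
    and h: "\<forall>i<n. R i (h (tb, t, i, 0))" "\<And>i a b c. i \<noteq> tb \<or> a \<noteq> t \<Longrightarrow> h (i, a, b, c) = heap s (i, a, b, c)"
    by blast
  have "setr r (regs s r) s' = s\<lparr>heap := h\<rparr>" by (simp add: s')
  then show "Q (setr r (regs s r) s')" using assms(8)[of h] h by simp
qed

lemma wp_fill2:
  fixes R :: "nat \<Rightarrow> nat \<Rightarrow> nat \<Rightarrow> bool"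
  assumes "abnd w B e s" "aval w e s = n" "n \<le> B" "regs s rT = t" "t \<le> B" "r \<noteq> rT" "r' \<noteq> rT" "r \<noteq> r'" "m \<le> B"
    and e': "\<And>k h. k < n \<Longrightarrow> (\<And>i a b c. i \<noteq> tb \<or> a \<noteq> t \<Longrightarrow> h (i, a, b, c) = heap s (i, a, b, c)) \<Longrightarrow>
      abnd w B e' (s\<lparr>regs := (regs s)(r := k), heap := h\<rparr>) \<and>
      aval w e' (s\<lparr>regs := (regs s)(r := k), heap := h\<rparr>) = m"
    and ex: "\<And>k j h. k < n \<Longrightarrow> j < m \<Longrightarrow> (\<And>i a b c. i \<noteq> tb \<or> a \<noteq> t \<Longrightarrow> h (i, a, b, c) = heap s (i, a, b, c)) \<Longrightarrow>
      abnd w B ex (s\<lparr>regs := (regs s)(r := k, r' := j), heap := h\<rparr>) \<and>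
      R k j (aval w ex (s\<lparr>regs := (regs s)(r := k, r' := j), heap := h\<rparr>))"
    and Q: "\<And>h. (\<And>k j. k < n \<Longrightarrow> j < m \<Longrightarrow> R k j (h (tb, t, k, j))) \<Longrightarrow>
      (\<And>i a b c. i \<noteq> tb \<or> a \<noteq> t \<Longrightarrow> h (i, a, b, c) = heap s (i, a, b, c)) \<Longrightarrow>
      Q (s\<lparr>heap := h\<rparr>)"
  shows "wp w B (For r e (For r' e' (Put tb (Var rT) (Var r) (Var r') ex))) Q s"
proof -
  define parse_frame where "parse_frame = (\<lambda>h. \<forall>i a b c. i \<noteq> tb \<or> a \<noteq> t \<longrightarrow> h (i, a, b, c) = heap s (i, a, b, c))"
  define J where "J = (\<lambda>k s'. \<exists>h x. s' = s\<lparr>regs := (regs s)(r := x), heap := h\<rparr> \<and>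
      (\<forall>i<k. \<forall>j<m. R i j (h (tb, t, i, j))) \<and> parse_frame h)"
  show ?thesis
  proof (rule wp_For[OF assms(1-3), where J = J])
    show "J 0 s"
      unfolding J_def parse_frame_def by (rule exI[of _ "heap s"], rule exI[of _ "regs s r"]) simp
  next
    fix k s' assume k: "k < n" and "J k s'"
    then obtain h x where s': "s' = s\<lparr>regs := (regs s)(r := x), heap := h\<rparr>"
      and h: "\<forall>i<k. \<forall>j<m. R i j (h (tb, t, i, j))" "parse_frame h"
      unfolding J_def by blast
    define J' where "J' = (\<lambda>l s''. \<exists>h x. s'' = s\<lparr>regs := (regs s)(r := k, r' := x), heap := h\<rparr> \<and>
      (\<forall>i<k. \<forall>j<m. R i j (h (tb, t, i, j))) \<and> (\<forall>j<l. R k j (h (tb, t, k, j))) \<and> parse_frame h)"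
    have eq: "setr r k s' = s\<lparr>regs := (regs s)(r := k), heap := h\<rparr>" by (simp add: s')
    have e'': "abnd w B e' (setr r k s') \<and> aval w e' (setr r k s') = m"
      unfolding eq by (rule e'[OF k]) (use h in \<open>auto simp: parse_frame_def\<close>)
    show "wp w B (For r' e' (Put tb (Var rT) (Var r) (Var r') ex)) (J (Suc k)) (setr r k s')"
    proof (rule wp_For[where J = J', OF conjunct1[OF e''] conjunct2[OF e''] assms(9)])
      show "J' 0 (setr r k s')"
        unfolding J'_def eq using h
        by (intro exI[of _ h] exI[of _ "regs s r'"]) (use \<open>r \<noteq> r'\<close> in \<open>auto intro!: arg_cong[of _ _ "\<lambda>f. s\<lparr>regs := f, heap := h\<rparr>"]\<close>)
    next
      fix l s'' assume l: "l < m" and "J' l s''"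
      then obtain g y where s'': "s'' = s\<lparr>regs := (regs s)(r := k, r' := y), heap := g\<rparr>"
        and g: "\<forall>i<k. \<forall>j<m. R i j (g (tb, t, i, j))" "\<forall>j<l. R k j (g (tb, t, k, j))" "parse_frame g"
        unfolding J'_def by blast
      have eq: "setr r' l s'' = s\<lparr>regs := (regs s)(r := k, r' := l), heap := g\<rparr>" by (simp add: s'')
      have x: "abnd w B ex (s\<lparr>regs := (regs s)(r := k, r' := l), heap := g\<rparr>) \<and>
          R k l (aval w ex (s\<lparr>regs := (regs s)(r := k, r' := l), heap := g\<rparr>))"
        by (rule ex[OF k l]) (use g in \<open>auto simp: parse_frame_def\<close>)
      let ?g = "g((tb, t, k, l) := aval w ex (s\<lparr>regs := (regs s)(r := k, r' := l), heap := g\<rparr>))"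
      have "J' (Suc l) (s\<lparr>regs := (regs s)(r := k, r' := l), heap := ?g\<rparr>)"
        unfolding J'_def
        by (intro exI[of _ ?g] exI[of _ l]) (use g x in \<open>auto simp: less_Suc_eq parse_frame_def\<close>)
      then show "wp w B (Put tb (Var rT) (Var r) (Var r') ex) (J' (Suc l)) (setr r' l s'')"
        unfolding eq using x k l assms(3-9) by (auto simp: fun_upd_twist)
    next
      fix s'' assume "J' m s''"
      then obtain g y where s'': "s'' = s\<lparr>regs := (regs s)(r := k, r' := y), heap := g\<rparr>"
        and g: "\<forall>i<k. \<forall>j<m. R i j (g (tb, t, i, j))" "\<forall>j<m. R k j (g (tb, t, k, j))" "parse_frame g"
        unfolding J'_def by blast
      have "setr r' (regs (setr r k s') r') s'' = s\<lparr>regs := (regs s)(r := k), heap := g\<rparr>"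
      proof -
        have "(regs s)(r := k, r' := regs s r') = (regs s)(r := k)"
          using \<open>r \<noteq> r'\<close> by auto
        then show ?thesis using \<open>r \<noteq> r'\<close> by (simp add: s'' s')
      qed
      then show "J (Suc k) (setr r' (regs (setr r k s') r') s'')"
        unfolding J_def using g by (auto simp: less_Suc_eq intro!: exI[of _ g] exI[of _ k])
    qed
  next
    fix s' assume "J n s'"
    then obtain h x where s': "s' = s\<lparr>regs := (regs s)(r := x), heap := h\<rparr>"
      and h: "\<forall>i<n. \<forall>j<m. R i j (h (tb, t, i, j))" "parse_frame h"
      unfolding J_def by blast
    have "setr r (regs s r) s' = s\<lparr>heap := h\<rparr>" by (simp add: s')
    then show "Q (setr r (regs s r) s')" using Q[of h] h by (simp add: parse_frame_def)
  qed
qed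

text \<open>The number of positions is written early because the later loops read their range from
  the new slot itself. Only the slot \<open>rT\<close> is written, so operands in other slots stay
  readable throughout.\<close>

definition build :: "aexp \<Rightarrow> aexp \<Rightarrow> aexp \<Rightarrow> aexp \<Rightarrow> aexp \<Rightarrow> aexp \<Rightarrow> aexp \<Rightarrow> aexp \<Rightarrow> aexp \<Rightarrow> com" where
  "build eN eNu eNe eT eL eFi eLa eS eF =
    Seq (Put 0 (Var rT) (Lit 0) (Lit 0) eN)
    (Seq (Put 1 (Var rT) (Lit 0) (Lit 0) eNu)
    (Seq (Put 2 (Var rT) (Lit 0) (Lit 0) eNe)
    (Seq (For rQ Len (Put 3 (Var rT) (Var rQ) (Lit 0) eT))
    (Seq (For rP (Rd 0 (Var rT) (Lit 0) (Lit 0)) (Put 4 (Var rT) (Var rP) (Lit 0) eL))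
    (Seq (For rP (Rd 0 (Var rT) (Lit 0) (Lit 0)) (Put 5 (Var rT) (Var rP) (Lit 0) eFi))
    (Seq (For rP (Rd 0 (Var rT) (Lit 0) (Lit 0)) (Put 6 (Var rT) (Var rP) (Lit 0) eLa))
    (Seq (For rP (Rd 0 (Var rT) (Lit 0) (Lit 0)) (For rQ Len (Put 7 (Var rT) (Var rP) (Var rQ) eS)))
         (For rP (Rd 0 (Var rT) (Lit 0) (Lit 0)) (For rQ (Rd 0 (Var rT) (Lit 0) (Lit 0))
           (Put 8 (Var rT) (Var rP) (Var rQ) eF))))))))))"

definition build_frame :: "nat \<Rightarrow> store \<Rightarrow> store \<Rightarrow> bool" where
  "build_frame t s s' \<longleftrightarrow> (\<forall>r. r \<noteq> rP \<and> r \<noteq> rQ \<longrightarrow> regs s' r = regs s r) \<and> agree_off t (heap s) (heap s')"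

lemma wp_build:
  assumes t: "regs s rT = t" "t \<le> B" "length w \<le> B" "npos A \<le> B"
    and v1: "\<And>s'. build_frame t s s' \<Longrightarrow> abnd w B eN s' \<and> aval w eN s' = npos A"
      "\<And>s'. build_frame t s s' \<Longrightarrow> abnd w B eNu s' \<and> (aval w eNu s' \<noteq> 0) = nullable A"
      "\<And>s'. build_frame t s s' \<Longrightarrow> abnd w B eNe s' \<and> (aval w eNe s' \<noteq> 0) = nonempty A"
    and vT: "\<And>s' j. build_frame t s s' \<Longrightarrow> regs s' rQ = j \<Longrightarrow> j < length w \<Longrightarrow> abnd w B eT s' \<and> aval w eT s' = marks A (w ! j)"
    and vP: "\<And>s' p. build_frame t s s' \<Longrightarrow> regs s' rP = p \<Longrightarrow> p < npos A \<Longrightarrow> abnd w B eL s' \<and> aval w eL s' = lab A p"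
      "\<And>s' p. build_frame t s s' \<Longrightarrow> regs s' rP = p \<Longrightarrow> p < npos A \<Longrightarrow> abnd w B eFi s' \<and> (aval w eFi s' \<noteq> 0) = is_first A p"
      "\<And>s' p. build_frame t s s' \<Longrightarrow> regs s' rP = p \<Longrightarrow> p < npos A \<Longrightarrow> abnd w B eLa s' \<and> (aval w eLa s' \<noteq> 0) = is_last A p"
    and vS: "\<And>s' p j. build_frame t s s' \<Longrightarrow> regs s' rP = p \<Longrightarrow> p < npos A \<Longrightarrow> regs s' rQ = j \<Longrightarrow> j < length w \<Longrightarrow>
       abnd w B eS s' \<and> aval w eS s' = status A p (w ! j)"
    and vF: "\<And>s' p q. build_frame t s s' \<Longrightarrow> regs s' rP = p \<Longrightarrow> p < npos A \<Longrightarrow> regs s' rQ = q \<Longrightarrow> q < npos A \<Longrightarrow>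
       abnd w B eF s' \<and> (aval w eF s' \<noteq> 0) = follow A p q"
    and Q: "\<And>h. agree_off t (heap s) h \<Longrightarrow> stored w h t A \<Longrightarrow> Q (s\<lparr>heap := h\<rparr>)"
  shows "wp w B (build eN eNu eNe eT eL eFi eLa eS eF) Q s"
proof -
  have S: "build_frame t s (s\<lparr>regs := (regs s)(rP := x, rQ := y), heap := h\<rparr>)"
      "build_frame t s (s\<lparr>regs := (regs s)(rP := x), heap := h\<rparr>)"
      "build_frame t s (s\<lparr>regs := (regs s)(rQ := y), heap := h\<rparr>)" "build_frame t s (s\<lparr>heap := h\<rparr>)"
    if "agree_off t (heap s) h" for x y h
    using that by (auto simp: build_frame_def)
  have O: "agree_off t (heap s) g" if "agree_off t (heap s) h" "\<And>i a b c. i \<noteq> tb \<or> a \<noteq> t \<Longrightarrow> g (i, a, b, c) = h (i, a, b, c)" "tb \<le> 8" for h g tb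
    using that by (auto simp: agree_off_def)
  have O0: "agree_off t (heap s) (heap s)" by (simp add: agree_off_def)
  have U: "agree_off t (heap s) (h((tb, t, b, c) := v))" if "agree_off t (heap s) h" "tb \<le> 8" for h tb b c v
    using that by (auto simp: agree_off_def)
  define h0 where "h0 = (heap s)((0, t, 0, 0) := npos A)"
  define h1 where "h1 = h0((1, t, 0, 0) := aval w eNu (s\<lparr>heap := h0\<rparr>))"
  define h2 where "h2 = h1((2, t, 0, 0) := aval w eNe (s\<lparr>heap := h1\<rparr>))"
  have o0: "agree_off t (heap s) h0" unfolding h0_def by (rule U[OF O0]) simp
  have o1: "agree_off t (heap s) h1" unfolding h1_def by (rule U[OF o0]) simp
  have o2: "agree_off t (heap s) h2" unfolding h2_def by (rule U[OF o1]) simp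
  have f2: "h2 (0, t, 0, 0) = npos A" "(h2 (1, t, 0, 0) \<noteq> 0) = nullable A" "(h2 (2, t, 0, 0) \<noteq> 0) = nonempty A"
    using v1(2)[OF S(4)[OF o0]] v1(3)[OF S(4)[OF o1]] by (auto simp: h2_def h1_def h0_def)
  have sself: "build_frame t s s" by (simp add: build_frame_def O0)
  have main: "wp w B
    (Seq (For rQ Len (Put 3 (Var rT) (Var rQ) (Lit 0) eT))
    (Seq (For rP (Rd 0 (Var rT) (Lit 0) (Lit 0)) (Put 4 (Var rT) (Var rP) (Lit 0) eL))
    (Seq (For rP (Rd 0 (Var rT) (Lit 0) (Lit 0)) (Put 5 (Var rT) (Var rP) (Lit 0) eFi))
    (Seq (For rP (Rd 0 (Var rT) (Lit 0) (Lit 0)) (Put 6 (Var rT) (Var rP) (Lit 0) eLa))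
    (Seq (For rP (Rd 0 (Var rT) (Lit 0) (Lit 0)) (For rQ Len (Put 7 (Var rT) (Var rP) (Var rQ) eS)))
         (For rP (Rd 0 (Var rT) (Lit 0) (Lit 0)) (For rQ (Rd 0 (Var rT) (Lit 0) (Lit 0))
           (Put 8 (Var rT) (Var rP) (Var rQ) eF)))))))) Q (s\<lparr>heap := h2\<rparr>)"
    unfolding wp_simps(4)
  proof (rule wp_fill1[where t = t and R = "\<lambda>j v. v = marks A (w ! j)" and n = "length w"], goal_cases)
    case (7 k h)
    then have "agree_off t (heap s) h" by (intro O[OF o2, of 3]) auto
    then show ?case using vT[OF S(3), of h k k] 7 by simp
  next
    case (8 h3)
    have o3: "agree_off t (heap s) h3" using 8 by (intro O[OF o2, of 3]) auto
    have f3: "h3 (i, a, b, c) = h2 (i, a, b, c)" if "i \<noteq> 3" for i a b c using 8(2)[of i a b c] that by simp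
    show ?case
    proof (rule wp_fill1[where t = t and R = "\<lambda>p v. v = lab A p" and n = "npos A"], goal_cases)
      case (7 k h)
      then have "agree_off t (heap s) h" by (intro O[OF o3, of 4]) auto
      then show ?case using vP(1)[OF S(2), of h k k] 7 by simp
    next
      case (8 h4)
      have o4: "agree_off t (heap s) h4" using 8 by (intro O[OF o3, of 4]) auto
      have f4: "h4 (i, a, b, c) = h3 (i, a, b, c)" if "i \<noteq> 4" for i a b c using 8(2)[of i a b c] that by simp
      note g4 = 8(1)
      show ?case
      proof (rule wp_fill1[where t = t and R = "\<lambda>p v. (v \<noteq> 0) = is_first A p" and n = "npos A"], goal_cases)
        case (7 k h)
        then have "agree_off t (heap s) h" by (intro O[OF o4, of 5]) auto
        then show ?case using vP(2)[OF S(2), of h k k] 7 by simp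
      next
        case (8 h5)
        have o5: "agree_off t (heap s) h5" using 8 by (intro O[OF o4, of 5]) auto
        have f5: "h5 (i, a, b, c) = h4 (i, a, b, c)" if "i \<noteq> 5" for i a b c using 8(2)[of i a b c] that by simp
        note g5 = 8(1)
        show ?case
        proof (rule wp_fill1[where t = t and R = "\<lambda>p v. (v \<noteq> 0) = is_last A p" and n = "npos A"], goal_cases)
          case (7 k h)
          then have "agree_off t (heap s) h" by (intro O[OF o5, of 6]) auto
          then show ?case using vP(3)[OF S(2), of h k k] 7 by simp
        next
          case (8 h6)
          have o6: "agree_off t (heap s) h6" using 8 by (intro O[OF o5, of 6]) auto
          have f6: "h6 (i, a, b, c) = h5 (i, a, b, c)" if "i \<noteq> 6" for i a b c using 8(2)[of i a b c] that by simp
          note g6 = 8(1)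
          show ?case
          proof (rule wp_fill2[where t = t and R = "\<lambda>p j v. v = status A p (w ! j)" and n = "npos A" and m = "length w"], goal_cases)
            case (11 k j h)
            then have "agree_off t (heap s) h" by (intro O[OF o6, of 7]) auto
            then show ?case using vS[OF S(1), of h k j k j] 11 by simp
          next
            case (12 h7)
            have o7: "agree_off t (heap s) h7" using 12 by (intro O[OF o6, of 7]) auto
            have f7: "h7 (i, a, b, c) = h6 (i, a, b, c)" if "i \<noteq> 7" for i a b c using 12(2)[of i a b c] that by simp
            note g7 = 12(1)
            show ?case
            proof (rule wp_fill2[where t = t and R = "\<lambda>p j v. (v \<noteq> 0) = follow A p j" and n = "npos A" and m = "npos A"], goal_cases)
              case (11 k j h)
              then have "agree_off t (heap s) h" by (intro O[OF o7, of 8]) auto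
              then show ?case using vF[OF S(1), of h k j k j] 11 by simp
            next
              case (12 h8)
              have o8: "agree_off t (heap s) h8" using 12 by (intro O[OF o7, of 8]) auto
              have f8: "h8 (i, a, b, c) = h7 (i, a, b, c)" if "i \<noteq> 8" for i a b c using 12(2)[of i a b c] that by simp
              have "stored w h8 t A"
                unfolding stored_def
                using f2 \<open>\<And>k. k < length w \<Longrightarrow> h3 (3, t, k, 0) = marks A (w ! k)\<close> g4 g5 g6 g7 12(1)
                by (simp add: f8 f7 f6 f5 f4 f3)
              then show ?case using Q[OF o8] by simp
            qed (use t f2 in \<open>simp_all add: f7 f6 f5 f4 f3\<close>)
          qed (use t f2 in \<open>simp_all add: f6 f5 f4 f3\<close>)
        qed (use t f2 in \<open>simp_all add: f5 f4 f3\<close>)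
      qed (use t f2 in \<open>simp_all add: f4 f3\<close>)
    qed (use t f2 in \<open>simp_all add: f3\<close>)
  qed (use t in simp_all)
  show ?thesis
    unfolding build_def
    using main v1(1)[OF sself] v1(2)[OF S(4)[OF o0]] v1(3)[OF S(4)[OF o1]] t
    by (simp add: h2_def h1_def h0_def)
qed

lemma nz_iff: "((x::nat) \<noteq> 0) = b \<longleftrightarrow> (x = 0) = (\<not> b)"
  by auto

lemma storedD:
  assumes "stored w h t A"
  shows "h (0, t, 0, 0) = npos A" "h (Suc 0, t, 0, 0) = 0 \<longleftrightarrow> \<not> nullable A" "0 < h (Suc 0, t, 0, 0) \<longleftrightarrow> nullable A"
    "h (2, t, 0, 0) = 0 \<longleftrightarrow> \<not> nonempty A" "0 < h (2, t, 0, 0) \<longleftrightarrow> nonempty A"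
    "j < length w \<Longrightarrow> h (3, t, j, 0) = marks A (w ! j)"
    "p < npos A \<Longrightarrow> h (4, t, p, 0) = lab A p"
    "p < npos A \<Longrightarrow> h (5, t, p, 0) = 0 \<longleftrightarrow> \<not> is_first A p" "p < npos A \<Longrightarrow> 0 < h (5, t, p, 0) \<longleftrightarrow> is_first A p"
    "p < npos A \<Longrightarrow> h (6, t, p, 0) = 0 \<longleftrightarrow> \<not> is_last A p" "p < npos A \<Longrightarrow> 0 < h (6, t, p, 0) \<longleftrightarrow> is_last A p"
    "p < npos A \<Longrightarrow> j < length w \<Longrightarrow> h (7, t, p, j) = status A p (w ! j)"
    "p < npos A \<Longrightarrow> q < npos A \<Longrightarrow> h (8, t, p, q) = 0 \<longleftrightarrow> \<not> follow A p q"
    "p < npos A \<Longrightarrow> q < npos A \<Longrightarrow> 0 < h (8, t, p, q) \<longleftrightarrow> follow A p q"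
  using assms unfolding stored_def nz_iff by (simp_all del: neq0_conv add: neq0_conv[symmetric])

lemma simD:
  assumes "build_frame t s s'"
  shows "regs s' rT = regs s rT" "regs s' rA = regs s rA" "regs s' rB = regs s rB" "regs s' rTag = regs s rTag"
    "a \<noteq> t \<Longrightarrow> stored w (heap s) a A \<Longrightarrow> stored w (heap s') a A"
  using assms offt_obj unfolding build_frame_def by auto

section \<open>Programs for the operators on automata\<close>

abbreviation "rdA i p q \<equiv> Rd i (Var rA) p q"
abbreviation "rdB i p q \<equiv> Rd i (Var rB) p q"
abbreviation "vP \<equiv> Var rP"
abbreviation "vQ \<equiv> Var rQ"
abbreviation "L0 \<equiv> Lit 0"
abbreviation "nA \<equiv> Rd 0 (Var rA) L0 L0"
abbreviation "nB \<equiv> Rd 0 (Var rB) L0 L0"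
abbreviation "arg1 \<equiv> Inp (Plus (Var rT) (Lit 1))"

text \<open>The tags 0, 1 and 2 of empty set, empty word and letter make the tag itself the value of
  \<open>nonempty\<close>. The cell behind the tag is read only for existing positions, hence only
  for a letter, when it is an argument.\<close>

definition b_prim :: com where
  "b_prim = build (eEq (Var rTag) (Lit 2)) (eEq (Var rTag) (Lit 1)) (Var rTag) L0 (Plus arg1 (Lit 1)) (Lit 1) (Lit 1) L0 L0"

lemma wp_b_prim:
  assumes "regs s rT = t" "regs s rTag = g" "t < length w" "length w \<le> B" "1 \<le> B" "g = 2 \<longrightarrow> t + 1 < length w"
    and "\<And>h. agree_off t (heap s) h \<Longrightarrow>
      stored w h t (aut_prim (of_bool (g = 2)) (if g = 2 then Suc (w ! (t + 1)) else 0) (g = 1) (g \<noteq> 0)) \<Longrightarrow> Q (s\<lparr>heap := h\<rparr>)"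
  shows "wp w B b_prim Q s"
  unfolding b_prim_def
proof (rule wp_build[where A = "aut_prim (of_bool (g = 2)) (if g = 2 then Suc (w ! (t + 1)) else 0) (g = 1) (g \<noteq> 0)" and t = t],
    goal_cases)
  case (14 h)
  then show ?case by (rule assms(7))
qed (use assms(1-6) in \<open>simp_all add: aut_prim_def simD split: if_splits\<close>, auto simp: of_bool_def split: if_splits)

text \<open>Both operands of a binary connective are stored side by side; positions of the second one are
  shifted by the size of the first one.\<close>

abbreviation "sel i r q \<equiv> Ite (eLt (Var r) nA) (rdA i (Var r) q) (rdB i (Minus (Var r) nA) q)"

definition b_or :: com where
  "b_or = build (Plus nA nB) (eOr (rdA 1 L0 L0) (rdB 1 L0 L0)) (eOr (rdA 2 L0 L0) (rdB 2 L0 L0))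
     (Ite (rdA 2 L0 L0) (rdA 3 vQ L0) (rdB 3 vQ L0))
     (sel 4 rP L0) (sel 5 rP L0) (sel 6 rP L0) (sel 7 rP vQ)
     (Ite (eLt vP nA) (eAnd (eLt vQ nA) (rdA 8 vP vQ))
       (eAnd (eNot (eLt vQ nA)) (rdB 8 (Minus vP nA) (Minus vQ nA))))"

lemma wp_b_or:
  assumes "regs s rT = t" "regs s rA = a" "regs s rB = b" "stored w (heap s) a A1" "stored w (heap s) b A2"
    "a < t" "b < t" "t < length w" "length w \<le> B" "npos (aut_or A1 A2) \<le> B"
    and "\<And>h. agree_off t (heap s) h \<Longrightarrow> stored w h t (aut_or A1 A2) \<Longrightarrow> Q (s\<lparr>heap := h\<rparr>)"
  shows "wp w B b_or Q s"
proof -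
  have 1: "regs s' rT = t" "regs s' rA = a" "regs s' rB = b" "stored w (heap s') a A1" "stored w (heap s') b A2" if "build_frame t s s'" for s'
    using simD[OF that] assms by auto
  note o = storedD[OF 1(4)] storedD[OF 1(5)]
  have le: "npos A1 + npos A2 \<le> B" using assms by (simp add: aut_or_def Let_def)
  show ?thesis
    unfolding b_or_def
  proof (rule wp_build[where A = "aut_or A1 A2" and t = t], goal_cases)
    case (14 h)
    then show ?case by (rule assms(11))
  qed (use assms(6-10) le in \<open>simp_all add: 1 o aut_or_def Let_def assms(1)\<close>, auto simp: 1 o)
qed

definition b_conc :: com where
  "b_conc = build (Plus nA nB) (eAnd (rdA 1 L0 L0) (rdB 1 L0 L0)) (eAnd (rdA 2 L0 L0) (rdB 2 L0 L0))
     (Plus (rdA 3 vQ L0) (rdB 3 vQ L0))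
     (sel 4 rP L0)
     (Ite (eLt vP nA) (rdA 5 vP L0) (eAnd (rdA 1 L0 L0) (rdB 5 (Minus vP nA) L0)))
     (Ite (eLt vP nA) (eAnd (rdB 1 L0 L0) (rdA 6 vP L0)) (rdB 6 (Minus vP nA) L0))
     (Ite (eLt vP nA) (rdA 7 vP vQ) (Plus (rdB 7 (Minus vP nA) vQ) (rdA 3 vQ L0)))
     (Ite (eLt vP nA)
       (Ite (eLt vQ nA) (rdA 8 vP vQ) (eAnd (rdA 6 vP L0) (rdB 5 (Minus vQ nA) L0)))
       (eAnd (eNot (eLt vQ nA)) (rdB 8 (Minus vP nA) (Minus vQ nA))))"

lemma wp_b_conc:
  assumes "regs s rT = t" "regs s rA = a" "regs s rB = b" "stored w (heap s) a A1" "stored w (heap s) b A2"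
    "a < t" "b < t" "t < length w" "length w \<le> B" "npos (aut_conc A1 A2) \<le> B"
    and "\<And>h. agree_off t (heap s) h \<Longrightarrow> stored w h t (aut_conc A1 A2) \<Longrightarrow> Q (s\<lparr>heap := h\<rparr>)"
  shows "wp w B b_conc Q s"
proof -
  have 1: "regs s' rT = t" "regs s' rA = a" "regs s' rB = b" "stored w (heap s') a A1" "stored w (heap s') b A2" if "build_frame t s s'" for s'
    using simD[OF that] assms by auto
  note o = storedD[OF 1(4)] storedD[OF 1(5)]
  have le: "npos A1 + npos A2 \<le> B" using assms by (simp add: aut_conc_def Let_def)
  show ?thesis
    unfolding b_conc_def
  proof (rule wp_build[where A = "aut_conc A1 A2" and t = t], goal_cases)
    case (14 h)
    then show ?case by (rule assms(11))
  qed (use assms(6-10) le in \<open>simp_all add: 1 o aut_conc_def Let_def assms(1)\<close>, auto simp: 1 o)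
qed

definition b_star :: com where
  "b_star = build nA (Lit 1) (Lit 1) L0 (rdA 4 vP L0) (rdA 5 vP L0) (rdA 6 vP L0) (rdA 7 vP vQ)
     (eOr (rdA 8 vP vQ) (eAnd (rdA 6 vP L0) (rdA 5 vQ L0)))"

lemma wp_b_star:
  assumes "regs s rT = t" "regs s rA = a" "stored w (heap s) a A1"
    "a < t" "t < length w" "length w \<le> B" "npos A1 \<le> B"
    and "\<And>h. agree_off t (heap s) h \<Longrightarrow> stored w h t (aut_star A1) \<Longrightarrow> Q (s\<lparr>heap := h\<rparr>)"
  shows "wp w B b_star Q s"
proof -
  have 1: "regs s' rT = t" "regs s' rA = a" "stored w (heap s') a A1" if "build_frame t s s'" for s'
    using simD[OF that] assms by auto
  note o = storedD[OF 1(3)]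
  show ?thesis
    unfolding b_star_def
  proof (rule wp_build[where A = "aut_star A1" and t = t], goal_cases)
    case (14 h)
    then show ?case by (rule assms(8))
  qed (use assms(4-7) in \<open>simp_all add: 1 o aut_star_def assms(1)\<close>)
qed

definition b_bind :: com where
  "b_bind = build nA (rdA 1 L0 L0) (rdA 2 L0 L0)
     (Plus (rdA 3 vQ L0) (Ite (eEq (Inp vQ) arg1) (Lit 2) (Lit 0)))
     (rdA 4 vP L0) (rdA 5 vP L0) (rdA 6 vP L0)
     (Plus (rdA 7 vP vQ) (Ite (eEq (Inp vQ) arg1) (Lit 1) (Lit 0)))
     (rdA 8 vP vQ)"

lemma wp_b_bind:
  assumes "regs s rT = t" "regs s rA = a" "stored w (heap s) a A1"
    "a < t" "t + 1 < length w" "length w \<le> B" "npos A1 \<le> B"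
    and "\<And>h. agree_off t (heap s) h \<Longrightarrow> stored w h t (aut_bind (w ! (t + 1)) A1) \<Longrightarrow> Q (s\<lparr>heap := h\<rparr>)"
  shows "wp w B b_bind Q s"
proof -
  have 1: "regs s' rT = t" "regs s' rA = a" "stored w (heap s') a A1" if "build_frame t s s'" for s'
    using simD[OF that] assms by auto
  note o = storedD[OF 1(3)]
  show ?thesis
    unfolding b_bind_def
  proof (rule wp_build[where A = "aut_bind (w ! (t + 1)) A1" and t = t], goal_cases)
    case (14 h)
    then show ?case by (rule assms(8))
  qed (use assms(4-7) in \<open>simp_all add: 1 o aut_bind_def assms(1)\<close>)
qed

definition b_mask :: "aexp \<Rightarrow> com" where
  "b_mask K = build nA (rdA 1 L0 L0) (rdA 2 L0 L0)
     (Ite K (rdA 3 vQ L0) L0)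
     (rdA 4 vP L0) (rdA 5 vP L0) (rdA 6 vP L0)
     (Ite K (rdA 7 vP vQ) (Lit 3))
     (rdA 8 vP vQ)"

lemma wp_b_mask:
  assumes "regs s rT = t" "regs s rA = a" "stored w (heap s) a A1"
    "a < t" "t < length w" "length w \<le> B" "npos A1 \<le> B"
    and K: "\<And>s' j. build_frame t s s' \<Longrightarrow> regs s' rQ = j \<Longrightarrow> j < length w \<Longrightarrow> abnd w B e s' \<and> (aval w e s' \<noteq> 0) = K (w ! j)"
    and "\<And>h. agree_off t (heap s) h \<Longrightarrow> stored w h t (aut_mask K A1) \<Longrightarrow> Q (s\<lparr>heap := h\<rparr>)"
  shows "wp w B (b_mask e) Q s"
proof -
  have 1: "regs s' rT = t" "regs s' rA = a" "stored w (heap s') a A1" if "build_frame t s s'" for s'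
    using simD[OF that] assms by auto
  have K1: "abnd w B e s'" "aval w e s' = 0 \<longleftrightarrow> \<not> K (w ! regs s' rQ)" "0 < aval w e s' \<longleftrightarrow> K (w ! regs s' rQ)"
    if "build_frame t s s'" "regs s' rQ < length w" for s'
    using K[OF that(1) refl that(2)] by auto
  note o = storedD[OF 1(3)]
  show ?thesis
    unfolding b_mask_def
  proof (rule wp_build[where A = "aut_mask K A1" and t = t], goal_cases)
    case (14 h)
    then show ?case by (rule assms(9))
  qed (use assms(4-7) in \<open>simp_all add: 1 o aut_mask_def assms(1) K1\<close>)
qed

text \<open>There is no division: the quotient is the number of positive multiples of the divisor up
  to the dividend. The summation variable \<open>rK\<close> differs from \<open>rP\<close> and
  \<open>rQ\<close>, whose values are divided.\<close>

definition eDiv :: "nat \<Rightarrow> aexp" where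
  "eDiv r = Sum rK (Var r) (eLe (Times (Plus (Var rK) (Lit 1)) nB) (Var r))"

definition eMod :: "nat \<Rightarrow> aexp" where
  "eMod r = Minus (Var r) (Times (eDiv r) nB)"

lemma sum_div: "0 < n \<Longrightarrow> (\<Sum>k<p. of_bool (Suc k * n \<le> p)) = p div (n::nat)"
proof -
  assume n: "0 < n"
  have "{k. k < p \<and> Suc k * n \<le> p} = {..<p div n}"
  proof (intro set_eqI iffI)
    fix k assume "k \<in> {k. k < p \<and> Suc k * n \<le> p}"
    then have "Suc k \<le> p div n" using n by (metis (lifting) mem_Collect_eq less_eq_div_iff_mult_less_eq)
    then show "k \<in> {..<p div n}" by simp
  next
    fix k assume "k \<in> {..<p div n}"
    then have "Suc k \<le> p div n" by simp
    then have "Suc k * n \<le> p" using n by (metis less_eq_div_iff_mult_less_eq)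
    moreover have "k < p" using \<open>Suc k \<le> p div n\<close> div_le_dividend[of p n] by linarith
    ultimately show "k \<in> {k. k < p \<and> Suc k * n \<le> p}" by simp
  qed
  moreover have "(\<Sum>k<p. of_bool (Suc k * n \<le> p)) = card {k. k < p \<and> Suc k * n \<le> p}"
  proof -
    have "(\<Sum>k<p. of_bool (Suc k * n \<le> p)) = (\<Sum>k\<in>{k. k < p \<and> Suc k * n \<le> p}. 1::nat)"
      by (rule sum.mono_neutral_cong_right) auto
    then show ?thesis by simp
  qed
  ultimately show ?thesis by simp
qed

lemma aval_div:
  assumes "r \<noteq> rK" "0 < heap s (0, regs s rB, 0, 0)"
  shows "aval w (eDiv r) s = regs s r div heap s (0, regs s rB, 0, 0)"
    "aval w (eMod r) s = regs s r mod heap s (0, regs s rB, 0, 0)"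
proof -
  show 1: "aval w (eDiv r) s = regs s r div heap s (0, regs s rB, 0, 0)"
    using assms sum_div[OF assms(2), of "regs s r"] by (simp add: eDiv_def)
  show "aval w (eMod r) s = regs s r mod heap s (0, regs s rB, 0, 0)"
    using 1 by (simp add: eMod_def minus_div_mult_eq_mod)
qed

lemma abnd_div:
  assumes "r \<noteq> rK" "0 < heap s (0, regs s rB, 0, 0)" "regs s r \<le> B" "regs s rB \<le> B"
  shows "abnd w B (eDiv r) s" "abnd w B (eMod r) s"
proof -
  show 1: "abnd w B (eDiv r) s"
    using assms by (auto simp: eDiv_def)
  show "abnd w B (eMod r) s"
    using 1 aval_div(1)[OF assms(1,2), of w] assms(3,4)
      order_trans[OF div_le_dividend[of "regs s r" "heap s (0, regs s rB, 0, 0)"] assms(3)]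
    by (simp add: eMod_def)
qed

text \<open>\<open>rQ\<close> is free while labels are filled, so there it serves as the variable of
  the quantifier over all input positions, which makes \<open>U\<close> the set of all numbers of
  the input. The inner sum counts violations.\<close>

definition b_join :: com where
  "b_join = build (Times nA nB) (eAnd (rdA 1 L0 L0) (rdB 1 L0 L0)) (eAnd (rdA 2 L0 L0) (rdB 2 L0 L0))
     (Plus (rdA 3 vQ L0) (rdB 3 vQ L0))
     (Ite (eAnd (eEq (rdA 4 (eDiv rP) L0) (rdB 4 (eMod rP) L0))
          (eNot (Sum rQ Len (eNot (eOr (eEq (rdA 7 (eDiv rP) vQ) (Lit 3)) (eOr (eEq (rdB 7 (eMod rP) vQ) (Lit 3))
             (eEq (rdA 7 (eDiv rP) vQ) (rdB 7 (eMod rP) vQ))))))))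
        (rdA 4 (eDiv rP) L0) L0)
     (eAnd (rdA 5 (eDiv rP) L0) (rdB 5 (eMod rP) L0))
     (eAnd (rdA 6 (eDiv rP) L0) (rdB 6 (eMod rP) L0))
     (Ite (eEq (rdA 7 (eDiv rP) vQ) (Lit 3)) (rdB 7 (eMod rP) vQ) (rdA 7 (eDiv rP) vQ))
     (eAnd (rdA 8 (eDiv rP) (eDiv rQ)) (rdB 8 (eMod rP) (eMod rQ)))"

lemma wp_b_join:
  assumes "regs s rT = t" "regs s rA = a" "regs s rB = b" "stored w (heap s) a A1" "stored w (heap s) b A2"
    "a < t" "b < t" "t < length w" "length w \<le> B" "npos A1 \<le> B" "npos (aut_join (set w) A1 A2) \<le> B"
    and "\<And>h. agree_off t (heap s) h \<Longrightarrow> stored w h t (aut_join (set w) A1 A2) \<Longrightarrow> Q (s\<lparr>heap := h\<rparr>)"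
  shows "wp w B b_join Q s"
proof -
  have 1: "regs s' rT = t" "regs s' rA = a" "regs s' rB = b" "stored w (heap s') a A1" "stored w (heap s') b A2" if "build_frame t s s'" for s'
    using simD[OF that] assms by auto
  note o = storedD[OF 1(4)] storedD[OF 1(5)]
  let ?N = "npos A1 * npos A2"
  have le: "?N \<le> B" using assms by (simp add: aut_join_def Let_def)
  have simQ: "build_frame t s (setr rQ k s')" if "build_frame t s s'" for s' k
    using that by (simp add: build_frame_def)
  have d: "regs s' r div npos A2 < npos A1" "regs s' r mod npos A2 < npos A2" "0 < npos A2"
      "aval w (eDiv r) s' = regs s' r div npos A2" "aval w (eMod r) s' = regs s' r mod npos A2"
      "abnd w B (eDiv r) s'" "abnd w B (eMod r) s'"
      "regs s' r div npos A2 \<le> B" "regs s' r mod npos A2 \<le> B"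
    if "build_frame t s s'" "regs s' r < ?N" "r = rP \<or> r = rQ" for s' r
  proof -
    \<comment> \<open>A product position exists, so the second factor has positions and dividing by
      their number is meaningful.\<close>
    show pos: "0 < npos A2" using that by (auto intro: gr0I)
    show "regs s' r div npos A2 < npos A1" using that by (simp add: less_mult_imp_div_less)
    show "regs s' r mod npos A2 < npos A2" using pos by simp
    have h: "heap s' (0, regs s' rB, 0, 0) = npos A2" using o[OF that(1)] 1[OF that(1)] by simp
    show "aval w (eDiv r) s' = regs s' r div npos A2" "aval w (eMod r) s' = regs s' r mod npos A2"
      using aval_div[of r s' w] h pos that by auto
    show "abnd w B (eDiv r) s'" "abnd w B (eMod r) s'"
      using abnd_div[of r s' B w] h pos that le 1[OF that(1)] assms by auto
    show "regs s' r div npos A2 \<le> B" "regs s' r mod npos A2 \<le> B"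
      using that le div_le_dividend[of "regs s' r" "npos A2"] mod_less_eq_dividend[of "regs s' r" "npos A2"] by linarith+
  qed
  note dP = d[of _ rP, simplified] and dQ = d[of _ rQ, simplified]
  have U: "(\<forall>x\<in>set w. compat (f x) (g x)) \<longleftrightarrow> (\<forall>k<length w. f (w ! k) = 3 \<or> g (w ! k) = 3 \<or> f (w ! k) = g (w ! k))" for f g
    by (auto simp: compat_def set_conv_nth)
  have A: "abnd w B (rdA i (eDiv rP) e) x" "abnd w B (rdB i (eMod rP) e) x"
      "aval w (rdA i (eDiv rP) e) x = heap x (i, a, p div npos A2, aval w e x)"
      "aval w (rdB i (eMod rP) e) x = heap x (i, b, p mod npos A2, aval w e x)"
    if "build_frame t s x" "regs x rP = p" "p < ?N" "abnd w B e x" "aval w e x \<le> B" for x p i e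
    using dP[OF that(1)] 1[OF that(1)] that(2-5) assms(6-9) by simp_all
  have Q3: "abnd w B (eAnd (eEq (rdA 4 (eDiv rP) L0) (rdB 4 (eMod rP) L0))
          (eNot (Sum rQ Len (eNot (eOr (eEq (rdA 7 (eDiv rP) vQ) (Lit 3)) (eOr (eEq (rdB 7 (eMod rP) vQ) (Lit 3))
             (eEq (rdA 7 (eDiv rP) vQ) (rdB 7 (eMod rP) vQ)))))))) x"
      "aval w (eAnd (eEq (rdA 4 (eDiv rP) L0) (rdB 4 (eMod rP) L0))
          (eNot (Sum rQ Len (eNot (eOr (eEq (rdA 7 (eDiv rP) vQ) (Lit 3)) (eOr (eEq (rdB 7 (eMod rP) vQ) (Lit 3))
             (eEq (rdA 7 (eDiv rP) vQ) (rdB 7 (eMod rP) vQ)))))))) x =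
         of_bool (lab A1 (p div npos A2) = lab A2 (p mod npos A2) \<and>
           (\<forall>x\<in>set w. compat (status A1 (p div npos A2) x) (status A2 (p mod npos A2) x)))"
    if "build_frame t s x" "regs x rP = p" "p < ?N" for x p
  proof -
    have B4: "aval w (rdA 4 (eDiv rP) L0) x = lab A1 (p div npos A2)" "aval w (rdB 4 (eMod rP) L0) x = lab A2 (p mod npos A2)"
      using dP[OF that(1)] o[OF that(1)] that by (simp_all add: A[OF that] del: aval.simps(10))
    have B7: "abnd w B (rdA 7 (eDiv rP) vQ) (setr rQ k x)" "abnd w B (rdB 7 (eMod rP) vQ) (setr rQ k x)"
        "aval w (rdA 7 (eDiv rP) vQ) (setr rQ k x) = status A1 (p div npos A2) (w ! k)"
        "aval w (rdB 7 (eMod rP) vQ) (setr rQ k x) = status A2 (p mod npos A2) (w ! k)" if "k < length w" for k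
    proof -
      let ?x = "setr rQ k x"
      have x: "build_frame t s ?x" "regs ?x rP = p" "abnd w B vQ ?x" "aval w vQ ?x \<le> B" "aval w vQ ?x = k"
        using simQ[OF \<open>build_frame t s x\<close>] \<open>regs x rP = p\<close> that assms(9) by simp_all
      note AA = A[OF x(1,2) \<open>p < ?N\<close> x(3,4)]
      have pd: "p div npos A2 < npos A1" "p mod npos A2 < npos A2" using dP[OF x(1)] x(2) \<open>p < ?N\<close> by simp_all
      show "abnd w B (rdA 7 (eDiv rP) vQ) ?x" "abnd w B (rdB 7 (eMod rP) vQ) ?x"
        by (rule AA)+
      show "aval w (rdA 7 (eDiv rP) vQ) ?x = status A1 (p div npos A2) (w ! k)"
        "aval w (rdB 7 (eMod rP) vQ) ?x = status A2 (p mod npos A2) (w ! k)"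
        unfolding AA(3,4) x(5) using o(12,26)[OF x(1)] pd that by auto
    qed
    show "abnd w B (eAnd (eEq (rdA 4 (eDiv rP) L0) (rdB 4 (eMod rP) L0))
          (eNot (Sum rQ Len (eNot (eOr (eEq (rdA 7 (eDiv rP) vQ) (Lit 3)) (eOr (eEq (rdB 7 (eMod rP) vQ) (Lit 3))
             (eEq (rdA 7 (eDiv rP) vQ) (rdB 7 (eMod rP) vQ)))))))) x"
      using assms(9) by (simp add: A[OF that] B7 del: aval.simps(10) abnd.simps(10))
    show "aval w (eAnd (eEq (rdA 4 (eDiv rP) L0) (rdB 4 (eMod rP) L0))
          (eNot (Sum rQ Len (eNot (eOr (eEq (rdA 7 (eDiv rP) vQ) (Lit 3)) (eOr (eEq (rdB 7 (eMod rP) vQ) (Lit 3))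
             (eEq (rdA 7 (eDiv rP) vQ) (rdB 7 (eMod rP) vQ)))))))) x =
         of_bool (lab A1 (p div npos A2) = lab A2 (p mod npos A2) \<and>
           (\<forall>x\<in>set w. compat (status A1 (p div npos A2) x) (status A2 (p mod npos A2) x)))"
      by (simp add: A[OF that] B7 B4 U aval_Sum0 del: aval.simps(9,10) abnd.simps(10))
  qed
  have sel: "npos (aut_join (set w) A1 A2) = ?N"
    by (simp add: aut_join_def Let_def)
  show ?thesis
    unfolding b_join_def
  proof (rule wp_build[where A = "aut_join (set w) A1 A2" and t = t], goal_cases)
    case (9 s' p)
    then have p: "p < ?N" by (simp add: sel)
    show ?case
      unfolding aval.simps(8) abnd.simps(8) Q3(2)[OF 9(1,2) p]
      using Q3(1)[OF 9(1,2) p] A[OF 9(1,2) p] dP[OF 9(1)] o[OF 9(1)] 9 p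
      by (simp add: aut_join_def Let_def del: aval.simps(10) abnd.simps(10))
  next
    case (10 s' p)
    then have p: "p < ?N" by (simp add: sel)
    then show ?case
      using A[OF 10(1,2) p] dP[OF 10(1)] o[OF 10(1)] 10
      by (simp add: aut_join_def Let_def del: aval.simps(10) abnd.simps(10))
  next
    case (11 s' p)
    then have p: "p < ?N" by (simp add: sel)
    then show ?case
      using A[OF 11(1,2) p] dP[OF 11(1)] o[OF 11(1)] 11
      by (simp add: aut_join_def Let_def del: aval.simps(10) abnd.simps(10))
  next
    case (12 s' p j)
    then have p: "p < ?N" by (simp add: sel)
    then show ?case
      using A[OF 12(1,2) p] dP[OF 12(1)] o[OF 12(1)] 12 assms(9)
      by (simp add: aut_join_def Let_def del: aval.simps(10) abnd.simps(10))
  next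
    case (13 s' p q)
    then have p: "p < ?N" "q < ?N" by (simp_all add: sel)
    then show ?case
      using dP[OF 13(1)] dQ[OF 13(1)] 1[OF 13(1)] o[OF 13(1)] 13 assms(6-11) by (simp add: aut_join_def Let_def)
  next
    case (14 h)
    then show ?case by (rule assms(12))
  qed (use assms(6-11) le in \<open>simp_all add: 1 o aut_join_def Let_def assms(1)\<close>)
qed

section \<open>Postfix evaluation, one token at a time\<close>

definition pop1 :: com where
  "pop1 = Seq (Set rSP (Minus (Var rSP) (Lit 1))) (Set rA (Rd 9 (Var rSP) L0 L0))"

definition pop2 :: com where
  "pop2 = Seq (Set rSP (Minus (Var rSP) (Lit 2)))
     (Seq (Set rA (Rd 9 (Var rSP) L0 L0)) (Set rB (Rd 9 (Plus (Var rSP) (Lit 1)) L0 L0)))"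

definition push :: "aexp \<Rightarrow> com" where
  "push e = Seq (Put 9 (Var rSP) L0 L0 (Var rT)) (Seq (Set rSP (Plus (Var rSP) (Lit 1))) (Set rNxt (Plus (Var rT) e)))"

definition tok0 :: "com \<Rightarrow> aexp \<Rightarrow> com" where "tok0 c e = Seq c (push e)"
definition tok1 :: "com \<Rightarrow> aexp \<Rightarrow> com" where "tok1 c e = Seq pop1 (Seq c (push e))"
definition tok2 :: "com \<Rightarrow> aexp \<Rightarrow> com" where "tok2 c e = Seq pop2 (Seq c (push e))"

text \<open>The projection list begins two cells behind the tag, after its length; the sum is
  nonzero iff the number at \<open>rQ\<close> is in it.\<close>

definition ePr :: aexp where
  "ePr = Sum rK arg1 (eEq (Inp (Plus (Plus (Var rT) (Lit 2)) (Var rK))) (Inp vQ))"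

text \<open>Executed at every input position, but active only where a token begins, as recorded in
  \<open>rNxt\<close>; otherwise arguments would be taken for tags. The end mark 11 moves
  \<open>rNxt\<close> beyond the input, so that the letters of the string are passed over. The last
  branch serves the unions of formulas and of representations, tags 3 and 8.\<close>

definition token_com :: com where
  "token_com = If (eEq (Var rT) (Var rNxt))
    (Seq (Set rTag (Inp (Var rT)))
     (If (eEq (Var rTag) (Lit 11)) (Seq (Set rM (Var rT)) (Set rNxt (Plus Len (Lit 1))))
     (If (eLt (Var rTag) (Lit 3)) (tok0 b_prim (Ite (eEq (Var rTag) (Lit 2)) (Lit 2) (Lit 1)))
     (If (eEq (Var rTag) (Lit 5)) (tok1 b_star (Lit 1))
     (If (eEq (Var rTag) (Lit 6)) (tok1 b_bind (Lit 2))
     (If (eEq (Var rTag) (Lit 7)) (tok1 (b_mask (rdA 3 vQ L0)) (Lit 1))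
     (If (eEq (Var rTag) (Lit 9)) (tok1 (b_mask ePr) (Plus (Lit 2) arg1))
     (If (eEq (Var rTag) (Lit 4)) (tok2 b_conc (Lit 1))
     (If (eEq (Var rTag) (Lit 10)) (tok2 b_join (Lit 1))
       (tok2 b_or (Lit 1)))))))))))
    Skip"

definition token_post :: "nat list \<Rightarrow> nat \<Rightarrow> nat \<Rightarrow> nat \<Rightarrow> store \<Rightarrow> aut \<Rightarrow> store \<Rightarrow> bool" where
  "token_post w t l d s A s' \<longleftrightarrow> regs s' rNxt = t + l \<and> regs s' rSP = d + 1 \<and> heap s' (9, d, 0, 0) = t \<and>
     stored w (heap s') t A \<and>
     (\<forall>i a b c. \<not> (i \<le> 8 \<and> a = t) \<and> \<not> (i = 9 \<and> a = d) \<longrightarrow> heap s' (i, a, b, c) = heap s (i, a, b, c)) \<and>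
     regs s' rM = regs s rM \<and> obuf s' = obuf s"

lemma stored_stack: "stored w (h((9, d, 0, 0) := v)) t A \<longleftrightarrow> stored w h t A"
  by (simp add: stored_def)

lemma wp_push:
  assumes "regs s rT = t" "regs s rSP = d" "d \<le> B"
    and e: "\<And>s'. regs s' rT = t \<Longrightarrow> regs s' rTag = regs s rTag \<Longrightarrow> abnd w B e s' \<and> aval w e s' = l"
    and "stored w (heap s) t A" "agree_off t (heap s0) (heap s)" "regs s rM = regs s0 rM" "obuf s = obuf s0"
  shows "wp w B (push e) (token_post w t l d s0 A) s"
  using assms(1-3,5-) unfolding push_def
  by (simp add: token_post_def stored_stack agree_off_def e)

lemma wp_tok0:
  assumes "regs s rT = t" "regs s rSP = d" "d \<le> B"
    and "\<And>Q. (\<And>h. agree_off t (heap s) h \<Longrightarrow> stored w h t A \<Longrightarrow> Q (s\<lparr>heap := h\<rparr>)) \<Longrightarrow> wp w B c Q s"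
    and "\<And>s'. regs s' rT = t \<Longrightarrow> regs s' rTag = regs s rTag \<Longrightarrow> abnd w B e s' \<and> aval w e s' = l"
  shows "wp w B (tok0 c e) (token_post w t l d s A) s"
  unfolding tok0_def wp_simps(4)
proof (rule assms(4))
  fix h assume h: "agree_off t (heap s) h" "stored w h t A"
  show "wp w B (push e) (token_post w t l d s A) (s\<lparr>heap := h\<rparr>)"
    by (rule wp_push) (use h assms(1-3,5) in simp_all)
qed

lemma wp_tok1:
  assumes "regs s rT = t" "regs s rSP = d + 1" "d \<le> B" "heap s (9, d, 0, 0) = a"
    and "\<And>s' Q. regs s' rT = t \<Longrightarrow> regs s' rA = a \<Longrightarrow> heap s' = heap s \<Longrightarrow>
      (\<And>h. agree_off t (heap s') h \<Longrightarrow> stored w h t A \<Longrightarrow> Q (s'\<lparr>heap := h\<rparr>)) \<Longrightarrow> wp w B c Q s'"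
    and "\<And>s'. regs s' rT = t \<Longrightarrow> regs s' rTag = regs s rTag \<Longrightarrow> abnd w B e s' \<and> aval w e s' = l"
  shows "wp w B (tok1 c e) (token_post w t l d s A) s"
proof -
  let ?s = "s\<lparr>regs := (regs s)(rSP := d, rA := a)\<rparr>"
  have "wp w B c (wp w B (push e) (token_post w t l d s A)) ?s"
  proof (rule assms(5))
    fix h assume h: "agree_off t (heap ?s) h" "stored w h t A"
    show "wp w B (push e) (token_post w t l d s A) (?s\<lparr>heap := h\<rparr>)"
      by (rule wp_push) (use h assms(1-4,6) in simp_all)
  qed (use assms in simp_all)
  then show ?thesis
    unfolding tok1_def pop1_def using assms(1-4) by simp
qed

lemma wp_tok2:
  assumes "regs s rT = t" "regs s rSP = d + 2" "d + 1 \<le> B" "heap s (9, d, 0, 0) = a" "heap s (9, d + 1, 0, 0) = b"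
    and "\<And>s' Q. regs s' rT = t \<Longrightarrow> regs s' rA = a \<Longrightarrow> regs s' rB = b \<Longrightarrow> heap s' = heap s \<Longrightarrow>
      (\<And>h. agree_off t (heap s') h \<Longrightarrow> stored w h t A \<Longrightarrow> Q (s'\<lparr>heap := h\<rparr>)) \<Longrightarrow> wp w B c Q s'"
    and "\<And>s'. regs s' rT = t \<Longrightarrow> regs s' rTag = regs s rTag \<Longrightarrow> abnd w B e s' \<and> aval w e s' = l"
  shows "wp w B (tok2 c e) (token_post w t l d s A) s"
proof -
  let ?s = "s\<lparr>regs := (regs s)(rSP := d, rA := a, rB := b)\<rparr>"
  have "wp w B c (wp w B (push e) (token_post w t l d s A)) ?s"
  proof (rule assms(6))
    fix h assume h: "agree_off t (heap ?s) h" "stored w h t A"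
    show "wp w B (push e) (token_post w t l d s A) (?s\<lparr>heap := h\<rparr>)"
      by (rule wp_push) (use h assms(1-5,7) in simp_all)
  qed (use assms in simp_all)
  then show ?thesis
    unfolding tok2_def pop2_def using assms(1-5) by simp
qed

lemma wp_token:
  assumes t: "regs s rT = t" "regs s rNxt = t" "t < length w" "length w \<le> B" "1 \<le> B" "w ! t = g" "d < B"
  shows
   "g = 2 \<longrightarrow> t + 1 < length w \<Longrightarrow> g < 3 \<Longrightarrow> regs s rSP = d \<Longrightarrow>
      wp w B token_com (token_post w t (if g = 2 then 2 else 1) d s
        (aut_prim (of_bool (g = 2)) (if g = 2 then Suc (w ! (t + 1)) else 0) (g = 1) (g \<noteq> 0))) s" (is "_ \<Longrightarrow> _ \<Longrightarrow> _ \<Longrightarrow> ?G0")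
   "regs s rSP = d + 1 \<Longrightarrow> heap s (9, d, 0, 0) = a \<Longrightarrow> a < t \<Longrightarrow> stored w (heap s) a A1 \<Longrightarrow> npos A1 \<le> B \<Longrightarrow> g = 5 \<Longrightarrow>
      wp w B token_com (token_post w t 1 d s (aut_star A1)) s" (is "_ \<Longrightarrow> _ \<Longrightarrow> _ \<Longrightarrow> _ \<Longrightarrow> _ \<Longrightarrow> _ \<Longrightarrow> ?G5")
   "regs s rSP = d + 1 \<Longrightarrow> heap s (9, d, 0, 0) = a \<Longrightarrow> a < t \<Longrightarrow> stored w (heap s) a A1 \<Longrightarrow> npos A1 \<le> B \<Longrightarrow> g = 6 \<Longrightarrow>
      t + 1 < length w \<Longrightarrow>
      wp w B token_com (token_post w t 2 d s (aut_bind (w ! (t + 1)) A1)) s" (is "_ \<Longrightarrow> _ \<Longrightarrow> _ \<Longrightarrow> _ \<Longrightarrow> _ \<Longrightarrow> _ \<Longrightarrow> _ \<Longrightarrow> ?G6")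
   "regs s rSP = d + 1 \<Longrightarrow> heap s (9, d, 0, 0) = a \<Longrightarrow> a < t \<Longrightarrow> stored w (heap s) a A1 \<Longrightarrow> npos A1 \<le> B \<Longrightarrow> g = 7 \<Longrightarrow>
      wp w B token_com (token_post w t 1 d s (aut_mask (\<lambda>x. marks A1 x \<noteq> 0) A1)) s" (is "_ \<Longrightarrow> _ \<Longrightarrow> _ \<Longrightarrow> _ \<Longrightarrow> _ \<Longrightarrow> _ \<Longrightarrow> ?G7")
   "regs s rSP = d + 1 \<Longrightarrow> heap s (9, d, 0, 0) = a \<Longrightarrow> a < t \<Longrightarrow> stored w (heap s) a A1 \<Longrightarrow> npos A1 \<le> B \<Longrightarrow> g = 9 \<Longrightarrow>
      t + 1 < length w \<Longrightarrow> w ! (t + 1) = k \<Longrightarrow> t + 2 + k \<le> length w \<Longrightarrow>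
      wp w B token_com (token_post w t (2 + k) d s (aut_mask (\<lambda>x. \<exists>i<k. w ! (t + 2 + i) = x) A1)) s" (is "_ \<Longrightarrow> _ \<Longrightarrow> _ \<Longrightarrow> _ \<Longrightarrow> _ \<Longrightarrow> _ \<Longrightarrow> _ \<Longrightarrow> _ \<Longrightarrow> _ \<Longrightarrow> ?G9")
   "regs s rSP = d + 2 \<Longrightarrow> heap s (9, d, 0, 0) = a \<Longrightarrow> heap s (9, d + 1, 0, 0) = b \<Longrightarrow> a < t \<Longrightarrow> b < t \<Longrightarrow>
      stored w (heap s) a A1 \<Longrightarrow> stored w (heap s) b A2 \<Longrightarrow> npos (aut_or A1 A2) \<le> B \<Longrightarrow> g = 3 \<or> g = 8 \<Longrightarrow>
      wp w B token_com (token_post w t 1 d s (aut_or A1 A2)) s" (is "_ \<Longrightarrow> _ \<Longrightarrow> _ \<Longrightarrow> _ \<Longrightarrow> _ \<Longrightarrow> _ \<Longrightarrow> _ \<Longrightarrow> _ \<Longrightarrow> _ \<Longrightarrow> ?G3")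
   "regs s rSP = d + 2 \<Longrightarrow> heap s (9, d, 0, 0) = a \<Longrightarrow> heap s (9, d + 1, 0, 0) = b \<Longrightarrow> a < t \<Longrightarrow> b < t \<Longrightarrow>
      stored w (heap s) a A1 \<Longrightarrow> stored w (heap s) b A2 \<Longrightarrow> npos (aut_conc A1 A2) \<le> B \<Longrightarrow> g = 4 \<Longrightarrow>
      wp w B token_com (token_post w t 1 d s (aut_conc A1 A2)) s" (is "_ \<Longrightarrow> _ \<Longrightarrow> _ \<Longrightarrow> _ \<Longrightarrow> _ \<Longrightarrow> _ \<Longrightarrow> _ \<Longrightarrow> _ \<Longrightarrow> _ \<Longrightarrow> ?G4")
   "regs s rSP = d + 2 \<Longrightarrow> heap s (9, d, 0, 0) = a \<Longrightarrow> heap s (9, d + 1, 0, 0) = b \<Longrightarrow> a < t \<Longrightarrow> b < t \<Longrightarrow>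
      stored w (heap s) a A1 \<Longrightarrow> stored w (heap s) b A2 \<Longrightarrow> npos A1 \<le> B \<Longrightarrow> npos (aut_join (set w) A1 A2) \<le> B \<Longrightarrow> g = 10 \<Longrightarrow>
      wp w B token_com (token_post w t 1 d s (aut_join (set w) A1 A2)) s" (is "_ \<Longrightarrow> _ \<Longrightarrow> _ \<Longrightarrow> _ \<Longrightarrow> _ \<Longrightarrow> _ \<Longrightarrow> _ \<Longrightarrow> _ \<Longrightarrow> _ \<Longrightarrow> _ \<Longrightarrow> ?G10")
proof -
  let ?s = "setr rTag g s"
  have sr: "regs ?s rT = t" "heap ?s = heap s" "regs ?s rSP = regs s rSP" "regs ?s rTag = g"
    using t by simp_all
  have ts: "token_post w t l d (setr rTag x s) A = token_post w t l d s A" for l A x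
    by (rule ext) (simp add: token_post_def)
  {
    assume a: "g = 2 \<longrightarrow> t + 1 < length w" "g < 3" "regs s rSP = d"
    have "wp w B (tok0 b_prim (Ite (eEq (Var rTag) (Lit 2)) (Lit 2) (Lit 1))) (token_post w t (if g = 2 then 2 else 1) d ?s
        (aut_prim (of_bool (g = 2)) (if g = 2 then Suc (w ! (t + 1)) else 0) (g = 1) (g \<noteq> 0))) ?s"
    proof (rule wp_tok0[OF sr(1)])
      fix Q :: "store \<Rightarrow> bool" assume q: "\<And>h. agree_off t (heap ?s) h \<Longrightarrow> stored w h t (aut_prim (of_bool (g = 2)) (if g = 2 then Suc (w ! (t + 1)) else 0) (g = 1) (g \<noteq> 0)) \<Longrightarrow> Q (?s\<lparr>heap := h\<rparr>)"
      show "wp w B b_prim Q ?s"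
        by (rule wp_b_prim[OF sr(1) sr(4) t(3-5) a(1)]) (rule q)
    qed (use a t in simp_all)
    then show ?G0
      using t a by (simp add: token_com_def ts)
  next
    assume a: "regs s rSP = d + 1" "heap s (9, d, 0, 0) = a" "a < t" "stored w (heap s) a A1" "npos A1 \<le> B" "g = 5"
    have "wp w B (tok1 b_star (Lit 1)) (token_post w t 1 d ?s (aut_star A1)) ?s"
      by (rule wp_tok1[OF sr(1)], use a t in simp_all) (rule wp_b_star[of _ t a w A1], use a t in auto)
    then show ?G5
      using t a by (simp add: token_com_def ts)
  next
    assume a: "regs s rSP = d + 1" "heap s (9, d, 0, 0) = a" "a < t" "stored w (heap s) a A1" "npos A1 \<le> B" "g = 6" "t + 1 < length w"
    have "wp w B (tok1 b_bind (Lit 2)) (token_post w t 2 d ?s (aut_bind (w ! (t + 1)) A1)) ?s"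
      by (rule wp_tok1[OF sr(1)], use a t in simp_all) (rule wp_b_bind[of _ t a w A1], use a t in auto)
    then show ?G6
      using t a by (simp add: token_com_def ts)
  next
    assume a: "regs s rSP = d + 1" "heap s (9, d, 0, 0) = a" "a < t" "stored w (heap s) a A1" "npos A1 \<le> B" "g = 7"
    have "wp w B (tok1 (b_mask (rdA 3 vQ L0)) (Lit 1)) (token_post w t 1 d ?s (aut_mask (\<lambda>x. marks A1 x \<noteq> 0) A1)) ?s"
    proof (rule wp_tok1[OF sr(1)])
      fix s' :: store and Q :: "store \<Rightarrow> bool" assume s': "regs s' rT = t" "regs s' rA = a" "heap s' = heap ?s"
        and q: "\<And>h. agree_off t (heap s') h \<Longrightarrow> stored w h t (aut_mask (\<lambda>x. marks A1 x \<noteq> 0) A1) \<Longrightarrow> Q (s'\<lparr>heap := h\<rparr>)"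
      show "wp w B (b_mask (rdA 3 vQ L0)) Q s'"
      proof (rule wp_b_mask[OF s'(1,2) _ a(3) t(3,4) a(5)])
        fix x j assume x: "build_frame t s' x" "regs x rQ = j" "j < length w"
        have "stored w (heap x) a A1" using simD(5)[OF x(1)] a s' by auto
        then show "abnd w B (rdA 3 vQ L0) x \<and> (aval w (rdA 3 vQ L0) x \<noteq> 0) = (marks A1 (w ! j) \<noteq> 0)"
          using x simD(1-4)[OF x(1)] s' a t by (simp add: storedD)
      qed (use a s' q in auto)
    qed (use a t in simp_all)
    then show ?G7
      using t a by (simp add: token_com_def ts)
  next
    assume a: "regs s rSP = d + 1" "heap s (9, d, 0, 0) = a" "a < t" "stored w (heap s) a A1" "npos A1 \<le> B" "g = 9" "t + 1 < length w"
      "w ! (t + 1) = k" "t + 2 + k \<le> length w"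
    have "wp w B (tok1 (b_mask ePr) (Plus (Lit 2) arg1)) (token_post w t (2 + k) d ?s (aut_mask (\<lambda>x. \<exists>i<k. w ! (t + 2 + i) = x) A1)) ?s"
    proof (rule wp_tok1[OF sr(1)])
      fix s' :: store and Q :: "store \<Rightarrow> bool" assume s': "regs s' rT = t" "regs s' rA = a" "heap s' = heap ?s"
        and q: "\<And>h. agree_off t (heap s') h \<Longrightarrow> stored w h t (aut_mask (\<lambda>x. \<exists>i<k. w ! (t + 2 + i) = x) A1) \<Longrightarrow> Q (s'\<lparr>heap := h\<rparr>)"
      show "wp w B (b_mask ePr) Q s'"
      proof (rule wp_b_mask[OF s'(1,2) _ a(3) t(3,4) a(5)])
        fix x j assume x: "build_frame t s' x" "regs x rQ = j" "j < length w"
        then show "abnd w B ePr x \<and> (aval w ePr x \<noteq> 0) = (\<exists>i<k. w ! (t + 2 + i) = w ! j)"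
          using simD(1-4)[OF x(1)] s' a t unfolding ePr_def nz_iff aval_Sum0 by simp
      qed (use a s' q in auto)
    qed (use a t in simp_all)
    then show ?G9
      using t a by (simp add: token_com_def ts)
  next
    assume a: "regs s rSP = d + 2" "heap s (9, d, 0, 0) = a" "heap s (9, d + 1, 0, 0) = b" "a < t" "b < t"
      "stored w (heap s) a A1" "stored w (heap s) b A2" "npos (aut_or A1 A2) \<le> B" "g = 3 \<or> g = 8"
    have "wp w B (tok2 b_or (Lit 1)) (token_post w t 1 d ?s (aut_or A1 A2)) ?s"
      by (rule wp_tok2[OF sr(1)], use a t in simp_all) (rule wp_b_or[of _ t a b w A1 A2], use a t in auto)
    then show ?G3
      using t a by (auto simp add: token_com_def ts)
  next
    assume a: "regs s rSP = d + 2" "heap s (9, d, 0, 0) = a" "heap s (9, d + 1, 0, 0) = b" "a < t" "b < t"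
      "stored w (heap s) a A1" "stored w (heap s) b A2" "npos (aut_conc A1 A2) \<le> B" "g = 4"
    have "wp w B (tok2 b_conc (Lit 1)) (token_post w t 1 d ?s (aut_conc A1 A2)) ?s"
      by (rule wp_tok2[OF sr(1)], use a t in simp_all) (rule wp_b_conc[of _ t a b w A1 A2], use a t in auto)
    then show ?G4
      using t a by (simp add: token_com_def ts)
  next
    assume a: "regs s rSP = d + 2" "heap s (9, d, 0, 0) = a" "heap s (9, d + 1, 0, 0) = b" "a < t" "b < t"
      "stored w (heap s) a A1" "stored w (heap s) b A2" "npos A1 \<le> B" "npos (aut_join (set w) A1 A2) \<le> B" "g = 10"
    have "wp w B (tok2 b_join (Lit 1)) (token_post w t 1 d ?s (aut_join (set w) A1 A2)) ?s"
      by (rule wp_tok2[OF sr(1)], use a t in simp_all) (rule wp_b_join[of _ t a b w A1 A2], use a t in auto)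
    then show ?G10
      using t a by (simp add: token_com_def ts)
  }
qed

section \<open>Parsing\<close>

definition occurs_at :: "nat list \<Rightarrow> nat \<Rightarrow> nat list \<Rightarrow> bool" where
  "occurs_at w t e \<longleftrightarrow> t + length e \<le> length w \<and> (\<forall>i<length e. w ! (t + i) = e ! i)"

lemma sub_append: "occurs_at w t (e @ f) \<longleftrightarrow> occurs_at w t e \<and> occurs_at w (t + length e) f"
proof -
  have "(\<forall>i<length e + length f. w ! (t + i) = (e @ f) ! i) \<longleftrightarrow>
     (\<forall>i<length e. w ! (t + i) = e ! i) \<and> (\<forall>i<length f. w ! (t + length e + i) = f ! i)"
    (is "?L \<longleftrightarrow> ?R")
  proof
    assume L: ?L
    show ?R
    proof (intro conjI allI impI)
      fix i assume "i < length e" then show "w ! (t + i) = e ! i" using L[rule_format, of i] by (simp add: nth_append)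
    next
      fix i assume "i < length f"
      then show "w ! (t + length e + i) = f ! i" using L[rule_format, of "length e + i"] by (simp add: nth_append add.assoc)
    qed
  next
    assume R: ?R
    show ?L
    proof (intro allI impI)
      fix i assume "i < length e + length f"
      then show "w ! (t + i) = (e @ f) ! i"
        using R conjunct2[OF R, rule_format, of "i - length e"] by (cases "i < length e") (auto simp: nth_append)
    qed
  qed
  then show ?thesis by (auto simp: occurs_at_def)
qed

text \<open>The pending left operands of enclosing expressions live in slots before \<open>t\<close>
  and in stack cells below \<open>d\<close>.\<close>

definition parse_frame :: "nat \<Rightarrow> nat \<Rightarrow> store \<Rightarrow> store \<Rightarrow> bool" where
  "parse_frame t d s s' \<longleftrightarrow> (\<forall>i a b c. \<not> (i \<le> 8 \<and> t \<le> a) \<and> \<not> (i = 9 \<and> d \<le> a) \<longrightarrow> heap s' (i, a, b, c) = heap s (i, a, b, c)) \<and>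
     regs s' rM = regs s rM \<and> obuf s' = obuf s"

lemma fr_obj: "parse_frame t d s s' \<Longrightarrow> a < t \<Longrightarrow> stored w (heap s) a A \<Longrightarrow> stored w (heap s') a A"
  unfolding parse_frame_def stored_def by simp

text \<open>Of the slot of the result only its range is recorded. It lies inside the expression just
  read, hence is safe from everything that is read later.\<close>

definition parsed :: "nat list \<Rightarrow> nat \<Rightarrow> nat \<Rightarrow> nat \<Rightarrow> store \<Rightarrow> aut \<Rightarrow> store \<Rightarrow> bool" where
  "parsed w t l d s A s' \<longleftrightarrow> regs s' rNxt = t + l \<and> regs s' rSP = d + 1 \<and>
     (\<exists>a. heap s' (9, d, 0, 0) = a \<and> t \<le> a \<and> a < t + l \<and> stored w (heap s') a A) \<and> parse_frame t d s s'"

text \<open>The condition \<open>d \<le> t\<close> keeps stack indices below \<open>B\<close>: the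
  height never exceeds the number of cells read.\<close>

definition parses :: "nat list \<Rightarrow> nat \<Rightarrow> nat list \<Rightarrow> aut \<Rightarrow> bool" where
  "parses w B e A \<longleftrightarrow> (\<forall>t s d. occurs_at w t e \<longrightarrow> regs s rNxt = t \<longrightarrow> regs s rSP = d \<longrightarrow> d \<le> t \<longrightarrow>
     iter w B token_com rT (length e) t (parsed w t (length e) d s A) s)"

lemma iter_mono: "iter w B c r n t Q s \<Longrightarrow> (\<And>s'. Q s' \<Longrightarrow> Q' s') \<Longrightarrow> iter w B c r n t Q' s"
  by (auto simp: iter_foldl)

text \<open>Meant for the argument cells of a token and for the letters behind the end mark.\<close>

lemma iter_skip:
  assumes "t + n \<le> regs s rNxt" "\<And>x. Q (setr rT x s)"
  shows "iter w B token_com rT n t Q s"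
proof (rule iter_inv[where J = "\<lambda>k s'. \<exists>x. s' = setr rT x s"])
  show "\<exists>x. s = setr rT x s" by (rule exI[of _ "regs s rT"]) simp
next
  fix k s' assume k: "k < n" and "\<exists>x. s' = setr rT x s"
  then obtain x where "s' = setr rT x s" by blast
  then have "setr rT (t + k) s' = setr rT (t + k) s" by simp
  then show "wp w B token_com (\<lambda>s'. \<exists>x. s' = setr rT x s) (setr rT (t + k) s')"
    using k assms(1) by (auto simp: token_com_def simp del: fun_upd_apply) (auto)
qed (use assms(2) in auto)

lemma iter_tok:
  assumes "wp w B token_com (token_post w t (Suc k) d (setr rT t s) A) (setr rT t s)"
  shows "iter w B token_com rT (Suc k) t (token_post w t (Suc k) d s A) s"
  unfolding iter.simps
proof (rule wp_mono[OF assms])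
  fix s' assume s': "token_post w t (Suc k) d (setr rT t s) A s'"
  show "iter w B token_com rT k (Suc t) (token_post w t (Suc k) d s A) s'"
    by (rule iter_skip) (use s' in \<open>auto simp: token_post_def\<close>)
qed

lemma parses_prim:
  assumes "length w \<le> B" "1 \<le> B" "g < 3" "length args = (if g = 2 then 1 else 0)"
  shows "parses w B (g # args) (aut_prim (of_bool (g = 2)) (if g = 2 then Suc (args ! 0) else 0) (g = 1) (g \<noteq> 0))"
  unfolding parses_def
proof (intro allI impI)
  fix t d :: nat and s :: store assume a: "occurs_at w t (g # args)" "regs s rNxt = t" "regs s rSP = d" "d \<le> t"
  let ?A = "aut_prim (of_bool (g = 2)) (if g = 2 then Suc (args ! 0) else 0) (g = 1) (g \<noteq> 0)"
  have w: "w ! t = g" "t < length w" using a(1) by (auto simp: occurs_at_def)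
  have w1: "t + 1 < length w \<and> w ! (t + 1) = args ! 0" if "g = 2"
    using a(1) that assms(4) by (auto simp: occurs_at_def)
  have 1: "wp w B token_com (token_post w t (Suc (length args)) d (setr rT t s) ?A) (setr rT t s)"
    using wp_token(1)[of "setr rT t s" t w B g d] w w1 a assms by (cases "g = 2") (auto simp: numeral_2_eq_2)
  show "iter w B token_com rT (length (g # args)) t (parsed w t (length (g # args)) d s ?A) s"
  proof -
    have L: "length (g # args) = Suc (length args)" by simp
    show ?thesis
      unfolding L by (rule iter_mono[OF iter_tok[OF 1]]) (auto simp: token_post_def parsed_def parse_frame_def)
  qed
qed

lemma parses_un:
  assumes B: "length w \<le> B" and P: "parses w B e A1"
    and tok: "\<And>t s d a. occurs_at w t (g # args) \<Longrightarrow> t < length w \<Longrightarrow> regs s rT = t \<Longrightarrow> regs s rNxt = t \<Longrightarrow> w ! t = g \<Longrightarrow> d < B \<Longrightarrow>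
      regs s rSP = d + 1 \<Longrightarrow> heap s (9, d, 0, 0) = a \<Longrightarrow> a < t \<Longrightarrow> stored w (heap s) a A1 \<Longrightarrow>
      wp w B token_com (token_post w t (Suc (length args)) d s A) s"
  shows "parses w B (e @ g # args) A"
  unfolding parses_def
proof (intro allI impI)
  fix t d :: nat and s :: store assume a: "occurs_at w t (e @ g # args)" "regs s rNxt = t" "regs s rSP = d" "d \<le> t"
  let ?t = "t + length e"
  have s1: "occurs_at w t e" "occurs_at w ?t (g # args)" using a(1) by (auto simp: sub_append)
  then have w: "w ! ?t = g" "?t < length w" by (auto simp: occurs_at_def)
  have "iter w B token_com rT (length e) t (iter w B token_com rT (Suc (length args)) ?t (parsed w t (length (e @ g # args)) d s A)) s"
  proof (rule iter_mono[OF P[unfolded parses_def, rule_format, OF s1(1) a(2-4)]])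
    fix s' assume s': "parsed w t (length e) d s A1 s'"
    then obtain b where b: "heap s' (9, d, 0, 0) = b" "t \<le> b" "b < ?t" "stored w (heap s') b A1" by (auto simp: parsed_def)
    have "wp w B token_com (token_post w ?t (Suc (length args)) d (setr rT ?t s') A) (setr rT ?t s')"
      by (rule tok[where a = b]) (use s1 w b s' a B in \<open>auto simp: parsed_def\<close>)
    then have "iter w B token_com rT (Suc (length args)) ?t (token_post w ?t (Suc (length args)) d s' A) s'"
      by (rule iter_tok)
    then show "iter w B token_com rT (Suc (length args)) ?t (parsed w t (length (e @ g # args)) d s A) s'"
    proof (rule iter_mono)
      fix s2 assume "token_post w ?t (Suc (length args)) d s' A s2"
      then show "parsed w t (length (e @ g # args)) d s A s2"
        using s' b by (auto simp: token_post_def parsed_def parse_frame_def)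
    qed
  qed
  then show "iter w B token_com rT (length (e @ g # args)) t (parsed w t (length (e @ g # args)) d s A) s"
  proof -
    have L: "length (e @ g # args) = length e + Suc (length args)" by simp
    assume "iter w B token_com rT (length e) t (iter w B token_com rT (Suc (length args)) ?t (parsed w t (length (e @ g # args)) d s A)) s"
    then show ?thesis by (simp only: L iter_add)
  qed
qed

lemma parses_un0:
  assumes B: "length w \<le> B" and P: "parses w B e A1"
    and tok: "\<And>t s d a. t < length w \<Longrightarrow> regs s rT = t \<Longrightarrow> regs s rNxt = t \<Longrightarrow> w ! t = g \<Longrightarrow> d < B \<Longrightarrow>
      regs s rSP = d + 1 \<Longrightarrow> heap s (9, d, 0, 0) = a \<Longrightarrow> a < t \<Longrightarrow> stored w (heap s) a A1 \<Longrightarrow>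
      wp w B token_com (token_post w t 1 d s A) s"
  shows "parses w B (e @ [g]) A"
  by (rule parses_un[OF B P]) (use tok in simp)

lemma parses_bin:
  assumes B: "length w \<le> B" and P: "parses w B e A1" "parses w B f A2"
    and tok: "\<And>t s d a b. t < length w \<Longrightarrow> regs s rT = t \<Longrightarrow> regs s rNxt = t \<Longrightarrow> w ! t = g \<Longrightarrow> d < B \<Longrightarrow>
      regs s rSP = d + 2 \<Longrightarrow> heap s (9, d, 0, 0) = a \<Longrightarrow> heap s (9, d + 1, 0, 0) = b \<Longrightarrow> a < t \<Longrightarrow> b < t \<Longrightarrow>
      stored w (heap s) a A1 \<Longrightarrow> stored w (heap s) b A2 \<Longrightarrow> wp w B token_com (token_post w t 1 d s A) s"
    and nonempty: "e \<noteq> []"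
  shows "parses w B (e @ f @ [g]) A"
  unfolding parses_def
proof (intro allI impI)
  fix t d :: nat and s :: store assume a: "occurs_at w t (e @ f @ [g])" "regs s rNxt = t" "regs s rSP = d" "d \<le> t"
  let ?t = "t + length e"
  let ?u = "t + length e + length f"
  have s1: "occurs_at w t e" "occurs_at w ?t f" "occurs_at w ?u [g]" using a(1) by (auto simp: sub_append)
  then have w: "w ! ?u = g" "?u < length w" by (auto simp: occurs_at_def)
  have "iter w B token_com rT (length e) t (iter w B token_com rT (length f + 1) ?t (parsed w t (length (e @ f @ [g])) d s A)) s"
  proof (rule iter_mono[OF P(1)[unfolded parses_def, rule_format, OF s1(1) a(2-4)]])
    fix s' assume s': "parsed w t (length e) d s A1 s'"
    then obtain b where b: "heap s' (9, d, 0, 0) = b" "t \<le> b" "b < ?t" "stored w (heap s') b A1" by (auto simp: parsed_def)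
    have s'r: "regs s' rNxt = ?t" "regs s' rSP = d + 1" using s' by (auto simp: parsed_def)
    \<comment> \<open>The cells of the left operand, of which there is at least one, pay for the
      additional stack entry.\<close>
    have dt: "d + 1 \<le> ?t" using a(4) nonempty by (cases e) auto
    have "iter w B token_com rT (length f) ?t (iter w B token_com rT (Suc 0) ?u (parsed w t (length (e @ f @ [g])) d s A)) s'"
    proof (rule iter_mono[OF P(2)[unfolded parses_def, rule_format, OF s1(2) s'r dt]])
      fix s2 assume s2: "parsed w ?t (length f) (d + 1) s' A2 s2"
      then obtain b2 where b2: "heap s2 (9, d + 1, 0, 0) = b2" "?t \<le> b2" "b2 < ?u" "stored w (heap s2) b2 A2" by (auto simp: parsed_def)
      have f: "parse_frame ?t (d + 1) s' s2" using s2 by (simp add: parsed_def)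
      \<comment> \<open>The left operand survives: its slot precedes the right operand, and its
        stack cell is below the height at which the latter is read.\<close>
      then have "stored w (heap s2) b A1" "heap s2 (9, d, 0, 0) = b"
        using fr_obj[OF f b(3,4)] b(1) by (auto simp: parse_frame_def)
      then have "wp w B token_com (token_post w ?u 1 d (setr rT ?u s2) A) (setr rT ?u s2)"
        by (intro tok[where a = b and b = b2]) (use s1 w b b2 s2 a B in \<open>auto simp: parsed_def\<close>)
      then have "iter w B token_com rT (Suc 0) ?u (token_post w ?u (Suc 0) d s2 A) s2"
        by (intro iter_tok) simp
      then show "iter w B token_com rT (Suc 0) ?u (parsed w t (length (e @ f @ [g])) d s A) s2"
      proof (rule iter_mono)
        fix s3 assume "token_post w ?u (Suc 0) d s2 A s3"
        then show "parsed w t (length (e @ f @ [g])) d s A s3"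
          using s' s2 b b2 by (auto simp: token_post_def parsed_def parse_frame_def)
      qed
    qed
    then show "iter w B token_com rT (length f + 1) ?t (parsed w t (length (e @ f @ [g])) d s A) s'"
      unfolding iter_add by simp
  qed
  then show "iter w B token_com rT (length (e @ f @ [g])) t (parsed w t (length (e @ f @ [g])) d s A) s"
    unfolding length_append iter_add by simp
qed

lemma enc_regex_ne: "enc_regex code \<alpha> \<noteq> []"
  by (cases \<alpha>) auto

lemma enc_rep_ne: "enc_rep code q \<noteq> []"
  by (cases q) auto

text \<open>The bound on the whole expression bounds the automata of all its subexpressions too,
  because powers of two grow with the length.\<close>

lemma parse_regex:
  assumes "length w \<le> B" "1 \<le> B"
  shows "2 ^ length (enc_regex code \<alpha>) \<le> B \<Longrightarrow> parses w B (enc_regex code \<alpha>) (aut_regex code \<alpha>)"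
proof (induction \<alpha>)
  case REmpty
  then show ?case using parses_prim[OF assms, of 0 "[]"] by simp
next
  case REps
  then show ?case using parses_prim[OF assms, of 1 "[]"] by simp
next
  case (RLetter a)
  then show ?case using parses_prim[OF assms, of 2 "[code a]"] by simp
next
  case (ROr \<alpha> \<beta>)
  have z: "npos (aut_or (aut_regex code \<alpha>) (aut_regex code \<beta>)) \<le> B"
    using npos_regex[of code "ROr \<alpha> \<beta>"] ROr.prems by simp
  have "2 ^ length (enc_regex code \<alpha>) \<le> B" "2 ^ length (enc_regex code \<beta>) \<le> B"
    by (rule order_trans[OF _ ROr.prems], rule power_increasing; simp)+
  note IH = ROr.IH(1)[OF this(1)] ROr.IH(2)[OF this(2)]
  show ?case
    unfolding enc_regex.simps aut_regex.simps
    by (rule parses_bin[OF assms(1) IH _ enc_regex_ne], rule wp_token(6)) (use assms z in auto)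
next
  case (RConc \<alpha> \<beta>)
  have z: "npos (aut_conc (aut_regex code \<alpha>) (aut_regex code \<beta>)) \<le> B"
    using npos_regex[of code "RConc \<alpha> \<beta>"] RConc.prems by simp
  have "2 ^ length (enc_regex code \<alpha>) \<le> B" "2 ^ length (enc_regex code \<beta>) \<le> B"
    by (rule order_trans[OF _ RConc.prems], rule power_increasing; simp)+
  note IH = RConc.IH(1)[OF this(1)] RConc.IH(2)[OF this(2)]
  show ?case
    unfolding enc_regex.simps aut_regex.simps
    by (rule parses_bin[OF assms(1) IH _ enc_regex_ne], rule wp_token(7)) (use assms z in auto)
next
  case (RStar \<alpha>)
  have p: "2 ^ length (enc_regex code \<alpha>) \<le> B"
    by (rule order_trans[OF _ RStar.prems], rule power_increasing; simp)
  then have z: "npos (aut_regex code \<alpha>) \<le> B" using npos_regex[of code \<alpha>] by simp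
  show ?case
    unfolding enc_regex.simps aut_regex.simps
    by (rule parses_un0[OF assms(1) RStar.IH[OF p]], rule wp_token(2)) (use assms z in auto)
next
  case (RBind x \<alpha>)
  have p: "2 ^ length (enc_regex code \<alpha>) \<le> B"
    by (rule order_trans[OF _ RBind.prems], rule power_increasing; simp)
  then have z: "npos (aut_regex code \<alpha>) \<le> B" using npos_regex[of code \<alpha>] by simp
  show ?case
    unfolding enc_regex.simps aut_regex.simps
  proof (rule parses_un[OF assms(1) RBind.IH[OF p]])
    fix t d a :: nat and s :: store assume s: "occurs_at w t [6, x]" "t < length w" "regs s rT = t" "regs s rNxt = t" "w ! t = 6" "d < B"
      "regs s rSP = d + 1" "heap s (9, d, 0, 0) = a" "a < t" "stored w (heap s) a (aut_regex code \<alpha>)"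
    have "w ! (t + 1) = x" "t + 1 < length w" using s(1) by (auto simp: occurs_at_def dest: spec[of _ 1])
    then show "wp w B token_com (token_post w t (Suc (length [x])) d s (aut_bind x (aut_regex code \<alpha>))) s"
      using wp_token(3)[OF s(3,4,2) assms s(5,6,7,8,9,10) z refl] by (simp add: eval_nat_numeral)
  qed
qed

lemma parse_rep:
  assumes "length w \<le> B" "1 \<le> B"
  shows "2 ^ length (enc_rep code q) \<le> B \<Longrightarrow> parses w B (enc_rep code q) (aut_rep code (set w) q)"
proof (induction q)
  case (Regex \<alpha>)
  have p: "2 ^ length (enc_regex code \<alpha>) \<le> B"
    by (rule order_trans[OF _ Regex.prems], rule power_increasing; simp)
  then have z: "npos (aut_regex code \<alpha>) \<le> B" using npos_regex[of code \<alpha>] by simp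
  show ?case
    unfolding enc_rep.simps aut_rep.simps
    by (rule parses_un0[OF assms(1) parse_regex[OF assms p]], rule wp_token(4)) (use assms z in auto)
next
  case (UnionOf p q)
  have z: "npos (aut_or (aut_rep code (set w) p) (aut_rep code (set w) q)) \<le> B"
    using npos_rep[of code "set w" "UnionOf p q"] UnionOf.prems by simp
  have "2 ^ length (enc_rep code p) \<le> B" "2 ^ length (enc_rep code q) \<le> B"
    by (rule order_trans[OF _ UnionOf.prems], rule power_increasing; simp)+
  note IH = UnionOf.IH(1)[OF this(1)] UnionOf.IH(2)[OF this(2)]
  show ?case
    unfolding enc_rep.simps aut_rep.simps
    by (rule parses_bin[OF assms(1) IH _ enc_rep_ne], rule wp_token(6)) (use assms z in auto)
next
  case (Proj Y p)
  have q: "2 ^ length (enc_rep code p) \<le> B"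
    by (rule order_trans[OF _ Proj.prems], rule power_increasing; simp)
  then have z: "npos (aut_rep code (set w) p) \<le> B" using npos_rep[of code "set w" p] by simp
  have "parses w B (enc_rep code p @ 9 # length Y # Y) (aut_mask (\<lambda>x. x \<in> set Y) (aut_rep code (set w) p))"
  proof (rule parses_un[OF assms(1) Proj.IH[OF q]])
    fix t d a :: nat and s :: store assume s: "occurs_at w t (9 # length Y # Y)" "t < length w" "regs s rT = t" "regs s rNxt = t" "w ! t = 9" "d < B"
      "regs s rSP = d + 1" "heap s (9, d, 0, 0) = a" "a < t" "stored w (heap s) a (aut_rep code (set w) p)"
    have w: "w ! (t + 1) = length Y" "t + 1 < length w" "t + 2 + length Y \<le> length w"
      using s(1) by (auto simp: occurs_at_def dest: spec[of _ 1])
    have "w ! (t + 2 + i) = Y ! i" if "i < length Y" for i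
      using s(1) that by (auto simp: occurs_at_def dest: spec[of _ "Suc (Suc i)"])
    then have "(\<lambda>x. \<exists>i<length Y. w ! (t + 2 + i) = x) = (\<lambda>x. x \<in> set Y)"
      by (auto simp: in_set_conv_nth fun_eq_iff)
    then show "wp w B token_com (token_post w t (Suc (length (length Y # Y))) d s (aut_mask (\<lambda>x. x \<in> set Y) (aut_rep code (set w) p))) s"
      using wp_token(5)[OF s(3,4,2) assms s(5,6,7,8,9,10) z refl w(2,1,3)] by simp
  qed
  then show ?case by simp
next
  case (JoinOf p q)
  have z: "npos (aut_join (set w) (aut_rep code (set w) p) (aut_rep code (set w) q)) \<le> B"
    using npos_rep[of code "set w" "JoinOf p q"] JoinOf.prems by simp
  have pp: "2 ^ length (enc_rep code p) \<le> B" "2 ^ length (enc_rep code q) \<le> B"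
    by (rule order_trans[OF _ JoinOf.prems], rule power_increasing; simp)+
  have z1: "npos (aut_rep code (set w) p) \<le> B" using npos_rep[of code "set w" p] pp by simp
  note IH = JoinOf.IH(1)[OF pp(1)] JoinOf.IH(2)[OF pp(2)]
  show ?case
    unfolding enc_rep.simps aut_rep.simps
    by (rule parses_bin[OF assms(1) IH _ enc_rep_ne], rule wp_token(8)) (use assms z z1 in auto)
qed

section \<open>The answering programs: tables of digits and runs over the string\<close>

abbreviation (input) "rTT \<equiv> 11 :: nat"
abbreviation (input) "rL \<equiv> 12 :: nat"
abbreviation (input) "rDM \<equiv> 13 :: nat"
abbreviation (input) "rRes \<equiv> 14 :: nat"
abbreviation (input) "rFlag \<equiv> 15 :: nat"
abbreviation (input) "rI \<equiv> 16 :: nat"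
abbreviation (input) "rJ \<equiv> 17 :: nat"
abbreviation (input) "rV \<equiv> 18 :: nat"
abbreviation (input) "rOld \<equiv> 19 :: nat"
abbreviation (input) "rR \<equiv> 20 :: nat"
abbreviation (input) "rW \<equiv> 21 :: nat"
abbreviation (input) "rX \<equiv> 22 :: nat"

definition parse_all :: com where
  "parse_all = Seq (For rT Len token_com) (Seq (Set rTT (Rd 9 L0 L0 L0)) (Set rL (Minus (Minus Len (Var rM)) (Lit 1))))"

text \<open>Selects the first input position of each output variable. A tag, length or letter code
  that happens to be the same number counts as an occurrence, which is harmless, since only the
  number itself matters.\<close>

definition eCan :: "nat \<Rightarrow> aexp" where
  "eCan r = eAnd (Rd 3 (Var rTT) (Var r) L0) (eNot (Sum rK (Var r) (eEq (Inp (Var rK)) (Inp (Var r)))))"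

text \<open>Answers list their variables in increasing order, so a variable is placed by the number
  of smaller ones.\<close>

definition eRank :: aexp where
  "eRank = Sum rR Len (eAnd (eCan rR) (eLt (Inp (Var rR)) (Inp (Var rJ))))"

definition tables :: com where
  "tables = Seq (For rJ Len (If (eCan rJ)
     (Seq (Set rX eRank)
     (Seq (Put 10 (Plus (Var rX) (Var rX)) L0 L0 (Var rJ))
     (Seq (Put 10 (Plus (Plus (Var rX) (Var rX)) (Lit 1)) L0 L0 (Var rJ))
     (Seq (Put 11 (Plus (Var rX) (Var rX)) L0 L0 (Lit 1))
          (Put 11 (Plus (Plus (Var rX) (Var rX)) (Lit 1)) L0 L0 (Lit 2)))))) Skip))
    (Set rDM (Sum rJ Len (Plus (eCan rJ) (eCan rJ))))"

text \<open>Digit \<open>k\<close> of an answer is the least position at which the status of its variable reaches a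
  threshold: 1 for the start and 2 for the end of the span.\<close>

definition eBad :: aexp where
  "eBad = eAnd (Rd 12 (Var rK) L0 L0)
     (eNot (eEq (eLe (Rd 11 (Var rK) L0 L0) (Rd 7 (Var rTT) vP (Rd 10 (Var rK) L0 L0)))
                (eLe (Rd 12 (Var rK) L0 L0) (Plus (Var rI) (Lit 1)))))"

definition eOk :: aexp where
  "eOk = eAnd (eEq (Rd 4 (Var rTT) vP L0) (Plus (Inp (Plus (Plus (Var rM) (Lit 1)) (Var rI))) (Lit 1)))
     (eNot (Sum rK (Var rDM) eBad))"

abbreviation "nT \<equiv> Rd 0 (Var rTT) L0 L0"

definition eCur :: aexp where
  "eCur = eAnd eOk (Ite (Var rI)
     (Sum rQ nT (eAnd (Rd 13 (Minus (Var rI) (Lit 1)) vQ L0) (Rd 8 (Var rTT) vQ vP)))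
     (Rd 5 (Var rTT) vP L0))"

text \<open>The empty string leaves no row to inspect; acceptance then is nullability.\<close>

definition check_digits :: com where
  "check_digits = Seq (For rI (Var rL) (For rP nT (Put 13 (Var rI) vP L0 eCur)))
     (Set rRes (Ite (Var rL)
        (Sum rQ nT (eAnd (Rd 13 (Minus (Var rL) (Lit 1)) vQ L0) (Rd 6 (Var rTT) vQ L0)))
        (Rd 1 (Var rTT) L0 L0)))"

primrec reachable :: "(nat \<Rightarrow> nat \<Rightarrow> bool) \<Rightarrow> aut \<Rightarrow> nat \<Rightarrow> nat \<Rightarrow> bool" where
  "reachable pos_ok A 0 p \<longleftrightarrow> pos_ok 0 p \<and> is_first A p"
| "reachable pos_ok A (Suc i) p \<longleftrightarrow> pos_ok (Suc i) p \<and> (\<exists>q<npos A. reachable pos_ok A i q \<and> follow A q p)"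

lemma reachp_path:
  "p < npos A \<Longrightarrow> reachable pos_ok A i p \<longleftrightarrow> (\<exists>ps. length ps = Suc i \<and> set ps \<subseteq> {..<npos A} \<and> is_first A (hd ps) \<and>
     successively (follow A) ps \<and> last ps = p \<and> (\<forall>j\<le>i. pos_ok j (ps ! j)))"
proof (induction i arbitrary: p)
  case 0
  show ?case
  proof
    assume "reachable pos_ok A 0 p"
    then show "\<exists>ps. length ps = Suc 0 \<and> set ps \<subseteq> {..<npos A} \<and> is_first A (hd ps) \<and>
     successively (follow A) ps \<and> last ps = p \<and> (\<forall>j\<le>0. pos_ok j (ps ! j))"
      using 0 by (intro exI[of _ "[p]"]) auto
  next
    assume "\<exists>ps. length ps = Suc 0 \<and> set ps \<subseteq> {..<npos A} \<and> is_first A (hd ps) \<and>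
     successively (follow A) ps \<and> last ps = p \<and> (\<forall>j\<le>0. pos_ok j (ps ! j))"
    then show "reachable pos_ok A 0 p" by (auto simp: length_Suc_conv)
  qed
next
  case (Suc i)
  show ?case
  proof
    assume "reachable pos_ok A (Suc i) p"
    then obtain q where q: "pos_ok (Suc i) p" "q < npos A" "reachable pos_ok A i q" "follow A q p" by auto
    then obtain ps where ps: "length ps = Suc i" "set ps \<subseteq> {..<npos A}" "is_first A (hd ps)"
      "successively (follow A) ps" "last ps = q" "\<forall>j\<le>i. pos_ok j (ps ! j)" using Suc.IH by blast
    then have "ps \<noteq> []" by auto
    then show "\<exists>ps. length ps = Suc (Suc i) \<and> set ps \<subseteq> {..<npos A} \<and> is_first A (hd ps) \<and>
      successively (follow A) ps \<and> last ps = p \<and> (\<forall>j\<le>Suc i. pos_ok j (ps ! j))"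
      using ps q Suc.prems by (intro exI[of _ "ps @ [p]"]) (auto simp: successively_append_iff nth_append le_Suc_eq)
  next
    assume "\<exists>ps. length ps = Suc (Suc i) \<and> set ps \<subseteq> {..<npos A} \<and> is_first A (hd ps) \<and>
      successively (follow A) ps \<and> last ps = p \<and> (\<forall>j\<le>Suc i. pos_ok j (ps ! j))"
    then obtain ps where ps: "length ps = Suc (Suc i)" "set ps \<subseteq> {..<npos A}" "is_first A (hd ps)"
      "successively (follow A) ps" "last ps = p" "\<forall>j\<le>Suc i. pos_ok j (ps ! j)" by blast
    obtain rs where rs: "ps = rs @ [p]" using ps(1,5) by (cases ps rule: rev_cases) auto
    then have l: "length rs = Suc i" "rs \<noteq> []" using ps(1) by auto
    have "\<forall>j\<le>i. pos_ok j (rs ! j)"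
    proof (intro allI impI)
      fix j assume "j \<le> i" then show "pos_ok j (rs ! j)" using ps(6)[rule_format, of j] l by (simp add: rs nth_append)
    qed
    moreover have lt: "last rs < npos A"
    proof -
      have "last rs \<in> set rs" using l(2) by simp
      moreover have "set rs \<subseteq> {..<npos A}" using ps(2) by (simp add: rs)
      ultimately have "last rs \<in> {..<npos A}" by blast
      then show ?thesis by simp
    qed
    ultimately have "reachable pos_ok A i (last rs)"
      using Suc.IH[of "last rs"] ps l by (auto simp: rs successively_append_iff)
    moreover have "pos_ok (Suc i) p" using ps(6)[rule_format, of "Suc i"] l by (simp add: rs nth_append)
    moreover have "follow A (last rs) p" using ps l by (auto simp: rs successively_append_iff)
    ultimately show "reachable pos_ok A (Suc i) p" using lt by auto
  qed
qed

text \<open>Admissibility depends on the position and the index of the letter only, because the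
  status vector belongs to the position. So dynamic programming over single positions decides
  whether there is an admissible accepting run.\<close>

lemma accept_path:
  "(if l = 0 then nullable A else \<exists>p<npos A. reachable pos_ok A (l - 1) p \<and> is_last A p) \<longleftrightarrow>
     (\<exists>ps. accepted A ps \<and> length ps = l \<and> (\<forall>i<l. pos_ok i (ps ! i)))"
proof (cases l)
  case 0
  then show ?thesis by (auto simp: accepted_def)
next
  case (Suc i)
  have "(\<exists>p<npos A. reachable pos_ok A i p \<and> is_last A p) \<longleftrightarrow> (\<exists>ps. length ps = Suc i \<and> set ps \<subseteq> {..<npos A} \<and> is_first A (hd ps) \<and>
     successively (follow A) ps \<and> is_last A (last ps) \<and> (\<forall>j\<le>i. pos_ok j (ps ! j)))" (is "?L \<longleftrightarrow> ?R")
  proof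
    assume ?L then show ?R using reachp_path by blast
  next
    assume ?R
    then obtain ps where ps: "length ps = Suc i" "set ps \<subseteq> {..<npos A}" "is_first A (hd ps)"
     "successively (follow A) ps" "is_last A (last ps)" "\<forall>j\<le>i. pos_ok j (ps ! j)" by blast
    have "last ps \<in> set ps" using ps(1) by (cases ps rule: rev_cases) auto
    then have "last ps < npos A" using ps(2) by auto
    then show ?L using ps reachp_path[of "last ps" A pos_ok i] by blast
  qed
  moreover have "accepted A ps \<longleftrightarrow> set ps \<subseteq> {..<npos A} \<and> is_first A (hd ps) \<and> is_last A (last ps) \<and> successively (follow A) ps"
    if "length ps = Suc i" for ps using that by (auto simp: accepted_def)
  ultimately show ?thesis using Suc by (auto simp: less_Suc_eq_le)
qed

lemma sorted_rank:
  fixes xs :: "nat list"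
  assumes "sorted xs" "distinct xs" "x \<in> set xs"
  shows "card {v \<in> set xs. v < x} < length xs" "xs ! card {v \<in> set xs. v < x} = x"
proof -
  obtain i where i: "i < length xs" "xs ! i = x" using assms(3) by (auto simp: in_set_conv_nth)
  have st: "xs ! k < xs ! j" if "k < j" "j < length xs" for k j
    using that sorted_nth_mono[OF assms(1), of k j] nth_eq_iff_index_eq[OF assms(2), of k j] by fastforce
  have "{v \<in> set xs. v < x} = (!) xs ` {..<i}"
  proof (intro set_eqI iffI)
    fix v assume "v \<in> {v \<in> set xs. v < x}"
    then obtain k where k: "k < length xs" "v = xs ! k" "xs ! k < xs ! i" using i by (auto simp: in_set_conv_nth)
    then have "k < i" using st[of i k] by (cases k i rule: linorder_cases) auto
    then show "v \<in> (!) xs ` {..<i}" using k by auto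
  next
    fix v assume "v \<in> (!) xs ` {..<i}"
    then show "v \<in> {v \<in> set xs. v < x}" using st i by auto
  qed
  moreover have "inj_on ((!) xs) {..<i}" using i assms(2) by (auto simp: inj_on_def nth_eq_iff_index_eq)
  ultimately have "card {v \<in> set xs. v < x} = i" by (simp add: card_image)
  then show "card {v \<in> set xs. v < x} < length xs" "xs ! card {v \<in> set xs. v < x} = x" using i by auto
qed

text \<open>\<open>B1\<close> covers the sizes of the automata; \<open>B2\<close> covers input
  positions and digits, two for each of at most \<open>length w\<close> variables.\<close>

locale enum_input =
  fixes code :: "'a \<Rightarrow> nat" and q :: "'a rep" and str :: "'a list" and B :: nat and w :: "nat list"
  assumes inj: "inj code" and reg: "regular_rep q" and w_def: "w = enc_input code q str"
    and B1: "2 ^ length (enc_rep code q) \<le> B" and B2: "2 * length w + 2 \<le> B"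
begin

definition A :: aut where "A = aut_rep code (set w) q"

abbreviation "m \<equiv> length (enc_rep code q)"
abbreviation "l \<equiv> length str"
abbreviation "n \<equiv> length w"

lemma n_eq: "n = m + (1 + l)"
  by (simp add: w_def enc_input_def)

lemma w_m: "w ! m = 11"
  by (simp add: w_def enc_input_def nth_append)

lemma w_str: "i < l \<Longrightarrow> w ! (m + 1 + i) = code (str ! i)"
  by (simp add: w_def enc_input_def nth_append)

lemma A_size: "npos A \<le> B"
  unfolding A_def using npos_rep[of code "set w" q] B1 by (rule order_trans)

lemmas A_correct = rep_correct[OF inj reg, of "set w", folded A_def]

lemma q_sub: "set (enc_rep code q) \<subseteq> set w"
  by (auto simp: w_def enc_input_def)

lemma sub_q: "occurs_at w 0 (enc_rep code q)"
  by (auto simp: occurs_at_def w_def enc_input_def nth_append)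

definition "s0 = \<lparr>regs = (\<lambda>_. 0), heap = (\<lambda>_. 0), obuf = []\<rparr>"

lemma wp_parse_all:
  assumes "\<And>s. regs s rTT < n \<Longrightarrow> stored w (heap s) (regs s rTT) A \<Longrightarrow> regs s rL = l \<Longrightarrow> regs s rM = m \<Longrightarrow>
      (\<And>i a b c. 9 < i \<Longrightarrow> heap s (i, a, b, c) = 0) \<Longrightarrow> obuf s = [] \<Longrightarrow> Q s"
  shows "wp w B parse_all Q s0"
proof -
  let ?c = "Seq (Set rTT (Rd 9 L0 L0 L0)) (Set rL (Minus (Minus Len (Var rM)) (Lit 1)))"
  have nB: "n \<le> B" "1 \<le> B" using B2 by auto
  have P: "parses w B (enc_rep code q) A"
    unfolding A_def by (rule parse_rep[OF nB B1])
  have 1: "iter w B token_com rT m 0 (parsed w 0 m 0 s0 A) s0"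
    by (rule P[unfolded parses_def, rule_format]) (auto simp: sub_q s0_def)
  \<comment> \<open>The \<open>n\<close> rounds split as \<open>m + (1 + l)\<close>: the expression,
    the end mark, and the string, whose rounds do nothing.\<close>
  have "iter w B token_com rT n 0 (\<lambda>s'. wp w B ?c Q (setr rT (regs s0 rT) s')) s0"
    unfolding n_eq iter_add
  proof (rule iter_mono[OF 1])
    fix s1 assume s1: "parsed w 0 m 0 s0 A s1"
    then obtain a where a: "heap s1 (9, 0, 0, 0) = a" "a < m" "stored w (heap s1) a A"
      and f: "parse_frame 0 0 s0 s1" "regs s1 rNxt = m" by (auto simp: parsed_def)
    let ?s2 = "s1\<lparr>regs := (regs s1)(rT := m, rTag := 11, rM := m, rNxt := n + 1)\<rparr>"
    have "iter w B token_com rT l (0 + m + 1) (\<lambda>s'. wp w B ?c Q (setr rT (regs s0 rT) s')) ?s2"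
    proof (rule iter_skip)
      show "0 + m + 1 + l \<le> regs ?s2 rNxt" using n_eq by simp
    next
      fix x
      have r: "Q (s1\<lparr>regs := (regs s1)(rT := y, rTag := 11, rM := m, rNxt := n + 1, rTT := a, rL := l)\<rparr>)" for y
        by (rule assms) (use a f n_eq in \<open>auto simp: parse_frame_def s0_def\<close>)
      have e: "(regs s1)(rT := m, rTag := 11, rM := m, rNxt := n + 1, rT := x, rT := 0, rTT := a, rL := l) =
          (regs s1)(rT := 0, rTag := 11, rM := m, rNxt := n + 1, rTT := a, rL := l)" by auto
      have e2: "n - m - 1 = l" using n_eq by simp
      show "wp w B ?c Q (setr rT (regs s0 rT) (setr rT x ?s2))"
        using r[of 0] a unfolding e[symmetric] by (simp add: s0_def e2 del: fun_upd_apply) (simp add: e2[simplified])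
    qed
    moreover have "wp w B token_com (\<lambda>s'. s' = ?s2) (setr rT m s1)"
      using f n_eq by (simp add: token_com_def w_m fun_upd_twist)
    ultimately show "iter w B token_com rT 1 (0 + m) (iter w B token_com rT l (0 + m + 1)
        (\<lambda>s'. wp w B ?c Q (setr rT (regs s0 rT) s'))) s1"
      by (auto simp: wp_def)
  qed
  then show ?thesis
    unfolding parse_all_def wp_simps(4) using nB by (intro wp_For_iter) (simp_all del: wp_simps)
qed

text \<open>The output variables as far as the machine can tell. This is the true set as soon as
  there is an answer; otherwise its value is irrelevant.\<close>

definition var_set :: "nat set" where "var_set = {w ! j | j. j < n \<and> marks A (w ! j) \<noteq> 0}"
definition var_list :: "nat list" where "var_list = sorted_list_of_set var_set"

lemma finite_Vs: "finite var_set"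
  by (simp add: var_set_def)

lemma var_list: "set var_list = var_set" "sorted var_list" "distinct var_list"
  using finite_Vs by (simp_all add: var_list_def)

definition canonical :: "nat \<Rightarrow> bool" where
  "canonical j \<longleftrightarrow> marks A (w ! j) \<noteq> 0 \<and> (\<forall>k<j. w ! k \<noteq> w ! j)"

definition rank :: "nat \<Rightarrow> nat" where
  "rank j = card {v \<in> var_set. v < w ! j}"

lemma can_bij: "bij_betw ((!) w) {j. j < n \<and> canonical j \<and> w ! j < x} {v \<in> var_set. v < x}"
    "bij_betw ((!) w) {j. j < n \<and> canonical j} var_set"
proof -
  have i: "inj_on ((!) w) {j. j < n \<and> canonical j}"
  proof (rule inj_onI)
    fix j k assume "j \<in> {j. j < n \<and> canonical j}" "k \<in> {j. j < n \<and> canonical j}" "w ! j = w ! k"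
    then show "j = k" by (cases j k rule: linorder_cases) (auto simp: canonical_def)
  qed
  have ex: "\<exists>j<n. canonical j \<and> w ! j = v" if "v \<in> var_set" for v
  proof -
    from that obtain j where j: "j < n \<and> w ! j = v" "marks A v \<noteq> 0" by (auto simp: var_set_def)
    define j0 where "j0 = (LEAST j. j < n \<and> w ! j = v)"
    have l: "j0 < n" "w ! j0 = v" using LeastI[of "\<lambda>j. j < n \<and> w ! j = v", OF j(1)] unfolding j0_def by blast+
    have "w ! k \<noteq> v" if "k < j0" for k
      using not_less_Least[OF that[unfolded j0_def]] l(1) that by force
    then show ?thesis using l j by (intro exI[of _ j0]) (auto simp: canonical_def)
  qed
  show "bij_betw ((!) w) {j. j < n \<and> canonical j} var_set"
    unfolding bij_betw_def
  proof (intro conjI equalityI subsetI)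
    fix v assume "v \<in> var_set"
    then show "v \<in> (!) w ` {j. j < n \<and> canonical j}" using ex[of v] by blast
  qed (use i in \<open>auto simp: var_set_def canonical_def\<close>)
  have "inj_on ((!) w) {j. j < n \<and> canonical j \<and> w ! j < x}" using i by (rule inj_on_subset) auto
  then show "bij_betw ((!) w) {j. j < n \<and> canonical j \<and> w ! j < x} {v \<in> var_set. v < x}"
    unfolding bij_betw_def
  proof (intro conjI equalityI subsetI)
    fix v assume "v \<in> {v \<in> var_set. v < x}"
    then show "v \<in> (!) w ` {j. j < n \<and> canonical j \<and> w ! j < x}" using ex[of v] by blast
  qed (auto simp: var_set_def canonical_def)
qed

lemma rank: "j < n \<Longrightarrow> canonical j \<Longrightarrow> rank j < length var_list \<and> var_list ! rank j = w ! j"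
  using sorted_rank[OF var_list(2,3), of "w ! j"] by (auto simp: rank_def var_list(1) var_set_def canonical_def)

lemma length_vs: "length var_list \<le> n" "card {j. j < n \<and> canonical j} = length var_list"
proof -
  show 1: "card {j. j < n \<and> canonical j} = length var_list"
    using bij_betw_same_card[OF can_bij(2)] var_list distinct_card[of var_list] by simp
  have "card {j. j < n \<and> canonical j} \<le> card {..<n}" by (rule card_mono) auto
  then show "length var_list \<le> n" using 1 by simp
qed

definition ready :: "store \<Rightarrow> bool" where
  "ready s \<longleftrightarrow> regs s rTT < n \<and> stored w (heap s) (regs s rTT) A \<and> regs s rL = l \<and> regs s rM = m \<and>
     regs s rDM = 2 * length var_list \<and>
     (\<forall>d<2 * length var_list. heap s (10, d, 0, 0) < n \<and> w ! heap s (10, d, 0, 0) = var_list ! (d div 2) \<and>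
        heap s (11, d, 0, 0) = d mod 2 + 1)"

lemma eCan:
  assumes "stored w (heap s) (regs s rTT) A" "regs s rTT < n" "r \<noteq> rK" "regs s r < n"
  shows "abnd w B (eCan r) s" "aval w (eCan r) s = of_bool (canonical (regs s r))"
proof -
  have "aval w (Sum rK (Var r) (eEq (Inp (Var rK)) (Inp (Var r)))) s = 0 \<longleftrightarrow> (\<forall>k<regs s r. w ! k \<noteq> w ! regs s r)"
    unfolding aval_Sum0 using assms(3) by simp
  then show "aval w (eCan r) s = of_bool (canonical (regs s r))"
    using assms storedD[OF assms(1)] by (simp add: eCan_def canonical_def del: aval.simps(9))
  show "abnd w B (eCan r) s"
    using assms storedD[OF assms(1)] B2 by (simp add: eCan_def)
qed

lemma eRank:
  assumes "stored w (heap s) (regs s rTT) A" "regs s rTT < n" "regs s rJ < n"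
  shows "abnd w B eRank s" "aval w eRank s = rank (regs s rJ)"
proof -
  have 1: "abnd w B (eCan rR) (setr rR k s)" "aval w (eCan rR) (setr rR k s) = of_bool (canonical k)" if "k < n" for k
    using eCan[of "setr rR k s" rR] assms that by auto
  have "aval w eRank s = (\<Sum>k<n. of_bool (canonical k \<and> w ! k < w ! regs s rJ))"
    unfolding eRank_def aval.simps by (rule sum.cong) (simp_all add: 1)
  also have "\<dots> = card {j. j < n \<and> canonical j \<and> w ! j < w ! regs s rJ}"
  proof -
    have "(\<Sum>k<n. of_bool (canonical k \<and> w ! k < w ! regs s rJ)) = (\<Sum>k\<in>{j. j < n \<and> canonical j \<and> w ! j < w ! regs s rJ}. 1::nat)"
      by (rule sum.mono_neutral_cong_right) auto
    then show ?thesis by simp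
  qed
  also have "\<dots> = rank (regs s rJ)"
    using bij_betw_same_card[OF can_bij(1)] by (simp add: rank_def)
  finally show "aval w eRank s = rank (regs s rJ)" .
  show "abnd w B eRank s"
    using 1 assms B2 by (simp add: eRank_def)
qed

lemma stored_upd: "9 < i \<Longrightarrow> stored w (h((i, a, b, c) := v)) t X \<longleftrightarrow> stored w h t X"
  by (simp add: stored_def)

lemma wp_tables:
  assumes s: "regs s rTT < n" "stored w (heap s) (regs s rTT) A" "regs s rL = l" "regs s rM = m"
      "\<And>i a b c. 9 < i \<Longrightarrow> heap s (i, a, b, c) = 0" "obuf s = []"
    and Q: "\<And>s'. ready s' \<Longrightarrow> (\<And>i a b c. 11 < i \<Longrightarrow> heap s' (i, a, b, c) = 0) \<Longrightarrow> obuf s' = [] \<Longrightarrow> Q s'"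
  shows "wp w B tables Q s"
proof -
  define J where "J = (\<lambda>j (s' :: store). regs s' rTT < n \<and> stored w (heap s') (regs s' rTT) A \<and> regs s' rL = l \<and> regs s' rM = m \<and>
     (\<forall>i a b c. 11 < i \<longrightarrow> heap s' (i, a, b, c) = 0) \<and> obuf s' = [] \<and>
     (\<forall>j'<j. canonical j' \<longrightarrow> (\<forall>e<2. heap s' (10, 2 * rank j' + e, 0, 0) < n \<and> w ! heap s' (10, 2 * rank j' + e, 0, 0) = w ! j' \<and>
        heap s' (11, 2 * rank j' + e, 0, 0) = e + 1)))"
  show ?thesis
    unfolding tables_def wp_simps(4)[of _ _ "For _ _ _"]
  proof (rule wp_For[where J = J and n = n])
    show "J 0 s" using s by (simp add: J_def)
  next
    fix k s' assume k: "k < n" and "J k s'"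
    then have J: "J k (setr rJ k s')" by (simp add: J_def)
    let ?s = "setr rJ k s'"
    have c: "abnd w B (eCan rJ) ?s" "aval w (eCan rJ) ?s = of_bool (canonical k)"
      using eCan[of ?s rJ] J k by (auto simp: J_def)
    show "wp w B (If (eCan rJ)
     (Seq (Set rX eRank)
     (Seq (Put 10 (Plus (Var rX) (Var rX)) L0 L0 (Var rJ))
     (Seq (Put 10 (Plus (Plus (Var rX) (Var rX)) (Lit 1)) L0 L0 (Var rJ))
     (Seq (Put 11 (Plus (Var rX) (Var rX)) L0 L0 (Lit 1))
          (Put 11 (Plus (Plus (Var rX) (Var rX)) (Lit 1)) L0 L0 (Lit 2)))))) Skip) (J (Suc k)) ?s"
    proof (cases "canonical k")
      case False
      then show ?thesis using c J by (auto simp: J_def less_Suc_eq)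
    next
      case True
      have r: "abnd w B eRank ?s" "aval w eRank ?s = rank k"
        using eRank[of ?s] J k by (auto simp: J_def)
      have rk: "rank k < length var_list" "var_list ! rank k = w ! k" using rank[OF k True] by auto
      \<comment> \<open>Different first positions carry different variables, hence different ranks,
        so no entry is overwritten.\<close>
      have rn: "rank j' \<noteq> rank k" if "j' < k" "canonical j'" for j'
        using rank[of j'] that k rk True by (auto simp: canonical_def)
      have b: "2 * rank k + 1 \<le> B" using rk length_vs B2 by linarith
      let ?h = "(heap s')((10, 2 * rank k, 0, 0) := k, (10, 2 * rank k + 1, 0, 0) := k,
         (11, 2 * rank k, 0, 0) := 1, (11, 2 * rank k + 1, 0, 0) := 2)"
      have e2: "(\<forall>e<2. P e) \<longleftrightarrow> P 0 \<and> P (Suc 0)" for P :: "nat \<Rightarrow> bool"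
        by (auto simp: less_2_cases_iff)
      have d: "2 * rank j' \<noteq> 2 * rank k + 1" "2 * rank j' + 1 \<noteq> 2 * rank k" for j' by presburger+
      have old: "?h (i, 2 * rank j' + e, 0, 0) = heap s' (i, 2 * rank j' + e, 0, 0)" if "j' < k" "canonical j'" "e < 2" for i j' e
        using rn[OF that(1,2)] that(3) by (auto simp: less_2_cases_iff)
      have "J (Suc k) (s'\<lparr>regs := (regs s')(rJ := k, rX := rank k), heap := ?h\<rparr>)"
        unfolding J_def
      proof (intro conjI)
        show "\<forall>j'<Suc k. canonical j' \<longrightarrow> (\<forall>e<2.
          heap (s'\<lparr>regs := (regs s')(rJ := k, rX := rank k), heap := ?h\<rparr>) (10, 2 * rank j' + e, 0, 0) < n \<and>
          w ! heap (s'\<lparr>regs := (regs s')(rJ := k, rX := rank k), heap := ?h\<rparr>) (10, 2 * rank j' + e, 0, 0) = w ! j' \<and>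
          heap (s'\<lparr>regs := (regs s')(rJ := k, rX := rank k), heap := ?h\<rparr>) (11, 2 * rank j' + e, 0, 0) = e + 1)"
        proof (intro allI impI)
          fix j' e :: nat assume a: "j' < Suc k" "canonical j'" "e < 2"
          show "heap (s'\<lparr>regs := (regs s')(rJ := k, rX := rank k), heap := ?h\<rparr>) (10, 2 * rank j' + e, 0, 0) < n \<and>
          w ! heap (s'\<lparr>regs := (regs s')(rJ := k, rX := rank k), heap := ?h\<rparr>) (10, 2 * rank j' + e, 0, 0) = w ! j' \<and>
          heap (s'\<lparr>regs := (regs s')(rJ := k, rX := rank k), heap := ?h\<rparr>) (11, 2 * rank j' + e, 0, 0) = e + 1"
          proof (cases "j' = k")
            case True
            then show ?thesis using a k by (auto simp: less_2_cases_iff)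
          next
            case False
            then have "j' < k" using a by simp
            then show ?thesis using J a old[of j' e] unfolding J_def by (simp del: fun_upd_apply)
          qed
        qed
      qed (use J in \<open>auto simp: J_def stored_upd\<close>)
      then show ?thesis using True c r b by (simp add: mult_2 fun_upd_same fun_upd_other del: fun_upd_apply)
    qed
  next
    fix s' assume "J n s'"
    then have J: "J n (setr rJ (regs s rJ) s')" by (simp add: J_def)
    let ?s = "setr rJ (regs s rJ) s'"
    have 1: "abnd w B (eCan rJ) (setr rJ k ?s)" "aval w (eCan rJ) (setr rJ k ?s) = of_bool (canonical k)" if "k < n" for k
      using eCan[of "setr rJ k ?s" rJ] J that by (auto simp: J_def)
    have sm: "(\<Sum>k<n. of_bool (canonical k) + of_bool (canonical k)) = 2 * length var_list"
    proof -
      have "(\<Sum>k<n. of_bool (canonical k)) = (\<Sum>k\<in>{j. j < n \<and> canonical j}. 1::nat)"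
        by (rule sum.mono_neutral_cong_right) auto
      then show ?thesis using length_vs(2) by (simp add: sum.distrib)
    qed
    have "ready (setr rDM (2 * length var_list) ?s)"
      unfolding ready_def
    proof (intro conjI allI impI)
      fix d assume d: "d < 2 * length var_list"
      then have "var_list ! (d div 2) \<in> var_set" using var_list(1) by (metis less_mult_imp_div_less mult.commute nth_mem)
      then have "var_list ! (d div 2) \<in> (!) w ` {j. j < n \<and> canonical j}"
        using bij_betw_imp_surj_on[OF can_bij(2)] by simp
      then obtain j where j: "j < n" "canonical j" "w ! j = var_list ! (d div 2)"
        by (metis (no_types, lifting) imageE mem_Collect_eq)
      then have "rank j = d div 2"
        using rank[of j] d var_list(3) nth_eq_iff_index_eq[of var_list "rank j" "d div 2"] by auto
      then have dj: "d = 2 * rank j + d mod 2" by simp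
      have "\<forall>e<2. heap s' (10, 2 * rank j + e, 0, 0) < n \<and> w ! heap s' (10, 2 * rank j + e, 0, 0) = w ! j \<and>
        heap s' (11, 2 * rank j + e, 0, 0) = e + 1" using J j by (simp add: J_def)
      from this[rule_format, of "d mod 2"] dj j(3)
      show "heap (setr rDM (2 * length var_list) ?s) (10, d, 0, 0) < n"
        "w ! heap (setr rDM (2 * length var_list) ?s) (10, d, 0, 0) = var_list ! (d div 2)"
        "heap (setr rDM (2 * length var_list) ?s) (11, d, 0, 0) = d mod 2 + 1" by auto
    qed (use J in \<open>simp_all add: J_def\<close>)
    then have "Q (setr rDM (2 * length var_list) ?s)"
      by (rule Q) (use J in \<open>auto simp: J_def\<close>)
    moreover have "aval w (Sum rJ Len (Plus (eCan rJ) (eCan rJ))) ?s = 2 * length var_list"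
      unfolding sm[symmetric] aval.simps by (rule sum.cong) (use 1 in \<open>simp_all del: fun_upd_apply\<close>)
    moreover have "abnd w B (Sum rJ Len (Plus (eCan rJ) (eCan rJ))) ?s"
      using 1 B2 by (simp del: fun_upd_apply)
    ultimately show "wp w B (Set rDM (Sum rJ Len (Plus (eCan rJ) (eCan rJ)))) Q ?s"
      by (simp only: wp_simps)
  qed (use B2 in simp_all)
qed

section \<open>Deciding whether an answer extends the digits already set\<close>

abbreviation "DM \<equiv> 2 * length var_list"

text \<open>The value 0 stands for an undetermined digit; no end point equals it, since positions
  are counted from 1. The index \<open>i\<close> counts letters from 0, hence
  \<open>i + 1\<close>.\<close>

definition pos_ok :: "(nat \<Rightarrow> nat) \<Rightarrow> nat \<Rightarrow> nat \<Rightarrow> bool" where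
  "pos_ok D i p \<longleftrightarrow> lab A p = Suc (code (str ! i)) \<and>
     (\<forall>k<DM. D k \<noteq> 0 \<longrightarrow> (k mod 2 + 1 \<le> status A p (var_list ! (k div 2)) \<longleftrightarrow> D k \<le> i + 1))"

definition accepts :: "(nat \<Rightarrow> nat) \<Rightarrow> bool" where
  "accepts D \<longleftrightarrow> (if l = 0 then nullable A else \<exists>p<npos A. reachable (pos_ok D) A (l - 1) p \<and> is_last A p)"

abbreviation digit :: "store \<Rightarrow> nat \<Rightarrow> nat" where
  "digit s \<equiv> \<lambda>k. heap s (12, k, 0, 0)"

lemma eOk:
  assumes r: "ready s" and i: "regs s rI < l" and p: "regs s rP < npos A"
  shows "abnd w B eOk s" "aval w eOk s = of_bool (pos_ok (digit s) (regs s rI) (regs s rP))"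
proof -
  let ?t = "regs s rTT"
  have o: "stored w (heap s) ?t A" "?t < n" using r by (auto simp: ready_def)
  have M: "regs s rM = m" "regs s rDM = DM" using r by (auto simp: ready_def)
  have b: "DM \<le> B" "n \<le> B" using length_vs B2 by auto
  have bad: "abnd w B eBad (setr rK k s)"
     "aval w eBad (setr rK k s) = 0 \<longleftrightarrow>
       (digit s k \<noteq> 0 \<longrightarrow> (k mod 2 + 1 \<le> status A (regs s rP) (var_list ! (k div 2)) \<longleftrightarrow> digit s k \<le> regs s rI + 1))"
    if "k < DM" for k
  proof -
    have t: "heap s (10, k, 0, 0) < n" "w ! heap s (10, k, 0, 0) = var_list ! (k div 2)" "heap s (11, k, 0, 0) = k mod 2 + 1"
      using r that by (auto simp: ready_def)
    have st: "heap s (7, ?t, regs s rP, heap s (10, k, 0, 0)) = status A (regs s rP) (var_list ! (k div 2))"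
      using storedD(12)[OF o(1) p t(1)] t(2) by simp
    show "abnd w B eBad (setr rK k s)"
      using t b that o(2) p A_size by (auto simp: eBad_def)
    show "aval w eBad (setr rK k s) = 0 \<longleftrightarrow>
       (digit s k \<noteq> 0 \<longrightarrow> (k mod 2 + 1 \<le> status A (regs s rP) (var_list ! (k div 2)) \<longleftrightarrow> digit s k \<le> regs s rI + 1))"
      using t st by (auto simp: eBad_def)
  qed
  have s0: "aval w (Sum rK (Var rDM) eBad) s = 0 \<longleftrightarrow> (\<forall>k<DM. digit s k \<noteq> 0 \<longrightarrow>
      (k mod 2 + 1 \<le> status A (regs s rP) (var_list ! (k div 2)) \<longleftrightarrow> digit s k \<le> regs s rI + 1))"
    unfolding aval_Sum0 using bad(2) M by simp
  have ws: "w ! (m + 1 + regs s rI) = code (str ! regs s rI)" using w_str i by simp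
  have lt: "m + 1 + regs s rI < n" using i n_eq by simp
  show "abnd w B eOk s"
    using bad(1) M b o(2) lt p A_size by (simp add: eOk_def)
  show "aval w eOk s = of_bool (pos_ok (digit s) (regs s rI) (regs s rP))"
    using s0 ws M storedD(7)[OF o(1) p] by (simp add: eOk_def pos_ok_def del: aval.simps(9))
qed

lemma ready_cong:
  "ready s \<Longrightarrow> regs s' rTT = regs s rTT \<Longrightarrow> regs s' rL = regs s rL \<Longrightarrow> regs s' rM = regs s rM \<Longrightarrow>
   regs s' rDM = regs s rDM \<Longrightarrow> (\<And>i a b c. i \<le> 11 \<Longrightarrow> heap s' (i, a, b, c) = heap s (i, a, b, c)) \<Longrightarrow> ready s'"
  unfolding ready_def stored_def by simp

definition same :: "store \<Rightarrow> (nat \<times> nat \<times> nat \<times> nat \<Rightarrow> nat) \<Rightarrow> bool" where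
  "same s h \<longleftrightarrow> (\<forall>i a b c. i \<noteq> 13 \<longrightarrow> h (i, a, b, c) = heap s (i, a, b, c))"

lemma eCur:
  assumes r: "ready s" and i: "regs s rI < l" and p: "regs s rP < npos A"
    and prev: "\<And>q. 0 < regs s rI \<Longrightarrow> q < npos A \<Longrightarrow>
      heap s (13, regs s rI - 1, q, 0) \<noteq> 0 \<longleftrightarrow> reachable (pos_ok D) A (regs s rI - 1) q"
    and D: "D = digit s"
  shows "abnd w B eCur s" "aval w eCur s \<noteq> 0 \<longleftrightarrow> reachable (pos_ok D) A (regs s rI) (regs s rP)"
proof -
  let ?t = "regs s rTT"
  have o: "stored w (heap s) ?t A" "?t < n" using r by (auto simp: ready_def)
  have b: "n \<le> B" "l \<le> B" using B2 n_eq by auto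
  note e = eOk[OF r i p, folded D]
  have sum: "aval w (Sum rQ nT (eAnd (Rd 13 (Minus (Var rI) (Lit 1)) vQ L0) (Rd 8 (Var rTT) vQ vP))) s = 0 \<longleftrightarrow>
      (\<forall>q<npos A. \<not> (heap s (13, regs s rI - 1, q, 0) \<noteq> 0 \<and> follow A q (regs s rP)))"
    unfolding aval_Sum0 using storedD[OF o(1)] p by simp
  show "abnd w B eCur s"
  proof -
    have "regs s rI - Suc 0 \<le> B" using i b by simp
    then show ?thesis using e(1) o(2) b i p A_size storedD(1)[OF o(1)] by (simp add: eCur_def)
  qed
  show "aval w eCur s \<noteq> 0 \<longleftrightarrow> reachable (pos_ok D) A (regs s rI) (regs s rP)"
  proof (cases "regs s rI")
    case 0
    then show ?thesis using e(2) storedD(8,9)[OF o(1) p] by (simp add: eCur_def)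
  next
    case (Suc j)
    have "aval w eCur s \<noteq> 0 \<longleftrightarrow> pos_ok D (regs s rI) (regs s rP) \<and>
       (\<exists>q<npos A. heap s (13, regs s rI - 1, q, 0) \<noteq> 0 \<and> follow A q (regs s rP))"
      using e(2) sum Suc unfolding eCur_def by (simp del: aval.simps(9))
    then show ?thesis using Suc prev by auto
  qed
qed

lemma wp_chk:
  assumes r: "ready s"
    and Q: "\<And>h v. same s h \<Longrightarrow> v \<noteq> 0 \<longleftrightarrow> accepts (digit s) \<Longrightarrow>
      Q (s\<lparr>heap := h, regs := (regs s)(rRes := v)\<rparr>)"
  shows "wp w B check_digits Q s"
proof -
  let ?D = "digit s" and ?t = "regs s rTT"
  have o: "stored w (heap s) ?t A" "?t < n" and L: "regs s rL = l" using r by (auto simp: ready_def)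
  have b: "n \<le> B" "l \<le> B" using B2 n_eq by auto
  define S where "S = (\<lambda>x y h. s\<lparr>regs := (regs s)(rI := x, rP := y), heap := h\<rparr>)"
  have rS: "ready (S x y h)" "digit (S x y h) = ?D" if "same s h" for x y h
    using that by (auto simp: S_def same_def intro: ready_cong[OF r])
  have N: "abnd w B nT (S x y h)" "aval w nT (S x y h) = npos A" if "same s h" for x y h
    using rS(1)[OF that, of x y] o(2) b by (auto simp: ready_def S_def storedD)
  define T where "T = (\<lambda>i (h :: nat \<times> nat \<times> nat \<times> nat \<Rightarrow> nat). \<forall>i'<i. \<forall>p<npos A. h (13, i', p, 0) \<noteq> (0::nat) \<longleftrightarrow> reachable (pos_ok ?D) A i' p)"
  define J where "J = (\<lambda>i s'. \<exists>x h. s' = S x (regs s rP) h \<and> same s h \<and> T i h)"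
  have loop: "wp w B (For rI (Var rL) (For rP nT (Put 13 (Var rI) vP L0 eCur)))
      (\<lambda>s'. \<exists>h. s' = s\<lparr>heap := h\<rparr> \<and> same s h \<and> T l h) s"
  proof (rule wp_For[where J = J and n = l])
    have "s = S (regs s rI) (regs s rP) (heap s)" by (simp add: S_def)
    then show "J 0 s" unfolding J_def by (intro exI conjI) (auto simp: same_def T_def)
  next
    fix i s' assume i: "i < l" and "J i s'"
    then obtain x h where s': "s' = S x (regs s rP) h" and h: "same s h" "T i h" unfolding J_def by blast
    have "(regs s)(rI := x, rP := regs s rP, rI := i) = (regs s)(rI := i, rP := regs s rP)" by auto
    then have e: "setr rI i s' = S i (regs s rP) h" by (simp add: s' S_def)
    define J' where "J' = (\<lambda>p s'. \<exists>y h. s' = S i y h \<and> same s h \<and> T i h \<and>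
       (\<forall>p'<p. h (13, i, p', 0) \<noteq> 0 \<longleftrightarrow> reachable (pos_ok ?D) A i p'))"
    show "wp w B (For rP nT (Put 13 (Var rI) vP L0 eCur)) (J (Suc i)) (setr rI i s')"
      unfolding e
    proof (rule wp_For[where J = J' and n = "npos A"])
      show "J' 0 (S i (regs s rP) h)" unfolding J'_def using h by blast
    next
      fix p s'' assume p: "p < npos A" and "J' p s''"
      then obtain y g where s'': "s'' = S i y g" and g: "same s g" "T i g"
         "\<forall>p'<p. g (13, i, p', 0) \<noteq> 0 \<longleftrightarrow> reachable (pos_ok ?D) A i p'" unfolding J'_def by blast
      have e: "setr rP p s'' = S i p g" by (simp add: s'' S_def)
      have rg: "regs (S i p g) rI = i" "regs (S i p g) rP = p" "heap (S i p g) = g" by (simp_all add: S_def)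
      have c: "abnd w B eCur (S i p g)" "aval w eCur (S i p g) \<noteq> 0 \<longleftrightarrow> reachable (pos_ok ?D) A i p"
      proof -
        have pr: "regs (S i p g) rI < l" "regs (S i p g) rP < npos A" "?D = digit (S i p g)"
          using i p rS(2)[OF g(1), of i p] by (simp_all only: rg)
        have pv: "heap (S i p g) (13, regs (S i p g) rI - 1, q, 0) \<noteq> 0 \<longleftrightarrow> reachable (pos_ok ?D) A (regs (S i p g) rI - 1) q"
          if "0 < regs (S i p g) rI" "q < npos A" for q
          using g(2) that unfolding rg T_def by simp
        note ec = eCur[where s = "S i p g" and D = ?D, OF rS(1)[OF g(1)] pr(1,2) pv pr(3)]
        show "abnd w B eCur (S i p g)" by (rule ec(1))
        show "aval w eCur (S i p g) \<noteq> 0 \<longleftrightarrow> reachable (pos_ok ?D) A i p" using ec(2) by (simp only: rg)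
      qed
      let ?v = "aval w eCur (S i p g)"
      have "J' (Suc p) (S i p (g((13, i, p, 0) := ?v)))"
        unfolding J'_def using g c
        by (intro exI[of _ p] exI[of _ "g((13, i, p, 0) := ?v)"]) (auto simp: same_def T_def less_Suc_eq)
      then show "wp w B (Put 13 (Var rI) vP L0 eCur) (J' (Suc p)) (setr rP p s'')"
        unfolding e using c i p b A_size by (simp add: rg) (simp add: S_def)
    next
      fix s'' assume "J' (npos A) s''"
      then obtain y g where s'': "s'' = S i y g" and g: "same s g" "T i g"
         "\<forall>p'<npos A. g (13, i, p', 0) \<noteq> 0 \<longleftrightarrow> reachable (pos_ok ?D) A i p'" unfolding J'_def by blast
      have "setr rP (regs (S i (regs s rP) h) rP) s'' = S i (regs s rP) g" by (simp add: s'' S_def)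
      moreover have "T (Suc i) g" using g(2,3) by (auto simp: T_def less_Suc_eq)
      ultimately show "J (Suc i) (setr rP (regs (S i (regs s rP) h) rP) s'')"
        unfolding J_def using g(1) by auto
    qed (use N[OF h(1)] A_size in auto)
  next
    fix s' assume "J l s'"
    then obtain x h where s': "s' = S x (regs s rP) h" and h: "same s h" "T l h" unfolding J_def by blast
    have "setr rI (regs s rI) s' = s\<lparr>heap := h\<rparr>"
    proof -
      have "(regs s)(rI := x, rP := regs s rP, rI := regs s rI) = regs s" by auto
      then show ?thesis by (simp add: s' S_def)
    qed
    then show "\<exists>h. setr rI (regs s rI) s' = s\<lparr>heap := h\<rparr> \<and> same s h \<and> T l h" using h by blast
  qed (use L b in simp_all)
  show ?thesis
    unfolding check_digits_def wp_simps(4)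
  proof (rule wp_mono[OF loop], elim exE conjE)
    fix s' h assume s': "s' = s\<lparr>heap := h\<rparr>" and h: "same s h" "T l h"
    have rh: "ready s'" using rS(1)[OF h(1), of "regs s rI" "regs s rP"] by (simp add: s' S_def)
    then have oh: "stored w (heap s') ?t A" by (simp add: ready_def s')
    let ?e = "Ite (Var rL) (Sum rQ nT (eAnd (Rd 13 (Minus (Var rL) (Lit 1)) vQ L0) (Rd 6 (Var rTT) vQ L0))) (Rd 1 (Var rTT) L0 L0)"
    have sum: "aval w (Sum rQ nT (eAnd (Rd 13 (Minus (Var rL) (Lit 1)) vQ L0) (Rd 6 (Var rTT) vQ L0))) s' = 0 \<longleftrightarrow>
        (\<forall>q<npos A. \<not> (h (13, l - 1, q, 0) \<noteq> 0 \<and> is_last A q))"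
      unfolding aval_Sum0 using storedD[OF oh] L by (simp add: s')
    have "l - Suc 0 \<le> B" using b by simp
    then have "abnd w B ?e s'"
      using storedD(1)[OF oh] L b o(2) A_size by (simp add: s')
    moreover have "aval w ?e s' \<noteq> 0 \<longleftrightarrow> accepts ?D"
    proof (cases "l = 0")
      case True
      have "accepts ?D \<longleftrightarrow> nullable A" by (simp only: accepts_def True simp_thms if_True)
      moreover have "regs s rL = 0" using L True by (rule trans)
      ultimately show ?thesis using storedD(2,3)[OF oh] by (simp add: s')
    next
      case False
      then have "aval w ?e s' \<noteq> 0 \<longleftrightarrow> (\<exists>q<npos A. h (13, l - 1, q, 0) \<noteq> 0 \<and> is_last A q)"
        using sum L by (simp add: s' del: aval.simps(9))
      also have "\<dots> \<longleftrightarrow> accepts ?D"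
        using False h(2) by (auto simp: accepts_def T_def)
      finally show ?thesis .
    qed
    ultimately show "wp w B (Set rRes ?e) Q s'"
      using Q[OF h(1)] by (simp add: s' del: aval.simps abnd.simps)
  qed
qed

section \<open>Digits of answers\<close>

definition sem :: "tuple set" where "sem = rep_sem q str"

definition digits :: "tuple \<Rightarrow> nat list" where
  "digits \<mu> = map (\<lambda>k. (if k mod 2 = 0 then fst else snd) (the (\<mu> (var_list ! (k div 2))))) [0..<DM]"

definition answers :: "nat list set" where "answers = digits ` sem"

lemma sem_wft: "\<mu> \<in> sem \<Longrightarrow> wf_tuple (rep_vars q) str \<mu>"
  using rep_sem_wft reg by (auto simp: sem_def)

text \<open>An answer excludes the case that \<open>nonempty\<close> fails, so \<open>marks\<close>
  reveals the scope; and no variable is missed, since each is written in the input.\<close>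

lemma Vs_sem: "sem \<noteq> {} \<Longrightarrow> var_set = rep_vars q"
proof -
  assume "sem \<noteq> {}"
  then have "marks A x \<noteq> 0 \<longleftrightarrow> x \<in> rep_vars q" for x
    using A_correct q_sub by (auto simp: sem_def)
  moreover have "rep_vars q \<subseteq> set w" using rep_vars_enc[of q code] q_sub by auto
  ultimately show ?thesis unfolding var_set_def by (auto simp: in_set_conv_nth) (metis in_set_conv_nth subsetD)
qed

lemma digs_nth: "k < DM \<Longrightarrow> digits \<mu> ! k = (if k mod 2 = 0 then fst else snd) (the (\<mu> (var_list ! (k div 2))))"
  by (simp add: digits_def)

lemma length_digs [simp]: "length (digits \<mu>) = DM"
  by (simp add: digits_def)

lemma vs_div: "k < DM \<Longrightarrow> var_list ! (k div 2) \<in> var_set"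
  using var_list(1) by (metis less_mult_imp_div_less mult.commute nth_mem)

lemma sem_digit:
  assumes "\<mu> \<in> sem" "k < DM"
  shows "1 \<le> digits \<mu> ! k" "digits \<mu> ! k \<le> l + 1"
    "k mod 2 + 1 \<le> tuple_status \<mu> i (var_list ! (k div 2)) \<longleftrightarrow> digits \<mu> ! k \<le> i"
proof -
  have "var_list ! (k div 2) \<in> dom \<mu>"
    using vs_div[OF assms(2)] Vs_sem sem_wft[OF assms(1)] assms(1) by (auto simp: wf_tuple_def)
  then obtain a b where ab: "\<mu> (var_list ! (k div 2)) = Some (a, b)" by auto
  then have r: "1 \<le> a" "a \<le> b" "b \<le> l + 1" using sem_wft[OF assms(1)] by (auto simp: wf_tuple_def)
  show "1 \<le> digits \<mu> ! k" "digits \<mu> ! k \<le> l + 1" "k mod 2 + 1 \<le> tuple_status \<mu> i (var_list ! (k div 2)) \<longleftrightarrow> digits \<mu> ! k \<le> i"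
    using r ab by (auto simp: digs_nth[OF assms(2)] tuple_status_def)
qed

text \<open>Accepting runs over the string correspond to answers through their status words, and the
  test at a position compares thresholds with the letter. What remains is that these comparisons
  already fix the digits.\<close>

lemma accepts_iff:
  assumes "\<And>k. k < DM \<Longrightarrow> D k \<le> l + 1"
  shows "accepts D \<longleftrightarrow> (\<exists>a\<in>answers. \<forall>k<DM. D k \<noteq> 0 \<longrightarrow> a ! k = D k)"
proof -
  have status_words: "status_words code A str = tuple_word str ` sem" using A_correct q_sub by (auto simp: sem_def)
  have "accepts D \<longleftrightarrow> (\<exists>ps. accepted A ps \<and> length ps = l \<and> (\<forall>i<l. pos_ok D i (ps ! i)))"
    unfolding accepts_def by (rule accept_path)
  also have "\<dots> \<longleftrightarrow> (\<exists>fs\<in>status_words code A str. \<forall>i<l. \<forall>k<DM. D k \<noteq> 0 \<longrightarrow> (k mod 2 + 1 \<le> (fs ! i) (var_list ! (k div 2)) \<longleftrightarrow> D k \<le> i + 1))"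
    (is "?L \<longleftrightarrow> ?R")
  proof
    assume ?L
    then obtain ps where ps: "accepted A ps" "length ps = l" "\<forall>i<l. pos_ok D i (ps ! i)" by blast
    have "map fst (word A ps) = map (\<lambda>a. Suc (code a)) str"
      by (rule nth_equalityI) (use ps in \<open>auto simp: word_def pos_ok_def\<close>)
    then have "map snd (word A ps) \<in> status_words code A str" using ps by (auto simp: status_words_def lang_def)
    moreover have "(map snd (word A ps) ! i) = status A (ps ! i)" if "i < l" for i using that ps by (simp add: word_def)
    ultimately show ?R using ps(3) by (auto simp: pos_ok_def intro!: bexI[of _ "map snd (word A ps)"])
  next
    assume ?R
    then obtain fs where fs: "fs \<in> status_words code A str" "\<forall>i<l. \<forall>k<DM. D k \<noteq> 0 \<longrightarrow> (k mod 2 + 1 \<le> (fs ! i) (var_list ! (k div 2)) \<longleftrightarrow> D k \<le> i + 1)"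
      by blast
    then obtain ps where ps: "accepted A ps" "fs = map snd (word A ps)" "map fst (word A ps) = map (\<lambda>a. Suc (code a)) str"
      by (auto simp: status_words_def lang_def)
    have len: "length ps = l" using arg_cong[OF ps(3), of length] by (simp add: word_def)
    have "lab A (ps ! i) = Suc (code (str ! i))" "fs ! i = status A (ps ! i)" if "i < l" for i
      using arg_cong[OF ps(3), of "\<lambda>xs. xs ! i"] that len by (auto simp: word_def ps(2))
    then have "\<forall>i<l. pos_ok D i (ps ! i)" using fs(2) by (auto simp: pos_ok_def)
    then show ?L using ps len by blast
  qed
  also have "\<dots> \<longleftrightarrow> (\<exists>\<mu>\<in>sem. \<forall>i<l. \<forall>k<DM. D k \<noteq> 0 \<longrightarrow> (digits \<mu> ! k \<le> Suc i \<longleftrightarrow> D k \<le> Suc i))"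
    unfolding status_words using sem_digit(3) by (auto simp: nth_stw)
  \<comment> \<open>Both numbers lie between 1 and \<open>l + 1\<close>; this is where the
    hypothesis on \<open>D\<close> enters.\<close>
  also have "\<dots> \<longleftrightarrow> (\<exists>\<mu>\<in>sem. \<forall>k<DM. D k \<noteq> 0 \<longrightarrow> digits \<mu> ! k = D k)"
  proof (rule bex_cong[OF refl])
    fix \<mu> assume mu: "\<mu> \<in> sem"
    have "digits \<mu> ! k = D k" if k: "k < DM" "D k \<noteq> 0" and a: "\<forall>i<l. digits \<mu> ! k \<le> Suc i \<longleftrightarrow> D k \<le> Suc i" for k
    proof (rule thr_eq[of l])
      fix i assume "1 \<le> i" "i \<le> l"
      then show "digits \<mu> ! k \<le> i \<longleftrightarrow> D k \<le> i" using a[rule_format, of "i - 1"] by simp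
    qed (use sem_digit(1,2)[OF mu k(1)] assms[OF k(1)] k(2) in auto)
    then show "(\<forall>i<l. \<forall>k<DM. D k \<noteq> 0 \<longrightarrow> (digits \<mu> ! k \<le> Suc i \<longleftrightarrow> D k \<le> Suc i)) \<longleftrightarrow>
        (\<forall>k<DM. D k \<noteq> 0 \<longrightarrow> digits \<mu> ! k = D k)" by auto
  qed
  finally show ?thesis by (auto simp: answers_def)
qed

text \<open>All answers have the same domain, so their digits determine them; hence enumerating
  digit lists without repetition enumerates tuples without repetition.\<close>

lemma digs_inj: "inj_on digits sem"
proof (rule inj_onI)
  fix \<mu> \<nu> assume a: "\<mu> \<in> sem" "\<nu> \<in> sem" "digits \<mu> = digits \<nu>"
  have d: "dom \<mu> = var_set" "dom \<nu> = var_set" using a sem_wft Vs_sem by (auto simp: wf_tuple_def)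
  show "\<mu> = \<nu>"
  proof
    fix x
    show "\<mu> x = \<nu> x"
    proof (cases "x \<in> var_set")
      case True
      then obtain i where i: "i < length var_list" "var_list ! i = x" using var_list(1) by (metis in_set_conv_nth)
      have "digits \<mu> ! (2 * i) = digits \<nu> ! (2 * i)" "digits \<mu> ! (2 * i + 1) = digits \<nu> ! (2 * i + 1)" using a(3) by auto
      then have "the (\<mu> x) = the (\<nu> x)" using i by (simp add: digs_nth prod_eq_iff)
      then show ?thesis using True d by (metis domD option.sel)
    next
      case False
      then show ?thesis using d by (metis domIff)
    qed
  qed
qed

lemma enc_tuple_digs:
  assumes "\<mu> \<in> sem"
  shows "enc_tuple \<mu> = concat (map (\<lambda>i. [var_list ! i, digits \<mu> ! (2 * i), digits \<mu> ! (2 * i + 1)]) [0..<length var_list])"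
proof -
  have "dom \<mu> = var_set" using assms sem_wft Vs_sem by (auto simp: wf_tuple_def)
  then have "sorted_list_of_set (dom \<mu>) = map ((!) var_list) [0..<length var_list]" unfolding map_nth by (simp add: var_list_def)
  then have "enc_tuple \<mu> = concat (map (\<lambda>i. [var_list ! i, fst (the (\<mu> (var_list ! i))), snd (the (\<mu> (var_list ! i)))]) [0..<length var_list])"
    by (simp add: enc_tuple_def o_def)
  also have "\<dots> = concat (map (\<lambda>i. [var_list ! i, digits \<mu> ! (2 * i), digits \<mu> ! (2 * i + 1)]) [0..<length var_list])"
    by (rule arg_cong[of _ _ concat], rule map_cong) (auto simp: digs_nth)
  finally show ?thesis .
qed

lemma Ans_props: "a \<in> answers \<Longrightarrow> length a = DM" "a \<in> answers \<Longrightarrow> k < DM \<Longrightarrow> 1 \<le> a ! k \<and> a ! k \<le> l + 1" "finite answers"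
proof -
  show "a \<in> answers \<Longrightarrow> length a = DM" by (auto simp: answers_def)
  show *: "1 \<le> a ! k \<and> a ! k \<le> l + 1" if "a \<in> answers" "k < DM" for a k
    using sem_digit(1,2)[OF _ that(2)] that(1) by (auto simp: answers_def)
  have "answers \<subseteq> {xs. set xs \<subseteq> {..l + 1} \<and> length xs = DM}"
  proof
    fix a assume a: "a \<in> answers"
    then have "length a = DM" by (auto simp: answers_def)
    moreover from this have "set a \<subseteq> {..l + 1}" using *[OF a] by (auto simp: in_set_conv_nth)
    ultimately show "a \<in> {xs. set xs \<subseteq> {..l + 1} \<and> length xs = DM}" by simp
  qed
  then show "finite answers" by (rule finite_subset) (rule finite_lists_length_eq, simp)
qed

end

section \<open>Lexicographic backtracking over the digits\<close>

abbreviation "dJ r \<equiv> Rd 12 (Var r) L0 L0"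

text \<open>A failed value is undone at once, so outside of a test the digits set always have an
  extension to an answer.\<close>

definition try_digit :: "nat \<Rightarrow> com \<Rightarrow> com" where
  "try_digit r c = Seq (Put 12 (Var r) L0 L0 (Plus (Var rV) (Lit 1)))
     (Seq check_digits (If (Var rRes) c (Put 12 (Var r) L0 L0 L0)))"

text \<open>A digit that has been set is nonzero and is skipped. Hence each open digit keeps the
  least value that works, and the digits of a given prefix stay untouched.\<close>

definition complete_digits :: com where
  "complete_digits = For rJ (Var rDM) (For rV (Plus (Var rL) (Lit 1)) (If (dJ rJ) Skip (try_digit rJ Skip)))"

text \<open>Digits are erased from the last one backwards, looking each time for the least larger
  value with an extension. The first success keeps the longest possible prefix of the current answer
  and therefore leads to its lexicographic successor.\<close>

definition search_next :: com where
  "search_next = Seq (Set rFlag L0) (For rW (Var rDM) (If (Var rFlag) Skip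
     (Seq (Set rX (Minus (Minus (Var rDM) (Lit 1)) (Var rW)))
     (Seq (Set rOld (dJ rX))
     (Seq (Put 12 (Var rX) L0 L0 L0)
       (For rV (Plus (Var rL) (Lit 1)) (If (eAnd (eNot (Var rFlag)) (eLt (Var rOld) (Plus (Var rV) (Lit 1))))
         (try_digit rX (Set rFlag (Lit 1))) Skip)))))))"

text \<open>Threshold 1 marks the start of a span, in front of which the variable is
  written.\<close>

definition write_answer :: com where
  "write_answer = For rJ (Var rDM) (Seq (If (eEq (Rd 11 (Var rJ) L0 L0) (Lit 1)) (Out (Inp (Rd 10 (Var rJ) L0 L0))) Skip) (Out (dJ rJ)))"

context enum_input
begin

definition holds_digits :: "nat list \<Rightarrow> store \<Rightarrow> (nat \<Rightarrow> nat) \<Rightarrow> bool" where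
  "holds_digits ob s D \<longleftrightarrow> ready s \<and> obuf s = ob \<and> (\<forall>k<DM. digit s k = D k)"

definition matches :: "(nat \<Rightarrow> nat) \<Rightarrow> nat list \<Rightarrow> bool" where
  "matches D a \<longleftrightarrow> (\<forall>k<DM. D k \<noteq> 0 \<longrightarrow> a ! k = D k)"

definition extendable :: "(nat \<Rightarrow> nat) \<Rightarrow> bool" where
  "extendable D \<longleftrightarrow> (\<exists>a\<in>answers. matches D a)"

text \<open>For an answer \<open>b\<close> this means that \<open>b\<close> lies beyond every answer
  matching \<open>D\<close>: the digits of \<open>D\<close> before \<open>k0\<close> are determined,
  since those of \<open>b\<close> are positive.\<close>

definition digits_below :: "(nat \<Rightarrow> nat) \<Rightarrow> nat list \<Rightarrow> bool" where
  "digits_below D b \<longleftrightarrow> (\<exists>k0<DM. (\<forall>k<k0. b ! k = D k) \<and> D k0 \<noteq> 0 \<and> D k0 < b ! k0)"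

definition lex_less :: "nat list \<Rightarrow> nat list \<Rightarrow> bool" where
  "lex_less a b \<longleftrightarrow> (\<exists>j<DM. (\<forall>k<j. a ! k = b ! k) \<and> a ! j < b ! j)"

lemma bB: "DM \<le> B" "l + 1 \<le> B" "n \<le> B"
  using length_vs B2 n_eq by auto

lemma stt_regs: "holds_digits ob s D \<Longrightarrow> r \<noteq> rTT \<Longrightarrow> r \<noteq> rL \<Longrightarrow> r \<noteq> rM \<Longrightarrow> r \<noteq> rDM \<Longrightarrow> holds_digits ob (setr r x s) D"
  unfolding holds_digits_def by (auto intro: ready_cong)

lemma stt_put: "holds_digits ob s D \<Longrightarrow> holds_digits ob (s\<lparr>heap := (heap s)((12, j, 0, 0) := x)\<rparr>) (D(j := x))"
  unfolding holds_digits_def by (auto intro: ready_cong)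

lemma stt_ext: "holds_digits ob s D \<Longrightarrow> (\<And>k. k < DM \<Longrightarrow> D k = D' k) \<Longrightarrow> holds_digits ob s D'"
  unfolding holds_digits_def by auto

lemma sttD: "holds_digits ob s D \<Longrightarrow> regs s rL = l" "holds_digits ob s D \<Longrightarrow> regs s rDM = DM" "holds_digits ob s D \<Longrightarrow> k < DM \<Longrightarrow> digit s k = D k"
  unfolding holds_digits_def ready_def by auto

lemma wp_chk':
  assumes s: "holds_digits ob s D" and D: "\<And>k. k < DM \<Longrightarrow> D k \<le> l + 1"
    and Q: "\<And>s' v. holds_digits ob s' D \<Longrightarrow> regs s' = (regs s)(rRes := v) \<Longrightarrow> v \<noteq> 0 \<longleftrightarrow> extendable D \<Longrightarrow> Q s'"
  shows "wp w B check_digits Q s"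
proof (rule wp_chk)
  show "ready s" using s by (simp add: holds_digits_def)
  fix h and v :: nat assume h: "same s h" and v: "v \<noteq> 0 \<longleftrightarrow> accepts (digit s)"
  have "accepts (digit s) \<longleftrightarrow> (\<exists>a\<in>answers. \<forall>k<DM. digit s k \<noteq> 0 \<longrightarrow> a ! k = digit s k)"
    by (rule accepts_iff) (use s D in \<open>auto simp: holds_digits_def\<close>)
  also have "\<dots> \<longleftrightarrow> extendable D" using s by (auto simp: holds_digits_def extendable_def matches_def)
  finally show "Q (s\<lparr>heap := h, regs := (regs s)(rRes := v)\<rparr>)"
    using v by (intro Q[of _ v]) (use s h in \<open>auto simp: holds_digits_def same_def intro: ready_cong\<close>)
qed

lemma wp_try:
  assumes s: "holds_digits ob s D" "regs s r = j" "regs s rV = v" "j < DM" "v < l + 1" "D j = 0" "r \<noteq> rRes"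
    and D: "\<And>k. k < DM \<Longrightarrow> D k \<le> l + 1"
    and yes: "\<And>s' u. holds_digits ob s' (D(j := v + 1)) \<Longrightarrow> regs s' = (regs s)(rRes := u) \<Longrightarrow> extendable (D(j := v + 1)) \<Longrightarrow> wp w B c Q s'"
    and no: "\<And>s' u. holds_digits ob s' D \<Longrightarrow> regs s' = (regs s)(rRes := u) \<Longrightarrow> \<not> extendable (D(j := v + 1)) \<Longrightarrow> Q s'"
  shows "wp w B (try_digit r c) Q s"
proof -
  have jB: "j \<le> B" using s(4) bB by simp
  have "wp w B check_digits (wp w B (If (Var rRes) c (Put 12 (Var r) L0 L0 L0)) Q) (s\<lparr>heap := (heap s)((12, j, 0, 0) := v + 1)\<rparr>)"
  proof (rule wp_chk'[OF stt_put[OF s(1)]])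
    show "(D(j := v + 1)) k \<le> l + 1" if "k < DM" for k using D that s(5) by simp
  next
    fix s' u assume s': "holds_digits ob s' (D(j := v + 1))"
      "regs s' = (regs (s\<lparr>heap := (heap s)((12, j, 0, 0) := v + 1)\<rparr>))(rRes := u)" "u \<noteq> 0 \<longleftrightarrow> extendable (D(j := v + 1))"
    show "wp w B (If (Var rRes) c (Put 12 (Var r) L0 L0 L0)) Q s'"
    proof (cases "u \<noteq> 0")
      case True
      then show ?thesis using yes[OF s'(1), of u] s' by simp
    next
      case False
      let ?s = "s'\<lparr>heap := (heap s')((12, j, 0, 0) := 0)\<rparr>"
      have "holds_digits ob ?s D"
        by (rule stt_ext[OF stt_put[OF s'(1)]]) (use s(6) in auto)
      then have "Q ?s" using s' False by (intro no[of _ u]) auto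
      then show ?thesis using False s' s(2,7) jB by simp
    qed
  qed
  then show ?thesis
    unfolding try_digit_def using s jB by simp
qed

lemma mt_upd: "matches D b \<Longrightarrow> b ! j = x \<Longrightarrow> matches (D(j := x)) b"
  unfolding matches_def by auto

text \<open>Greedy completion finds the least matching answer. Each further digit gets the least
  value that still has an extension, and since an extension always exists, no choice is ever
  revised. \<open>j0\<close> says that the digits already set form a prefix.\<close>

lemma wp_complete:
  assumes s: "holds_digits ob s D" and D: "\<And>k. k < DM \<Longrightarrow> D k \<le> l + 1" and ED: "extendable D"
    and j0: "\<And>k. k < DM \<Longrightarrow> D k \<noteq> 0 \<longleftrightarrow> k < j0"
    and Q: "\<And>s' a. holds_digits ob s' ((!) a) \<Longrightarrow> a \<in> answers \<Longrightarrow> matches D a \<Longrightarrow> (\<And>b. b \<in> answers \<Longrightarrow> matches D b \<Longrightarrow> b = a \<or> lex_less a b) \<Longrightarrow>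
      regs s' rFlag = regs s rFlag \<Longrightarrow> Q s'"
  shows "wp w B complete_digits Q s"
proof -
  \<comment> \<open>The last conjunct carries minimality: an answer that no longer matches already
    lies beyond all those that still do.\<close>
  define G where "G = (\<lambda>j D'. (\<forall>k<DM. D' k \<le> l + 1) \<and> extendable D' \<and> (\<forall>k<DM. D' k \<noteq> 0 \<longleftrightarrow> k < max j j0) \<and>
      (\<forall>k<DM. D k \<noteq> 0 \<longrightarrow> D' k = D k) \<and> (\<forall>b\<in>answers. matches D b \<longrightarrow> matches D' b \<or> digits_below D' b))"
  define J where "J = (\<lambda>j s'. \<exists>D'. holds_digits ob s' D' \<and> G j D' \<and> regs s' rFlag = regs s rFlag)"
  show ?thesis
    unfolding complete_digits_def
  proof (rule wp_For[where J = J and n = DM])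
    have "G 0 D" using D ED j0 by (auto simp: G_def)
    then show "J 0 s" unfolding J_def using s by blast
  next
    fix j s' assume j: "j < DM" and "J j s'"
    then obtain D' where s': "holds_digits ob s' D'" "regs s' rFlag = regs s rFlag" and G: "G j D'" unfolding J_def by blast
    have D': "D' k \<le> l + 1" "D' k \<noteq> 0 \<longleftrightarrow> k < max j j0" "D k \<noteq> 0 \<Longrightarrow> D' k = D k" if "k < DM" for k
      using G that by (auto simp: G_def)
    have ED': "extendable D'" and LB: "\<And>b. b \<in> answers \<Longrightarrow> matches D b \<Longrightarrow> matches D' b \<or> digits_below D' b" using G by (auto simp: G_def)
    \<comment> \<open>Either nothing has been changed, digit \<open>j\<close> being given in advance
      or all values up to \<open>v\<close> having failed, or the digit was set to a value
      \<open>u\<close> that no matching answer undercuts.\<close>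
    define K where "K = (\<lambda>v s''. regs s'' rFlag = regs s rFlag \<and> regs s'' rJ = j \<and>
       (holds_digits ob s'' D' \<and> (D' j \<noteq> 0 \<or> (\<forall>b\<in>answers. matches D' b \<longrightarrow> v < b ! j)) \<or>
       (\<exists>u. holds_digits ob s'' (D'(j := u)) \<and> D' j = 0 \<and> 1 \<le> u \<and> u \<le> l + 1 \<and> extendable (D'(j := u)) \<and> (\<forall>b\<in>answers. matches D' b \<longrightarrow> u \<le> b ! j))))"
    show "wp w B (For rV (Plus (Var rL) (Lit 1)) (If (dJ rJ) Skip (try_digit rJ Skip))) (J (Suc j)) (setr rJ j s')"
    proof (rule wp_For[where J = K and n = "l + 1"])
      have "holds_digits ob (setr rJ j s') D'" using s' by (intro stt_regs) auto
      moreover have "\<forall>b\<in>answers. matches D' b \<longrightarrow> 0 < b ! j" using Ans_props(2) j by force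
      ultimately show "K 0 (setr rJ j s')" using s' unfolding K_def by simp
    next
      fix v s'' assume v: "v < l + 1" and K: "K v s''"
      let ?s = "setr rV v s''"
      have r: "regs ?s rFlag = regs s rFlag" "regs ?s rJ = j" using K by (auto simp: K_def)
      have jB: "j \<le> B" using j bB by simp
      show "wp w B (If (dJ rJ) Skip (try_digit rJ Skip)) (K (Suc v)) ?s"
      proof (cases "digit s'' j = 0")
        case False
        have "K (Suc v) ?s"
        proof (cases "holds_digits ob s'' D' \<and> (D' j \<noteq> 0 \<or> (\<forall>b\<in>answers. matches D' b \<longrightarrow> v < b ! j))")
          case True
          then have "D' j \<noteq> 0" "holds_digits ob ?s D'" using False sttD(3)[of ob s'' D' j] j by (auto intro: stt_regs)
          then show ?thesis using r unfolding K_def by blast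
        next
          case False
          then obtain u where "holds_digits ob s'' (D'(j := u)) \<and> D' j = 0 \<and> 1 \<le> u \<and> u \<le> l + 1 \<and> extendable (D'(j := u)) \<and> (\<forall>b\<in>answers. matches D' b \<longrightarrow> u \<le> b ! j)"
            using K unfolding K_def by blast
          moreover from this have "holds_digits ob ?s (D'(j := u))" by (intro stt_regs) auto
          ultimately show ?thesis using r unfolding K_def by blast
        qed
        then show ?thesis using False r jB by simp
      next
        case True
        have d: "holds_digits ob s'' D'" "D' j = 0" "\<forall>b\<in>answers. matches D' b \<longrightarrow> v < b ! j"
        proof -
          have "\<not> (\<exists>u. holds_digits ob s'' (D'(j := u)) \<and> 1 \<le> u)"
            using sttD(3)[OF _ j, of ob s''] True by fastforce
          then have *: "holds_digits ob s'' D' \<and> (D' j \<noteq> 0 \<or> (\<forall>b\<in>answers. matches D' b \<longrightarrow> v < b ! j))" using K unfolding K_def by blast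
          then show "holds_digits ob s'' D'" by blast
          show "D' j = 0" using sttD(3)[OF _ j, of ob s'' D'] True * by auto
          then show "\<forall>b\<in>answers. matches D' b \<longrightarrow> v < b ! j" using * by blast
        qed
        have "wp w B (try_digit rJ Skip) (K (Suc v)) ?s"
        proof (rule wp_try[where D = D' and j = j and v = v and ob = ob])
          show "holds_digits ob ?s D'" using d by (intro stt_regs) auto
        next
          fix s3 u assume a: "holds_digits ob s3 (D'(j := v + 1))" "regs s3 = (regs ?s)(rRes := u)" "extendable (D'(j := v + 1))"
          have "\<forall>b\<in>answers. matches D' b \<longrightarrow> v + 1 \<le> b ! j" using d(3) by auto
          then show "wp w B Skip (K (Suc v)) s3"
            using a d(2) v r unfolding K_def wp_simps by (intro conjI disjI2 exI[of _ "v + 1"]) auto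
        next
          fix s3 u assume a: "holds_digits ob s3 D'" "regs s3 = (regs ?s)(rRes := u)" "\<not> extendable (D'(j := v + 1))"
          have "Suc v < b ! j" if "b \<in> answers" "matches D' b" for b
          proof -
            have "b ! j \<noteq> v + 1" using a(3) mt_upd[OF that(2), of j "v + 1"] that(1) unfolding extendable_def by blast
            then show ?thesis using d(3) that by fastforce
          qed
          then show "K (Suc v) s3" using a r unfolding K_def by auto
        qed (use D' d j v r in auto)
        then show ?thesis using True r jB by simp
      qed
    next
      fix s'' assume K: "K (l + 1) s''"
      let ?s = "setr rV (regs (setr rJ j s') rV) s''"
      have r: "regs ?s rFlag = regs s rFlag" using K by (auto simp: K_def)
      show "J (Suc j) ?s"
      proof (cases "holds_digits ob s'' D' \<and> (D' j \<noteq> 0 \<or> (\<forall>b\<in>answers. matches D' b \<longrightarrow> l + 1 < b ! j))")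
        case True
        then have st: "holds_digits ob ?s D'" by (intro stt_regs) auto
        \<comment> \<open>The digit cannot have stayed open: the extension that is known to exist
          would have a digit above \<open>l + 1\<close>.\<close>
        obtain a where "a \<in> answers" "matches D' a" using ED' by (auto simp: extendable_def)
        then have "\<not> l + 1 < a ! j" using Ans_props(2)[of a j] j by auto
        then have "D' j \<noteq> 0" using True \<open>a \<in> answers\<close> \<open>matches D' a\<close> by blast
        then have "max (Suc j) j0 = max j j0" using D'(2)[OF j] by auto
        then have "G (Suc j) D'" using G by (simp add: G_def)
        then show ?thesis using st r unfolding J_def by blast
      next
        case False
        then obtain u where u: "holds_digits ob s'' (D'(j := u))" "D' j = 0" "1 \<le> u" "u \<le> l + 1" "extendable (D'(j := u))"
            "\<forall>b\<in>answers. matches D' b \<longrightarrow> u \<le> b ! j"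
          using K unfolding K_def by blast
        have st: "holds_digits ob ?s (D'(j := u))" using u(1) by (intro stt_regs) auto
        have jm: "j0 \<le> j" using D'(2)[OF j] u(2) by auto
        have LB': "matches (D'(j := u)) b \<or> digits_below (D'(j := u)) b" if b: "b \<in> answers" "matches D b" for b
          using LB[OF b]
        proof
          assume m: "matches D' b"
          show ?thesis
          proof (cases "b ! j = u")
            case True then show ?thesis using mt_upd[OF m] by blast
          next
            case False
            then have "u < b ! j" using u(6) b m by fastforce
            moreover have "\<forall>k<j. b ! k = (D'(j := u)) k" using m j D'(2) by (auto simp: matches_def)
            ultimately show ?thesis using u(3) j unfolding digits_below_def by (intro disjI2 exI[of _ j]) auto
          qed
        next
          assume "digits_below D' b"
          then obtain k0 where k0: "k0 < DM" "\<forall>k<k0. b ! k = D' k" "D' k0 \<noteq> 0" "D' k0 < b ! k0" unfolding digits_below_def by blast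
          then have "k0 < j" using D'(2)[OF k0(1)] jm by auto
          then show ?thesis using k0 unfolding digits_below_def by (intro disjI2 exI[of _ k0]) auto
        qed
        have z: "D k \<noteq> 0 \<Longrightarrow> k < DM \<Longrightarrow> k \<noteq> j" for k using D'(3)[of k] u(2) by auto
        have "G (Suc j) (D'(j := u))"
          unfolding G_def using D' u(3-5) LB' jm z by (auto simp: less_Suc_eq max_def)
        then show ?thesis using st r unfolding J_def by blast
      qed
    qed (use sttD(1)[OF s'(1)] bB in auto)
  next
    fix s' assume "J DM s'"
    then obtain D' where s': "holds_digits ob s' D'" "regs s' rFlag = regs s rFlag" and G: "G DM D'" unfolding J_def by blast
    have nz: "D' k \<noteq> 0" if "k < DM" for k using G that by (auto simp: G_def)
    obtain a where a: "a \<in> answers" "matches D' a" using G by (auto simp: G_def extendable_def)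
    have aD: "a ! k = D' k" if "k < DM" for k using a(2) nz that by (auto simp: matches_def)
    show "Q (setr rJ (regs s rJ) s')"
    proof (rule Q)
      show "holds_digits ob (setr rJ (regs s rJ) s') ((!) a)"
        by (rule stt_ext[OF stt_regs[OF s'(1)]]) (use aD in auto)
      show "a \<in> answers" by fact
      show "matches D a" using G aD by (auto simp: G_def matches_def)
      fix b assume b: "b \<in> answers" "matches D b"
      then have "matches D' b \<or> digits_below D' b" using G by (auto simp: G_def)
      then show "b = a \<or> lex_less a b"
      proof
        assume "matches D' b"
        then have "b = a" using nz aD Ans_props(1) a(1) b(1) by (intro nth_equalityI) (auto simp: matches_def)
        then show ?thesis ..
      next
        assume "digits_below D' b"
        then show ?thesis using aD unfolding digits_below_def lex_less_def by (metis order.strict_trans)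
      qed
    qed (use s' in auto)
  qed (use sttD(2)[OF s] bB in auto)
qed

text \<open>The state between search and completion: the digits set follow \<open>a\<close> up to
  position \<open>j\<close>, exceed it there, and form a prefix as \<open>wp_complete\<close>
  requires. The last conjunct ensures that completion skips no answer after
  \<open>a\<close>.\<close>

definition Found :: "nat list \<Rightarrow> (nat \<Rightarrow> nat) \<Rightarrow> bool" where
  "Found a D \<longleftrightarrow> (\<forall>k<DM. D k \<le> l + 1) \<and> extendable D \<and> (\<exists>j<DM. (\<forall>k<DM. D k \<noteq> 0 \<longleftrightarrow> k < Suc j) \<and> (\<forall>k<j. D k = a ! k) \<and> a ! j < D j) \<and>
     (\<forall>b\<in>answers. lex_less a b \<longrightarrow> matches D b \<or> digits_below D b)"

lemma wp_search:
  assumes s: "holds_digits ob s ((!) a)" and a: "a \<in> answers"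
    and none: "\<And>s' D. holds_digits ob s' D \<Longrightarrow> regs s' rFlag = 0 \<Longrightarrow> (\<And>b. b \<in> answers \<Longrightarrow> \<not> lex_less a b) \<Longrightarrow> Q s'"
    and found: "\<And>s' D. holds_digits ob s' D \<Longrightarrow> regs s' rFlag \<noteq> 0 \<Longrightarrow> Found a D \<Longrightarrow> Q s'"
  shows "wp w B search_next Q s"
proof -
  define Dz where "Dz = (\<lambda>j k. if k < j then a ! k else 0)"
  \<comment> \<open>As long as nothing is found, the last \<open>i\<close> digits are erased, and no
    larger answer branches off from \<open>a\<close> at one of them.\<close>
  define J where "J = (\<lambda>i s'. (regs s' rFlag = 0 \<and> holds_digits ob s' (Dz (DM - i)) \<and>
      (\<forall>b\<in>answers. \<forall>j. DM - i \<le> j \<and> j < DM \<and> (\<forall>k<j. a ! k = b ! k) \<longrightarrow> \<not> a ! j < b ! j)) \<or>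
      (regs s' rFlag \<noteq> 0 \<and> (\<exists>D. holds_digits ob s' D \<and> Found a D)))"
  have anz: "a ! k \<noteq> 0" "a ! k \<le> l + 1" if "k < DM" for k using Ans_props(2)[OF a that] by auto
  let ?body = "If (Var rFlag) Skip
     (Seq (Set rX (Minus (Minus (Var rDM) (Lit 1)) (Var rW)))
     (Seq (Set rOld (dJ rX))
     (Seq (Put 12 (Var rX) L0 L0 L0)
       (For rV (Plus (Var rL) (Lit 1)) (If (eAnd (eNot (Var rFlag)) (eLt (Var rOld) (Plus (Var rV) (Lit 1))))
         (try_digit rX (Set rFlag (Lit 1))) Skip)))))"
  have loop: "wp w B (For rW (Var rDM) ?body) Q (setr rFlag 0 s)"
  proof (rule wp_For[where J = J and n = DM])
    have "holds_digits ob (setr rFlag 0 s) (Dz DM)"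
      by (rule stt_ext[OF stt_regs[OF s]]) (auto simp: Dz_def)
    then show "J 0 (setr rFlag 0 s)" unfolding J_def by auto
  next
    fix i s' assume i: "i < DM" and Ji: "J i s'"
    let ?s = "setr rW i s'"
    show "wp w B ?body (J (Suc i)) ?s"
    proof (cases "regs s' rFlag = 0")
      case False
      then obtain D where "holds_digits ob s' D" "Found a D" using Ji by (auto simp: J_def)
      then have "holds_digits ob ?s D" "Found a D" by (auto intro: stt_regs)
      then have "J (Suc i) ?s" using False unfolding J_def by auto
      then show ?thesis using False by simp
    next
      case True
      then have st: "holds_digits ob s' (Dz (DM - i))"
        and nn: "\<And>b j. b \<in> answers \<Longrightarrow> DM - i \<le> j \<Longrightarrow> j < DM \<Longrightarrow> (\<And>k. k < j \<Longrightarrow> a ! k = b ! k) \<Longrightarrow> \<not> a ! j < b ! j"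
        using Ji unfolding J_def by auto
      let ?j = "DM - 1 - i"
      have j: "?j < DM" "DM - i = Suc ?j" "?j \<le> B" using i bB by auto
      have dj: "digit s' ?j = a ! ?j" using sttD(3)[OF st j(1)] j(2) by (simp add: Dz_def)
      let ?s2 = "s'\<lparr>regs := (regs s')(rW := i, rX := ?j, rOld := a ! ?j), heap := (heap s')((12, ?j, 0, 0) := 0)\<rparr>"
      have st2: "holds_digits ob ?s2 (Dz ?j)"
      proof -
        have "holds_digits ob (setr rOld (a ! ?j) (setr rX ?j (setr rW i s'))) (Dz (DM - i))"
          by (intro stt_regs st) auto
        from stt_put[OF this, of ?j 0]
        have "holds_digits ob ?s2 ((Dz (DM - i))(?j := 0))" by simp
        then show ?thesis by (rule stt_ext) (use j(2) in \<open>auto simp: Dz_def\<close>)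
      qed
      define KB where "KB = (\<lambda>s'' u. holds_digits ob s'' ((Dz ?j)(?j := u)) \<and> a ! ?j < u \<and> u \<le> l + 1 \<and> extendable ((Dz ?j)(?j := u)) \<and>
            (\<forall>b\<in>answers. matches (Dz ?j) b \<longrightarrow> a ! ?j < b ! ?j \<longrightarrow> u \<le> b ! ?j))"
      \<comment> \<open>No answer with the current prefix has its digit at \<open>?j\<close> above
        that of \<open>a\<close> and at most \<open>v\<close>; or the least such digit
        \<open>u\<close> has been found.\<close>
      define K where "K = (\<lambda>v s''. regs s'' rX = ?j \<and> regs s'' rOld = a ! ?j \<and>
        ((regs s'' rFlag = 0 \<and> holds_digits ob s'' (Dz ?j) \<and> (\<forall>b\<in>answers. matches (Dz ?j) b \<longrightarrow> \<not> (a ! ?j < b ! ?j \<and> b ! ?j \<le> v))) \<or>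
         (regs s'' rFlag \<noteq> 0 \<and> (\<exists>u. KB s'' u))))"
      have "wp w B (For rV (Plus (Var rL) (Lit 1)) (If (eAnd (eNot (Var rFlag)) (eLt (Var rOld) (Plus (Var rV) (Lit 1))))
         (try_digit rX (Set rFlag (Lit 1))) Skip)) (J (Suc i)) ?s2"
      proof (rule wp_For[where J = K and n = "l + 1"])
        show "K 0 ?s2" using st2 True unfolding K_def by auto
      next
        fix v s'' assume v: "v < l + 1" and Kv: "K v s''"
        let ?s3 = "setr rV v s''"
        have r: "regs ?s3 rX = ?j" "regs ?s3 rOld = a ! ?j" "regs ?s3 rV = v" "regs ?s3 rFlag = regs s'' rFlag"
          using Kv by (auto simp: K_def)
        show "wp w B (If (eAnd (eNot (Var rFlag)) (eLt (Var rOld) (Plus (Var rV) (Lit 1))))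
         (try_digit rX (Set rFlag (Lit 1))) Skip) (K (Suc v)) ?s3"
        proof (cases "regs s'' rFlag = 0 \<and> a ! ?j < v + 1")
          case False
          have "K (Suc v) ?s3"
          proof (cases "regs s'' rFlag = 0")
            case True
            then have st3: "holds_digits ob s'' (Dz ?j)" "\<forall>b\<in>answers. matches (Dz ?j) b \<longrightarrow> \<not> (a ! ?j < b ! ?j \<and> b ! ?j \<le> v)"
              using Kv unfolding K_def by auto
            have "holds_digits ob ?s3 (Dz ?j)" using st3(1) by (intro stt_regs) auto
            moreover have "\<forall>b\<in>answers. matches (Dz ?j) b \<longrightarrow> \<not> (a ! ?j < b ! ?j \<and> b ! ?j \<le> Suc v)"
              using False True by auto
            ultimately show ?thesis using True r unfolding K_def by simp
          next
            case nz: False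
            then obtain u where "KB s'' u" using Kv by (auto simp: K_def)
            moreover from this have "holds_digits ob ?s3 ((Dz ?j)(?j := u))" unfolding KB_def by (intro stt_regs) auto
            ultimately show ?thesis using nz r unfolding K_def KB_def by (intro conjI disjI2 exI[of _ u]) auto
          qed
          then show ?thesis using False r by auto
        next
          case yes: True
          then have st3: "holds_digits ob s'' (Dz ?j)" "\<forall>b\<in>answers. matches (Dz ?j) b \<longrightarrow> \<not> (a ! ?j < b ! ?j \<and> b ! ?j \<le> v)"
            using Kv unfolding K_def by auto
          have "wp w B (try_digit rX (Set rFlag (Lit 1))) (K (Suc v)) ?s3"
          proof (rule wp_try[where D = "Dz ?j" and j = ?j and v = v and ob = ob])
            show "holds_digits ob ?s3 (Dz ?j)" using st3 by (intro stt_regs) auto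
            show "Dz ?j k \<le> l + 1" if "k < DM" for k using anz that by (auto simp: Dz_def)
            show "Dz ?j ?j = 0" by (simp add: Dz_def)
          next
            fix s4 u assume b: "holds_digits ob s4 ((Dz ?j)(?j := v + 1))" "regs s4 = (regs ?s3)(rRes := u)" "extendable ((Dz ?j)(?j := v + 1))"
            have "holds_digits ob (setr rFlag 1 s4) ((Dz ?j)(?j := v + 1))" using b(1) by (intro stt_regs) auto
            moreover have "\<forall>b\<in>answers. matches (Dz ?j) b \<longrightarrow> a ! ?j < b ! ?j \<longrightarrow> v + 1 \<le> b ! ?j" using st3(2) by fastforce
            ultimately show "wp w B (Set rFlag (Lit 1)) (K (Suc v)) s4"
              using b yes v r unfolding K_def KB_def wp_simps by (intro conjI disjI2 exI[of _ "v + 1"]) auto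
          next
            fix s4 u assume b: "holds_digits ob s4 (Dz ?j)" "regs s4 = (regs ?s3)(rRes := u)" "\<not> extendable ((Dz ?j)(?j := v + 1))"
            have "\<not> (a ! ?j < c ! ?j \<and> c ! ?j \<le> Suc v)" if "c \<in> answers" "matches (Dz ?j) c" for c
            proof -
              have "c ! ?j \<noteq> v + 1" using b(3) mt_upd[OF that(2), of ?j "v + 1"] that(1) unfolding extendable_def by blast
              moreover have "\<not> (a ! ?j < c ! ?j \<and> c ! ?j \<le> v)" using st3(2) that by blast
              ultimately show ?thesis by linarith
            qed
            then show "K (Suc v) s4" using b yes r unfolding K_def by auto
          qed (use r j v in auto)
          then show ?thesis using yes r by simp
        qed
      next
        fix s'' assume Kv: "K (l + 1) s''"
        let ?s3 = "setr rV (regs ?s2 rV) s''"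
        show "J (Suc i) ?s3"
        proof (cases "regs s'' rFlag = 0")
          case True
          then have st3: "holds_digits ob s'' (Dz ?j)" "\<forall>b\<in>answers. matches (Dz ?j) b \<longrightarrow> \<not> (a ! ?j < b ! ?j \<and> b ! ?j \<le> l + 1)"
            using Kv unfolding K_def by auto
          have st4: "holds_digits ob ?s3 (Dz ?j)" using st3(1) by (intro stt_regs) auto
          have e: "DM - Suc i = ?j" by simp
          have none': "\<not> a ! k < b ! k" if b: "b \<in> answers" "?j \<le> k" "k < DM" "\<And>k'. k' < k \<Longrightarrow> a ! k' = b ! k'" for b k
          proof (cases "k = ?j")
            case True
            have "matches (Dz ?j) b" using b(4) True by (auto simp: matches_def Dz_def)
            then show ?thesis using st3(2) b(1) Ans_props(2)[OF b(1) j(1)] True by auto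
          next
            case False
            then show ?thesis using nn[OF b(1) _ b(3,4)] j(2) b(2) by auto
          qed
          show ?thesis
            unfolding J_def e
          proof (rule disjI1, intro conjI ballI allI impI)
            show "regs ?s3 rFlag = 0" using True by simp
            show "holds_digits ob ?s3 (Dz ?j)" by (rule st4)
            fix b k assume "b \<in> answers" "?j \<le> k \<and> k < DM \<and> (\<forall>k'<k. a ! k' = b ! k')"
            then show "\<not> a ! k < b ! k" using none' by blast
          qed
        next
          case False
          then obtain u where "KB s'' u" using Kv by (auto simp: K_def)
          then have u: "holds_digits ob s'' ((Dz ?j)(?j := u))" "a ! ?j < u" "u \<le> l + 1" "extendable ((Dz ?j)(?j := u))"
            "\<forall>b\<in>answers. matches (Dz ?j) b \<longrightarrow> a ! ?j < b ! ?j \<longrightarrow> u \<le> b ! ?j" unfolding KB_def by blast+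
          let ?D = "(Dz ?j)(?j := u)"
          have st3: "holds_digits ob ?s3 ?D" using u(1) by (intro stt_regs) auto
          have "Found a ?D"
            unfolding Found_def
          proof (intro conjI ballI impI exI[of _ ?j])
            show "\<forall>k<DM. ?D k \<le> l + 1" using anz u(3) by (auto simp: Dz_def)
            show "extendable ?D" by fact
            show "?j < DM" by (rule j(1))
            show "\<forall>k<DM. ?D k \<noteq> 0 \<longleftrightarrow> k < Suc ?j" using anz u(2) by (auto simp: Dz_def)
            show "\<forall>k<?j. ?D k = a ! k" by (auto simp: Dz_def)
            show "a ! ?j < ?D ?j" using u(2) by simp
            fix b assume b: "b \<in> answers" "lex_less a b"
            then obtain k where k: "k < DM" "\<forall>k'<k. a ! k' = b ! k'" "a ! k < b ! k" unfolding lex_less_def by blast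
            consider "k < ?j" | "k = ?j" | "?j < k" by linarith
            then show "matches ?D b \<or> digits_below ?D b"
            proof cases
              case 1
              then show ?thesis using k anz[of k] unfolding digits_below_def by (intro disjI2 exI[of _ k]) (auto simp: Dz_def)
            next
              case 2
              have m: "matches (Dz ?j) b" using k 2 by (auto simp: matches_def Dz_def)
              then have "u \<le> b ! ?j" using u(5) b(1) k(3) 2 by blast
              show ?thesis
              proof (cases "b ! ?j = u")
                case True then show ?thesis using mt_upd[OF m] by blast
              next
                case False
                then show ?thesis using \<open>u \<le> b ! ?j\<close> u(2) j(1) k(2) 2 unfolding digits_below_def
                  by (intro disjI2 exI[of _ ?j]) (auto simp: Dz_def)
              qed
            next
              \<comment> \<open>A branch at a later digit was excluded by the preceding
                rounds.\<close>
              case 3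
              then show ?thesis using nn[OF b(1) _ k(1)] k(2,3) j(2) by auto
            qed
          qed
          then show ?thesis using False st3 unfolding J_def by auto
        qed
      qed (use sttD(1)[OF st2] bB in auto)
      then show ?thesis using True dj sttD(2)[OF st] j(3) by simp
    qed
  next
    fix s' assume Jn: "J DM s'"
    let ?s = "setr rW (regs (setr rFlag 0 s) rW) s'"
    show "Q ?s"
    proof (cases "regs s' rFlag = 0")
      case True
      then have st: "holds_digits ob s' (Dz 0)" "\<forall>b\<in>answers. \<forall>j. j < DM \<and> (\<forall>k<j. a ! k = b ! k) \<longrightarrow> \<not> a ! j < b ! j"
        using Jn unfolding J_def by auto
      show ?thesis
      proof (rule none)
        show "holds_digits ob ?s (Dz 0)" using st by (intro stt_regs) auto
        show "\<not> lex_less a b" if "b \<in> answers" for b using st(2) that unfolding lex_less_def by blast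
      qed (use True in auto)
    next
      case False
      then obtain D where "holds_digits ob s' D" "Found a D" using Jn by (auto simp: J_def)
      then show ?thesis using False by (intro found[of _ D] stt_regs) auto
    qed
  qed (use sttD(2)[OF s] bB in auto)
  then show ?thesis unfolding search_next_def by simp
qed

text \<open>If there is no successor, only the flag matters, because the machine then halts.\<close>

lemma wp_next:
  assumes s: "holds_digits ob s ((!) a)" and a: "a \<in> answers"
    and none: "\<And>s'. regs s' rFlag = 0 \<Longrightarrow> (\<And>b. b \<in> answers \<Longrightarrow> \<not> lex_less a b) \<Longrightarrow> Q s'"
    and found: "\<And>s' a'. holds_digits ob s' ((!) a') \<Longrightarrow> regs s' rFlag \<noteq> 0 \<Longrightarrow> a' \<in> answers \<Longrightarrow> lex_less a a' \<Longrightarrow>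
      (\<And>b. b \<in> answers \<Longrightarrow> lex_less a b \<Longrightarrow> b = a' \<or> lex_less a' b) \<Longrightarrow> Q s'"
  shows "wp w B (Seq search_next (If (Var rFlag) complete_digits Skip)) Q s"
  unfolding wp_simps(4)
proof (rule wp_search[OF s a])
  fix s' D assume "holds_digits ob s' D" "regs s' rFlag = 0" "\<And>b. b \<in> answers \<Longrightarrow> \<not> lex_less a b"
  then show "wp w B (If (Var rFlag) complete_digits Skip) Q s'" using none by simp
next
  fix s' D assume s': "holds_digits ob s' D" "regs s' rFlag \<noteq> 0" and F: "Found a D"
  then obtain j where j: "j < DM" "\<forall>k<DM. D k \<noteq> 0 \<longleftrightarrow> k < Suc j" "\<forall>k<j. D k = a ! k" "a ! j < D j" unfolding Found_def by blast
  have "wp w B complete_digits Q s'"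
  proof (rule wp_complete[OF s'(1), where ?j0.0 = "Suc j"])
    fix s2 a' assume a': "holds_digits ob s2 ((!) a')" "a' \<in> answers" "matches D a'" "\<And>b. b \<in> answers \<Longrightarrow> matches D b \<Longrightarrow> b = a' \<or> lex_less a' b"
      "regs s2 rFlag = regs s' rFlag"
    have D: "a' ! k = D k" if "k \<le> j" for k using a'(3) j(1,2) that by (auto simp: matches_def)
    show "Q s2"
    proof (rule found[OF a'(1) _ a'(2)])
      show "lex_less a a'" unfolding lex_less_def using D j by (intro exI[of _ j]) auto
      fix b assume b: "b \<in> answers" "lex_less a b"
      then have "matches D b \<or> digits_below D b" using F by (auto simp: Found_def)
      then show "b = a' \<or> lex_less a' b"
      proof
        assume "digits_below D b"
        then obtain k where k: "k < DM" "\<forall>k'<k. b ! k' = D k'" "D k \<noteq> 0" "D k < b ! k" unfolding digits_below_def by blast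
        then have "k \<le> j" using j(2) by auto
        then have "lex_less a' b" unfolding lex_less_def using k D by (intro exI[of _ k]) auto
        then show ?thesis ..
      qed (use a'(4) b in blast)
    qed (use a' s' in auto)
  qed (use F j in \<open>auto simp: Found_def\<close>)
  then show "wp w B (If (Var rFlag) complete_digits Skip) Q s'" using s' by simp
qed

text \<open>With all digits open, an extension is just any answer. Without variables there are no
  digits, the empty list is the only possible answer, and completion has no rounds.\<close>

lemma wp_first:
  assumes s: "holds_digits ob s (\<lambda>_. 0)"
    and none: "\<And>s'. regs s' rFlag = 0 \<Longrightarrow> answers = {} \<Longrightarrow> Q s'"
    and found: "\<And>s' a'. holds_digits ob s' ((!) a') \<Longrightarrow> regs s' rFlag \<noteq> 0 \<Longrightarrow> a' \<in> answers \<Longrightarrow>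
      (\<And>b. b \<in> answers \<Longrightarrow> b = a' \<or> lex_less a' b) \<Longrightarrow> Q s'"
  shows "wp w B (Seq check_digits (Seq (Set rFlag (Var rRes)) (If (Var rFlag) complete_digits Skip))) Q s"
  unfolding wp_simps(4)[of _ _ check_digits]
proof (rule wp_chk'[OF s])
  fix s' v assume s': "holds_digits ob s' (\<lambda>_. 0)" "regs s' = (regs s)(rRes := v)" "v \<noteq> 0 \<longleftrightarrow> extendable (\<lambda>_. 0)"
  have matches: "matches (\<lambda>_. 0) b" for b by (simp add: matches_def)
  have st: "holds_digits ob (setr rFlag v s') (\<lambda>_. 0)" using s'(1) by (intro stt_regs) auto
  show "wp w B (Seq (Set rFlag (Var rRes)) (If (Var rFlag) complete_digits Skip)) Q s'"
  proof (cases "v = 0")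
    case True
    then have "answers = {}" using s'(3) matches by (auto simp: extendable_def)
    then have "Q (setr rFlag v s')" using True by (intro none) auto
    then show ?thesis using True s'(2) by simp
  next
    case False
    have "wp w B complete_digits Q (setr rFlag v s')"
      by (rule wp_complete[OF st, where ?j0.0 = 0]) (use False s' matches in \<open>auto intro: found\<close>)
    then show ?thesis using False s'(2) by simp
  qed
qed simp

definition answer_list :: "nat list \<Rightarrow> nat list" where
  "answer_list a = concat (map (\<lambda>k. (if k mod 2 = 0 then [var_list ! (k div 2)] else []) @ [a ! k]) [0..<DM])"

lemma outl_digs: "\<mu> \<in> sem \<Longrightarrow> answer_list (digits \<mu>) = enc_tuple \<mu>"
proof -
  have "concat (map g [0..<2 * N]) = concat (map (\<lambda>i. g (2 * i) @ g (2 * i + 1)) [0..<N])" for g :: "nat \<Rightarrow> nat list" and N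
    by (induction N) auto
  then show "\<mu> \<in> sem \<Longrightarrow> answer_list (digits \<mu>) = enc_tuple \<mu>"
    unfolding answer_list_def by (simp add: enc_tuple_digs)
qed

lemma wp_outc:
  assumes s: "holds_digits [] s ((!) a)"
    and Q: "\<And>s'. holds_digits (answer_list a) s' ((!) a) \<Longrightarrow> regs s' rFlag = regs s rFlag \<Longrightarrow> Q s'"
  shows "wp w B write_answer Q s"
  unfolding write_answer_def
proof (rule wp_For[where n = DM and J = "\<lambda>j s'. \<exists>x. s' = s\<lparr>regs := (regs s)(rJ := x), obuf := concat (map (\<lambda>k. (if k mod 2 = 0 then [var_list ! (k div 2)] else []) @ [a ! k]) [0..<j])\<rparr>"])
  have "obuf s = []" using s by (simp add: holds_digits_def)
  then show "\<exists>x. s = s\<lparr>regs := (regs s)(rJ := x), obuf := concat (map (\<lambda>k. (if k mod 2 = 0 then [var_list ! (k div 2)] else []) @ [a ! k]) [0..<0])\<rparr>"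
    by (intro exI[of _ "regs s rJ"]) simp
next
  fix j s' assume j: "j < DM" and "\<exists>x. s' = s\<lparr>regs := (regs s)(rJ := x), obuf := concat (map (\<lambda>k. (if k mod 2 = 0 then [var_list ! (k div 2)] else []) @ [a ! k]) [0..<j])\<rparr>"
  then obtain x where s': "s' = s\<lparr>regs := (regs s)(rJ := x), obuf := concat (map (\<lambda>k. (if k mod 2 = 0 then [var_list ! (k div 2)] else []) @ [a ! k]) [0..<j])\<rparr>"
    by blast
  have t: "heap s (10, j, 0, 0) < n" "w ! heap s (10, j, 0, 0) = var_list ! (j div 2)" "heap s (11, j, 0, 0) = j mod 2 + 1"
    "heap s (12, j, 0, 0) = a ! j"
    using s j by (auto simp: holds_digits_def ready_def)
  have "j \<le> B" using j bB by simp
  then show "wp w B (Seq (If (eEq (Rd 11 (Var rJ) L0 L0) (Lit 1)) (Out (Inp (Rd 10 (Var rJ) L0 L0))) Skip) (Out (dJ rJ)))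
     (\<lambda>s'. \<exists>x. s' = s\<lparr>regs := (regs s)(rJ := x), obuf := concat (map (\<lambda>k. (if k mod 2 = 0 then [var_list ! (k div 2)] else []) @ [a ! k]) [0..<Suc j])\<rparr>)
     (setr rJ j s')"
    using t by (auto simp: s' intro!: exI[of _ j])
next
  fix s' assume "\<exists>x. s' = s\<lparr>regs := (regs s)(rJ := x), obuf := concat (map (\<lambda>k. (if k mod 2 = 0 then [var_list ! (k div 2)] else []) @ [a ! k]) [0..<DM])\<rparr>"
  then obtain x where "s' = s\<lparr>regs := (regs s)(rJ := x), obuf := answer_list a\<rparr>" by (auto simp: answer_list_def)
  then have e: "setr rJ (regs s rJ) s' = s\<lparr>obuf := answer_list a\<rparr>" by simp
  have "holds_digits (answer_list a) (s\<lparr>obuf := answer_list a\<rparr>) ((!) a)"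
    using s by (auto simp: holds_digits_def intro: ready_cong)
  then show "Q (setr rJ (regs s rJ) s')" unfolding e by (intro Q) auto
qed (use sttD(2)[OF s] bB in auto)

end

section \<open>Delay\<close>

text \<open>\<open>e\<close> is the time left until the next \<open>Yield\<close> or halt,
  \<open>d\<close> the allowance granted afresh after each \<open>Yield\<close>. The
  \<open>Yield\<close> step itself is not charged, so answers are at most \<open>Suc d\<close>
  apart. Being inductive, the predicate includes termination.\<close>

inductive enumerates_from :: "program \<Rightarrow> nat \<Rightarrow> config \<Rightarrow> nat \<Rightarrow> nat list list \<Rightarrow> bool" for P d where
  enum_halt: "halted P c \<Longrightarrow> enumerates_from P d c e []"
| enum_step: "\<not> halted P c \<Longrightarrow> P ! pc c \<noteq> Yield \<Longrightarrow> enumerates_from P d (step P c) e os \<Longrightarrow> enumerates_from P d c (Suc e) os"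
| enum_yield: "\<not> halted P c \<Longrightarrow> P ! pc c = Yield \<Longrightarrow> enumerates_from P d (step P c) d os \<Longrightarrow> enumerates_from P d c e (out c # os)"

lemma enum_mono: "enumerates_from P d c e os \<Longrightarrow> e \<le> e' \<Longrightarrow> enumerates_from P d c e' os"
proof (induction arbitrary: e' rule: enumerates_from.induct)
  case (enum_step c e os)
  then show ?case by (cases e') (auto intro: enumerates_from.enum_step)
qed (auto intro: enumerates_from.intros)

lemma enum_seg: "seg P t c c' \<Longrightarrow> enumerates_from P d c' e os \<Longrightarrow> enumerates_from P d c (t + e) os"
proof (induction rule: seg.induct)
  case (segS c t c')
  then have "enumerates_from P d (step P c) (t + e) os" by (simp add: step_def halted_def)
  then show ?case using segS by (auto intro: enumerates_from.enum_step simp: halted_def)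
qed simp

lemma enum_reach: "reach P b c c' \<Longrightarrow> enumerates_from P d c' e os \<Longrightarrow> enumerates_from P d c (b + e) os"
  unfolding reach_def using enum_seg enum_mono by (metis add_le_mono1)

lemma filter_upt_Suc:
  "filter Y [0..<Suc T] = (if Y 0 then [0] else []) @ map Suc (filter (\<lambda>t. Y (Suc t)) [0..<T])"
proof -
  have "[0..<Suc T] = 0 # map Suc [0..<T]" by (simp add: map_Suc_upt upt_conv_Cons del: upt_Suc)
  then show ?thesis by (simp add: filter_map o_def del: upt_Suc)
qed

text \<open>Induction on the derivation: one machine step in front shifts all later times by one,
  and a new answer gets time 0.\<close>

lemma enum_run:
  assumes "enumerates_from P d c e os"
  shows "\<exists>T. halted P ((step P ^^ T) c) \<and> (\<forall>t<T. \<not> halted P ((step P ^^ t) c)) \<and>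
    (let ts = filter (\<lambda>t. \<not> halted P ((step P ^^ t) c) \<and> P ! pc ((step P ^^ t) c) = Yield) [0..<T] in
      map (\<lambda>t. out ((step P ^^ t) c)) ts = os \<and> hd (ts @ [T]) \<le> e \<and>
      successively (\<lambda>x y. y - x \<le> Suc d) (ts @ [T]))"
  using assms
proof (induction rule: enumerates_from.induct)
  case (enum_halt c e)
  then show ?case by (intro exI[of _ 0]) simp
next
  case (enum_step c e os)
  let ?Y = "\<lambda>c t. \<not> halted P ((step P ^^ t) c) \<and> P ! pc ((step P ^^ t) c) = Yield"
  obtain T where T: "halted P ((step P ^^ T) (step P c))" "\<forall>t<T. \<not> halted P ((step P ^^ t) (step P c))"
    "map (\<lambda>t. out ((step P ^^ t) (step P c))) (filter (?Y (step P c)) [0..<T]) = os"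
    "hd (filter (?Y (step P c)) [0..<T] @ [T]) \<le> e"
    "successively (\<lambda>x y. y - x \<le> Suc d) (filter (?Y (step P c)) [0..<T] @ [T])"
    using enum_step.IH by (auto simp: Let_def)
  have S: "(step P ^^ Suc t) c = (step P ^^ t) (step P c)" for t by (simp add: funpow_swap1)
  have Y0: "\<not> ?Y c 0" using enum_step by simp
  have f: "filter (?Y c) [0..<Suc T] = map Suc (filter (?Y (step P c)) [0..<T])"
    unfolding filter_upt_Suc S using Y0 by simp
  have a: "\<forall>t<Suc T. \<not> halted P ((step P ^^ t) c)"
  proof (intro allI impI)
    fix t assume "t < Suc T"
    then show "\<not> halted P ((step P ^^ t) c)"
      using T(2) enum_step by (cases t) (auto simp: S simp del: funpow.simps(2))
  qed
  have m: "map Suc xs @ [Suc T] = map Suc (xs @ [T])" for xs by simp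
  show ?case
  proof (rule exI[of _ "Suc T"], unfold Let_def f, intro conjI)
    show "halted P ((step P ^^ Suc T) c)" unfolding S by (rule T(1))
    show "\<forall>t<Suc T. \<not> halted P ((step P ^^ t) c)" by (rule a)
    show "map (\<lambda>t. out ((step P ^^ t) c)) (map Suc (filter (?Y (step P c)) [0..<T])) = os"
      using T(3) by (simp add: o_def S del: funpow.simps(2))
    show "hd (map Suc (filter (?Y (step P c)) [0..<T]) @ [Suc T]) \<le> Suc e"
      unfolding m using T(4) by (subst hd_map) auto
    show "successively (\<lambda>x y. y - x \<le> Suc d) (map Suc (filter (?Y (step P c)) [0..<T]) @ [Suc T])"
      unfolding m successively_map using T(5) by simp
  qed
next
  case (enum_yield c os e)
  let ?Y = "\<lambda>c t. \<not> halted P ((step P ^^ t) c) \<and> P ! pc ((step P ^^ t) c) = Yield"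
  obtain T where T: "halted P ((step P ^^ T) (step P c))" "\<forall>t<T. \<not> halted P ((step P ^^ t) (step P c))"
    "map (\<lambda>t. out ((step P ^^ t) (step P c))) (filter (?Y (step P c)) [0..<T]) = os"
    "hd (filter (?Y (step P c)) [0..<T] @ [T]) \<le> d"
    "successively (\<lambda>x y. y - x \<le> Suc d) (filter (?Y (step P c)) [0..<T] @ [T])"
    using enum_yield.IH by (auto simp: Let_def)
  have S: "(step P ^^ Suc t) c = (step P ^^ t) (step P c)" for t by (simp add: funpow_swap1)
  have Y0: "?Y c 0" using enum_yield by simp
  have f: "filter (?Y c) [0..<Suc T] = 0 # map Suc (filter (?Y (step P c)) [0..<T])"
    unfolding filter_upt_Suc S using Y0 by simp
  have a: "\<forall>t<Suc T. \<not> halted P ((step P ^^ t) c)"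
  proof (intro allI impI)
    fix t assume "t < Suc T"
    then show "\<not> halted P ((step P ^^ t) c)"
      using T(2) enum_yield by (cases t) (auto simp: S simp del: funpow.simps(2))
  qed
  have m: "map Suc xs @ [Suc T] = map Suc (xs @ [T])" for xs by simp
  show ?case
  proof (rule exI[of _ "Suc T"], unfold Let_def f, intro conjI)
    show "halted P ((step P ^^ Suc T) c)" unfolding S by (rule T(1))
    show "\<forall>t<Suc T. \<not> halted P ((step P ^^ t) c)" by (rule a)
    show "map (\<lambda>t. out ((step P ^^ t) c)) (0 # map Suc (filter (?Y (step P c)) [0..<T])) = out c # os"
      using T(3) by (simp add: o_def S del: funpow.simps(2))
    show "hd ((0 # map Suc (filter (?Y (step P c)) [0..<T])) @ [Suc T]) \<le> e"
      by simp
    have "hd (map Suc (filter (?Y (step P c)) [0..<T] @ [T])) \<le> Suc d"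
      using T(4) by (subst hd_map) auto
    then show "successively (\<lambda>x y. y - x \<le> Suc d) ((0 # map Suc (filter (?Y (step P c)) [0..<T])) @ [Suc T])"
      unfolding append_Cons m successively_Cons successively_map using T(5) by simp
  qed
qed

text \<open>Time 0 is treated like an answer, so the initial allowance has to be that of a gap,
  \<open>Suc d\<close>.\<close>

lemma enum_enumerates:
  assumes "enumerates_from P d (init_config w) (Suc d) os" and "os = map enc as" "distinct as" "set as = S" "Suc d \<le> D"
  shows "enumerates_with_delay P w enc S D"
proof -
  obtain T where T: "halted P (run P w T)" "\<forall>t<T. \<not> halted P (run P w t)"
    "map (\<lambda>t. out (run P w t)) (answer_times P w T) = os" "hd (answer_times P w T @ [T]) \<le> Suc d"
    "successively (\<lambda>x y. y - x \<le> Suc d) (answer_times P w T @ [T])"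
    using enum_run[OF assms(1)] unfolding Let_def run_def[symmetric] yields_def[symmetric] answer_times_def[symmetric] by blast
  have "successively (\<lambda>x y. y - x \<le> Suc d) (0 # answer_times P w T @ [T])"
    unfolding successively_Cons using T(4,5) by simp
  then have "\<forall>i. Suc i < length (0 # answer_times P w T @ [T]) \<longrightarrow>
      (0 # answer_times P w T @ [T]) ! Suc i - (0 # answer_times P w T @ [T]) ! i \<le> Suc d"
    unfolding successively_conv_nth by simp
  then show ?thesis
    unfolding enumerates_with_delay_def halts_at_def Let_def
    using T(1-3) assms(2-5) order_trans[OF _ assms(5)] by (intro exI[of _ T] exI[of _ as]) (auto dest!: spec)
qed

section \<open>The enumerating machine and its delay\<close>

lemma rel_init: "rel w \<lparr>regs = (\<lambda>_. 0), heap = (\<lambda>_. 0), obuf = []\<rparr> ((\<lambda>_. 0)(0 := length w), (\<lambda>i. if i < length w then w ! i else 0), [])"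
  by (simp add: rel_def)

lemma init_cfg: "init_config w = cfg 0 ((\<lambda>_. 0)(0 := length w), (\<lambda>i. if i < length w then w ! i else 0), [])"
  by (simp add: init_config_def cfg_def)

text \<open>Top-level code is compiled at height 1 because register 0 is reserved.\<close>

lemma wp_reach:
  assumes "wp w B c Q s" "rel w s d" "code_at P off (ccomp c 1 off)"
  obtains d' s' where "reach P (ccst c B) (cfg off d) (cfg (off + length (ccomp c 1 off)) d')" "rel w s' d'" "Q s'"
proof -
  have "gwp (ccomp c 1) (ccst c B) (\<lambda>d'. rel w (exec w c s) d' \<and> keepe 1 d d') d"
    by (rule ccomp_gwp) (use assms in \<open>auto simp: wp_def\<close>)
  then obtain d' where "reach P (ccst c B) (cfg off d) (cfg (off + length (ccomp c 1 off)) d')" "rel w (exec w c s) d'"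
    using assms(3) unfolding gwp_def by blast
  then show ?thesis using that assms(1) by (auto simp: wp_def)
qed

text \<open>The constant is the left factor, which has to be bounded; the growing power is the right
  one, which need not be.\<close>

definition pow_com :: "nat \<Rightarrow> com" where
  "pow_com e = Seq (Set 0 (Lit 1)) (Seq (For 1 (Inp (Lit 0)) (Set 0 (Times (Lit (2 ^ e)) (Var 0)))) (Out (Var 0)))"

lemma computable_pow: "computable (\<lambda>n. 2 ^ (e * n))"
  unfolding computable_def
proof (rule exI[of _ "ccomp (pow_com e) 1 0"], intro allI)
  fix n :: nat
  let ?P = "ccomp (pow_com e) 1 0" and ?s = "\<lparr>regs = (\<lambda>_. 0), heap = (\<lambda>_. 0), obuf = []\<rparr> :: store"
  \<comment> \<open>\<open>n\<close> for the rounds of the loop, \<open>2 ^ e\<close> for the left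
    factor.\<close>
  define B where "B = max n (2 ^ e)"
  have "wp [n] B (For 1 (Inp (Lit 0)) (Set 0 (Times (Lit (2 ^ e)) (Var 0))))
      (\<lambda>s. obuf s = [] \<and> regs s 0 = 2 ^ (e * n)) (setr 0 1 ?s)"
    by (rule wp_For[where n = n and J = "\<lambda>k s. obuf s = [] \<and> regs s 0 = 2 ^ (e * k)"])
      (auto simp: B_def power_add)
  then have "wp [n] B (pow_com e) (\<lambda>s. obuf s = [2 ^ (e * n)]) ?s"
    unfolding pow_com_def by (auto elim: wp_mono)
  then obtain d' s' where r: "reach ?P (ccst (pow_com e) B) (init_config [n]) (cfg (0 + length ?P) d')"
      "rel [n] s' d'" "obuf s' = [2 ^ (e * n)]"
    by (rule wp_reach[OF _ rel_init, where P = ?P and off = 0, folded init_cfg]) (auto simp: code_at_def)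
  then obtain T where T: "seg ?P T (init_config [n]) (cfg (0 + length ?P) d')" by (auto simp: reach_def)
  have "out (cfg (0 + length ?P) d') = [2 ^ (e * n)]" using r(2,3) by (cases d') (simp add: rel_def)
  moreover note seg_steps[OF T]
  ultimately have "halts_at ?P [n] T \<and> out (run ?P [n] T) = [2 ^ (e * n)]"
    by (simp add: halts_at_def run_def halted_def)
  then show "\<exists>T. halts_at ?P [n] T \<and> out (run ?P [n] T) = [2 ^ (e * n)]" ..
qed

definition init_com :: com where
  "init_com = Seq parse_all (Seq tables (Seq check_digits (Seq (Set rFlag (Var rRes)) (If (Var rFlag) complete_digits Skip))))"

definition next_com :: com where
  "next_com = Seq search_next (If (Var rFlag) complete_digits Skip)"

text \<open>The main loop is written by hand: bounded loops cannot express it, since its number of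
  rounds is the number of answers, and \<open>Yield\<close> does not belong to the language.
  \<open>2 * rFlag + 1\<close> is the machine register of \<open>rFlag\<close>; flag 0 leads out of
  the program.\<close>

definition enum_program :: program where
  "enum_program = (let c1 = ccomp init_com 1 0; a = length c1;
     co = ccomp write_answer 1 (Suc a); y = Suc a + length co;
     cn = ccomp next_com 1 (Suc y); z = Suc y + length cn in
     c1 @ [JumpZero (2 * rFlag + 1) (Suc z)] @ co @ [Yield] @ cn @ [Jump a])"

context enum_input
begin

lemma lx_irrefl: "\<not> lex_less a a"
  by (auto simp: lex_less_def)

lemma lx_trans: "lex_less a b \<Longrightarrow> lex_less b c \<Longrightarrow> lex_less a c"
proof -
  assume "lex_less a b" "lex_less b c"
  then obtain i j where i: "i < DM" "\<forall>k<i. a ! k = b ! k" "a ! i < b ! i"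
    and j: "j < DM" "\<forall>k<j. b ! k = c ! k" "b ! j < c ! j" unfolding lex_less_def by blast
  consider "i < j" | "i = j" | "j < i" by linarith
  then show "lex_less a c"
  proof cases
    case 1
    then show ?thesis unfolding lex_less_def using i j by (intro exI[of _ i]) auto
  next
    case 2
    then show ?thesis unfolding lex_less_def using i j by (intro exI[of _ i]) auto
  next
    case 3
    then show ?thesis unfolding lex_less_def using i j by (intro exI[of _ j]) auto
  qed
qed

definition a0 :: nat where "a0 = length (ccomp init_com 1 0)"
definition y0 :: nat where "y0 = Suc a0 + length (ccomp write_answer 1 (Suc a0))"
definition z0 :: nat where "z0 = Suc y0 + length (ccomp next_com 1 (Suc y0))"
text \<open>Between two answers the machine runs \<open>next_com\<close>, jumps back, tests the flag
  and runs \<open>write_answer\<close>; the jump and the test make the 2. The cost of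
  \<open>init_com\<close> is included so that the same number covers the time before the first
  answer.\<close>

definition delay_bound :: nat where "delay_bound = ccst init_com B + ccst write_answer B + ccst next_com B + 2"

lemma prog_code:
  "code_at enum_program 0 (ccomp init_com 1 0)"
  "a0 < length enum_program" "enum_program ! a0 = JumpZero (2 * rFlag + 1) (Suc z0)"
  "code_at enum_program (Suc a0) (ccomp write_answer 1 (Suc a0))"
  "y0 < length enum_program" "enum_program ! y0 = Yield"
  "code_at enum_program (Suc y0) (ccomp next_com 1 (Suc y0))"
  "z0 < length enum_program" "enum_program ! z0 = Jump a0"
  "length enum_program = Suc z0"
proof -
  have off: "0 + length (ccomp init_com 1 0) = a0" "Suc a0 + length (ccomp write_answer 1 (Suc a0)) = y0"
    "Suc y0 + length (ccomp next_com 1 (Suc y0)) = z0"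
    by (simp_all only: a0_def y0_def z0_def add_0)
  have "code_at enum_program 0 enum_program" by (simp add: code_at_def)
  moreover have e: "enum_program = ccomp init_com 1 0 @ JumpZero (2 * rFlag + 1) (Suc z0) # ccomp write_answer 1 (Suc a0) @
      Yield # ccomp next_com 1 (Suc y0) @ [Jump a0]"
    by (simp add: enum_program_def Let_def a0_def y0_def z0_def)
  ultimately have "code_at enum_program 0 (ccomp init_com 1 0 @ JumpZero (2 * rFlag + 1) (Suc z0) # ccomp write_answer 1 (Suc a0) @
      Yield # ccomp next_com 1 (Suc y0) @ [Jump a0])" by simp
  then show "code_at enum_program 0 (ccomp init_com 1 0)"
  "a0 < length enum_program" "enum_program ! a0 = JumpZero (2 * rFlag + 1) (Suc z0)"
  "code_at enum_program (Suc a0) (ccomp write_answer 1 (Suc a0))"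
  "y0 < length enum_program" "enum_program ! y0 = Yield"
  "code_at enum_program (Suc y0) (ccomp next_com 1 (Suc y0))"
  "z0 < length enum_program" "enum_program ! z0 = Jump a0"
    unfolding code_at_append code_at_Cons off by blast+
  show "length enum_program = Suc z0"
    using off by (subst e) (simp del: One_nat_def)
qed

lemma enum_end: "rel w s d \<Longrightarrow> regs s rFlag = 0 \<Longrightarrow> enumerates_from enum_program delay_bound (cfg a0 d) (Suc e) []"
proof (rule enum_step)
  assume r: "rel w s d" "regs s rFlag = 0"
  show "\<not> halted enum_program (cfg a0 d)" "enum_program ! pc (cfg a0 d) \<noteq> Yield"
    using prog_code by (simp_all add: halted_def)
  have "fst d (2 * rFlag + 1) = 0" using r unfolding rel_def by metis
  then have "step enum_program (cfg a0 d) = cfg (Suc z0) d"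
    using prog_code by (cases d) (simp add: step_def halted_def cfg_def)
  then show "enumerates_from enum_program delay_bound (step enum_program (cfg a0 d)) e []"
    using prog_code by (intro enum_halt) (simp add: halted_def)
qed

text \<open>Induction on the number of answers after \<open>a\<close>: these are the successor of
  \<open>a\<close> together with the answers after it, so passing to the successor removes at least
  one.\<close>

lemma enum_loop:
  "rel w s d \<Longrightarrow> holds_digits [] s ((!) a) \<Longrightarrow> regs s rFlag \<noteq> 0 \<Longrightarrow> a \<in> answers \<Longrightarrow>
    \<exists>as. enumerates_from enum_program delay_bound (cfg a0 d) (Suc (ccst write_answer B)) (map answer_list as) \<and> distinct as \<and>
      set as = insert a {b \<in> answers. lex_less a b}"
proof (induction "card {b \<in> answers. lex_less a b}" arbitrary: a s d rule: less_induct)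
  case less
  have "fst d (2 * rFlag + 1) \<noteq> 0" using less.prems(1,3) unfolding rel_def by metis
  then have st1: "step enum_program (cfg a0 d) = cfg (Suc a0) d"
    using prog_code by (cases d) (simp add: step_def halted_def cfg_def)
  have "wp w B write_answer (\<lambda>s'. holds_digits (answer_list a) s' ((!) a)) s"
    by (rule wp_outc[OF less.prems(2)])
  then obtain d1 s1 where r1: "reach enum_program (ccst write_answer B) (cfg (Suc a0) d) (cfg y0 d1)" "rel w s1 d1" "holds_digits (answer_list a) s1 ((!) a)"
    by (rule wp_reach[OF _ less.prems(1) prog_code(4)]) (simp add: y0_def)
  define s2 where "s2 = s1\<lparr>obuf := []\<rparr>"
  define d2 where "d2 = (fst d1, fst (snd d1), [] :: nat list)"
  have st2: "step enum_program (cfg y0 d1) = cfg (Suc y0) d2" "out (cfg y0 d1) = answer_list a"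
    using prog_code r1(2,3) by (cases d1; simp add: step_def halted_def cfg_def d2_def rel_def holds_digits_def)+
  have r2: "rel w s2 d2" "holds_digits [] s2 ((!) a)"
    using r1(2,3) by (auto simp: rel_def s2_def d2_def holds_digits_def intro: ready_cong)
  have "wp w B next_com (\<lambda>s'. (regs s' rFlag = 0 \<and> (\<forall>b\<in>answers. \<not> lex_less a b)) \<or>
      (\<exists>a'. holds_digits [] s' ((!) a') \<and> regs s' rFlag \<noteq> 0 \<and> a' \<in> answers \<and> lex_less a a' \<and> (\<forall>b\<in>answers. lex_less a b \<longrightarrow> b = a' \<or> lex_less a' b))) s2"
    unfolding next_com_def by (rule wp_next[OF r2(2) less.prems(4)]) blast+
  then obtain d3 s3 where r3: "reach enum_program (ccst next_com B) (cfg (Suc y0) d2) (cfg z0 d3)" "rel w s3 d3"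
      "(regs s3 rFlag = 0 \<and> (\<forall>b\<in>answers. \<not> lex_less a b)) \<or>
      (\<exists>a'. holds_digits [] s3 ((!) a') \<and> regs s3 rFlag \<noteq> 0 \<and> a' \<in> answers \<and> lex_less a a' \<and> (\<forall>b\<in>answers. lex_less a b \<longrightarrow> b = a' \<or> lex_less a' b))"
    by (rule wp_reach[OF _ r2(1) prog_code(7)]) (simp add: z0_def)
  have st3: "step enum_program (cfg z0 d3) = cfg a0 d3"
    using prog_code by (cases d3) (simp add: step_def halted_def cfg_def)
  have "\<exists>as. enumerates_from enum_program delay_bound (cfg a0 d3) (Suc (ccst write_answer B)) (map answer_list as) \<and> distinct as \<and> set as = {b \<in> answers. lex_less a b}"
    using r3(3)
  proof (elim disjE conjE exE)
    assume "regs s3 rFlag = 0" "\<forall>b\<in>answers. \<not> lex_less a b"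
    then show ?thesis using enum_end[OF r3(2)] by (intro exI[of _ "[]"]) auto
  next
    fix a' assume a': "holds_digits [] s3 ((!) a')" "regs s3 rFlag \<noteq> 0" "a' \<in> answers" "lex_less a a'" "\<forall>b\<in>answers. lex_less a b \<longrightarrow> b = a' \<or> lex_less a' b"
    have occurs_at: "{b \<in> answers. lex_less a b} = insert a' {b \<in> answers. lex_less a' b}"
      using a'(3-5) lx_trans by blast
    then have "{b \<in> answers. lex_less a' b} \<subset> {b \<in> answers. lex_less a b}" using lx_irrefl by blast
    then have "card {b \<in> answers. lex_less a' b} < card {b \<in> answers. lex_less a b}"
      using Ans_props(3) by (intro psubset_card_mono) auto
    from less.hyps[OF this r3(2) a'(1-3)] show ?thesis unfolding occurs_at .
  qed
  then obtain as where as: "enumerates_from enum_program delay_bound (cfg a0 d3) (Suc (ccst write_answer B)) (map answer_list as)" "distinct as" "set as = {b \<in> answers. lex_less a b}"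
    by blast
  have "enumerates_from enum_program delay_bound (cfg z0 d3) (Suc (Suc (ccst write_answer B))) (map answer_list as)"
    by (rule enum_step) (use prog_code st3 as in \<open>simp_all add: halted_def\<close>)
  from enum_reach[OF r3(1) this]
  have "enumerates_from enum_program delay_bound (cfg (Suc y0) d2) delay_bound (map answer_list as)"
    by (rule enum_mono) (simp add: delay_bound_def)
  then have "enumerates_from enum_program delay_bound (cfg y0 d1) 0 (answer_list a # map answer_list as)"
    using enum_yield[of enum_program "cfg y0 d1" delay_bound "map answer_list as" 0] prog_code st2 by (simp add: halted_def)
  from enum_reach[OF r1(1) this]
  have "enumerates_from enum_program delay_bound (cfg (Suc a0) d) (ccst write_answer B) (answer_list a # map answer_list as)" by simp
  then have "enumerates_from enum_program delay_bound (cfg a0 d) (Suc (ccst write_answer B)) (map answer_list (a # as))"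
    by (intro enum_step) (use prog_code st1 in \<open>simp_all add: halted_def\<close>)
  then show ?case using as lx_irrefl by (intro exI[of _ "a # as"]) auto
qed

lemma enumerates: "enumerates_with_delay enum_program w enc_tuple (rep_sem q str) (Suc delay_bound)"
proof -
  have wp: "wp w B init_com (\<lambda>s'. (regs s' rFlag = 0 \<and> answers = {}) \<or>
      (\<exists>a. holds_digits [] s' ((!) a) \<and> regs s' rFlag \<noteq> 0 \<and> a \<in> answers \<and> (\<forall>b\<in>answers. b = a \<or> lex_less a b))) s0"
    unfolding init_com_def wp_simps(4)[of _ _ parse_all]
  proof (rule wp_parse_all)
    fix s :: store assume s: "regs s rTT < n" "stored w (heap s) (regs s rTT) A" "regs s rL = l" "regs s rM = m"
      "\<And>i a b c. 9 < i \<Longrightarrow> heap s (i, a, b, c) = 0" "obuf s = []"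
    show "wp w B (Seq tables (Seq check_digits (Seq (Set rFlag (Var rRes)) (If (Var rFlag) complete_digits Skip))))
      (\<lambda>s'. (regs s' rFlag = 0 \<and> answers = {}) \<or>
        (\<exists>a. holds_digits [] s' ((!) a) \<and> regs s' rFlag \<noteq> 0 \<and> a \<in> answers \<and> (\<forall>b\<in>answers. b = a \<or> lex_less a b))) s"
      unfolding wp_simps(4)[of _ _ tables]
    proof (rule wp_tables[OF s], assumption)
      fix s' :: store assume "ready s'" "\<And>i a b c. 11 < i \<Longrightarrow> heap s' (i, a, b, c) = 0" "obuf s' = []"
      then have "holds_digits [] s' (\<lambda>_. 0)" by (simp add: holds_digits_def)
      then show "wp w B (Seq check_digits (Seq (Set rFlag (Var rRes)) (If (Var rFlag) complete_digits Skip)))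
        (\<lambda>s'. (regs s' rFlag = 0 \<and> answers = {}) \<or>
          (\<exists>a. holds_digits [] s' ((!) a) \<and> regs s' rFlag \<noteq> 0 \<and> a \<in> answers \<and> (\<forall>b\<in>answers. b = a \<or> lex_less a b))) s'"
        by (rule wp_first) blast+
    qed
  qed
  obtain d1 s1 where r1: "reach enum_program (ccst init_com B) (init_config w) (cfg a0 d1)" "rel w s1 d1"
      "(regs s1 rFlag = 0 \<and> answers = {}) \<or>
       (\<exists>a. holds_digits [] s1 ((!) a) \<and> regs s1 rFlag \<noteq> 0 \<and> a \<in> answers \<and> (\<forall>b\<in>answers. b = a \<or> lex_less a b))"
    by (rule wp_reach[OF wp rel_init[folded s0_def] prog_code(1), folded init_cfg]) (simp add: a0_def)
  have "\<exists>as. enumerates_from enum_program delay_bound (cfg a0 d1) (Suc (ccst write_answer B)) (map answer_list as) \<and> distinct as \<and> set as = answers"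
    using r1(3)
  proof (elim disjE conjE exE)
    assume "regs s1 rFlag = 0" "answers = {}"
    then show ?thesis using enum_end[OF r1(2)] by (intro exI[of _ "[]"]) auto
  next
    fix a assume a: "holds_digits [] s1 ((!) a)" "regs s1 rFlag \<noteq> 0" "a \<in> answers" "\<forall>b\<in>answers. b = a \<or> lex_less a b"
    have "insert a {b \<in> answers. lex_less a b} = answers" using a(3,4) by blast
    then show ?thesis using enum_loop[OF r1(2) a(1-3)] by simp
  qed
  then obtain as where as: "enumerates_from enum_program delay_bound (cfg a0 d1) (Suc (ccst write_answer B)) (map answer_list as)" "distinct as" "set as = answers" by blast
  \<comment> \<open>The enumerated digit lists are turned back into tuples; by injectivity of
    \<open>digits\<close> these run through all of \<open>sem\<close>.\<close>
  define ms where "ms = map (inv_into sem digits) as"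
  have dm: "digits (inv_into sem digits a) = a" "inv_into sem digits a \<in> sem" if "a \<in> set as" for a
    using that as(3) by (simp_all add: answers_def f_inv_into_f inv_into_into)
  have "map digits ms = as" unfolding ms_def map_map by (rule map_idI) (simp add: dm)
  moreover have "set ms = sem"
  proof -
    have "set ms = inv_into sem digits ` digits ` sem" using as(3) by (simp add: ms_def answers_def)
    also have "\<dots> = sem" using digs_inj by (force simp: image_iff)
    finally show ?thesis .
  qed
  moreover from calculation have "distinct ms" using as(2) by (metis distinct_map)
  moreover have "map answer_list as = map enc_tuple ms"
    unfolding \<open>map digits ms = as\<close>[symmetric] map_map using \<open>set ms = sem\<close> outl_digs by auto
  moreover have "enumerates_from enum_program delay_bound (init_config w) (Suc delay_bound) (map answer_list as)"
    by (rule enum_mono[OF enum_reach[OF r1(1) as(1)]]) (simp add: delay_bound_def)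
  ultimately show ?thesis
    unfolding sem_def[symmetric] by (intro enum_enumerates[of _ delay_bound _ "map answer_list as" _ ms]) auto
qed

end

theorem corollary3p7:
  fixes code :: "'a::finite \<Rightarrow> nat"
  assumes "card (UNIV :: 'a set) \<ge> 2"
    and "inj code"
  shows "\<exists>(f :: nat \<Rightarrow> nat) (p :: nat poly) (P :: program). computable f \<and>
    (\<forall>(q :: 'a rep) (s :: 'a list). regular_rep q \<longrightarrow>
       enumerates_with_delay P (enc_input code q s) enc_tuple (rep_sem q s)
         (f (length (enc_rep code q)) * poly p (length (enc_input code q s))))"
proof -
  \<comment> \<open>The sum is \<open>Suc delay_bound\<close>, hence 3 in place of 2.
    \<open>C\<close> and \<open>k\<close> come from the text of the program alone, so they serve all
    inputs.\<close>
  have "polyb (\<lambda>B. ccst init_com B + ccst write_answer B + ccst next_com B + 3)"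
    by (intro polyb_intros polyb_ccst)
  then obtain C k where Ck: "\<And>B. ccst init_com B + ccst write_answer B + ccst next_com B + 3 \<le> C * (B + 1) ^ k"
    unfolding polyb_def by blast
  \<comment> \<open>\<open>[:3, 2:]\<close> is the polynomial \<open>3 + 2 * n\<close>, which comes
    from \<open>B + 1 \<le> 2 ^ m * (3 + 2 * n)\<close> for the bound \<open>B\<close>
    below.\<close>
  let ?p = "smult C ([:3, 2:] ^ k) :: nat poly"
  have "enumerates_with_delay enum_program (enc_input code q s) enc_tuple (rep_sem q s)
         (2 ^ (k * length (enc_rep code q)) * poly ?p (length (enc_input code q s)))"
    if q: "regular_rep q" for q :: "'a rep" and s :: "'a list"
  proof -
    let ?m = "length (enc_rep code q)" and ?n = "length (enc_input code q s)"
    \<comment> \<open>A product of the two required lower bounds, so that its power separates the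
      parameter from the size of the input.\<close>
    define B where "B = 2 ^ ?m * (2 * ?n + 2)"
    have "1 * (2 * ?n + 2) \<le> B"
      unfolding B_def by (intro mult_le_mono1) simp
    then have B: "2 ^ ?m \<le> B" "2 * ?n + 2 \<le> B"
      by (simp_all add: B_def)
    interpret enum_input code q s B "enc_input code q s"
      by unfold_locales (use assms(2) q B in simp_all)
    have "Suc delay_bound \<le> C * (B + 1) ^ k" using Ck[of B] by (simp add: delay_bound_def)
    also have "\<dots> \<le> C * (2 ^ ?m * (3 + 2 * ?n)) ^ k"
    proof -
      have "B + 1 \<le> B + 2 ^ ?m" by simp
      also have "\<dots> = 2 ^ ?m * (3 + 2 * ?n)" by (simp add: B_def algebra_simps)
      finally show ?thesis by (intro mult_le_mono2 power_mono) simp_all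
    qed
    also have "\<dots> = 2 ^ (k * ?m) * poly ?p ?n"
      by (simp add: power_mult_distrib power_mult[symmetric] mult.commute mult.left_commute)
    finally have "Suc delay_bound \<le> 2 ^ (k * ?m) * poly ?p ?n" .
    then show ?thesis
      using enumerates unfolding enumerates_with_delay_def Let_def by (meson order_trans)
  qed
  then show ?thesis
    using computable_pow[of k] by (intro exI[of _ "\<lambda>n. 2 ^ (k * n)"] exI[of _ ?p] exI[of _ enum_program]) auto
qed

end
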